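(* Let $\rho>0$. Consider the infinite horizon discounted cost performance functional $$J_\rho(\boldsymbol{x}_0,\boldsymbol{u})=\mathbb{E}\Big[\int_0^\infty e^{-\rho t}\big(\langle\boldsymbol{x}_t,\mathbb{M}\boldsymbol{x}_t\rangle+\langle\boldsymbol{u}_t,\mathbb{R}\boldsymbol{u}_t\rangle\big)dt\Big]$$ for the system $d\boldsymbol{x}_t=(\mathbb{A}\boldsymbol{x}_t+\mathbb{B}\boldsymbol{u}_t)dt+d\boldsymbol{w}_t$ with initial condition $\boldsymbol{x}_0\in L_2[0,1]$. It is minimized by $\boldsymbol{u}_t=-\mathbb{R}^{-1}\mathbb{B}^*S_\infty\boldsymbol{x}_t$, where $S_\infty$ solves the discounted algebraic Riccati equation $$\rho S_\infty=S_\infty\mathbb{A}^*+\mathbb{A}S_\infty-S_\infty\mathbb{B}\mathbb{R}^{-1}\mathbb{B}^*S_\infty+\mathbb{M}.$$ When $\mathbb{B}=\mathbb{R}=\mathbb{I}$ and $\mathbb{A}$ is symmetric, the unique positive symmetric solution is given by $$S^\rho_\infty=\Big(\mathbb{A}-\frac{\rho}{2}\mathbb{I}\Big)+\Big(\big(\mathbb{A}-\frac{\rho}{2}\mathbb{I}\big)^2+\mathbb{M}\Big)^{1/2}.$$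
   Context: All operators act on the real Hilbert space $L_2[0,1]$ with inner product $\langle\cdot,\cdot\rangle$; $\mathbb{I}$ is the identity. $\mathbb{A}=\boldsymbol{A}+a\mathbb{I}$ and $\mathbb{B}=\boldsymbol{B}+b\mathbb{I}$, where $\boldsymbol{A},\boldsymbol{B}$ are integral operators with bounded symmetric kernels on $[0,1]^2$ (graphons) and $a,b\in\mathbb{R}$. $\mathbb{M}$ and $\mathbb{R}$ are bounded positive self-adjoint operators, of the form $\mathbb{M}=\boldsymbol{M}+m\mathbb{I}$ and $\mathbb{R}=\mathbf{R}+r\mathbb{I}$ with $m\ge0$, $r>0$, and $\mathbb{R}$ is boundedly invertible. For a positive operator $P$, $P^{1/2}$ is its positive square root. $\boldsymbol{w}_t$ is a Q-noise with covariance $\mathbf{Q}$: a Gaussian $L_2[0,1]$-valued process with $\boldsymbol{w}_0=0$, Wiener increments in time, and $\mathbb{E}[\boldsymbol{w}_t(\alpha)\boldsymbol{w}_s(\beta)]=\min(t,s)\mathbf{Q}(\alpha,\beta)$, where $\mathbf{Q}$ is a bounded symmetric non-negative kernel on $[0,1]^2$; e.g. $\boldsymbol{w}_t=\sum_k\sqrt{\lambda_k}\phi_kW_k(t)$ with $(\lambda_k,\phi_k)$ the eigenvalues and orthonormal eigenfunctions of $\mathbf{Q}$ and $W_k$ independent Brownian motions. A control $\boldsymbol{u}$ is admissible if it is $L_2[0,1]$-valued, adapted to the filtration generated by $\boldsymbol{w}$, and square-integrable in time on bounded intervals. Solutions are mild solutions: $\boldsymbol{x}_t=e^{\mathbb{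A}t}\boldsymbol{x}_0+\int_0^te^{\mathbb{A}(t-s)}\mathbb{B}\boldsymbol{u}_sds+\int_0^te^{\mathbb{A}(t-s)}d\boldsymbol{w}_s$.
   Formalization: The optimality claim assumes that the Riccati equation has a positive solution and takes S_∞ to be the least one; uniqueness of S^ρ_∞ is claimed among positive definite solutions, and among all positive semidefinite ones when M is positive definite. *)

theory Defs
  imports "HOL-Probability.Probability"
begin

abbreviation unit_interval :: "real measure" where
  "unit_interval \<equiv> restrict_space lborel {0..1}"

lemma prob_space_unit_interval: "prob_space unit_interval"
  by (rule prob_spaceI) (simp add: emeasure_restrict_space space_restrict_space)

interpretation unit_interval: prob_space unit_interval
  by (rule prob_space_unit_interval)

definition square_integrable :: "(real \<Rightarrow> real) \<Rightarrow> bool" where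
  "square_integrable f \<longleftrightarrow>
     f \<in> borel_measurable unit_interval \<and> integrable unit_interval (\<lambda>x. (f x)\<^sup>2)"

lemma square_integrable_measurable [measurable_dest]:
  "square_integrable f \<Longrightarrow> f \<in> borel_measurable unit_interval"
  by (simp add: square_integrable_def)

lemma square_integrable_mult:
  assumes f: "square_integrable f" and g: "square_integrable g"
  shows "integrable unit_interval (\<lambda>x. f x * g x)"
proof (rule Bochner_Integration.integrable_bound)
  show "integrable unit_interval (\<lambda>x. (f x)\<^sup>2 + (g x)\<^sup>2)"
    using f g by (auto simp: square_integrable_def)
  show "(\<lambda>x. f x * g x) \<in> borel_measurable unit_interval"
    using f g by (auto simp: square_integrable_def)
  have "\<bar>a * b\<bar> \<le> a\<^sup>2 + b\<^sup>2" for a b :: real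
  proof -
    have "2 * \<bar>a\<bar> * \<bar>b\<bar> \<le> a\<^sup>2 + b\<^sup>2"
      using sum_squares_bound[of "\<bar>a\<bar>" "\<bar>b\<bar>"] by simp
    moreover have "0 \<le> \<bar>a\<bar> * \<bar>b\<bar>" by simp
    ultimately show ?thesis unfolding abs_mult by linarith
  qed
  then show "AE x in unit_interval. norm (f x * g x) \<le> norm ((f x)\<^sup>2 + (g x)\<^sup>2)"
    by simp
qed

lemma square_integrable_add:
  assumes f: "square_integrable f" and g: "square_integrable g"
  shows "square_integrable (\<lambda>x. f x + g x)"
  using assms square_integrable_mult[OF f g]
  by (auto simp: square_integrable_def power2_sum mult.assoc)

lemma square_integrable_scale: "square_integrable f \<Longrightarrow> square_integrable (\<lambda>x. c * f x)"
  by (auto simp: square_integrable_def power_mult_distrib)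

lemma square_integrable_bounded:
  assumes "f \<in> borel_measurable unit_interval" "\<And>x. x \<in> {0..1} \<Longrightarrow> \<bar>f x\<bar> \<le> C"
  shows "square_integrable f"
  unfolding square_integrable_def
proof
  show "integrable unit_interval (\<lambda>x. (f x)\<^sup>2)"
  proof (rule unit_interval.integrable_const_bound[of _ "C\<^sup>2"])
    show "AE x in unit_interval. norm ((f x)\<^sup>2) \<le> C\<^sup>2"
    proof (rule AE_I2)
      fix x assume "x \<in> space unit_interval"
      then have "\<bar>f x\<bar> \<le> C" using assms(2)[of x] by (auto simp: space_restrict_space)
      then show "norm ((f x)\<^sup>2) \<le> C\<^sup>2"
        by (simp add: abs_le_square_iff[symmetric])
    qed
  qed (use assms in auto)
qed (use assms in auto)

lemma square_integrable_const: "square_integrable (\<lambda>x. c)"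
  by (auto simp: square_integrable_def)

text \<open>The Hilbert space of (classes of) square integrable functions on $[0,1]$.\<close>

quotient_type L2 = "real \<Rightarrow> real" /
    partial: "\<lambda>f g. square_integrable f \<and> square_integrable g \<and> (AE x in unit_interval. f x = g x)"
  morphisms L2_fun L2_class
proof (rule part_equivpI)
  show "\<exists>f. square_integrable f \<and> square_integrable f \<and> (AE x in unit_interval. f x = f x)"
    using square_integrable_const by auto
qed (auto intro!: sympI transpI)

instantiation L2 :: real_vector
begin

lift_definition zero_L2 :: L2 is "\<lambda>_. 0"
  by (simp add: square_integrable_const)

lift_definition plus_L2 :: "L2 \<Rightarrow> L2 \<Rightarrow> L2" is "\<lambda>f g x. f x + g x"
  by (auto intro!: square_integrable_add)

lift_definition scaleR_L2 :: "real \<Rightarrow> L2 \<Rightarrow> L2" is "\<lambda>c f x. c * f x"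
  by (auto intro!: square_integrable_scale)

definition uminus_L2 :: "L2 \<Rightarrow> L2" where "uminus_L2 f = (- 1) *\<^sub>R f"

definition minus_L2 :: "L2 \<Rightarrow> L2 \<Rightarrow> L2" where "minus_L2 f g = f + - g"

instance
proof
  fix a b c :: L2 and r s :: real
  show "a + b + c = a + (b + c)" "a + b = b + a" "0 + a = a"
    by (transfer, auto simp: square_integrable_const ac_simps intro!: square_integrable_add)+
  show "- a + a = 0"
    unfolding uminus_L2_def
    by (transfer, use square_integrable_add square_integrable_scale square_integrable_const in fastforce)
  show "a - b = a + - b" by (simp add: minus_L2_def)
  show "r *\<^sub>R (a + b) = r *\<^sub>R a + r *\<^sub>R b" "(r + s) *\<^sub>R a = r *\<^sub>R a + s *\<^sub>R a"
    "r *\<^sub>R s *\<^sub>R a = (r * s) *\<^sub>R a" "1 *\<^sub>R a = a"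
    by (transfer, auto simp: algebra_simps intro!: square_integrable_add square_integrable_scale)+
qed

end

instantiation L2 :: real_inner
begin

lift_definition inner_L2 :: "L2 \<Rightarrow> L2 \<Rightarrow> real" is "\<lambda>f g. (LINT x|unit_interval. f x * g x)"
  by (intro integral_cong_AE) (auto simp: square_integrable_def)

definition norm_L2 :: "L2 \<Rightarrow> real" where "norm_L2 f = sqrt (f \<bullet> f)"

definition sgn_L2 :: "L2 \<Rightarrow> L2" where "sgn_L2 f = f /\<^sub>R norm f"

definition dist_L2 :: "L2 \<Rightarrow> L2 \<Rightarrow> real" where "dist_L2 f g = norm (f - g)"

definition uniformity_L2 :: "(L2 \<times> L2) filter" where
  "uniformity_L2 = (INF e\<in>{0 <..}. principal {(f, g). dist f g < e})"

definition open_L2 :: "L2 set \<Rightarrow> bool" where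
  "open_L2 U \<longleftrightarrow> (\<forall>x\<in>U. eventually (\<lambda>(x', y). x' = x \<longrightarrow> y \<in> U) uniformity)"

instance
proof
  fix a b c :: L2 and r :: real and U :: "L2 set"
  show "sgn a = a /\<^sub>R norm a" "dist a b = norm (a - b)" "norm a = sqrt (a \<bullet> a)"
    "uniformity = (INF e\<in>{0 <..}. principal {(f :: L2, g). dist f g < e})"
    "open U \<longleftrightarrow> (\<forall>x\<in>U. eventually (\<lambda>(x', y). x' = x \<longrightarrow> y \<in> U) uniformity)"
    by (simp_all add: sgn_L2_def dist_L2_def norm_L2_def uniformity_L2_def open_L2_def)
  show "a \<bullet> b = b \<bullet> a"
    by transfer (simp add: mult.commute)
  show "(a + b) \<bullet> c = a \<bullet> c + b \<bullet> c"
    by transfer (simp add: algebra_simps square_integrable_mult)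
  show "(r *\<^sub>R a) \<bullet> b = r * (a \<bullet> b)"
    by transfer (simp add: mult.assoc)
  show "0 \<le> a \<bullet> a"
    by transfer simp
  show "a \<bullet> a = 0 \<longleftrightarrow> a = 0"
  proof transfer
    fix f :: "real \<Rightarrow> real"
    assume "square_integrable f \<and> square_integrable f \<and> (AE x in unit_interval. f x = f x)"
    then have f: "square_integrable f" by simp
    have "(LINT x|unit_interval. f x * f x) = 0 \<longleftrightarrow> (AE x in unit_interval. f x * f x = 0)"
      by (intro integral_nonneg_eq_0_iff_AE square_integrable_mult f) simp
    then show "(LINT x|unit_interval. f x * f x) = 0 \<longleftrightarrow>
        square_integrable f \<and> square_integrable (\<lambda>_. 0) \<and> (AE x in unit_interval. f x = 0)"
      using f square_integrable_const by simp
  qed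
qed

end

lemma L2_fun_square_integrable: "square_integrable (L2_fun f)"
  using Quotient3_rep_reflp[OF Quotient3_L2] by simp

lemma L2_class_L2_fun [simp]: "L2_class (L2_fun f) = f"
  using Quotient3_abs_rep[OF Quotient3_L2] by simp

lemma L2_fun_L2_class:
  "square_integrable f \<Longrightarrow> AE x in unit_interval. L2_fun (L2_class f) x = f x"
  using Quotient3_rep_abs[OF Quotient3_L2, of f] by simp

lemma L2_class_eqI:
  "square_integrable f \<Longrightarrow> square_integrable g \<Longrightarrow> AE x in unit_interval. f x = g x
    \<Longrightarrow> L2_class f = L2_class g"
  using Quotient3_rel_abs[OF Quotient3_L2, of f g] by simp

lemma L2_class_add:
  "square_integrable f \<Longrightarrow> square_integrable g \<Longrightarrow>
     L2_class f + L2_class g = L2_class (\<lambda>x. f x + g x)"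
  by (simp add: plus_L2.abs_eq eq_onp_def)

lemma L2_class_scale: "square_integrable f \<Longrightarrow> c *\<^sub>R L2_class f = L2_class (\<lambda>x. c * f x)"
  by (simp add: scaleR_L2.abs_eq)

lemma L2_class_diff:
  assumes f: "square_integrable f" and g: "square_integrable g"
  shows "L2_class f - L2_class g = L2_class (\<lambda>x. f x - g x)"
proof -
  have "L2_class f - L2_class g = L2_class f + L2_class (\<lambda>x. - 1 * g x)"
    unfolding minus_L2_def uminus_L2_def L2_class_scale[OF g] ..
  also have "\<dots> = L2_class (\<lambda>x. f x + - 1 * g x)"
    by (rule L2_class_add[OF f square_integrable_scale[OF g]])
  finally show ?thesis by simp
qed

lemma inner_L2_class:
  "square_integrable f \<Longrightarrow> square_integrable g \<Longrightarrow>
     L2_class f \<bullet> L2_class g = (LINT x|unit_interval. f x * g x)"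
  by (simp add: inner_L2.abs_eq)

lemma norm_L2_class:
  "square_integrable f \<Longrightarrow> (norm (L2_class f))\<^sup>2 = (LINT x|unit_interval. (f x)\<^sup>2)"
  unfolding power2_norm_eq_inner by (simp add: inner_L2_class power2_eq_square)

lemma norm_L2_class_le:
  assumes "square_integrable f" "\<And>x. x \<in> {0..1} \<Longrightarrow> \<bar>f x\<bar> \<le> C" "0 \<le> C"
  shows "norm (L2_class f) \<le> C"
proof -
  have "(LINT x|unit_interval. (f x)\<^sup>2) \<le> (LINT x|unit_interval. C\<^sup>2)"
  proof (rule integral_mono)
    fix x assume "x \<in> space unit_interval"
    then have "\<bar>f x\<bar> \<le> \<bar>C\<bar>" using assms(2)[of x] assms(3) by (simp add: space_restrict_space)
    then show "(f x)\<^sup>2 \<le> C\<^sup>2" by (simp only: abs_le_square_iff)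
  qed (use assms in \<open>auto simp: square_integrable_def\<close>)
  then have "(norm (L2_class f))\<^sup>2 \<le> C\<^sup>2"
    using unit_interval.prob_space by (simp add: norm_L2_class[OF assms(1)])
  then show ?thesis using assms(3) by (rule power2_le_imp_le)
qed

lemma L2_class_zero: "L2_class (\<lambda>_. 0) = 0"
  by (simp only: zero_L2.abs_eq)

lemma L2_cases: obtains g where "square_integrable g" "f = L2_class g"
  using L2_fun_square_integrable[of f] by (metis L2_class_L2_fun)

lemma square_integrable_diff:
  "square_integrable f \<Longrightarrow> square_integrable g \<Longrightarrow> square_integrable (\<lambda>x. f x - g x)"
  using square_integrable_add[OF _ square_integrable_scale, of f g "- 1"] by simp


lemma nn_integral_square:
  assumes "square_integrable f"
  shows "(\<integral>\<^sup>+x. ennreal ((f x)\<^sup>2) \<partial>unit_interval) = ennreal ((norm (L2_class f))\<^sup>2)"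
  using assms by (subst nn_integral_eq_integral) (auto simp: square_integrable_def norm_L2_class)

lemma nn_integral_abs_le:
  assumes d: "square_integrable d"
  shows "(\<integral>\<^sup>+x. ennreal \<bar>d x\<bar> \<partial>unit_interval) \<le> ennreal (norm (L2_class d))"
proof -
  have ad: "square_integrable (\<lambda>x. \<bar>d x\<bar>)"
    using d by (auto simp: square_integrable_def)
  have c: "square_integrable (\<lambda>x. 1)" by (rule square_integrable_const)
  have n1: "(norm (L2_class (\<lambda>x. 1)))\<^sup>2 = 1"
    using unit_interval.prob_space by (simp add: norm_L2_class[OF c])
  have n2: "norm (L2_class (\<lambda>x. \<bar>d x\<bar>)) = norm (L2_class d)"
    using norm_L2_class[OF ad] norm_L2_class[OF d]
    by (simp flip: power2_eq_iff_nonneg[OF norm_ge_zero norm_ge_zero])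
  have "integrable unit_interval (\<lambda>x. \<bar>d x\<bar>)"
    using square_integrable_mult[OF ad c] by simp
  then have "(\<integral>\<^sup>+x. ennreal \<bar>d x\<bar> \<partial>unit_interval) = ennreal (LINT x|unit_interval. \<bar>d x\<bar> * 1)"
    by (subst nn_integral_eq_integral) auto
  also have "(LINT x|unit_interval. \<bar>d x\<bar> * 1) = L2_class (\<lambda>x. \<bar>d x\<bar>) \<bullet> L2_class (\<lambda>x. 1)"
    by (rule inner_L2_class[OF ad c, symmetric])
  also have "\<dots> \<le> norm (L2_class (\<lambda>x. \<bar>d x\<bar>)) * norm (L2_class (\<lambda>x. 1))"
    by (rule norm_cauchy_schwarz)
  also have "\<dots> = norm (L2_class d)"
    using n1 n2 by (simp add: norm_ge_zero power2_eq_iff_nonneg[of _ 1, simplified])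
  finally show ?thesis by (simp add: ennreal_leI)
qed

instance L2 :: complete_space
proof
  fix X :: "nat \<Rightarrow> L2"
  assume X: "Cauchy X"
  have "\<forall>n. \<exists>N. \<forall>i\<ge>N. \<forall>j\<ge>N. norm (X i - X j) < (1/2)^n"
    using X by (auto simp: Cauchy_iff)
  then obtain N where N: "\<And>n i j. i \<ge> N n \<Longrightarrow> j \<ge> N n \<Longrightarrow> norm (X i - X j) < (1/2)^n"
    by metis
  define r where "r n = (\<Sum>k\<le>n. N k)" for n
  have rN: "N n \<le> r n" for n
    unfolding r_def by (rule member_le_sum) auto
  have r_mono: "m \<le> n \<Longrightarrow> r m \<le> r n" for m n
    unfolding r_def by (rule sum_mono2) auto
  have rX: "norm (X (r m) - X (r n)) < (1/2)^n" if "n \<le> m" for m n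
    using N[of n "r m" "r n"] rN[of n] r_mono[OF that] by linarith
  define f where "f n = L2_fun (X (r n))" for n
  have f: "square_integrable (f n)" and Lf: "L2_class (f n) = X (r n)" for n
    by (simp_all add: f_def L2_fun_square_integrable)
  have [measurable]: "f n \<in> borel_measurable unit_interval" for n
    using f by (auto simp: square_integrable_def)
  define d where "d n x = f (Suc n) x - f n x" for n x
  have d: "square_integrable (d n)" and Ld: "norm (L2_class (d n)) \<le> (1/2)^n" for n
  proof -
    show "square_integrable (d n)"
      unfolding d_def by (intro square_integrable_diff f)
    show "norm (L2_class (d n)) \<le> (1/2)^n"
      unfolding d_def using rX[of n "Suc n"] by (simp add: L2_class_diff[OF f f, symmetric] Lf)
  qed
  have [measurable]: "d n \<in> borel_measurable unit_interval" for n
    using d by (auto simp: square_integrable_def)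
  have "(\<integral>\<^sup>+x. (\<Sum>n. ennreal \<bar>d n x\<bar>) \<partial>unit_interval) = (\<Sum>n. \<integral>\<^sup>+x. ennreal \<bar>d n x\<bar> \<partial>unit_interval)"
    by (rule nn_integral_suminf) simp
  also have "\<dots> \<le> (\<Sum>n. ennreal ((1/2)^n))"
    by (intro suminf_le summableI order_trans[OF nn_integral_abs_le[OF d]] ennreal_leI Ld)
  also have "\<dots> = ennreal (\<Sum>n. (1/2)^n)"
    by (rule suminf_ennreal2) (auto intro: summable_geometric)
  finally have "(\<integral>\<^sup>+x. (\<Sum>n. ennreal \<bar>d n x\<bar>) \<partial>unit_interval) \<noteq> \<infinity>"
    by (auto simp: top_unique)
  then have "AE x in unit_interval. (\<Sum>n. ennreal \<bar>d n x\<bar>) \<noteq> \<infinity>"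
    by (intro nn_integral_PInf_AE) simp_all
  then have conv: "AE x in unit_interval. (\<lambda>n. f n x) \<longlonglongrightarrow> lim (\<lambda>n. f n x)"
  proof eventually_elim
    case (elim x)
    have "summable (\<lambda>n. \<bar>d n x\<bar>)"
      using elim by (intro summable_suminf_not_top) auto
    then have "summable (\<lambda>n. d n x)"
      by (rule summable_rabs_cancel)
    then have "convergent (\<lambda>n. \<Sum>k<n. d k x)"
      by (simp add: summable_iff_convergent)
    then have "convergent (\<lambda>n. f 0 x + (\<Sum>k<n. d k x))"
      by (intro convergent_add convergent_const)
    moreover have "f 0 x + (\<Sum>k<n. d k x) = f n x" for n
      by (simp add: d_def sum_lessThan_telescope[of "\<lambda>n. f n x"])
    ultimately show ?case
      by (simp add: convergent_LIMSEQ_iff)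
  qed
  define g where "g x = lim (\<lambda>n. f n x)" for x
  have [measurable]: "g \<in> borel_measurable unit_interval"
    unfolding g_def by measurable
  have bound: "(\<integral>\<^sup>+x. ennreal ((g x - f n x)\<^sup>2) \<partial>unit_interval) \<le> ennreal (((1/2)^n)\<^sup>2)" for n
  proof -
    have "(\<integral>\<^sup>+x. ennreal ((g x - f n x)\<^sup>2) \<partial>unit_interval)
        = (\<integral>\<^sup>+x. liminf (\<lambda>m. ennreal ((f m x - f n x)\<^sup>2)) \<partial>unit_interval)"
    proof (rule nn_integral_cong_AE, use conv in eventually_elim)
      case (elim x)
      then have "(\<lambda>m. ennreal ((f m x - f n x)\<^sup>2)) \<longlonglongrightarrow> ennreal ((g x - f n x)\<^sup>2)"
        by (auto intro!: tendsto_intros simp: g_def)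
      then show ?case
        by (rule lim_imp_Liminf[OF sequentially_bot, symmetric])
    qed
    also have "\<dots> \<le> liminf (\<lambda>m. \<integral>\<^sup>+x. ennreal ((f m x - f n x)\<^sup>2) \<partial>unit_interval)"
      by (rule nn_integral_liminf) simp
    also have "\<dots> \<le> liminf (\<lambda>m. ennreal (((1/2)^n)\<^sup>2))"
    proof (rule Liminf_mono, rule eventually_sequentiallyI)
      fix m assume "n \<le> m"
      have "(\<integral>\<^sup>+x. ennreal ((f m x - f n x)\<^sup>2) \<partial>unit_interval) = ennreal ((norm (X (r m) - X (r n)))\<^sup>2)"
        by (simp add: nn_integral_square square_integrable_diff f L2_class_diff[OF f f, symmetric] Lf)
      also have "\<dots> \<le> ennreal (((1/2)^n)\<^sup>2)"
        using rX[OF \<open>n \<le> m\<close>] by (intro ennreal_leI power_mono) simp_all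
      finally show "(\<integral>\<^sup>+x. ennreal ((f m x - f n x)\<^sup>2) \<partial>unit_interval) \<le> ennreal (((1/2)^n)\<^sup>2)" .
    qed
    also have "\<dots> = ennreal (((1/2)^n)\<^sup>2)"
      by (simp add: Liminf_const)
    finally show ?thesis .
  qed
  have gf: "square_integrable (\<lambda>x. g x - f n x)" for n
    unfolding square_integrable_def
  proof
    show "integrable unit_interval (\<lambda>x. (g x - f n x)\<^sup>2)"
    proof (rule integrableI_bounded)
      show "(\<integral>\<^sup>+x. ennreal (norm ((g x - f n x)\<^sup>2)) \<partial>unit_interval) < \<infinity>"
        using le_less_trans[OF bound[of n] ennreal_less_top] by simp
    qed simp
  qed simp
  have g: "square_integrable g"
    using square_integrable_add[OF gf[of 0] f[of 0]] by simp
  have gX: "norm (L2_class g - X (r n)) \<le> (1/2)^n" for n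
  proof -
    have "ennreal ((norm (L2_class g - X (r n)))\<^sup>2) \<le> ennreal (((1/2)^n)\<^sup>2)"
      using bound[of n] by (simp add: nn_integral_square gf L2_class_diff[OF g f, symmetric] Lf)
    then have "(norm (L2_class g - X (r n)))\<^sup>2 \<le> ((1/2)^n)\<^sup>2"
      by (simp add: ennreal_le_iff)
    then show ?thesis
      by (rule power2_le_imp_le) simp
  qed
  have "X \<longlonglongrightarrow> L2_class g"
  proof (rule LIMSEQ_I)
    fix e :: real assume "0 < e"
    then obtain n where n: "(1/2)^n < e / 2"
      using real_arch_pow_inv[of "e / 2" "1 / 2"] by auto
    have "norm (X m - L2_class g) < e" if "m \<ge> r n" for m
    proof -
      have "norm (X m - L2_class g) \<le> norm (X m - X (r n)) + norm (L2_class g - X (r n))"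
        using norm_triangle_ineq4[of "X m - X (r n)" "L2_class g - X (r n)"] by simp
      moreover have "norm (X m - X (r n)) < (1/2)^n"
        using N[of n m "r n"] rN[of n] that by simp
      ultimately show ?thesis using gX[of n] n by simp
    qed
    then show "\<exists>no. \<forall>m\<ge>no. norm (X m - L2_class g) < e" by blast
  qed
  then show "convergent X" by (rule convergentI)
qed

lemma tendsto_L2_class:
  assumes s: "\<And>n. square_integrable (s n)" and f: "square_integrable f"
    and h: "square_integrable h"
    and lim: "AE x in unit_interval. (\<lambda>n. s n x) \<longlonglongrightarrow> f x"
    and bd: "\<And>n. AE x in unit_interval. \<bar>s n x - f x\<bar> \<le> h x"
  shows "(\<lambda>n. L2_class (s n)) \<longlonglongrightarrow> L2_class f"
proof -
  have [measurable]: "s n \<in> borel_measurable unit_interval" "f \<in> borel_measurable unit_interval" for n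
    using s f by (auto simp: square_integrable_def)
  have "(\<lambda>n. LINT x|unit_interval. (s n x - f x)\<^sup>2) \<longlonglongrightarrow> (LINT x|unit_interval. 0)"
  proof (rule integral_dominated_convergence[where w = "\<lambda>x. (h x)\<^sup>2"])
    show "integrable unit_interval (\<lambda>x. (h x)\<^sup>2)"
      using h by (simp add: square_integrable_def)
    show "AE x in unit_interval. (\<lambda>n. (s n x - f x)\<^sup>2) \<longlonglongrightarrow> 0"
      using lim by eventually_elim (auto intro!: tendsto_eq_intros)
    show "AE x in unit_interval. norm ((s n x - f x)\<^sup>2) \<le> (h x)\<^sup>2" for n
      using bd[of n]
    proof eventually_elim
      case (elim x)
      then have "\<bar>s n x - f x\<bar> \<le> \<bar>h x\<bar>" by linarith
      then show ?case by (simp only: abs_le_square_iff real_norm_def abs_power2)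
    qed
  qed auto
  then have "(\<lambda>n. (norm (L2_class (s n) - L2_class f))\<^sup>2) \<longlonglongrightarrow> 0"
    by (simp add: L2_class_diff[OF s f] norm_L2_class square_integrable_diff s f)
  then have "(\<lambda>n. norm (L2_class (s n) - L2_class f)) \<longlonglongrightarrow> 0"
    by (simp only: power_tendsto_0_iff zero_less_numeral)
  then show ?thesis
    by (rule LIM_zero_cancel[OF tendsto_norm_zero_cancel])
qed

lemma square_integrable_indicator:
  "A \<in> sets borel \<Longrightarrow> square_integrable (indicator A)"
proof (rule square_integrable_bounded[where C = 1])
  assume "A \<in> sets borel"
  then show "(indicator A :: real \<Rightarrow> real) \<in> borel_measurable unit_interval"
    by (intro measurable_restrict_space1[OF borel_measurable_indicator]) (simp only: sets_lborel)
next
  show "\<bar>indicator A x :: real\<bar> \<le> 1" for x by (cases "x \<in> A") auto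
qed

lemma L2_countable_dense: "\<exists>D :: L2 set. countable D \<and> closure D = UNIV"
proof -
  define e :: "rat \<Rightarrow> L2" where "e q = L2_class (indicator {..of_rat q})" for q
  define comb where "comb xs = (\<Sum>(c, q)\<leftarrow>xs. (of_rat c :: real) *\<^sub>R e q)" for xs :: "(rat \<times> rat) list"
  define D where "D = range comb"
  have D_add: "x + y \<in> D" if "x \<in> D" "y \<in> D" for x y
  proof -
    from that obtain xs ys where "x = comb xs" "y = comb ys" unfolding D_def by blast
    then have "x + y = comb (xs @ ys)" by (simp add: comb_def)
    then show ?thesis by (simp add: D_def)
  qed
  have D_scale: "(of_rat c :: real) *\<^sub>R x \<in> D" if "x \<in> D" for x c
  proof -
    from that obtain xs where "x = comb xs" unfolding D_def by blast
    moreover have "of_rat c *\<^sub>R comb xs = comb (map (\<lambda>(a, q). (c * a, q)) xs)"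
      by (induction xs) (simp_all add: comb_def scaleR_right_distrib of_rat_mult split_beta)
    ultimately show ?thesis by (simp add: D_def)
  qed
  define C where "C = closure D"
  have C0: "0 \<in> C"
  proof -
    have "comb [] \<in> C" using closure_subset[of D] unfolding C_def D_def by blast
    then show ?thesis by (simp add: comb_def)
  qed
  have C_lim: "x \<in> C" if "\<And>n. s n \<in> C" "s \<longlonglongrightarrow> x" for s and x :: L2
    using that closed_sequentially[of C s x] by (simp add: C_def)
  have C_add: "x + y \<in> C" if "x \<in> C" "y \<in> C" for x y
  proof -
    from that obtain s t where "\<And>n. s n \<in> D" "s \<longlonglongrightarrow> x" "\<And>n. t n \<in> D" "t \<longlonglongrightarrow> y"
      unfolding C_def closure_sequential by blast
    then have "\<forall>n. s n + t n \<in> D" and l: "(\<lambda>n. s n + t n) \<longlonglongrightarrow> x + y"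
      by (simp_all add: D_add tendsto_add)
    then show ?thesis unfolding C_def closure_sequential by (intro exI[of _ "\<lambda>n. s n + t n"] conjI)
  qed
  have C_scale: "c *\<^sub>R x \<in> C" if "x \<in> C" for c :: real and x
  proof -
    from that obtain s where s: "\<And>n. s n \<in> D" "s \<longlonglongrightarrow> x"
      unfolding C_def closure_sequential by blast
    have "\<exists>q. \<bar>of_rat q - c\<bar> < inverse (real (Suc n))" for n
      using of_rat_dense[of "c - inverse (real (Suc n))" "c + inverse (real (Suc n))"]
      by (auto simp: abs_less_iff algebra_simps)
    then obtain q where q: "\<And>n. \<bar>of_rat (q n) - c\<bar> < inverse (real (Suc n))" by metis
    have "(\<lambda>n. of_rat (q n) - c) \<longlonglongrightarrow> 0"
      by (rule tendsto_0_le[OF LIMSEQ_inverse_real_of_nat, where K = 1])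
        (use q in \<open>simp add: less_imp_le\<close>)
    then have "(\<lambda>n. of_rat (q n)) \<longlonglongrightarrow> c" by (rule LIM_zero_cancel)
    then have "\<forall>n. of_rat (q n) *\<^sub>R s n \<in> D" "(\<lambda>n. of_rat (q n) *\<^sub>R s n) \<longlonglongrightarrow> c *\<^sub>R x"
      using s by (simp_all add: D_scale tendsto_scaleR)
    then show ?thesis unfolding C_def closure_sequential by (intro exI[of _ "\<lambda>n. of_rat (q n) *\<^sub>R s n"] conjI)
  qed
  have C_sum: "(\<Sum>i\<in>I. s i) \<in> C" if "\<And>i. i \<in> I \<Longrightarrow> s i \<in> C" for I :: "'i set" and s
    using that by (induction I rule: infinite_finite_induct) (auto intro: C0 C_add)
  have one: "square_integrable (\<lambda>x. 1)" by (rule square_integrable_const)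
  have C_atMost: "L2_class (indicator {..a}) \<in> C" for a :: real
  proof -
    have "\<exists>q. a < of_rat q \<and> of_rat q < a + inverse (real (Suc n))" for n
      using of_rat_dense[of a "a + inverse (real (Suc n))"] by auto
    then obtain q where q: "\<And>n. a < of_rat (q n)" "\<And>n. of_rat (q n) < a + inverse (real (Suc n))"
      by metis
    have "(\<lambda>n. L2_class (indicator {..of_rat (q n)})) \<longlonglongrightarrow> L2_class (indicator {..a})"
    proof (rule tendsto_L2_class[OF _ _ one])
      show "AE x in unit_interval. (\<lambda>n. indicator {..of_rat (q n)} x) \<longlonglongrightarrow> (indicator {..a} x :: real)"
      proof (rule AE_I2)
        fix x :: real
        show "(\<lambda>n. indicator {..of_rat (q n)} x) \<longlonglongrightarrow> (indicator {..a} x :: real)"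
        proof (cases "x \<le> a")
          case True
          then have "x \<le> of_rat (q n)" for n using q(1)[of n] by linarith
          then show ?thesis using True by simp
        next
          case False
          then have "\<forall>\<^sub>F n in sequentially. inverse (real (Suc n)) < x - a"
            using order_tendstoD(2)[OF LIMSEQ_inverse_real_of_nat, of "x - a"] by simp
          then have "\<forall>\<^sub>F n in sequentially. indicator {..of_rat (q n)} x = (0::real)"
          proof eventually_elim
            case (elim n)
            then have "of_rat (q n) < x" using q(2)[of n] by linarith
            then show ?case by simp
          qed
          then show ?thesis using False by (simp add: tendsto_eventually)
        qed
      qed
    qed (auto intro!: square_integrable_indicator simp: indicator_def)
    moreover have "e p \<in> D" for p
      unfolding D_def comb_def by (rule image_eqI[of _ _ "[(1, p)]"]) simp_all
    then have "L2_class (indicator {..of_rat (q n)}) \<in> C" for n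
      using closure_subset[of D] by (auto simp: C_def e_def)
    ultimately show ?thesis by (rule C_lim[rotated])
  qed
  have one_C: "L2_class (\<lambda>x. 1) \<in> C"
  proof -
    have "L2_class (indicator {..1}) = L2_class (\<lambda>x. 1)"
      by (rule L2_class_eqI) (auto intro!: square_integrable_indicator one AE_I2 simp: space_restrict_space)
    then show ?thesis using C_atMost[of 1] by simp
  qed
  have C_diff: "x - y \<in> C" if "x \<in> C" "y \<in> C" for x y
    using C_add[OF that(1) C_scale[OF that(2), of "- 1"]] by simp
  have C_ind: "L2_class (indicator A) \<in> C" if "A \<in> sets borel" for A
  proof -
    have A_sig: "A \<in> sigma_sets UNIV (range (\<lambda>a::real. {..a}))"
      using that unfolding borel_eq_atMost by simp
    have "Int_stable (range (\<lambda>a::real. {..a}))"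
      by (auto simp: Int_stable_def)
    moreover have "range (\<lambda>a::real. {..a}) \<subseteq> Pow UNIV" by simp
    ultimately show ?thesis
      using A_sig
    proof (induction rule: sigma_sets_induct_disjoint)
      case (basic A)
      then show ?case using C_atMost by auto
    next
      case empty
      show ?case by (simp add: L2_class_zero C0)
    next
      case (compl A)
      then have A: "A \<in> sets borel" unfolding borel_eq_atMost by simp
      have "indicator (UNIV - A) = (\<lambda>x. 1 - indicator A x :: real)"
        by (rule ext) (simp add: indicator_def)
      then have "L2_class (indicator (UNIV - A)) = L2_class (\<lambda>x. 1) - L2_class (indicator A)"
        using L2_class_diff[OF one square_integrable_indicator[OF A]] by simp
      then show ?case using compl one_C by (simp add: C_diff)
    next
      case (union A)
      then have A: "\<And>i. A i \<in> sets borel" unfolding borel_eq_atMost by auto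
      have fin: "L2_class (indicator (\<Union>i<n. A i)) \<in> C" for n
      proof (induction n)
        case 0
        show ?case by (simp add: L2_class_zero C0)
      next
        case (Suc n)
        have "A n \<inter> A i = {}" if "i < n" for i
          using union(1) that by (simp add: disjoint_family_on_def)
        then have "A n \<inter> (\<Union>i<n. A i) = {}" by blast
        then have "indicator (\<Union>i<Suc n. A i) = (\<lambda>x. indicator (\<Union>i<n. A i) x + indicator (A n) x :: real)"
          by (intro ext) (auto simp: indicator_def lessThan_Suc)
        then have "L2_class (indicator (\<Union>i<Suc n. A i)) = L2_class (indicator (\<Union>i<n. A i)) + L2_class (indicator (A n))"
          using A by (simp add: L2_class_add square_integrable_indicator)
        then show ?case using Suc union by (simp add: C_add)
      qed
      have "(\<lambda>n. L2_class (indicator (\<Union>i<n. A i))) \<longlonglongrightarrow> L2_class (indicator (\<Union>i. A i))"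
      proof (rule tendsto_L2_class[OF _ _ one])
        show "AE x in unit_interval. (\<lambda>n. indicator (\<Union>i<n. A i) x) \<longlonglongrightarrow> (indicator (\<Union>i. A i) x :: real)"
          by (intro AE_I2 LIMSEQ_indicator_UN)
      qed (use A in \<open>auto intro!: square_integrable_indicator simp: indicator_def\<close>)
      with fin show ?case by (rule C_lim)
    qed
  qed
  have "f \<in> C" for f
  proof -
    obtain g where g: "square_integrable g" "f = L2_class g" by (rule L2_cases)
    then have "g \<in> borel_measurable unit_interval" by (simp add: square_integrable_def)
    then obtain s where s: "\<And>i. simple_function unit_interval (s i)"
      "\<And>x. x \<in> space unit_interval \<Longrightarrow> (\<lambda>i. s i x) \<longlonglongrightarrow> g x"
      "\<And>i x. x \<in> space unit_interval \<Longrightarrow> dist (s i x) 0 \<le> 2 * dist (g x) 0"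
      using borel_measurable_implies_sequence_metric[of g unit_interval 0] by blast
    have sm: "s i \<in> borel_measurable unit_interval" for i
      using s(1) by (rule borel_measurable_simple_function)
    have ag: "square_integrable (\<lambda>x. 3 * \<bar>g x\<bar>)"
      using g by (intro square_integrable_scale) (auto simp: square_integrable_def)
    have sq: "square_integrable (s i)" for i
      unfolding square_integrable_def
    proof
      show "integrable unit_interval (\<lambda>x. (s i x)\<^sup>2)"
      proof (rule Bochner_Integration.integrable_bound)
        show "integrable unit_interval (\<lambda>x. (3 * \<bar>g x\<bar>)\<^sup>2)"
          using ag by (simp add: square_integrable_def)
        have "\<bar>s i x\<bar> \<le> \<bar>3 * \<bar>g x\<bar>\<bar>" if "x \<in> space unit_interval" for x
          using s(3)[OF that, of i] by simp
        then show "AE x in unit_interval. norm ((s i x)\<^sup>2) \<le> norm ((3 * \<bar>g x\<bar>)\<^sup>2)"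
          by (intro AE_I2) (simp only: abs_le_square_iff real_norm_def abs_power2)
      qed (use sm in simp)
    qed (rule sm)
    have "(\<lambda>i. L2_class (s i)) \<longlonglongrightarrow> L2_class g"
    proof (rule tendsto_L2_class[OF sq g(1) ag])
      show "AE x in unit_interval. (\<lambda>i. s i x) \<longlonglongrightarrow> g x"
        using s(2) by (rule AE_I2)
      show "AE x in unit_interval. \<bar>s i x - g x\<bar> \<le> 3 * \<bar>g x\<bar>" for i
      proof (rule AE_I2)
        fix x assume "x \<in> space unit_interval"
        then have "\<bar>s i x\<bar> \<le> 2 * \<bar>g x\<bar>" using s(3)[of x i] by simp
        then show "\<bar>s i x - g x\<bar> \<le> 3 * \<bar>g x\<bar>" by linarith
      qed
    qed
    moreover have "L2_class (s i) \<in> C" for i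
    proof -
      let ?A = "\<lambda>y. s i -` {y} \<inter> space unit_interval"
      have fin: "finite (s i ` space unit_interval)"
        using s(1) by (simp add: simple_function_def)
      have A: "?A y \<in> sets borel" for y
      proof -
        have "?A y \<in> sets unit_interval"
          using sm by (rule measurable_sets) simp
        then show ?thesis by (simp add: sets_restrict_space_iff)
      qed
      have sums: "square_integrable (\<lambda>x. \<Sum>y\<in>I. y * indicator (?A y) x) \<and>
          L2_class (\<lambda>x. \<Sum>y\<in>I. y * indicator (?A y) x) = (\<Sum>y\<in>I. y *\<^sub>R L2_class (indicator (?A y)))"
        if "finite I" for I
        using that
      proof (induction I)
        case empty
        then show ?case by (simp add: square_integrable_const L2_class_zero)
      next
        case (insert y I)
        have y: "square_integrable (\<lambda>x. y * indicator (?A y) x)"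
          by (intro square_integrable_scale square_integrable_indicator A)
        note S = conjunct1[OF insert.IH] and E = conjunct2[OF insert.IH]
        have "L2_class (\<lambda>x. y * indicator (?A y) x + (\<Sum>y\<in>I. y * indicator (?A y) x))
            = y *\<^sub>R L2_class (indicator (?A y)) + (\<Sum>y\<in>I. y *\<^sub>R L2_class (indicator (?A y)))"
          unfolding E[symmetric] L2_class_scale[OF square_integrable_indicator[OF A[of y]], of y]
          by (rule L2_class_add[OF y S, symmetric])
        then show ?case
          unfolding sum.insert[OF insert.hyps] by (intro conjI square_integrable_add[OF y S])
      qed
      have "AE x in unit_interval. s i x = (\<Sum>y\<in>s i ` space unit_interval. y * indicator (?A y) x)"
      proof (rule AE_I2)
        fix x assume x: "x \<in> space unit_interval"
        have "(\<Sum>y\<in>s i ` space unit_interval. y * indicator (?A y) x)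
            = (\<Sum>y\<in>s i ` space unit_interval. if y = s i x then y else 0)"
          using x by (intro sum.cong) (auto simp: indicator_def)
        also have "\<dots> = s i x" using fin x by simp
        finally show "s i x = (\<Sum>y\<in>s i ` space unit_interval. y * indicator (?A y) x)" by simp
      qed
      then have "L2_class (s i) = (\<Sum>y\<in>s i ` space unit_interval. y *\<^sub>R L2_class (indicator (?A y)))"
        using sums[OF fin] L2_class_eqI[OF sq, of "\<lambda>x. \<Sum>y\<in>s i ` space unit_interval. y * indicator (?A y) x"] by (simp only:)
      then show ?thesis
        by (simp only: C_sum C_scale C_ind A)
    qed
    ultimately have "L2_class g \<in> C" by (rule C_lim[rotated])
    then show ?thesis using g(2) by simp
  qed
  then have "closure D = UNIV" by (auto simp: C_def)
  moreover have "countable D" by (simp add: D_def)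
  ultimately show ?thesis by blast
qed

instance L2 :: second_countable_topology
proof
  obtain D :: "L2 set" where D: "countable D" "closure D = UNIV"
    using L2_countable_dense by blast
  define B where "B = (\<lambda>(c, n). ball c (inverse (real (Suc n)))) ` (D \<times> UNIV)"
  have "topological_basis B"
  proof (rule topological_basisI)
    fix U and x :: L2 assume "open U" "x \<in> U"
    then obtain r where r: "0 < r" "ball x r \<subseteq> U" by (auto simp: open_contains_ball)
    obtain n where n: "inverse (real (Suc n)) < r / 2"
      using reals_Archimedean[of "r / 2"] r(1) by auto
    have "x \<in> closure D" using D by simp
    then obtain c where c: "c \<in> D" "dist c x < inverse (real (Suc n))"
      unfolding closure_approachable by (metis inverse_positive_iff_positive of_nat_0_less_iff zero_less_Suc)
    have "ball c (inverse (real (Suc n))) \<subseteq> ball x r"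
    proof
      fix y assume "y \<in> ball c (inverse (real (Suc n)))"
      then have "dist x y < r"
        using dist_triangle[of x y c] c n by (simp add: dist_commute)
      then show "y \<in> ball x r" by simp
    qed
    then show "\<exists>V\<in>B. x \<in> V \<and> V \<subseteq> U"
      using c r by (intro bexI[of _ "ball c (inverse (real (Suc n)))"]) (auto simp: B_def)
  qed (auto simp: B_def)
  moreover have "countable B" using D by (auto simp: B_def)
  ultimately show "\<exists>B :: L2 set set. countable B \<and> open = generate_topology B"
    using topological_basis_imp_subbasis by blast
qed

instance L2 :: banach ..

instance L2 :: polish_space ..


text \<open>Integral operators and the functional calculus of bounded operators on \<^typ>\<open>L2\<close>\<close>

definition bounded_symmetric_kernel :: "(real \<times> real \<Rightarrow> real) \<Rightarrow> bool" where
  "bounded_symmetric_kernel W \<longleftrightarrow>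
     W \<in> borel_measurable (unit_interval \<Otimes>\<^sub>M unit_interval) \<and>
     (\<exists>C. \<forall>\<alpha>\<in>{0..1}. \<forall>\<beta>\<in>{0..1}. \<bar>W (\<alpha>, \<beta>)\<bar> \<le> C) \<and>
     (\<forall>\<alpha>\<in>{0..1}. \<forall>\<beta>\<in>{0..1}. W (\<alpha>, \<beta>) = W (\<beta>, \<alpha>))"

definition integral_operator :: "(real \<times> real \<Rightarrow> real) \<Rightarrow> L2 \<Rightarrow>\<^sub>L L2" where
  "integral_operator W =
     Blinfun (\<lambda>f. L2_class (\<lambda>\<alpha>. LINT \<beta>|unit_interval. W (\<alpha>, \<beta>) * L2_fun f \<beta>))"

lemma square_integrable_kernel_section:
  assumes "bounded_symmetric_kernel W" "\<alpha> \<in> {0..1}"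
  shows "square_integrable (\<lambda>\<beta>. W (\<alpha>, \<beta>))"
proof -
  from assms obtain C where "\<forall>\<beta>\<in>{0..1}. \<bar>W (\<alpha>, \<beta>)\<bar> \<le> C"
    unfolding bounded_symmetric_kernel_def by blast
  moreover have "(\<lambda>\<beta>. W (\<alpha>, \<beta>)) \<in> borel_measurable unit_interval"
    using assms unfolding bounded_symmetric_kernel_def
    by (intro measurable_compose[OF measurable_Pair1'[of \<alpha> unit_interval unit_interval]])
      (simp_all add: space_restrict_space)
  ultimately show ?thesis
    by (intro square_integrable_bounded) auto
qed

lemma kernel_image:
  assumes W: "bounded_symmetric_kernel W"
  shows "square_integrable (\<lambda>\<alpha>. LINT \<beta>|unit_interval. W (\<alpha>, \<beta>) * L2_fun f \<beta>)"
    and "\<exists>C\<ge>0. \<forall>f. norm (L2_class (\<lambda>\<alpha>. LINT \<beta>|unit_interval. W (\<alpha>, \<beta>) * L2_fun f \<beta>)) \<le> norm f * C"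
proof -
  let ?K = "\<lambda>f \<alpha>. LINT \<beta>|unit_interval. W (\<alpha>, \<beta>) * L2_fun f \<beta>"
  from W obtain C where C: "\<And>\<alpha> \<beta>. \<alpha> \<in> {0..1} \<Longrightarrow> \<beta> \<in> {0..1} \<Longrightarrow> \<bar>W (\<alpha>, \<beta>)\<bar> \<le> C"
    unfolding bounded_symmetric_kernel_def by blast
  have C0: "0 \<le> C" using C[of 0 0] by simp
  have sec_bound: "\<bar>?K f \<alpha>\<bar> \<le> norm f * C" if \<alpha>: "\<alpha> \<in> {0..1}" for f \<alpha>
  proof -
    have "?K f \<alpha> = L2_class (\<lambda>\<beta>. W (\<alpha>, \<beta>)) \<bullet> L2_class (L2_fun f)"
      by (rule inner_L2_class[symmetric, OF square_integrable_kernel_section[OF W \<alpha>] L2_fun_square_integrable])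
    then have "\<bar>?K f \<alpha>\<bar> \<le> norm (L2_class (\<lambda>\<beta>. W (\<alpha>, \<beta>))) * norm f"
      using Cauchy_Schwarz_ineq2[of "L2_class (\<lambda>\<beta>. W (\<alpha>, \<beta>))" f] by simp
    moreover have "norm (L2_class (\<lambda>\<beta>. W (\<alpha>, \<beta>))) \<le> C"
      by (rule norm_L2_class_le[OF square_integrable_kernel_section[OF W \<alpha>] C[OF \<alpha>] C0])
    ultimately show ?thesis
      using mult_right_mono[of "norm (L2_class (\<lambda>\<beta>. W (\<alpha>, \<beta>)))" C "norm f"] by (simp add: mult.commute)
  qed
  have meas: "?K f \<in> borel_measurable unit_interval" for f
  proof -
    have [measurable]: "W \<in> borel_measurable (unit_interval \<Otimes>\<^sub>M unit_interval)"
      using W by (simp add: bounded_symmetric_kernel_def)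
    have [measurable]: "L2_fun f \<in> borel_measurable unit_interval"
      using L2_fun_square_integrable[of f] by (rule square_integrable_measurable)
    show ?thesis
      by (rule unit_interval.borel_measurable_lebesgue_integral) measurable
  qed
  show sq: "square_integrable (?K f)" for f
    by (rule square_integrable_bounded[OF meas sec_bound])
  have "norm (L2_class (?K f)) \<le> norm f * C" for f
    by (rule norm_L2_class_le[OF sq sec_bound]) (use C0 in simp_all)
  then show "\<exists>C\<ge>0. \<forall>f. norm (L2_class (?K f)) \<le> norm f * C"
    using C0 by blast
qed

lemma integral_operator_apply:
  assumes W: "bounded_symmetric_kernel W"
  shows "integral_operator W f = L2_class (\<lambda>\<alpha>. LINT \<beta>|unit_interval. W (\<alpha>, \<beta>) * L2_fun f \<beta>)"
proof -
  let ?K = "\<lambda>f \<alpha>. LINT \<beta>|unit_interval. W (\<alpha>, \<beta>) * L2_fun f \<beta>"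
  note sq = kernel_image(1)[OF W]
  note sec = square_integrable_kernel_section[OF W]
  have K: "?K f \<alpha> = L2_class (\<lambda>\<beta>. W (\<alpha>, \<beta>)) \<bullet> f" if "\<alpha> \<in> {0..1}" for f \<alpha>
    using inner_L2_class[OF sec[OF that] L2_fun_square_integrable[of f]] by simp
  have "bounded_linear (\<lambda>f. L2_class (?K f))"
  proof (rule bounded_linear_intro)
    show "L2_class (?K (f + g)) = L2_class (?K f) + L2_class (?K g)" for f g
      unfolding L2_class_add[OF sq sq]
      by (rule L2_class_eqI[OF sq square_integrable_add[OF sq sq]], rule AE_I2)
        (simp add: K space_restrict_space inner_add_right)
    show "L2_class (?K (r *\<^sub>R f)) = r *\<^sub>R L2_class (?K f)" for r f
      unfolding L2_class_scale[OF sq]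
      by (rule L2_class_eqI[OF sq square_integrable_scale[OF sq]], rule AE_I2)
        (simp add: K space_restrict_space)
    show "norm (L2_class (?K f)) \<le> norm f * (SOME C. 0 \<le> C \<and> (\<forall>f. norm (L2_class (?K f)) \<le> norm f * C))" for f
      using someI_ex[OF kernel_image(2)[OF W]] by blast
  qed
  then show ?thesis
    by (simp add: integral_operator_def bounded_linear_Blinfun_apply)
qed

text \<open>Positivity is meant in the sense of operator theory, i.e. it includes symmetry and allows
  a nontrivial null space.\<close>

definition positive_operator :: "(L2 \<Rightarrow>\<^sub>L L2) \<Rightarrow> bool" where
  "positive_operator T \<longleftrightarrow> (\<forall>f g. T f \<bullet> g = f \<bullet> T g) \<and> (\<forall>f. 0 \<le> f \<bullet> T f)"

definition positive_definite_operator :: "(L2 \<Rightarrow>\<^sub>L L2) \<Rightarrow> bool" where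
  "positive_definite_operator T \<longleftrightarrow> positive_operator T \<and> (\<forall>f. f \<noteq> 0 \<longrightarrow> 0 < f \<bullet> T f)"

definition adjoint_operator :: "(L2 \<Rightarrow>\<^sub>L L2) \<Rightarrow> L2 \<Rightarrow>\<^sub>L L2" where
  "adjoint_operator T = Blinfun (adjoint (blinfun_apply T))"

definition is_inverse_operator :: "(L2 \<Rightarrow>\<^sub>L L2) \<Rightarrow> (L2 \<Rightarrow>\<^sub>L L2) \<Rightarrow> bool" where
  "is_inverse_operator T T' \<longleftrightarrow> T o\<^sub>L T' = id_blinfun \<and> T' o\<^sub>L T = id_blinfun"

definition inverse_operator :: "(L2 \<Rightarrow>\<^sub>L L2) \<Rightarrow> L2 \<Rightarrow>\<^sub>L L2" where
  "inverse_operator T = (THE T'. is_inverse_operator T T')"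

definition sqrt_operator :: "(L2 \<Rightarrow>\<^sub>L L2) \<Rightarrow> L2 \<Rightarrow>\<^sub>L L2" where
  "sqrt_operator T = (THE X. positive_operator X \<and> X o\<^sub>L X = T)"

definition exp_operator :: "(L2 \<Rightarrow>\<^sub>L L2) \<Rightarrow> L2 \<Rightarrow>\<^sub>L L2" where
  "exp_operator T = (\<Sum>n. (((o\<^sub>L) T ^^ n) id_blinfun) /\<^sub>R fact n)"


text \<open>Q-noise and Wiener integrals\<close>

definition history :: "'w measure \<Rightarrow> (real \<Rightarrow> 'w \<Rightarrow> L2) \<Rightarrow> real \<Rightarrow> 'w measure" where
  "history P w t =
     sigma (space P) (\<Union>s\<in>{0..t}. {w s -` E \<inter> space P | E. E \<in> sets borel})"

text \<open>The case \<open>\<sigma> = 0\<close> is the point mass at 0.\<close>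

definition centred_normal :: "'w measure \<Rightarrow> ('w \<Rightarrow> real) \<Rightarrow> bool" where
  "centred_normal P X \<longleftrightarrow> X \<in> borel_measurable P \<and>
     (\<exists>\<sigma>. distr P borel X = distr std_normal_distribution borel (\<lambda>z. \<sigma> * z))"

text \<open>The identity $E[w_t(\alpha) w_s(\beta)] = \min(t,s) Q(\alpha,\beta)$ is tested against
  \<open>f(\<alpha>) g(\<beta>)\<close>, since point values of an \<open>L2\<close> class are not defined.\<close>

definition Q_noise :: "'w measure \<Rightarrow> (real \<times> real \<Rightarrow> real) \<Rightarrow> (real \<Rightarrow> 'w \<Rightarrow> L2) \<Rightarrow> bool" where
  "Q_noise P Q w \<longleftrightarrow>
     (\<forall>t\<ge>0. w t \<in> borel_measurable P) \<and>
     (\<forall>\<omega>\<in>space P. w 0 \<omega> = 0 \<and> continuous_on {0..} (\<lambda>t. w t \<omega>)) \<and>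
     (\<forall>s\<ge>0. \<forall>t\<ge>s. prob_space.indep_set P (sets (history P w s))
        {(\<lambda>\<omega>. w t \<omega> - w s \<omega>) -` E \<inter> space P | E. E \<in> sets borel}) \<and>
     (\<forall>(n::nat) \<tau> f. (\<forall>i<n. 0 \<le> \<tau> i) \<longrightarrow> centred_normal P (\<lambda>\<omega>. \<Sum>i<n. w (\<tau> i) \<omega> \<bullet> f i)) \<and>
     (\<forall>s\<ge>0. \<forall>t\<ge>0. \<forall>f g.
        (LINT \<omega>|P. (w t \<omega> \<bullet> f) * (w s \<omega> \<bullet> g)) = min t s * (f \<bullet> integral_operator Q g))"

text \<open>$Z = \int_0^t \Phi(s)\, dw_s$ for a deterministic, norm continuous integrand \<open>\<Phi>\<close>, as the mean
  square limit of the left-endpoint sums over uniform partitions of $[0,t]$.\<close>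

definition is_wiener_integral ::
    "'w measure \<Rightarrow> (real \<Rightarrow> 'w \<Rightarrow> L2) \<Rightarrow> real \<Rightarrow> (real \<Rightarrow> L2 \<Rightarrow>\<^sub>L L2) \<Rightarrow> ('w \<Rightarrow> L2) \<Rightarrow> bool" where
  "is_wiener_integral P w t \<Phi> Z \<longleftrightarrow> Z \<in> borel_measurable P \<and>
     (\<lambda>n. \<integral>\<^sup>+\<omega>. ennreal ((norm (
        (\<Sum>k<n. \<Phi> (t * real k / real n) (w (t * real (Suc k) / real n) \<omega> - w (t * real k / real n) \<omega>)) - Z \<omega>))\<^sup>2) \<partial>P)
     \<longlonglongrightarrow> 0"


text \<open>The control problem\<close>

definition jointly_measurable :: "'w measure \<Rightarrow> (real \<Rightarrow> 'w \<Rightarrow> L2) \<Rightarrow> bool" where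
  "jointly_measurable P y \<longleftrightarrow>
     (\<lambda>(t, \<omega>). y t \<omega>) \<in> borel_measurable (restrict_space lborel {0..} \<Otimes>\<^sub>M P)"

definition admissible :: "'w measure \<Rightarrow> (real \<Rightarrow> 'w \<Rightarrow> L2) \<Rightarrow> (real \<Rightarrow> 'w \<Rightarrow> L2) \<Rightarrow> bool" where
  "admissible P w u \<longleftrightarrow>
     jointly_measurable P u \<and>
     (\<forall>t\<ge>0. u t \<in> borel_measurable (history P w t)) \<and>
     (AE \<omega> in P. \<forall>T\<ge>0. set_integrable lborel {0..T} (\<lambda>t. (norm (u t \<omega>))\<^sup>2))"

definition mild_solution ::
    "'w measure \<Rightarrow> (real \<Rightarrow> 'w \<Rightarrow> L2) \<Rightarrow> (L2 \<Rightarrow>\<^sub>L L2) \<Rightarrow> (L2 \<Rightarrow>\<^sub>L L2) \<Rightarrow> L2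
      \<Rightarrow> (real \<Rightarrow> 'w \<Rightarrow> L2) \<Rightarrow> (real \<Rightarrow> 'w \<Rightarrow> L2) \<Rightarrow> bool" where
  "mild_solution P w A B x0 u x \<longleftrightarrow>
     jointly_measurable P x \<and>
     (\<forall>t\<ge>0. \<exists>Z. is_wiener_integral P w t (\<lambda>s. exp_operator ((t - s) *\<^sub>R A)) Z \<and>
        (AE \<omega> in P. x t \<omega> = exp_operator (t *\<^sub>R A) x0
           + (LBINT s:{0..t}. exp_operator ((t - s) *\<^sub>R A) (B (u s \<omega>))) + Z \<omega>))"

text \<open>For positive \<open>M\<close> and \<open>R\<close> the integrand is nonnegative, so the cost is a well-defined element of
  $[0,\infty]$.\<close>

definition discounted_cost ::
    "'w measure \<Rightarrow> real \<Rightarrow> (L2 \<Rightarrow>\<^sub>L L2) \<Rightarrow> (L2 \<Rightarrow>\<^sub>L L2)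
      \<Rightarrow> (real \<Rightarrow> 'w \<Rightarrow> L2) \<Rightarrow> (real \<Rightarrow> 'w \<Rightarrow> L2) \<Rightarrow> ennreal" where
  "discounted_cost P \<rho> M R x u =
     (\<integral>\<^sup>+\<omega>. (\<integral>\<^sup>+t\<in>{0..}. ennreal (exp (- \<rho> * t) *
        (x t \<omega> \<bullet> M (x t \<omega>) + u t \<omega> \<bullet> R (u t \<omega>))) \<partial>lborel) \<partial>P)"

definition minimizes_cost ::
    "'w measure \<Rightarrow> (real \<Rightarrow> 'w \<Rightarrow> L2) \<Rightarrow> (L2 \<Rightarrow>\<^sub>L L2) \<Rightarrow> (L2 \<Rightarrow>\<^sub>L L2) \<Rightarrow> (L2 \<Rightarrow>\<^sub>L L2) \<Rightarrow> (L2 \<Rightarrow>\<^sub>L L2)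
      \<Rightarrow> real \<Rightarrow> L2 \<Rightarrow> (real \<Rightarrow> 'w \<Rightarrow> L2) \<Rightarrow> (real \<Rightarrow> 'w \<Rightarrow> L2) \<Rightarrow> bool" where
  "minimizes_cost P w A B M R \<rho> x0 x u \<longleftrightarrow>
     admissible P w u \<and> mild_solution P w A B x0 u x \<and>
     (\<forall>x' u'. admissible P w u' \<and> mild_solution P w A B x0 u' x' \<longrightarrow>
        discounted_cost P \<rho> M R x u \<le> discounted_cost P \<rho> M R x' u')"

definition feedback_pair ::
    "'w measure \<Rightarrow> (real \<Rightarrow> 'w \<Rightarrow> L2) \<Rightarrow> (L2 \<Rightarrow>\<^sub>L L2) \<Rightarrow> (L2 \<Rightarrow>\<^sub>L L2) \<Rightarrow> (L2 \<Rightarrow>\<^sub>L L2) \<Rightarrow> L2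
      \<Rightarrow> (real \<Rightarrow> 'w \<Rightarrow> L2) \<Rightarrow> (real \<Rightarrow> 'w \<Rightarrow> L2) \<Rightarrow> bool" where
  "feedback_pair P w A B K x0 x u \<longleftrightarrow>
     admissible P w u \<and> mild_solution P w A B x0 u x \<and>
     (\<forall>t\<ge>0. \<forall>\<omega>\<in>space P. u t \<omega> = K (x t \<omega>))"

definition discounted_riccati ::
    "real \<Rightarrow> (L2 \<Rightarrow>\<^sub>L L2) \<Rightarrow> (L2 \<Rightarrow>\<^sub>L L2) \<Rightarrow> (L2 \<Rightarrow>\<^sub>L L2) \<Rightarrow> (L2 \<Rightarrow>\<^sub>L L2) \<Rightarrow> (L2 \<Rightarrow>\<^sub>L L2) \<Rightarrow> bool" where
  "discounted_riccati \<rho> A B M R S \<longleftrightarrow>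
     \<rho> *\<^sub>R S = (S o\<^sub>L adjoint_operator A) + (A o\<^sub>L S)
       - (S o\<^sub>L B o\<^sub>L inverse_operator R o\<^sub>L adjoint_operator B o\<^sub>L S) + M"

end

theory Submission
  imports Defs
begin

text \<open>The two claims of the theorem concern the same algebraic equation but rest on different ideas.

  \<^bold>\<open>Closed form.\<close> For \<open>B = R = 1\<close> put \<open>\<Gamma> = A - \<rho>/2\<close>. Completing the square, the Riccati equation says
  \<open>(S - \<Gamma>)\<^sup>2 = \<Gamma>\<^sup>2 + M\<close> (\<open>riccati_square\<close>). Let \<open>N\<close> be the positive square root of \<open>\<Gamma>\<^sup>2 + M\<close>. Then
  \<open>\<Gamma>\<^sup>2 \<le> N\<^sup>2\<close>, and the square root is monotone (\<open>psd_add_of_square_le\<close>), so \<open>\<Gamma> + N\<close> is positive. If \<open>S\<close> is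
  any positive solution, then \<open>Y = S - \<Gamma>\<close> has the same square as \<open>N\<close> and commutes with it, hence
  \<open>(Y + N) (Y - N) = 0\<close>; the first factor is injective as soon as \<open>S\<close> or \<open>M\<close> is strictly positive
  (\<open>riccati_unique\<close>).

  \<^bold>\<open>Optimal feedback.\<close> Let \<open>X\<close> solve the Riccati differential equation with \<open>X 0 = 0\<close>. Comparison of
  solutions (\<open>riccati_comparison\<close>) shows that \<open>X\<close> increases and stays below every positive solution of
  the algebraic equation. Hence it exists for all times and converges strongly to the minimal positive
  solution \<open>S\<^sub>\<infinity>\<close> (\<open>riccati_flow_converges\<close>).

  On a finite horizon \<open>[0, T]\<close> the feedback \<open>u t = - R\<inverse> B X(T - t) x t\<close> is optimal. Compare it with
  another control \<open>u'\<close> and its state \<open>x'\<close>. In \<open>x' - x\<close> the stochastic convolutions cancel, so this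
  difference is an ordinary integral of \<open>B (u' - u)\<close>. The cost is convex and quadratic, so it suffices
  that its first variation in the direction \<open>u' - u\<close> vanishes. By Fubini the state part of that
  variation pairs \<open>B (u' - u)\<close> at time \<open>s\<close> with the adjoint state
  \<open>\<integral>\<^sub>s\<^sup>T e\<^bsup>-\<rho>t\<^esup> e\<^bsup>A(t-s)\<^esup> M x t dt\<close>. Path by path, the Riccati equation identifies the adjoint state with
  \<open>e\<^bsup>-\<rho>s\<^esup> X(T - s) x s\<close> plus a term that is linear in the increments \<open>w t - w s\<close> for \<open>t \<ge> s\<close>
  (\<open>adjoint_state\<close>). The choice of the gain makes the first summand cancel the control part of the
  variation; the second is orthogonal to the past, because the increments are centred and independent of
  it (\<open>first_variation_zero\<close>).

  As the horizon grows through the integers, the optimal loops converge path by path to the loop with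
  gain \<open>- R\<inverse> B S\<^sub>\<infinity>\<close>, and Fatou's lemma transfers optimality to the infinite horizon
  (\<open>stationary_feedback_optimal\<close>).

  Two facts about the noise support this. First, \<open>w\<close> has second moments: dyadic step functions form
  explicit orthonormal systems in which the trace of a bounded positive kernel is at most its supremum
  (\<open>increment_second_moment\<close>). Second, the stochastic convolution, which is given as a mean square limit
  of Riemann sums, has a pathwise expression by integration by parts
  (\<open>stoch_conv_is_wiener_integral\<close>). Consequently a linear feedback loop is an ordinary differential
  equation for \<open>x - w\<close>, and all feedback pairs for the same gain and initial state agree outside
  null sets (\<open>feedback_pair_unique\<close>).\<close>

section \<open>The Banach algebra of bounded operators\<close>

text \<open>Bounded operators on \<^typ>\<open>L2\<close> form a Banach algebra under composition, but the type
  \<^typ>\<open>L2 \<Rightarrow>\<^sub>L L2\<close> cannot be made an instance of the algebra classes. The copy below can, which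
  gives access to ring normalisation and to the library's exponential function.\<close>

typedef bop = "UNIV :: (L2 \<Rightarrow>\<^sub>L L2) set"
  morphisms blinfun_of_bop Bop ..

setup_lifting type_definition_bop

lemma L2_norm_one: "norm (L2_class (\<lambda>_. 1)) = 1"
  using norm_L2_class[OF square_integrable_const, of 1] unit_interval.prob_space
  by (metis norm_ge_zero one_power2 power2_eq_iff_nonneg zero_le_one mult_1 lebesgue_integral_const real_scaleR_def)

instantiation bop :: real_vector
begin

lift_definition zero_bop :: bop is 0 .
lift_definition plus_bop :: "bop \<Rightarrow> bop \<Rightarrow> bop" is "(+)" .
lift_definition minus_bop :: "bop \<Rightarrow> bop \<Rightarrow> bop" is "(-)" .
lift_definition uminus_bop :: "bop \<Rightarrow> bop" is "uminus" .
lift_definition scaleR_bop :: "real \<Rightarrow> bop \<Rightarrow> bop" is "scaleR" .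

instance
  by standard (transfer; simp add: algebra_simps)+

end

instantiation bop :: real_normed_algebra_1
begin

lift_definition one_bop :: bop is id_blinfun .
lift_definition times_bop :: "bop \<Rightarrow> bop \<Rightarrow> bop" is "(o\<^sub>L)" .
lift_definition norm_bop :: "bop \<Rightarrow> real" is norm .
definition dist_bop :: "bop \<Rightarrow> bop \<Rightarrow> real" where "dist_bop S T = norm (S - T)"
definition sgn_bop :: "bop \<Rightarrow> bop" where "sgn_bop T = T /\<^sub>R norm T"
definition uniformity_bop :: "(bop \<times> bop) filter" where
  "uniformity_bop = (INF e\<in>{0 <..}. principal {(S, T). dist S T < e})"
definition open_bop :: "bop set \<Rightarrow> bool" where
  "open_bop U \<longleftrightarrow> (\<forall>x\<in>U. eventually (\<lambda>(x', y). x' = x \<longrightarrow> y \<in> U) uniformity)"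

instance
proof
  fix S T V :: bop and r s :: real and U :: "bop set"
  show "dist S T = norm (S - T)" "sgn S = S /\<^sub>R norm S"
    "uniformity = (INF e\<in>{0 <..}. principal {(S :: bop, T). dist S T < e})"
    "open U \<longleftrightarrow> (\<forall>x\<in>U. eventually (\<lambda>(x', y). x' = x \<longrightarrow> y \<in> U) uniformity)"
    by (simp_all add: dist_bop_def sgn_bop_def uniformity_bop_def open_bop_def)
  show "S * T * V = S * (T * V)" "1 * S = S" "S * 1 = S"
    "(S + T) * V = S * V + T * V" "S * (T + V) = S * T + S * V"
    "(r *\<^sub>R S) * T = r *\<^sub>R (S * T)" "S * (r *\<^sub>R T) = r *\<^sub>R (S * T)"
    by (transfer; auto intro!: blinfun_eqI simp: blinfun.bilinear_simps)+
  show "(0::bop) \<noteq> 1"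
  proof transfer
    show "0 \<noteq> (id_blinfun :: L2 \<Rightarrow>\<^sub>L L2)"
      by (metis L2_norm_one blinfun.zero_left id_blinfun.rep_eq norm_zero zero_neq_one)
  qed
  show "norm (1::bop) = 1"
  proof transfer
    have "norm (blinfun_apply id_blinfun (L2_class (\<lambda>_. 1))) \<le> norm (id_blinfun :: L2 \<Rightarrow>\<^sub>L L2) * norm (L2_class (\<lambda>_. 1))"
      by (rule norm_blinfun)
    then have "1 \<le> norm (id_blinfun :: L2 \<Rightarrow>\<^sub>L L2)"
      by (simp add: L2_norm_one)
    moreover have "norm (id_blinfun :: L2 \<Rightarrow>\<^sub>L L2) \<le> 1"
      by (rule norm_blinfun_bound) simp_all
    ultimately show "norm (id_blinfun :: L2 \<Rightarrow>\<^sub>L L2) = 1" by simp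
  qed
  show "norm (S * T) \<le> norm S * norm T"
    by transfer (rule norm_blinfun_compose)
  show "norm S = 0 \<longleftrightarrow> S = 0" "norm (S + T) \<le> norm S + norm T" "norm (r *\<^sub>R S) = \<bar>r\<bar> * norm S"
    by (transfer; simp add: norm_triangle_ineq)+
qed

end

lemma bounded_linear_Bop: "bounded_linear Bop"
  by (rule bounded_linear_intro[where K = 1])
     (simp_all add: plus_bop.abs_eq scaleR_bop.abs_eq norm_bop.abs_eq)

lemma bounded_linear_blinfun_of_bop: "bounded_linear blinfun_of_bop"
  by (rule bounded_linear_intro[where K = 1])
     (simp_all add: plus_bop.rep_eq scaleR_bop.rep_eq norm_bop.rep_eq)

instance bop :: banach
proof
  fix X :: "nat \<Rightarrow> bop" assume "Cauchy X"
  then have "Cauchy (\<lambda>n. blinfun_of_bop (X n))"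
    by (rule bounded_linear.Cauchy[OF bounded_linear_blinfun_of_bop])
  then obtain L where "(\<lambda>n. blinfun_of_bop (X n)) \<longlonglongrightarrow> L"
    using convergent_def Cauchy_convergent_iff by blast
  then have "(\<lambda>n. Bop (blinfun_of_bop (X n))) \<longlonglongrightarrow> Bop L"
    by (rule bounded_linear.tendsto[OF bounded_linear_Bop])
  then show "convergent X" by (simp add: blinfun_of_bop_inverse convergentI)
qed

definition bop_apply :: "bop \<Rightarrow> L2 \<Rightarrow> L2" (infixr "\<odot>" 75)
  where "T \<odot> f = blinfun_apply (blinfun_of_bop T) f"

lemma blinfun_apply_bop: "blinfun_apply (blinfun_of_bop T) f = T \<odot> f"
  by (simp add: bop_apply_def)

lemma Bop_apply: "Bop T \<odot> f = blinfun_apply T f"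
  by (simp add: bop_apply_def Bop_inverse)

interpretation bop: bounded_bilinear "(\<odot>)"
proof
  show "\<exists>K. \<forall>T f. norm (T \<odot> f) \<le> norm T * norm f * K"
    by (rule exI[of _ 1]) (simp add: bop_apply_def norm_bop.rep_eq norm_blinfun)
qed (simp_all add: bop_apply_def plus_bop.rep_eq scaleR_bop.rep_eq blinfun.bilinear_simps)

lemma norm_bop_apply: "norm (T \<odot> f) \<le> norm T * norm f"
  by (simp add: bop_apply_def norm_bop.rep_eq norm_blinfun)

lemma bop_apply_mult [simp]: "(S * T) \<odot> f = S \<odot> T \<odot> f"
  by (simp add: bop_apply_def times_bop.rep_eq)

lemma bop_apply_one [simp]: "1 \<odot> f = f"
  by (simp add: bop_apply_def one_bop.rep_eq)

lemma bop_eqI: "(\<And>f. S \<odot> f = T \<odot> f) \<Longrightarrow> S = T"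
  by (metis blinfun_eqI blinfun_of_bop_inject bop_apply_def)

lemma bop_eq_iff_inner: "S = T \<longleftrightarrow> (\<forall>f g. (S \<odot> f) \<bullet> g = (T \<odot> f) \<bullet> g)"
  by (metis bop_eqI inner_commute vector_eq_ldot)

lemma norm_bop_le: "norm T \<le> C" if "\<And>f. norm (T \<odot> f) \<le> C * norm f" "0 \<le> C"
  using norm_blinfun_bound[of C "blinfun_of_bop T"] that
  by (simp add: norm_bop.rep_eq bop_apply_def)

lemma continuous_on_bop_apply [continuous_intros]:
  "continuous_on S F \<Longrightarrow> continuous_on S g \<Longrightarrow> continuous_on S (\<lambda>x. F x \<odot> g x)"
  by (rule bop.continuous_on)

section \<open>Positive operators and square roots\<close>

definition selfadj :: "bop \<Rightarrow> bool" where
  "selfadj T \<longleftrightarrow> (\<forall>f g. (T \<odot> f) \<bullet> g = f \<bullet> (T \<odot> g))"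

definition psd :: "bop \<Rightarrow> bool" where
  "psd T \<longleftrightarrow> selfadj T \<and> (\<forall>f. 0 \<le> f \<bullet> (T \<odot> f))"

lemma psd_iff: "psd T \<longleftrightarrow> positive_operator (blinfun_of_bop T)"
  by (simp add: psd_def selfadj_def positive_operator_def blinfun_apply_bop)

lemma selfadjD: "selfadj T \<Longrightarrow> (T \<odot> f) \<bullet> g = f \<bullet> (T \<odot> g)"
  by (simp add: selfadj_def)

lemma psd_selfadj: "psd T \<Longrightarrow> selfadj T"
  by (simp add: psd_def)

lemma psd_nonneg: "psd T \<Longrightarrow> 0 \<le> f \<bullet> (T \<odot> f)" "psd T \<Longrightarrow> 0 \<le> (T \<odot> f) \<bullet> f"
  by (simp_all add: psd_def inner_commute)

lemma selfadj_simps [intro, simp]: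
  "selfadj 0" "selfadj 1"
  "selfadj S \<Longrightarrow> selfadj T \<Longrightarrow> selfadj (S + T)"
  "selfadj S \<Longrightarrow> selfadj T \<Longrightarrow> selfadj (S - T)"
  "selfadj S \<Longrightarrow> selfadj (- S)"
  "selfadj S \<Longrightarrow> selfadj (c *\<^sub>R S)"
  by (simp_all add: selfadj_def bop.zero_left bop.add_left bop.diff_left bop.minus_left bop.scaleR_left
      inner_simps)

lemma selfadj_sandwich: "selfadj S \<Longrightarrow> selfadj T \<Longrightarrow> selfadj (S * T * S)"
  by (simp add: selfadj_def)

lemma selfadj_square: "selfadj S \<Longrightarrow> selfadj (S * S)"
  by (simp add: selfadj_def)

lemma closed_selfadj: "closed {T. selfadj T}"
proof -
  have "{T. selfadj T} = (\<Inter>f. \<Inter>g. {T. (T \<odot> f) \<bullet> g = f \<bullet> (T \<odot> g)})"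
    by (auto simp: selfadj_def)
  also have "closed \<dots>"
    by (intro closed_INT ballI closed_Collect_eq continuous_intros)
  finally show ?thesis .
qed

lemma psd_add: "psd S \<Longrightarrow> psd T \<Longrightarrow> psd (S + T)"
  by (simp add: psd_def bop.add_left inner_add_right)

lemma psd_sandwich: "selfadj S \<Longrightarrow> psd T \<Longrightarrow> psd (S * T * S)"
  using selfadj_sandwich[of S T] psd_nonneg(1)[of T "S \<odot> _"]
  by (auto simp: psd_def selfadjD[symmetric])

text \<open>The discriminant of the nonnegative quadratic polynomial \<open>\<langle>T (f + s g), f + s g\<rangle>\<close> in \<open>s\<close>. Its leading
  coefficient may vanish although \<open>g\<close> does not, because the form is only semidefinite.\<close>

lemma psd_Cauchy_Schwarz:
  assumes "psd T"
  shows "((T \<odot> f) \<bullet> g)\<^sup>2 \<le> ((T \<odot> f) \<bullet> f) * ((T \<odot> g) \<bullet> g)"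
proof -
  let ?a = "(T \<odot> f) \<bullet> f" and ?b = "(T \<odot> f) \<bullet> g" and ?c = "(T \<odot> g) \<bullet> g"
  have sym: "(T \<odot> g) \<bullet> f = ?b"
    using selfadjD[OF psd_selfadj[OF assms], of g f] by (simp add: inner_commute)
  have q: "0 \<le> ?a + 2 * s * ?b + s\<^sup>2 * ?c" for s
  proof -
    have "0 \<le> (T \<odot> (f + s *\<^sub>R g)) \<bullet> (f + s *\<^sub>R g)" by (rule psd_nonneg(2)[OF assms])
    also have "\<dots> = ?a + 2 * s * ?b + s\<^sup>2 * ?c"
      by (simp add: bop.add_right bop.scaleR_right inner_simps sym power2_eq_square algebra_simps)
    finally show ?thesis .
  qed
  have c: "0 \<le> ?c" by (rule psd_nonneg(2)[OF assms])
  show ?thesis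
  proof (cases "?c = 0")
    case True
    have "?b = 0"
    proof (rule ccontr)
      assume b: "?b \<noteq> 0"
      from q[of "- (?a + 1) / (2 * ?b)"] show False using b True by (simp add: field_simps)
    qed
    then show ?thesis by (simp add: True)
  next
    case False
    with c have c: "0 < ?c" by simp
    have "0 \<le> ?c * (?a + 2 * (- ?b / ?c) * ?b + (- ?b / ?c)\<^sup>2 * ?c)"
      using c q[of "- ?b / ?c"] by (intro mult_nonneg_nonneg) simp_all
    also have "\<dots> = ?a * ?c - ?b\<^sup>2"
      using c by (simp add: field_simps power2_eq_square)
    finally show ?thesis by simp
  qed
qed

text \<open>Cauchy--Schwarz with \<open>g = T f\<close>. Control of the quadratic form thus becomes control of the vector
  \<open>T f\<close>; this is how convergence of forms yields strong convergence.\<close>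

lemma psd_norm_apply_le:
  assumes "psd T"
  shows "(norm (T \<odot> f))\<^sup>2 \<le> norm T * ((T \<odot> f) \<bullet> f)"
proof -
  let ?n = "(norm (T \<odot> f))\<^sup>2"
  have **: "?n\<^sup>2 \<le> ((T \<odot> f) \<bullet> f) * ((T \<odot> T \<odot> f) \<bullet> (T \<odot> f))"
    using psd_Cauchy_Schwarz[OF assms, of f "T \<odot> f"] by (simp add: power2_norm_eq_inner)
  have *: "(T \<odot> T \<odot> f) \<bullet> (T \<odot> f) \<le> norm T * ?n"
  proof -
    have "(T \<odot> T \<odot> f) \<bullet> (T \<odot> f) \<le> norm (T \<odot> T \<odot> f) * norm (T \<odot> f)" by (rule norm_cauchy_schwarz)
    also have "\<dots> \<le> norm T * norm (T \<odot> f) * norm (T \<odot> f)"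
      by (intro mult_right_mono norm_bop_apply) simp
    finally show ?thesis by (simp add: power2_eq_square mult.assoc)
  qed
  have *: "?n * ?n \<le> (norm T * ((T \<odot> f) \<bullet> f)) * ?n"
  proof -
    have "((T \<odot> f) \<bullet> f) * ((T \<odot> T \<odot> f) \<bullet> (T \<odot> f)) \<le> ((T \<odot> f) \<bullet> f) * (norm T * ?n)"
      using * psd_nonneg(2)[OF assms, of f] by (rule mult_left_mono)
    with ** show ?thesis by (simp add: power2_eq_square[of ?n] algebra_simps)
  qed
  show ?thesis
  proof (cases "?n = 0")
    case True
    then show ?thesis using psd_nonneg(2)[OF assms, of f] by simp
  next
    case False
    then have "0 < ?n" by simp
    with * show ?thesis using mult_right_le_imp_le by blast
  qed
qed

lemma psd_inner_zeroD: "psd T \<Longrightarrow> f \<bullet> (T \<odot> f) = 0 \<Longrightarrow> T \<odot> f = 0"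
  using psd_norm_apply_le[of T f] by (simp add: inner_commute)

text \<open>Again Cauchy--Schwarz with \<open>g = T f\<close>, now with both forms on the right estimated by \<open>c\<close>.\<close>

lemma norm_le_of_form_le:
  assumes "psd T" "\<And>f. f \<bullet> (T \<odot> f) \<le> c * (norm f)\<^sup>2" "0 \<le> c"
  shows "norm T \<le> c"
proof (rule norm_bop_le)
  fix f
  have "((norm (T \<odot> f))\<^sup>2)\<^sup>2 \<le> ((T \<odot> f) \<bullet> f) * ((T \<odot> T \<odot> f) \<bullet> (T \<odot> f))"
    using psd_Cauchy_Schwarz[OF assms(1), of f "T \<odot> f"] by (simp add: power2_norm_eq_inner)
  also have "\<dots> \<le> (c * (norm f)\<^sup>2) * (c * (norm (T \<odot> f))\<^sup>2)"
    using assms(2)[of f] assms(2)[of "T \<odot> f"] psd_nonneg[OF assms(1)] assms(3)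
    by (intro mult_mono) (simp_all add: inner_commute)
  finally have "(norm (T \<odot> f))\<^sup>2 * (norm (T \<odot> f))\<^sup>2 \<le> (c * norm f)\<^sup>2 * (norm (T \<odot> f))\<^sup>2"
    by (simp add: power2_eq_square algebra_simps)
  then have "(norm (T \<odot> f))\<^sup>2 \<le> (c * norm f)\<^sup>2 \<or> norm (T \<odot> f) = 0"
    using mult_right_le_imp_le[of "(norm (T \<odot> f))\<^sup>2" "(norm (T \<odot> f))\<^sup>2" "(c * norm f)\<^sup>2"]
    by fastforce
  then show "norm (T \<odot> f) \<le> c * norm f"
    using power2_le_imp_le[of "norm (T \<odot> f)" "c * norm f"] assms(3) by auto
qed (rule assms)

text \<open>Monotonicity of the square root, in the form \<open>G\<^sup>2 \<le> N\<^sup>2 \<Longrightarrow> -G \<le> N\<close>. If the infimum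
  \<open>c\<close> of the quadratic form of \<open>N + G\<close> over unit vectors were negative, then there would be unit
  vectors with \<open>G f \<approx> c f - N f\<close>; expanding the square, \<open>\<parallel>G f\<parallel>\<^sup>2\<close> would exceed \<open>\<parallel>N f\<parallel>\<^sup>2\<close> by
  about \<open>c\<^sup>2\<close>.\<close>

lemma psd_add_of_square_le:
  assumes N: "psd N" and G: "selfadj G" and le: "\<And>f. norm (G \<odot> f) \<le> norm (N \<odot> f)"
  shows "psd (N + G)"
proof (rule ccontr)
  define T where "T = N + G"
  assume "\<not> psd (N + G)"
  have sT: "selfadj T" using N G by (simp add: T_def psd_selfadj)
  with \<open>\<not> psd (N + G)\<close> obtain f0 where f0: "f0 \<bullet> (T \<odot> f0) < 0"
    by (auto simp: psd_def T_def not_le)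
  then have f0n: "norm f0 \<noteq> 0" by auto
  define U where "U = {f \<bullet> (T \<odot> f) | f :: L2. norm f = 1}"
  define c where "c = Inf U"
  have bdd: "bdd_below U"
  proof (rule bdd_belowI)
    fix x assume "x \<in> U"
    then obtain f where f: "x = f \<bullet> (T \<odot> f)" "norm f = 1" by (auto simp: U_def)
    have "\<bar>f \<bullet> (T \<odot> f)\<bar> \<le> norm f * norm (T \<odot> f)" by (rule Cauchy_Schwarz_ineq2)
    then show "- norm T \<le> x" using norm_bop_apply[of T f] f by simp
  qed
  let ?g0 = "f0 /\<^sub>R norm f0"
  have U_mem: "(f /\<^sub>R norm f) \<bullet> (T \<odot> (f /\<^sub>R norm f)) \<in> U" if "norm f \<noteq> 0" for f
    unfolding U_def by (rule CollectI, rule exI[of _ "f /\<^sub>R norm f"]) (use that in simp)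
  have g0: "?g0 \<bullet> (T \<odot> ?g0) \<in> U" using U_mem[OF f0n] .
  then have ne: "U \<noteq> {}" by blast
  have "?g0 \<bullet> (T \<odot> ?g0) < 0"
    using f0 f0n by (simp add: bop.scaleR_right mult_less_0_iff divide_less_0_iff zero_less_mult_iff)
  then have c0: "c < 0" using cInf_lower[OF g0 bdd] by (simp add: c_def)
  have lower: "c * (norm f)\<^sup>2 \<le> f \<bullet> (T \<odot> f)" for f
  proof (cases "f = 0")
    case False
    have "(f /\<^sub>R norm f) \<bullet> (T \<odot> (f /\<^sub>R norm f)) \<in> U" using False U_mem by simp
    then have "c \<le> (f /\<^sub>R norm f) \<bullet> (T \<odot> (f /\<^sub>R norm f))"
      unfolding c_def by (rule cInf_lower[OF _ bdd])
    then show ?thesis using False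
      by (simp add: bop.scaleR_right field_simps power2_eq_square)
  qed simp
  define P where "P = T - c *\<^sub>R 1"
  have P: "psd P"
    using sT lower by (simp add: psd_def P_def bop.diff_left bop.scaleR_left inner_diff_right power2_norm_eq_inner)
  have "\<exists>f. norm f = 1 \<and> f \<bullet> (T \<odot> f) < c + e" if "0 < e" for e
    using cInf_lessD[OF ne, of "c + e"] that by (auto simp: c_def U_def)
  then have ex: "\<exists>f. norm f = 1 \<and> f \<bullet> (P \<odot> f) < e" if "0 < e" for e
    using that by (force simp: P_def bop.diff_left bop.scaleR_left inner_diff_right power2_norm_eq_inner[symmetric])
  define K where "K = norm P"
  \<comment> \<open>the constant makes the cross term below at most a quarter of the gain from the square of c\<close>
  define e where "e = c\<^sup>2 / (8 * (norm N + 1 - c))"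
  have K0: "0 \<le> K" by (simp add: K_def)
  have den: "0 < norm N + 1 - c" using c0 norm_ge_zero[of N] by linarith
  have e0: "0 < e" using c0 den by (simp add: e_def)
  obtain f where f: "norm f = 1" "f \<bullet> (P \<odot> f) < (min e 1)\<^sup>2 / (K + 1)"
    using ex[of "(min e 1)\<^sup>2 / (K + 1)"] e0 K0 by auto
  have "(norm (P \<odot> f))\<^sup>2 \<le> K * ((min e 1)\<^sup>2 / (K + 1))"
    using psd_norm_apply_le[OF P, of f] mult_left_mono[OF less_imp_le[OF f(2)] K0]
    by (simp add: K_def inner_commute)
  also have "\<dots> \<le> (min e 1)\<^sup>2"
    using K0 by (simp add: field_simps)
  finally have r: "norm (P \<odot> f) \<le> min e 1"
    using e0 by (auto intro: power2_le_imp_le)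
  \<comment> \<open>the small remainder in the approximate eigenvalue equation for the lowest point of the form\<close>
  define r where "r = P \<odot> f"
  define h where "h = c *\<^sub>R f - N \<odot> f"
  have Gf: "G \<odot> f = h + r"
    by (simp add: r_def h_def P_def T_def bop.diff_left bop.add_left bop.scaleR_left)
  have hh: "h \<bullet> h = c\<^sup>2 - 2 * c * (f \<bullet> (N \<odot> f)) + (norm (N \<odot> f))\<^sup>2"
  proof -
    have "f \<bullet> f = 1" using f(1) by (simp add: norm_eq_1)
    moreover have "(N \<odot> f) \<bullet> f = f \<bullet> (N \<odot> f)" by (rule inner_commute)
    ultimately show ?thesis
      unfolding h_def power2_norm_eq_inner power2_eq_square[of c]
      by (simp add: inner_diff_left inner_diff_right algebra_simps)
  qed
  have "0 \<le> - 2 * c * (f \<bullet> (N \<odot> f))"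
    using c0 psd_nonneg(1)[OF N, of f] by (simp add: mult_nonpos_nonneg)
  then have hh2: "c\<^sup>2 + (norm (N \<odot> f))\<^sup>2 \<le> h \<bullet> h" by (simp add: hh)
  have nh: "norm h \<le> norm N + - c"
    using norm_triangle_ineq4[of "c *\<^sub>R f" "N \<odot> f"] norm_bop_apply[of N f] f(1) c0
    by (simp add: h_def)
  have "\<bar>h \<bullet> r\<bar> \<le> norm h * norm r" by (rule Cauchy_Schwarz_ineq2)
  also have "\<dots> \<le> (norm N + 1 - c) * e"
    using r nh e0 den by (intro mult_mono) (auto simp: r_def)
  also have "\<dots> = c\<^sup>2 / 8" using den by (simp add: e_def del: right_diff_distrib_numeral distrib_left_numeral)
  finally have hr: "- c\<^sup>2 / 8 \<le> h \<bullet> r" by linarith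
  have "(norm (G \<odot> f))\<^sup>2 = h \<bullet> h + 2 * (h \<bullet> r) + r \<bullet> r"
    unfolding Gf power2_norm_eq_inner by (simp add: inner_simps inner_commute)
  then have "(norm (N \<odot> f))\<^sup>2 + c\<^sup>2 * (3/4) \<le> (norm (G \<odot> f))\<^sup>2"
    using hh2 hr inner_ge_zero[of r] by linarith
  moreover have "(norm (G \<odot> f))\<^sup>2 \<le> (norm (N \<odot> f))\<^sup>2"
    using le[of f] by (simp add: power_mono)
  moreover have "0 < c\<^sup>2" using c0 by simp
  ultimately show False by linarith
qed

lemma selfadj_norm_square: "selfadj N \<Longrightarrow> (norm (N \<odot> f))\<^sup>2 = f \<bullet> ((N * N) \<odot> f)"
  by (simp add: power2_norm_eq_inner selfadj_def)

lemma psd_antisym: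
  assumes "psd (S - T)" "psd (T - S)"
  shows "S = T"
proof -
  have "f \<bullet> ((S - T) \<odot> f) = 0" for f
    using psd_nonneg(1)[OF assms(1), of f] psd_nonneg(1)[OF assms(2), of f]
    by (simp add: bop.diff_left inner_diff_right)
  then have "(S - T) \<odot> f = 0" for f
    by (intro psd_inner_zeroD[OF assms(1)])
  then show ?thesis by (intro bop_eqI) (simp add: bop.diff_left)
qed

text \<open>If \<open>X\<^sup>2 = Y\<^sup>2\<close> then \<open>\<parallel>X f\<parallel> = \<parallel>Y f\<parallel>\<close>, so monotonicity of the square root applies in both directions.\<close>

lemma psd_sqrt_unique:
  assumes "psd X" "psd Y" "X * X = Y * Y"
  shows "X = Y"
proof -
  have n: "norm (X \<odot> f) = norm (Y \<odot> f)" for f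
    using selfadj_norm_square[OF psd_selfadj[OF assms(1)], of f]
      selfadj_norm_square[OF psd_selfadj[OF assms(2)], of f] assms(3)
    by (metis norm_ge_zero power2_eq_iff_nonneg)
  have "psd (X + - Y)"
    by (rule psd_add_of_square_le[OF assms(1)]) (simp_all add: n psd_selfadj assms bop.minus_left)
  moreover have "psd (Y + - X)"
    by (rule psd_add_of_square_le[OF assms(2)]) (simp_all add: n psd_selfadj assms bop.minus_left)
  ultimately show ?thesis by (intro psd_antisym) simp_all
qed

text \<open>The square root of \<open>1 - K\<close> is \<open>1 - Z\<close>, where \<open>Z\<close> is a fixed point of \<open>Z \<mapsto> (K + Z\<^sup>2) / 2\<close>.
  The iterates are polynomials in \<open>K\<close> with nonnegative coefficients, so for \<open>\<parallel>K\<parallel> \<le> 1\<close> their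
  increments are dominated in norm by those of the scalar iteration with \<open>K = 1\<close>.\<close>

primrec sqrt_iter :: "'a::real_normed_algebra_1 \<Rightarrow> nat \<Rightarrow> 'a" where
  "sqrt_iter K 0 = 0"
| "sqrt_iter K (Suc n) = (1/2) *\<^sub>R (K + sqrt_iter K n * sqrt_iter K n)"

lemma sqrt_iter_commutes: "C * K = K * C \<Longrightarrow> C * sqrt_iter K n = sqrt_iter K n * C"
  by (induction n) (simp_all add: algebra_simps, metis mult.assoc)

lemma sqrt_iter_scalar: "0 \<le> sqrt_iter (1::real) n" "sqrt_iter (1::real) n \<le> 1"
  "sqrt_iter (1::real) n \<le> sqrt_iter 1 (Suc n)"
proof -
  show 1: "0 \<le> sqrt_iter (1::real) n" for n by (induction n) simp_all
  show "sqrt_iter (1::real) n \<le> 1"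
    using 1 by (induction n) (simp_all add: mult_le_one)
  have "2 * sqrt_iter (1::real) n \<le> 1 + sqrt_iter 1 n * sqrt_iter 1 n"
    using zero_le_power2[of "1 - sqrt_iter (1::real) n"] by (simp add: power2_eq_square algebra_simps)
  then show "sqrt_iter (1::real) n \<le> sqrt_iter 1 (Suc n)" by simp
qed

lemma sqrt_iter_bounds:
  fixes K :: "'a::real_normed_algebra_1"
  assumes K: "norm K \<le> 1"
  shows "norm (sqrt_iter K n) \<le> sqrt_iter 1 n"
    and "norm (sqrt_iter K (Suc n) - sqrt_iter K n) \<le> sqrt_iter 1 (Suc n) - sqrt_iter 1 n"
proof -
  show 1: "norm (sqrt_iter K n) \<le> sqrt_iter 1 n" for n
  proof (induction n)
    case (Suc n)
    have "norm (K + sqrt_iter K n * sqrt_iter K n) \<le> norm K + norm (sqrt_iter K n) * norm (sqrt_iter K n)"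
      by (meson norm_triangle_ineq norm_mult_ineq add_left_mono order_trans)
    also have "\<dots> \<le> 1 + sqrt_iter 1 n * sqrt_iter 1 n"
      using K Suc sqrt_iter_scalar(1)[of n] by (intro add_mono mult_mono) auto
    finally show ?case by simp
  qed simp
  show "norm (sqrt_iter K (Suc n) - sqrt_iter K n) \<le> sqrt_iter 1 (Suc n) - sqrt_iter 1 n"
  proof (induction n)
    case 0
    then show ?case using K by simp
  next
    case (Suc n)
    let ?a = "sqrt_iter K (Suc n)" and ?b = "sqrt_iter K n"
    let ?s = "sqrt_iter (1::real) (Suc n)" and ?t = "sqrt_iter (1::real) n"
    have comm: "?a * ?b = ?b * ?a"
      by (intro sqrt_iter_commutes) (metis sqrt_iter_commutes)
    have "sqrt_iter K (Suc (Suc n)) - ?a = (1/2) *\<^sub>R (?a * ?a - ?b * ?b)"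
      by (simp only: sqrt_iter.simps(2)[of K "Suc n"] sqrt_iter.simps(2)[of K n] scaleR_diff_right[symmetric])
        simp
    also have "?a * ?a - ?b * ?b = (?a - ?b) * (?a + ?b)"
      using comm by (simp only: ring_distribs left_diff_distrib right_diff_distrib) simp
    also have "norm ((1/2) *\<^sub>R ((?a - ?b) * (?a + ?b))) \<le> (1/2) * ((?s - ?t) * (?s + ?t))"
    proof -
      have "norm ((?a - ?b) * (?a + ?b)) \<le> norm (?a - ?b) * norm (?a + ?b)" by (rule norm_mult_ineq)
      also have "\<dots> \<le> (?s - ?t) * (?s + ?t)"
        using Suc norm_triangle_ineq[of ?a ?b] 1[of n] 1[of "Suc n"] sqrt_iter_scalar(3)[of n]
        by (intro mult_mono) (auto simp del: sqrt_iter.simps)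
      finally show ?thesis by simp
    qed
    also have "\<dots> = sqrt_iter 1 (Suc (Suc n)) - ?s"
      by (simp only: sqrt_iter.simps(2)[of 1 "Suc n"] sqrt_iter.simps(2)[of 1 n]) (simp add: algebra_simps)
    finally show ?case .
  qed
qed

lemma convergent_sqrt_iter:
  fixes K :: "'a::{real_normed_algebra_1, banach}"
  assumes K: "norm K \<le> 1"
  shows "convergent (sqrt_iter K)"
proof -
  have "convergent (sqrt_iter (1::real))"
  proof (intro Bseq_mono_convergent allI impI)
    show "Bseq (sqrt_iter (1::real))"
      using sqrt_iter_scalar(1,2) by (intro BseqI'[where K = 1]) simp
    show "sqrt_iter (1::real) m \<le> sqrt_iter 1 n" if "m \<le> n" for m n
      using sqrt_iter_scalar(3) that by (rule lift_Suc_mono_le)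
  qed
  then have "summable (\<lambda>n. sqrt_iter (1::real) (Suc n) - sqrt_iter 1 n)"
    unfolding summable_iff_convergent sum_lessThan_telescope by simp
  then have "summable (\<lambda>n. sqrt_iter K (Suc n) - sqrt_iter K n)"
    by (rule summable_comparison_test'[where N = 0]) (use sqrt_iter_bounds(2)[OF K] in auto)
  then show ?thesis
    unfolding summable_iff_convergent sum_lessThan_telescope by simp
qed

text \<open>The bound \<open>0 \<le> T \<le> 1\<close> makes \<open>K = 1 - T\<close> a contraction, so the iteration converges in norm. Every
  iterate is a polynomial in \<open>K\<close>; self-adjointness and commutation relations pass to the limit.\<close>

lemma sqrt_exists_le_one:
  assumes T: "psd T" and T1: "psd (1 - T)"
  shows "\<exists>X. psd X \<and> X * X = T \<and> (\<forall>C. C * T = T * C \<longrightarrow> C * X = X * C)"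
proof -
  define K where "K = 1 - T"
  have nK: "norm K \<le> 1"
  proof (rule norm_le_of_form_le)
    fix f show "f \<bullet> (K \<odot> f) \<le> 1 * (norm f)\<^sup>2"
      using psd_nonneg(1)[OF T, of f]
      by (simp add: K_def bop.diff_left inner_diff_right power2_norm_eq_inner)
  qed (use T1 in \<open>simp_all add: K_def\<close>)
  obtain Z where Z: "sqrt_iter K \<longlonglongrightarrow> Z"
    using convergent_sqrt_iter[OF nK] by (auto simp: convergent_def)
  have "(\<lambda>n. sqrt_iter K (Suc n)) \<longlonglongrightarrow> (1/2) *\<^sub>R (K + Z * Z)"
    unfolding sqrt_iter.simps by (intro tendsto_intros Z)
  then have fp: "Z = (1/2) *\<^sub>R (K + Z * Z)"
    using LIMSEQ_Suc[OF Z] LIMSEQ_unique by blast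
  have sZ: "selfadj (sqrt_iter K n)" for n
  proof (induction n)
    case (Suc n)
    have "selfadj K" using T by (simp add: K_def psd_selfadj)
    then show ?case using Suc selfadj_square by (simp del: scaleR_add_right)
  qed simp
  then have selfZ: "selfadj Z"
    using closed_sequentially[OF closed_selfadj _ Z] by simp
  have nZ: "norm Z \<le> 1"
  proof (rule LIMSEQ_le_const2[OF tendsto_norm[OF Z]])
    show "\<exists>N. \<forall>n\<ge>N. norm (sqrt_iter K n) \<le> 1"
      using sqrt_iter_bounds(1)[OF nK] sqrt_iter_scalar(2) order_trans by blast
  qed
  have "psd (1 - Z)"
  proof -
    have "f \<bullet> (Z \<odot> f) \<le> f \<bullet> f" for f
    proof -
      have "f \<bullet> (Z \<odot> f) \<le> norm f * norm (Z \<odot> f)" by (rule norm_cauchy_schwarz)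
      also have "\<dots> \<le> norm f * (1 * norm f)"
        using nZ by (intro mult_left_mono order_trans[OF norm_bop_apply] mult_right_mono) simp_all
      finally show ?thesis by (simp add: power2_eq_square[symmetric] power2_norm_eq_inner)
    qed
    then show ?thesis using selfZ by (simp add: psd_def bop.diff_left inner_diff_right)
  qed
  moreover have "(1 - Z) * (1 - Z) = T"
  proof -
    have "2 *\<^sub>R Z = 2 *\<^sub>R ((1/2) *\<^sub>R (K + Z * Z))" using fp by (rule arg_cong)
    then have "2 *\<^sub>R Z = K + Z * Z" by simp
    then have "Z + Z = 1 - T + Z * Z" by (simp add: scaleR_2 K_def)
    moreover have "(1 - Z) * (1 - Z) = 1 - (Z + Z) + Z * Z" by (simp add: algebra_simps)
    ultimately show ?thesis by simp
  qed
  moreover have "C * (1 - Z) = (1 - Z) * C" if "C * T = T * C" for C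
  proof -
    have "C * K = K * C" using that by (simp add: K_def algebra_simps)
    then have "(\<lambda>n. C * sqrt_iter K n) = (\<lambda>n. sqrt_iter K n * C)"
      by (simp add: sqrt_iter_commutes)
    moreover have "(\<lambda>n. C * sqrt_iter K n) \<longlonglongrightarrow> C * Z" "(\<lambda>n. sqrt_iter K n * C) \<longlonglongrightarrow> Z * C"
      by (intro tendsto_intros Z)+
    ultimately have "C * Z = Z * C" using LIMSEQ_unique by metis
    then show ?thesis by (simp add: algebra_simps)
  qed
  ultimately show ?thesis by blast
qed

lemma psd_scaleR: "psd T \<Longrightarrow> 0 \<le> c \<Longrightarrow> psd (c *\<^sub>R T)"
  by (simp add: psd_def bop.scaleR_left)

lemma sqrt_exists:
  assumes T: "psd T"
  shows "\<exists>X. psd X \<and> X * X = T \<and> (\<forall>C. C * T = T * C \<longrightarrow> C * X = X * C)"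
proof -
  define c where "c = norm T + 1"
  have c: "0 < c" by (simp add: c_def add_nonneg_pos)
  have "psd (1 - (1/c) *\<^sub>R T)"
  proof -
    have "f \<bullet> (T \<odot> f) \<le> c * (f \<bullet> f)" for f
    proof -
      have "f \<bullet> (T \<odot> f) \<le> norm f * norm (T \<odot> f)" by (rule norm_cauchy_schwarz)
      also have "\<dots> \<le> norm f * (c * norm f)"
        by (intro mult_left_mono order_trans[OF norm_bop_apply] mult_right_mono) (simp_all add: c_def)
      finally show ?thesis by (simp add: power2_eq_square[symmetric] power2_norm_eq_inner[symmetric] algebra_simps)
    qed
    then show ?thesis
      using c psd_selfadj[OF T]
      by (simp add: psd_def bop.diff_left bop.scaleR_left inner_diff_right field_simps)
  qed
  then obtain Y where Y: "psd Y" "Y * Y = (1/c) *\<^sub>R T"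
    and comm: "\<forall>C. C * ((1/c) *\<^sub>R T) = ((1/c) *\<^sub>R T) * C \<longrightarrow> C * Y = Y * C"
    using sqrt_exists_le_one[OF psd_scaleR[OF T]] c by (metis divide_nonneg_pos zero_le_one)
  let ?X = "sqrt c *\<^sub>R Y"
  have "psd ?X" using Y(1) c by (simp add: psd_scaleR)
  moreover have "?X * ?X = T" using Y(2) c by simp
  moreover have "C * ?X = ?X * C" if "C * T = T * C" for C
    using comm that by simp
  ultimately show ?thesis by blast
qed

text \<open>Uniqueness turns the definite description behind \<open>sqrt_operator\<close> into the root constructed above. The
  commutation property is what makes the factorisation of a difference of squares possible later.\<close>

lemma sqrt_operator_props:
  assumes T: "psd T"
  defines "N \<equiv> Bop (sqrt_operator (blinfun_of_bop T))"
  shows "psd N" "N * N = T" "\<And>C. C * T = T * C \<Longrightarrow> C * N = N * C"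
proof -
  obtain X where X: "psd X" "X * X = T" "\<And>C. C * T = T * C \<Longrightarrow> C * X = X * C"
    using sqrt_exists[OF T] by blast
  have "sqrt_operator (blinfun_of_bop T) = blinfun_of_bop X"
    unfolding sqrt_operator_def
  proof (rule the_equality)
    show "positive_operator (blinfun_of_bop X) \<and> blinfun_of_bop X o\<^sub>L blinfun_of_bop X = blinfun_of_bop T"
      unfolding psd_iff[symmetric] times_bop.rep_eq[symmetric] X(2) using X(1) by simp
    fix Y assume Y: "positive_operator Y \<and> Y o\<^sub>L Y = blinfun_of_bop T"
    then have "psd (Bop Y)" by (simp add: psd_iff Bop_inverse)
    moreover have "Bop Y * Bop Y = X * X"
      unfolding times_bop.abs_eq X(2) using Y by (simp add: blinfun_of_bop_inverse)
    ultimately have "Bop Y = X" using psd_sqrt_unique X(1) by blast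
    then show "Y = blinfun_of_bop X" by (metis Bop_inverse UNIV_I)
  qed
  then have N: "N = X" by (simp add: N_def blinfun_of_bop_inverse)
  show "psd N" "N * N = T" unfolding N by (rule X)+
  show "C * N = N * C" if "C * T = T * C" for C
    unfolding N using that by (rule X(3))
qed

section \<open>The algebraic Riccati equation\<close>

text \<open>The right hand side of the Riccati differential equation \<open>X' = riccati A G M \<rho> X\<close>; its zeros are the
  solutions of the algebraic equation. The operator \<open>G\<close> stands for \<open>B R\<inverse> B\<^sup>*\<close>.\<close>

definition riccati :: "bop \<Rightarrow> bop \<Rightarrow> bop \<Rightarrow> real \<Rightarrow> bop \<Rightarrow> bop" where
  "riccati A G M \<rho> X = X * A + A * X - X * G * X + M - \<rho> *\<^sub>R X"

lemma adjoint_operator_selfadj: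
  assumes "selfadj (Bop T)"
  shows "adjoint_operator T = T"
proof -
  have "adjoint (blinfun_apply T) = blinfun_apply T"
    using assms by (intro adjoint_unique) (simp add: selfadj_def Bop_apply)
  then show ?thesis by (simp add: adjoint_operator_def blinfun_apply_inverse)
qed

lemma Bop_algebra:
  "Bop (S + T) = Bop S + Bop T" "Bop (S - T) = Bop S - Bop T" "Bop (c *\<^sub>R S) = c *\<^sub>R Bop S"
  "Bop (- S) = - Bop S" "Bop (S o\<^sub>L T) = Bop S * Bop T" "Bop id_blinfun = 1" "Bop 0 = 0"
  by (simp_all add: plus_bop.abs_eq minus_bop.abs_eq scaleR_bop.abs_eq uminus_bop.abs_eq
      times_bop.abs_eq one_bop.abs_eq zero_bop.abs_eq)

lemma Bop_eq_iff: "Bop S = Bop T \<longleftrightarrow> S = T"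
  by (simp add: Bop_inject)

lemma inverse_operator_eq:
  assumes "is_inverse_operator T T'"
  shows "inverse_operator T = T'"
  unfolding inverse_operator_def
proof (rule the_equality)
  show "is_inverse_operator T T'" by (rule assms)
next
  fix V assume V: "is_inverse_operator T V"
  have one: "Bop V * Bop T = 1" "Bop T * Bop T' = 1"
    using V assms by (simp_all add: is_inverse_operator_def Bop_algebra[symmetric])
  have "Bop V = Bop V * (Bop T * Bop T')" by (simp add: one)
  also have "\<dots> = (Bop V * Bop T) * Bop T'" by (simp only: mult.assoc)
  also have "\<dots> = Bop T'" by (simp add: one)
  finally show "V = T'" by (simp add: Bop_eq_iff)
qed

lemma discounted_riccati_iff:
  assumes "selfadj (Bop A)" "selfadj (Bop B)" "is_inverse_operator R R'"
  shows "discounted_riccati \<rho> A B M R S \<longleftrightarrow>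
    riccati (Bop A) (Bop B * Bop R' * Bop B) (Bop M) \<rho> (Bop S) = 0"
proof -
  have "discounted_riccati \<rho> A B M R S \<longleftrightarrow> Bop (\<rho> *\<^sub>R S) = Bop ((S o\<^sub>L A) + (A o\<^sub>L S)
       - (S o\<^sub>L B o\<^sub>L R' o\<^sub>L B o\<^sub>L S) + M)"
    unfolding discounted_riccati_def Bop_eq_iff
    using assms by (simp add: adjoint_operator_selfadj inverse_operator_eq)
  then show ?thesis
    by (auto simp: Bop_algebra riccati_def mult.assoc)
qed

lemma exp_operator_eq: "exp_operator T = blinfun_of_bop (exp (Bop T))"
proof -
  have "blinfun_of_bop (Bop T ^ n) = ((o\<^sub>L) T ^^ n) id_blinfun" for n
    by (induction n) (simp_all add: one_bop.rep_eq times_bop.rep_eq Bop_inverse)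
  then have "blinfun_of_bop (\<Sum>n. Bop T ^ n /\<^sub>R fact n) = (\<Sum>n. ((o\<^sub>L) T ^^ n) id_blinfun /\<^sub>R fact n)"
    by (subst bounded_linear.suminf[OF bounded_linear_blinfun_of_bop summable_exp_generic])
       (simp add: scaleR_bop.rep_eq)
  then show ?thesis by (simp add: exp_operator_def exp_def)
qed

text \<open>With \<open>B = R = 1\<close> and \<open>\<Gamma> = A - (\<rho>/2)\<close> the Riccati equation says \<open>(S - \<Gamma>)\<^sup>2 = \<Gamma>\<^sup>2 + M\<close>:
  completing the square.\<close>

lemma riccati_square:
  fixes A M S :: bop and \<rho> :: real
  defines "\<Gamma> \<equiv> A - (\<rho> / 2) *\<^sub>R 1"
  shows "riccati A 1 M \<rho> S = \<Gamma> * \<Gamma> + M - (S - \<Gamma>) * (S - \<Gamma>)"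
proof -
  have "\<rho> *\<^sub>R S = (\<rho> / 2) *\<^sub>R S + (\<rho> / 2) *\<^sub>R S"
    by (simp add: scaleR_add_left[symmetric])
  then show ?thesis by (simp add: riccati_def \<Gamma>_def algebra_simps)
qed

text \<open>Both claims expand \<open>\<parallel>N f\<parallel>\<^sup>2 = \<langle>f, N\<^sup>2 f\<rangle>\<close>. The inequality is the hypothesis of monotonicity of the square
  root, for \<open>G\<close> and for \<open>- G\<close> alike.\<close>

lemma square_le_add_psd:
  assumes G: "selfadj G" and M: "psd M" and N: "psd N" and sq: "N * N = G * G + M"
  shows "(norm (N \<odot> f))\<^sup>2 = (norm (G \<odot> f))\<^sup>2 + f \<bullet> (M \<odot> f)" "norm (G \<odot> f) \<le> norm (N \<odot> f)"
proof -
  show 1: "(norm (N \<odot> f))\<^sup>2 = (norm (G \<odot> f))\<^sup>2 + f \<bullet> (M \<odot> f)"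
    by (simp add: selfadj_norm_square[OF psd_selfadj[OF N]] selfadj_norm_square[OF G] sq
        bop.add_left inner_add_right del: bop_apply_mult)
  show "norm (G \<odot> f) \<le> norm (N \<odot> f)"
  proof (rule power2_le_imp_le)
    show "(norm (G \<odot> f))\<^sup>2 \<le> (norm (N \<odot> f))\<^sup>2"
      using psd_nonneg(1)[OF M, of f] unfolding 1 by linarith
  qed simp
qed

text \<open>A vector on which the form of \<open>\<Gamma> + N\<close> vanishes satisfies \<open>N f = - \<Gamma> f\<close>, hence \<open>\<parallel>N f\<parallel> = \<parallel>\<Gamma> f\<parallel>\<close>, which is
  possible only where the form of \<open>M\<close> vanishes. In this way strict positivity passes from \<open>M\<close> to the
  solution.\<close>

lemma riccati_closed_form:
  fixes A M N :: bop and \<rho> :: real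
  defines "\<Gamma> \<equiv> A - (\<rho> / 2) *\<^sub>R 1"
  assumes A: "selfadj A" and M: "psd M" and N: "psd N" and sq: "N * N = \<Gamma> * \<Gamma> + M"
  shows "psd (\<Gamma> + N)" "riccati A 1 M \<rho> (\<Gamma> + N) = 0"
    and "\<And>f. f \<bullet> ((\<Gamma> + N) \<odot> f) = 0 \<Longrightarrow> f \<bullet> (M \<odot> f) = 0"
proof -
  have G: "selfadj \<Gamma>" using A by (simp add: \<Gamma>_def)
  note le = square_le_add_psd[OF G M N sq]
  show 1: "psd (\<Gamma> + N)"
    using psd_add_of_square_le[OF N G le(2)] by (simp add: add.commute)
  show "riccati A 1 M \<rho> (\<Gamma> + N) = 0"
    by (simp add: riccati_square \<Gamma>_def[symmetric] sq)
  fix f assume "f \<bullet> ((\<Gamma> + N) \<odot> f) = 0"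
  then have "(\<Gamma> + N) \<odot> f = 0" by (rule psd_inner_zeroD[OF 1])
  then have "N \<odot> f = - (\<Gamma> \<odot> f)" by (simp add: bop.add_left add_eq_0_iff)
  then show "f \<bullet> (M \<odot> f) = 0" using le(1)[of f] by simp
qed

text \<open>\<open>Y = S - \<Gamma>\<close> and \<open>N\<close> commute and have the same square, so \<open>Y = N\<close> once the kernel of \<open>Y + N\<close>
  is trivial. On that kernel \<open>S\<close> acts as \<open>\<Gamma> - N \<le> 0\<close>, so the forms of \<open>S\<close> and of \<open>N - \<Gamma>\<close> both vanish;
  the latter forces the form of \<open>M\<close> to vanish too.\<close>

lemma riccati_unique:
  fixes A M N S :: bop and \<rho> :: real
  defines "\<Gamma> \<equiv> A - (\<rho> / 2) *\<^sub>R 1"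
  assumes A: "selfadj A" and M: "psd M" and N: "psd N" and sq: "N * N = \<Gamma> * \<Gamma> + M"
    and comm: "\<And>C. C * (\<Gamma> * \<Gamma> + M) = (\<Gamma> * \<Gamma> + M) * C \<Longrightarrow> C * N = N * C"
    and S: "psd S" "riccati A 1 M \<rho> S = 0"
    and pd: "(\<forall>f. f \<noteq> 0 \<longrightarrow> 0 < f \<bullet> (S \<odot> f)) \<or> (\<forall>f. f \<noteq> 0 \<longrightarrow> 0 < f \<bullet> (M \<odot> f))"
  shows "S = \<Gamma> + N"
proof -
  have G: "selfadj \<Gamma>" using A by (simp add: \<Gamma>_def)
  note le = square_le_add_psd[OF G M N sq]
  define Y where "Y = S - \<Gamma>"
  have YY: "Y * Y = \<Gamma> * \<Gamma> + M"
    using S(2) by (simp add: riccati_square \<Gamma>_def[symmetric] Y_def)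
  have YN: "Y * N = N * Y"
    by (rule comm) (simp add: YY[symmetric] mult.assoc)
  have NmG: "psd (N + - \<Gamma>)"
    using G le(2) by (intro psd_add_of_square_le[OF N]) (simp_all add: bop.minus_left)
  have inj: "f = 0" if "(Y + N) \<odot> f = 0" for f
  proof (rule ccontr)
    assume f: "f \<noteq> 0"
    have "S \<odot> f = - ((N + - \<Gamma>) \<odot> f)"
      using that by (simp add: Y_def bop.add_left bop.diff_left bop.minus_left algebra_simps
          add_eq_0_iff eq_neg_iff_add_eq_0)
    then have eq: "f \<bullet> (S \<odot> f) = - (f \<bullet> ((N + - \<Gamma>) \<odot> f))" by simp
    then have z: "f \<bullet> (S \<odot> f) = 0" "f \<bullet> ((N + - \<Gamma>) \<odot> f) = 0"
      using psd_nonneg(1)[OF S(1), of f] psd_nonneg(1)[OF NmG, of f] by linarith+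
    have "(N + - \<Gamma>) \<odot> f = 0" by (rule psd_inner_zeroD[OF NmG z(2)])
    then have "N \<odot> f = \<Gamma> \<odot> f" by (simp add: bop.diff_left)
    then have "f \<bullet> (M \<odot> f) = 0" using le(1)[of f] by simp
    with z(1) pd f show False by force
  qed
  have "(Y + N) * (Y - N) = 0"
    using YN YY sq by (simp add: algebra_simps)
  then have "(Y + N) \<odot> ((Y - N) \<odot> f) = 0" for f
    by (simp add: bop_apply_mult[symmetric] bop.zero_left del: bop_apply_mult)
  then have "(Y - N) \<odot> f = 0" for f by (rule inj)
  then have "Y = N" by (intro bop_eqI) (simp add: bop.diff_left)
  then show ?thesis by (simp add: Y_def algebra_simps)
qed

lemma positive_operator_iff: "positive_operator T \<longleftrightarrow> psd (Bop T)"
  by (simp add: psd_iff Bop_inverse)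

lemma positive_definite_operator_iff:
  "positive_definite_operator T \<longleftrightarrow> psd (Bop T) \<and> (\<forall>f. f \<noteq> 0 \<longrightarrow> 0 < f \<bullet> (Bop T \<odot> f))"
  by (simp add: positive_definite_operator_def positive_operator_iff Bop_apply)

lemma discounted_riccati_closed_form:
  fixes A M :: "L2 \<Rightarrow>\<^sub>L L2" and \<rho> :: real
  assumes A: "selfadj (Bop A)" and M: "positive_operator M"
  defines "\<Gamma> \<equiv> A - (\<rho> / 2) *\<^sub>R id_blinfun"
  defines "S0 \<equiv> \<Gamma> + sqrt_operator ((\<Gamma> o\<^sub>L \<Gamma>) + M)"
  shows "positive_operator S0" "discounted_riccati \<rho> A id_blinfun M id_blinfun S0"
    and "\<And>S. positive_definite_operator S \<Longrightarrow> discounted_riccati \<rho> A id_blinfun M id_blinfun S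
      \<Longrightarrow> S = S0"
    and "positive_definite_operator M \<Longrightarrow> positive_definite_operator S0"
    and "\<And>S. positive_definite_operator M \<Longrightarrow> positive_operator S
      \<Longrightarrow> discounted_riccati \<rho> A id_blinfun M id_blinfun S \<Longrightarrow> S = S0"
proof -
  define N where "N = Bop (sqrt_operator ((\<Gamma> o\<^sub>L \<Gamma>) + M))"
  define a where "a = Bop A"
  define g where "g = a - (\<rho> / 2) *\<^sub>R 1"
  define m where "m = Bop M"
  have gB: "Bop \<Gamma> = g" by (simp add: \<Gamma>_def g_def a_def Bop_algebra)
  have sa: "selfadj a" and pm: "psd m" using A M by (simp_all add: a_def m_def positive_operator_iff)
  have sg: "selfadj g" using sa by (simp add: g_def)
  have "psd (g * g)" using psd_sandwich[OF sg, of 1] by (simp add: psd_def)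
  then have T: "psd (g * g + m)" using pm by (rule psd_add)
  have "blinfun_of_bop (g * g + m) = (\<Gamma> o\<^sub>L \<Gamma>) + M"
    by (simp add: gB[symmetric] m_def Bop_algebra[symmetric] Bop_inverse)
  then have N_eq: "N = Bop (sqrt_operator (blinfun_of_bop (g * g + m)))" by (simp add: N_def)
  note N = sqrt_operator_props[OF T, folded N_eq]
  have S0: "Bop S0 = g + N" by (simp add: S0_def Bop_algebra gB N_def)
  have "is_inverse_operator id_blinfun id_blinfun" 
    by (simp add: is_inverse_operator_def Bop_algebra flip: Bop_eq_iff)
  moreover have "selfadj (Bop id_blinfun)" by (simp add: Bop_algebra)
  ultimately have ric: "discounted_riccati \<rho> A id_blinfun M id_blinfun S \<longleftrightarrow> riccati a 1 m \<rho> (Bop S) = 0" for S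
    using discounted_riccati_iff[OF A] by (simp add: a_def m_def Bop_algebra)
  note cf = riccati_closed_form[OF sa pm N(1), of \<rho>, folded g_def, OF N(2)]
  note un = riccati_unique[OF sa pm N(1), of \<rho>, folded g_def, OF N(2) N(3)]
  show "positive_operator S0" by (simp add: positive_operator_iff S0 cf)
  show "discounted_riccati \<rho> A id_blinfun M id_blinfun S0" by (simp add: ric S0 cf)
  show "S = S0" if "positive_definite_operator S" "discounted_riccati \<rho> A id_blinfun M id_blinfun S" for S
    using un[of "Bop S"] that S0 by (simp add: positive_definite_operator_iff ric flip: Bop_eq_iff)
  show "positive_definite_operator S0" if "positive_definite_operator M"
    unfolding positive_definite_operator_iff S0
  proof (intro conjI allI impI cf(1))
    fix f :: L2 assume "f \<noteq> 0"
    then have "f \<bullet> (m \<odot> f) \<noteq> 0"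
      using that by (force simp: positive_definite_operator_iff m_def)
    then show "0 < f \<bullet> ((g + N) \<odot> f)"
      using cf(3)[of f] psd_nonneg(1)[OF cf(1), of f] by linarith
  qed
  show "S = S0" if "positive_definite_operator M" "positive_operator S"
    "discounted_riccati \<rho> A id_blinfun M id_blinfun S" for S
    using un[of "Bop S"] that S0
    by (simp add: positive_definite_operator_iff positive_operator_iff ric m_def flip: Bop_eq_iff)
qed

section \<open>Integral operators\<close>

lemma integral_operator_inner:
  assumes W: "bounded_symmetric_kernel W" and f: "square_integrable f" and g: "square_integrable g"
  shows "L2_class f \<bullet> integral_operator W (L2_class g)
    = (LINT \<alpha>|unit_interval. f \<alpha> * (LINT \<beta>|unit_interval. W (\<alpha>, \<beta>) * g \<beta>))"
proof -
  have "(LINT \<beta>|unit_interval. W (\<alpha>, \<beta>) * L2_fun (L2_class g) \<beta>) = (LINT \<beta>|unit_interval. W (\<alpha>, \<beta>) * g \<beta>)"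
    if "\<alpha> \<in> {0..1}" for \<alpha>
  proof (rule integral_cong_AE)
    show "AE \<beta> in unit_interval. W (\<alpha>, \<beta>) * L2_fun (L2_class g) \<beta> = W (\<alpha>, \<beta>) * g \<beta>"
      using L2_fun_L2_class[OF g] by eventually_elim simp
  qed (use square_integrable_mult[OF square_integrable_kernel_section[OF W that]] g
        L2_fun_square_integrable in \<open>simp_all add: borel_measurable_integrable\<close>)
  then have "(LINT \<alpha>|unit_interval. f \<alpha> * (LINT \<beta>|unit_interval. W (\<alpha>, \<beta>) * L2_fun (L2_class g) \<beta>))
    = (LINT \<alpha>|unit_interval. f \<alpha> * (LINT \<beta>|unit_interval. W (\<alpha>, \<beta>) * g \<beta>))"
    by (intro Bochner_Integration.integral_cong) (auto simp: space_restrict_space)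
  then show ?thesis
    by (simp add: integral_operator_apply[OF W] inner_L2_class[OF f kernel_image(1)[OF W]])
qed

lemma square_integrable_abs_integrable:
  assumes "square_integrable f"
  shows "integrable unit_interval (\<lambda>x. \<bar>f x\<bar>)"
  using square_integrable_mult[OF assms square_integrable_const[of 1]] by simp

lemma selfadj_integral_operator:
  assumes W: "bounded_symmetric_kernel W"
  shows "selfadj (Bop (integral_operator W))"
  unfolding selfadj_def Bop_apply
proof (intro allI)
  fix u v :: L2
  obtain f g where f: "square_integrable f" "u = L2_class f" and g: "square_integrable g" "v = L2_class g"
    using L2_cases by metis
  from W obtain C where C: "\<And>\<alpha> \<beta>. \<alpha> \<in> {0..1} \<Longrightarrow> \<beta> \<in> {0..1} \<Longrightarrow> \<bar>W (\<alpha>, \<beta>)\<bar> \<le> C"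
    unfolding bounded_symmetric_kernel_def by blast
  interpret pair_sigma_finite unit_interval unit_interval ..
  let ?h = "\<lambda>(\<alpha>, \<beta>). f \<alpha> * (W (\<alpha>, \<beta>) * g \<beta>)"
  have [measurable]: "W \<in> borel_measurable (unit_interval \<Otimes>\<^sub>M unit_interval)"
    using W by (simp add: bounded_symmetric_kernel_def)
  have [measurable]: "f \<in> borel_measurable unit_interval" "g \<in> borel_measurable unit_interval"
    using f g by (auto simp: square_integrable_def)
  have fi: "integrable unit_interval (\<lambda>x. \<bar>f x\<bar>)" and gi: "integrable unit_interval (\<lambda>x. \<bar>g x\<bar>)"
    using f g square_integrable_abs_integrable by auto
  have dom: "integrable (unit_interval \<Otimes>\<^sub>M unit_interval) (\<lambda>(\<alpha>, \<beta>). \<bar>f \<alpha>\<bar> * \<bar>g \<beta>\<bar>)"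
    by (rule Fubini_integrable) (auto simp: fi gi abs_mult)
  have "integrable (unit_interval \<Otimes>\<^sub>M unit_interval) (\<lambda>x. C * (case x of (\<alpha>, \<beta>) \<Rightarrow> \<bar>f \<alpha>\<bar> * \<bar>g \<beta>\<bar>))"
    using dom by (rule integrable_mult_right)
  then have int: "integrable (unit_interval \<Otimes>\<^sub>M unit_interval) ?h"
  proof (rule Bochner_Integration.integrable_bound)
    show "AE x in unit_interval \<Otimes>\<^sub>M unit_interval. norm (?h x) \<le> norm (C * (case x of (\<alpha>, \<beta>) \<Rightarrow> \<bar>f \<alpha>\<bar> * \<bar>g \<beta>\<bar>))"
    proof (rule AE_I2, clarsimp simp: space_pair_measure space_restrict_space abs_mult)
      fix \<alpha> \<beta> :: real assume "0 \<le> \<alpha>" "\<alpha> \<le> 1" "0 \<le> \<beta>" "\<beta> \<le> 1"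
      then have "\<bar>W (\<alpha>, \<beta>)\<bar> \<le> \<bar>C\<bar>" using C[of \<alpha> \<beta>] by simp
      then have "\<bar>W (\<alpha>, \<beta>)\<bar> * (\<bar>f \<alpha>\<bar> * \<bar>g \<beta>\<bar>) \<le> \<bar>C\<bar> * (\<bar>f \<alpha>\<bar> * \<bar>g \<beta>\<bar>)"
        by (intro mult_right_mono) auto
      then show "\<bar>f \<alpha>\<bar> * (\<bar>W (\<alpha>, \<beta>)\<bar> * \<bar>g \<beta>\<bar>) \<le> \<bar>C\<bar> * (\<bar>f \<alpha>\<bar> * \<bar>g \<beta>\<bar>)"
        by (simp add: mult_ac)
    qed
  qed measurable
  have "u \<bullet> integral_operator W v = (LINT \<alpha>|unit_interval. LINT \<beta>|unit_interval. f \<alpha> * (W (\<alpha>, \<beta>) * g \<beta>))"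
    unfolding f g by (simp add: integral_operator_inner[OF W f(1) g(1)])
  also have "\<dots> = (LINT \<beta>|unit_interval. LINT \<alpha>|unit_interval. f \<alpha> * (W (\<alpha>, \<beta>) * g \<beta>))"
    using Fubini_integral[OF int] by simp
  also have "\<dots> = (LINT \<beta>|unit_interval. g \<beta> * (LINT \<alpha>|unit_interval. W (\<beta>, \<alpha>) * f \<alpha>))"
  proof (rule Bochner_Integration.integral_cong[OF refl])
    fix \<beta> :: real assume b: "\<beta> \<in> space unit_interval"
    have "(LINT \<alpha>|unit_interval. f \<alpha> * (W (\<alpha>, \<beta>) * g \<beta>)) = (LINT \<alpha>|unit_interval. g \<beta> * (W (\<beta>, \<alpha>) * f \<alpha>))"
      using W b by (intro Bochner_Integration.integral_cong[OF refl])
        (simp add: bounded_symmetric_kernel_def space_restrict_space)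
    then show "(LINT \<alpha>|unit_interval. f \<alpha> * (W (\<alpha>, \<beta>) * g \<beta>)) = g \<beta> * (LINT \<alpha>|unit_interval. W (\<beta>, \<alpha>) * f \<alpha>)"
      by simp
  qed
  also have "\<dots> = v \<bullet> integral_operator W u"
    unfolding f g by (simp add: integral_operator_inner[OF W g(1) f(1)])
  finally show "integral_operator W u \<bullet> v = u \<bullet> integral_operator W v" by (simp add: inner_commute)
qed

lemma selfadj_kernel_plus_scalar:
  "bounded_symmetric_kernel W \<Longrightarrow> selfadj (Bop (integral_operator W + c *\<^sub>R id_blinfun))"
  by (simp add: Bop_algebra selfadj_integral_operator)

text \<open>An upper bound for the quadratic form of a kernel by its supremum. Applied to an orthonormal
  family of normalised step functions it bounds the trace.\<close>

lemma integral_operator_form_le: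
  assumes W: "bounded_symmetric_kernel W" and C: "\<And>\<alpha> \<beta>. \<alpha> \<in> {0..1} \<Longrightarrow> \<beta> \<in> {0..1} \<Longrightarrow> \<bar>W (\<alpha>, \<beta>)\<bar> \<le> C"
    and f: "square_integrable f"
  shows "L2_class f \<bullet> integral_operator W (L2_class f) \<le> C * (LINT x|unit_interval. \<bar>f x\<bar>)\<^sup>2"
proof -
  let ?F = "LINT x|unit_interval. \<bar>f x\<bar>"
  have fi: "integrable unit_interval (\<lambda>x. \<bar>f x\<bar>)" by (rule square_integrable_abs_integrable[OF f])
  have fm: "f \<in> borel_measurable unit_interval" using f by (simp add: square_integrable_def)
  have b: "\<bar>LINT \<beta>|unit_interval. W (\<alpha>, \<beta>) * f \<beta>\<bar> \<le> C * ?F" if a: "\<alpha> \<in> {0..1}" for \<alpha>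
  proof -
    have "\<bar>LINT \<beta>|unit_interval. W (\<alpha>, \<beta>) * f \<beta>\<bar> \<le> (LINT \<beta>|unit_interval. \<bar>W (\<alpha>, \<beta>) * f \<beta>\<bar>)"
      using integral_norm_bound[of unit_interval "\<lambda>\<beta>. W (\<alpha>, \<beta>) * f \<beta>"] by simp
    also have "\<dots> \<le> (LINT \<beta>|unit_interval. C * \<bar>f \<beta>\<bar>)"
    proof (rule integral_mono)
      show "integrable unit_interval (\<lambda>\<beta>. \<bar>W (\<alpha>, \<beta>) * f \<beta>\<bar>)"
        using square_integrable_mult[OF square_integrable_kernel_section[OF W a] f] by (rule integrable_abs)
    qed (use fi C[OF a] in \<open>auto simp: abs_mult space_restrict_space intro!: mult_right_mono\<close>)
    finally show ?thesis by simp
  qed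
  have "L2_class f \<bullet> integral_operator W (L2_class f)
      = (LINT \<alpha>|unit_interval. f \<alpha> * (LINT \<beta>|unit_interval. W (\<alpha>, \<beta>) * f \<beta>))"
    by (rule integral_operator_inner[OF W f f])
  also have "\<dots> \<le> (LINT \<alpha>|unit_interval. \<bar>f \<alpha>\<bar> * (C * ?F))"
  proof (rule integral_mono')
    show "f \<alpha> * (LINT \<beta>|unit_interval. W (\<alpha>, \<beta>) * f \<beta>) \<le> \<bar>f \<alpha>\<bar> * (C * ?F)" if "\<alpha> \<in> space unit_interval" for \<alpha>
    proof -
      have "f \<alpha> * (LINT \<beta>|unit_interval. W (\<alpha>, \<beta>) * f \<beta>) \<le> \<bar>f \<alpha>\<bar> * \<bar>LINT \<beta>|unit_interval. W (\<alpha>, \<beta>) * f \<beta>\<bar>"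
        by (metis abs_ge_self abs_mult)
      also have "\<dots> \<le> \<bar>f \<alpha>\<bar> * (C * ?F)"
        using b[of \<alpha>] that by (intro mult_left_mono) (auto simp: space_restrict_space)
      finally show ?thesis .
    qed
    show "0 \<le> \<bar>f \<alpha>\<bar> * (C * ?F)" for \<alpha>
      using C[of 0 0] by (intro mult_nonneg_nonneg) (auto intro: Bochner_Integration.integral_nonneg)
  qed (use fi in auto)
  also have "\<dots> = C * ?F\<^sup>2" by (simp add: power2_eq_square)
  finally show ?thesis .
qed

section \<open>Ordinary differential equations in a Banach space\<close>

lemma integral_has_vector_derivative_halfline:
  fixes g :: "real \<Rightarrow> 'a::banach"
  assumes g: "continuous_on {0..} g" and t: "0 \<le> t"
  shows "((\<lambda>u. integral {0..u} g) has_vector_derivative g t) (at t within {0..})"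
proof -
  have "((\<lambda>u. integral {0..u} g) has_vector_derivative g t) (at t within {0..t + 1})"
    using t by (intro integral_has_vector_derivative continuous_on_subset[OF g]) auto
  moreover have "at t within {0..} = at t within {0..t + 1}"
    by (rule at_within_nhd[of t "{..<t + 1}"]) auto
  ultimately show ?thesis by simp
qed

lemma integral_vector_derivative_eq:
  fixes y :: "real \<Rightarrow> 'a::banach"
  assumes "\<And>s. s \<in> {0..t} \<Longrightarrow> (y has_vector_derivative y' s) (at s within {0..t})" "0 \<le> t"
  shows "y t = y 0 + integral {0..t} y'"
  using integral_unique[OF fundamental_theorem_of_calculus[OF assms(2,1)]] by simp

lemma integral_exp_weight:
  fixes L :: real
  assumes "0 < L" "0 \<le> t"
  shows "integral {0..t} (\<lambda>s. exp (2 * L * s)) = (exp (2 * L * t) - 1) / (2 * L)"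
proof -
  have "((\<lambda>s. exp (2 * L * s)) has_integral exp (2 * L * t) / (2 * L) - exp (2 * L * 0) / (2 * L)) {0..t}"
  proof (rule fundamental_theorem_of_calculus[OF assms(2)])
    show "((\<lambda>s. exp (2 * L * s) / (2 * L)) has_vector_derivative exp (2 * L * s)) (at s within {0..t})" for s
      unfolding has_real_derivative_iff_has_vector_derivative[symmetric]
      using assms by (auto intro!: derivative_eq_intros)
  qed
  then show ?thesis using assms by (simp add: integral_unique diff_divide_distrib)
qed

lemma continuous_on_interval_halfline:
  fixes y :: "real \<Rightarrow> 'a::topological_space"
  assumes "\<And>b. 0 \<le> b \<Longrightarrow> continuous_on {0..b} y"
  shows "continuous_on {0..} y"
  unfolding continuous_on_eq_continuous_within
proof
  fix t :: real assume t: "t \<in> {0..}"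
  have "continuous (at t within {0..t + 1}) y"
    using assms[of "t + 1"] t by (auto simp: continuous_on_eq_continuous_within)
  moreover have "at t within {0..} = at t within {0..t + 1}"
    by (rule at_within_nhd[of t "{..<t + 1}"]) auto
  ultimately show "continuous (at t within {0..}) y" by simp
qed

text \<open>The weight \<open>exp (-2 L t)\<close> absorbs half of the integral term, which gives the Gronwall bound
  without solving a differential inequality.\<close>

lemma gronwall:
  fixes \<phi> :: "real \<Rightarrow> real"
  assumes cont: "continuous_on {0..T} \<phi>" and L: "0 < L" and d: "0 \<le> \<delta>"
    and le: "\<And>t. t \<in> {0..T} \<Longrightarrow> \<phi> t \<le> \<delta> + L * integral {0..t} \<phi>"
    and t: "t \<in> {0..T}"
  shows "\<phi> t \<le> 2 * \<delta> * exp (2 * L * t)"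
proof -
  define \<psi> where "\<psi> t = exp (- (2 * L * t)) * \<phi> t" for t
  have "continuous_on {0..T} \<psi>" unfolding \<psi>_def by (intro continuous_intros cont)
  moreover have "{0..T} \<noteq> {}" using t by auto
  ultimately obtain t0 where t0: "t0 \<in> {0..T}" and max: "\<And>s. s \<in> {0..T} \<Longrightarrow> \<psi> s \<le> \<psi> t0"
    using continuous_attains_sup[of "{0..T}" \<psi>] by auto
  define m where "m = \<psi> t0"
  have phi: "\<phi> s = exp (2 * L * s) * \<psi> s" for s by (simp add: \<psi>_def exp_minus)
  have m: "m \<le> 2 * \<delta>"
  proof (cases "m \<le> 0")
    case False
    have "integral {0..t0} \<phi> \<le> integral {0..t0} (\<lambda>s. exp (2 * L * s) * m)"
    proof (rule integral_le)
      show "\<phi> integrable_on {0..t0}"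
        using t0 by (intro integrable_continuous_real continuous_on_subset[OF cont]) auto
      show "(\<lambda>s. exp (2 * L * s) * m) integrable_on {0..t0}"
        by (intro integrable_continuous_real continuous_intros)
      show "\<phi> s \<le> exp (2 * L * s) * m" if "s \<in> {0..t0}" for s
        using max[of s] that t0 by (auto simp: phi m_def)
    qed
    also have "\<dots> = m * ((exp (2 * L * t0) - 1) / (2 * L))"
      using integral_exp_weight[OF L, of t0] t0 by simp
    finally have "L * integral {0..t0} \<phi> \<le> L * (m * ((exp (2 * L * t0) - 1) / (2 * L)))"
      using L by (intro mult_left_mono) auto
    also have "\<dots> = (m / 2) * (exp (2 * L * t0) - 1)" using L by (simp add: field_simps)
    also have "\<dots> \<le> (m / 2) * exp (2 * L * t0)" using False by simp
    finally have "\<phi> t0 \<le> \<delta> + (m / 2) * exp (2 * L * t0)" using le[OF t0] by linarith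
    then have "m * exp (2 * L * t0) \<le> \<delta> + (m / 2) * exp (2 * L * t0)"
      by (simp add: phi m_def mult.commute)
    moreover have "\<delta> \<le> \<delta> * exp (2 * L * t0)"
      using d L t0 by (simp add: mult_le_cancel_left1)
    ultimately have "m * exp (2 * L * t0) \<le> (\<delta> + m / 2) * exp (2 * L * t0)"
      by (simp add: distrib_right)
    then have "m \<le> \<delta> + m / 2" by simp
    then show ?thesis by simp
  qed (use d in auto)
  have "\<phi> t = exp (2 * L * t) * \<psi> t" by (rule phi)
  also have "\<dots> \<le> exp (2 * L * t) * (2 * \<delta>)"
    using max[OF t] m by (intro mult_left_mono) (auto simp: m_def)
  finally show ?thesis by (simp add: mult.commute)
qed

text \<open>Picard iteration, measured with the weight \<open>exp (- 2 L t)\<close>, in which the integral operator contracts by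
  the factor \<open>1/2\<close> on every bounded interval. The operators \<open>\<Lambda> i\<close> cut out a closed linear subspace that
  the right hand side preserves. The iterates never leave it, and this is how self-adjointness of the
  Riccati flow is obtained.\<close>

lemma picard_lindeloef:
  fixes f :: "real \<Rightarrow> 'a::banach \<Rightarrow> 'a" and \<Lambda> :: "'i \<Rightarrow> 'a \<Rightarrow> 'b::real_normed_vector"
  assumes cont: "\<And>y. continuous_on {0..} y \<Longrightarrow> continuous_on {0..} (\<lambda>t. f t (y t))"
    and lip: "\<And>t x y. 0 \<le> t \<Longrightarrow> norm (f t x - f t y) \<le> L * norm (x - y)" and L: "0 < L"
    and lin: "\<And>i. bounded_linear (\<Lambda> i)" and \<Lambda>0: "\<And>i. \<Lambda> i y0 = 0"
    and inv: "\<And>t x i. 0 \<le> t \<Longrightarrow> (\<And>i. \<Lambda> i x = 0) \<Longrightarrow> \<Lambda> i (f t x) = 0"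
  shows "\<exists>y. y 0 = y0 \<and> (\<forall>t\<ge>0. (y has_vector_derivative f t (y t)) (at t within {0..})) \<and>
    (\<forall>t\<ge>0. \<forall>i. \<Lambda> i (y t) = 0)"
proof -
  define p where "p n = rec_nat (\<lambda>t. y0) (\<lambda>_ q t. y0 + integral {0..t} (\<lambda>s. f s (q s))) n" for n :: nat
  have p0: "p 0 = (\<lambda>t. y0)" and pS: "p (Suc n) = (\<lambda>t. y0 + integral {0..t} (\<lambda>s. f s (p n s)))" for n
    by (simp_all add: p_def)
  have int_cont: "continuous_on {0..} (\<lambda>t. y0 + integral {0..t} g)" if "continuous_on {0..} g" for g :: "real \<Rightarrow> 'a"
    using integral_has_vector_derivative_halfline[OF that]
    by (intro continuous_on_add continuous_on_const continuous_on_vector_derivative[where f' = g]) auto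
  have pc: "continuous_on {0..} (p n)" for n
    by (induction n) (simp_all add: p0 pS int_cont cont)
  have fpc: "continuous_on {0..} (\<lambda>s. f s (p n s))" for n
    by (rule cont[OF pc])
  have sub: "continuous_on {0..t} g" if "continuous_on {0..} g" for g :: "real \<Rightarrow> 'c::topological_space" and t
    by (rule continuous_on_subset[OF that]) auto
  have ex_lim: "\<exists>C\<ge>0. \<forall>n. \<forall>t\<in>{0..b}. norm (p (Suc n) t - p n t) \<le> C * exp (2 * L * t) * (1/2)^n" for b
  proof -
    have "compact ((\<lambda>t. p 1 t - p 0 t) ` {0..b})"
      by (intro compact_continuous_image continuous_on_diff sub pc) simp
    then obtain C where C: "\<And>t. t \<in> {0..b} \<Longrightarrow> norm (p 1 t - p 0 t) \<le> C" "0 < C"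
      using compact_imp_bounded bounded_pos by (metis (no_types, lifting) imageI)
    have "norm (p (Suc n) t - p n t) \<le> C * exp (2 * L * t) * (1/2)^n" if "t \<in> {0..b}" for n t
      using that
    proof (induction n arbitrary: t)
      case 0
      have "C \<le> C * exp (2 * L * t)" using C(2) L 0 by (simp add: mult_le_cancel_left1)
      then show ?case using C(1)[OF 0] by simp
    next
      case (Suc n)
      have "p (Suc (Suc n)) t - p (Suc n) t = integral {0..t} (\<lambda>s. f s (p (Suc n) s) - f s (p n s))"
      proof -
        have i: "(\<lambda>s. f s (p k s)) integrable_on {0..t}" for k
          by (intro integrable_continuous_real sub fpc)
        have e: "p (Suc k) t = y0 + integral {0..t} (\<lambda>s. f s (p k s))" for k by (simp only: pS)
        show ?thesis
          unfolding integral_diff[OF i i] e[of "Suc n"] e[of n] by simp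
      qed
      also have "norm \<dots> \<le> integral {0..t} (\<lambda>s. exp (2 * L * s) * (L * C * (1/2)^n))"
      proof (rule integral_norm_bound_integral)
        show "(\<lambda>s. f s (p (Suc n) s) - f s (p n s)) integrable_on {0..t}"
          by (intro integrable_continuous_real continuous_on_diff sub fpc)
        show "(\<lambda>s. exp (2 * L * s) * (L * C * (1/2)^n)) integrable_on {0..t}"
          by (intro integrable_continuous_real continuous_intros)
        fix s assume s: "s \<in> {0..t}"
        have "norm (f s (p (Suc n) s) - f s (p n s)) \<le> L * norm (p (Suc n) s - p n s)"
          using s by (intro lip) auto
        also have "\<dots> \<le> L * (C * exp (2 * L * s) * (1/2)^n)"
          using L s Suc.prems by (intro mult_left_mono Suc.IH) auto
        finally show "norm (f s (p (Suc n) s) - f s (p n s)) \<le> exp (2 * L * s) * (L * C * (1/2)^n)"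
          by (simp add: mult_ac)
      qed
      also have "\<dots> = (exp (2 * L * t) - 1) / (2 * L) * (L * C * (1/2)^n)"
        using integral_exp_weight[OF L, of t] Suc.prems by simp
      also have "\<dots> = (exp (2 * L * t) - 1) * (C * (1/2)^Suc n)"
        using L by (simp add: field_simps)
      also have "\<dots> \<le> exp (2 * L * t) * (C * (1/2)^Suc n)"
        using C(2) by (intro mult_right_mono) auto
      finally show ?case by (simp add: mult_ac)
    qed
    then show ?thesis using C(2) by (intro exI[of _ C]) auto
  qed
  define y where "y t = y0 + (\<Sum>n. p (Suc n) t - p n t)" for t
  have p_sum: "p n t = y0 + (\<Sum>k<n. p (Suc k) t - p k t)" for n t
    by (simp add: sum_lessThan_telescope[of "\<lambda>n. p n t"] p0)
  have unif: "uniform_limit {0..b} p y sequentially" if "0 \<le> b" for b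
  proof -
    obtain C where C: "0 \<le> C" "\<And>n t. t \<in> {0..b} \<Longrightarrow> norm (p (Suc n) t - p n t) \<le> C * exp (2 * L * t) * (1/2)^n"
      using ex_lim[of b] by blast
    have "uniform_limit {0..b} (\<lambda>n t. \<Sum>k<n. p (Suc k) t - p k t) (\<lambda>t. \<Sum>n. p (Suc n) t - p n t) sequentially"
    proof (rule Weierstrass_m_test)
      show "norm (p (Suc n) t - p n t) \<le> C * exp (2 * L * b) * (1/2)^n" if "t \<in> {0..b}" for n t
      proof -
        have "C * exp (2 * L * t) * (1/2)^n \<le> C * exp (2 * L * b) * (1/2)^n"
          using C(1) L that by (intro mult_right_mono mult_left_mono) auto
        with C(2)[OF that, of n] show ?thesis by linarith
      qed
      show "summable (\<lambda>n. C * exp (2 * L * b) * (1/2)^n)"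
        by (intro summable_mult summable_geometric) simp
    qed
    then have "uniform_limit {0..b} (\<lambda>n t. y0 + (\<Sum>k<n. p (Suc k) t - p k t)) y sequentially"
      unfolding y_def by (intro uniform_limit_intros)
    then show ?thesis unfolding p_sum[symmetric] .
  qed
  have lim: "(\<lambda>n. p n t) \<longlonglongrightarrow> y t" if "0 \<le> t" for t
    using tendsto_uniform_limitI[OF unif[OF that], of t] that by simp
  have yc: "continuous_on {0..} y"
  proof (rule continuous_on_interval_halfline)
    show "continuous_on {0..b} y" if "0 \<le> b" for b
      by (rule uniform_limit_theorem[OF _ unif[OF that]]) (auto intro!: eventuallyI sub pc)
  qed
  have y_eq: "y t = y0 + integral {0..t} (\<lambda>s. f s (y s))" if t: "0 \<le> t" for t
  proof -
    have "uniform_limit {0..t} (\<lambda>n s. f s (p n s)) (\<lambda>s. f s (y s)) sequentially"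
      unfolding uniform_limit_iff
    proof (intro allI impI)
      fix e :: real assume "0 < e"
      then have "\<forall>\<^sub>F n in sequentially. \<forall>s\<in>{0..t}. dist (p n s) (y s) < e / L"
        using unif[OF t] L unfolding uniform_limit_iff by auto
      then show "\<forall>\<^sub>F n in sequentially. \<forall>s\<in>{0..t}. dist (f s (p n s)) (f s (y s)) < e"
      proof eventually_elim
        case (elim n)
        show ?case
        proof
          fix s assume s: "s \<in> {0..t}"
          have "dist (f s (p n s)) (f s (y s)) \<le> L * dist (p n s) (y s)"
            using lip[of s] s by (simp add: dist_norm)
          also have "\<dots> < e" using elim s L by (simp add: field_simps)
          finally show "dist (f s (p n s)) (f s (y s)) < e" .
        qed
      qed
    qed
    then obtain I J where IJ: "\<And>n. ((\<lambda>s. f s (p n s)) has_integral I n) {0..t}"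
      "((\<lambda>s. f s (y s)) has_integral J) {0..t}" "I \<longlonglongrightarrow> J"
      by (rule uniform_limit_integral) (auto intro!: sub fpc)
    have "(\<lambda>n. p (Suc n) t) \<longlonglongrightarrow> y0 + J"
      using IJ(3) unfolding pS integral_unique[OF IJ(1)] by (intro tendsto_intros)
    moreover have "(\<lambda>n. p (Suc n) t) \<longlonglongrightarrow> y t" by (rule LIMSEQ_Suc[OF lim[OF t]])
    ultimately show ?thesis using LIMSEQ_unique integral_unique[OF IJ(2)] by blast
  qed
  have \<Lambda>p: "\<Lambda> i (p n t) = 0" if "0 \<le> t" for n t i
    using that
  proof (induction n arbitrary: t i)
    case (Suc n)
    interpret bounded_linear "\<Lambda> i" by (rule lin)
    have "\<Lambda> i (integral {0..t} (\<lambda>s. f s (p n s))) = integral {0..t} (\<lambda>s. \<Lambda> i (f s (p n s)))"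
      using integral_linear[OF integrable_continuous_real[OF sub[OF fpc]] lin[of i], of t n]
      by (simp add: o_def)
    also have "\<dots> = integral {0..t} (\<lambda>s. 0)"
      by (rule integral_cong) (use inv Suc.IH in auto)
    finally show ?case by (simp add: pS add \<Lambda>0)
  qed (simp add: p0 \<Lambda>0)
  have "\<Lambda> i (y t) = 0" if "0 \<le> t" for t i
    using bounded_linear.tendsto[OF lin lim[OF that], of i] \<Lambda>p[OF that] by (simp add: LIMSEQ_const_iff)
  moreover have "(y has_vector_derivative f t (y t)) (at t within {0..})" if "0 \<le> t" for t
  proof (rule has_vector_derivative_transform[where f = "\<lambda>t. y0 + integral {0..t} (\<lambda>s. f s (y s))"])
    show "((\<lambda>t. y0 + integral {0..t} (\<lambda>s. f s (y s))) has_vector_derivative f t (y t)) (at t within {0..})"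
      using integral_has_vector_derivative_halfline[OF cont[OF yc] that]
      by (auto intro!: derivative_eq_intros)
  qed (use that y_eq in auto)
  moreover have "y 0 = y0" using y_eq[of 0] by simp
  ultimately show ?thesis by blast
qed

corollary picard_lindeloef_unconstrained:
  fixes f :: "real \<Rightarrow> 'a::banach \<Rightarrow> 'a"
  assumes "\<And>y. continuous_on {0..} y \<Longrightarrow> continuous_on {0..} (\<lambda>t. f t (y t))"
    and "\<And>t x y. 0 \<le> t \<Longrightarrow> norm (f t x - f t y) \<le> L * norm (x - y)" and "0 < L"
  shows "\<exists>y. y 0 = y0 \<and> (\<forall>t\<ge>0. (y has_vector_derivative f t (y t)) (at t within {0..}))"
  using picard_lindeloef[where \<Lambda> = "\<lambda>(_::unit) _. 0::real" and f = f and L = L and ?y0.0 = y0] assms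
  by simp

text \<open>The inverse \<open>U\<close> of the fundamental solution \<open>V\<close> is obtained from its own equation. That \<open>U V = 1\<close> is
  immediate, since the derivative vanishes, but in infinite dimensions a left inverse need not be a right
  inverse: \<open>V U - 1\<close> satisfies a linear equation, and Gronwall shows that it is \<open>0\<close>.\<close>

lemma evolution_operator:
  fixes F :: "real \<Rightarrow> bop"
  assumes F: "continuous_on {0..} F" and bound: "\<And>t. 0 \<le> t \<Longrightarrow> norm (F t) \<le> L"
  shows "\<exists>V U. V 0 = 1 \<and> U 0 = 1 \<and>
    (\<forall>t\<ge>0. (V has_vector_derivative F t * V t) (at t within {0..})) \<and>
    (\<forall>t\<ge>0. (U has_vector_derivative - (U t * F t)) (at t within {0..})) \<and>
    (\<forall>t\<ge>0. U t * V t = 1 \<and> V t * U t = 1)"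
proof -
  define K where "K = \<bar>L\<bar> + 1"
  have K: "0 < K" "\<And>t. 0 \<le> t \<Longrightarrow> norm (F t) \<le> K" using bound by (fastforce simp: K_def)+
  have "\<exists>V. V 0 = 1 \<and> (\<forall>t\<ge>0. (V has_vector_derivative F t * V t) (at t within {0..}))"
  proof (rule picard_lindeloef_unconstrained[where L = K])
    show "norm (F t * x - F t * y) \<le> K * norm (x - y)" if "0 \<le> t" for t x y
    proof -
      have "norm (F t * (x - y)) \<le> norm (F t) * norm (x - y)" by (rule norm_mult_ineq)
      also have "\<dots> \<le> K * norm (x - y)" using K that by (intro mult_right_mono) auto
      finally show ?thesis by (simp add: right_diff_distrib)
    qed
  qed (auto intro!: continuous_intros F K)
  then obtain V where V0: "V 0 = 1" and V: "\<And>t. 0 \<le> t \<Longrightarrow> (V has_vector_derivative F t * V t) (at t within {0..})"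
    by blast
  have "\<exists>U. U 0 = 1 \<and> (\<forall>t\<ge>0. (U has_vector_derivative - (U t * F t)) (at t within {0..}))"
  proof (rule picard_lindeloef_unconstrained[where L = K and f = "\<lambda>t x. - (x * F t)"])
    show "norm (- (x * F t) - - (y * F t)) \<le> K * norm (x - y)" if "0 \<le> t" for t x y
    proof -
      have "norm ((y - x) * F t) \<le> norm (y - x) * norm (F t)" by (rule norm_mult_ineq)
      also have "\<dots> \<le> norm (y - x) * K" using K that by (intro mult_left_mono) auto
      finally show ?thesis by (simp add: left_diff_distrib norm_minus_commute mult.commute)
    qed
  qed (auto intro!: continuous_intros F K)
  then obtain U where U0: "U 0 = 1" and U: "\<And>t. 0 \<le> t \<Longrightarrow> (U has_vector_derivative - (U t * F t)) (at t within {0..})"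
    by blast
  have "((\<lambda>t. U t * V t) has_vector_derivative 0) (at t within {0..})" if "0 \<le> t" for t
    by (rule has_vector_derivative_eq_rhs[OF has_vector_derivative_mult[OF U[OF that] V[OF that]]])
       (simp add: mult.assoc)
  then obtain c where c: "\<And>t. 0 \<le> t \<Longrightarrow> U t * V t = c"
    using has_vector_derivative_zero_constant[of "{0..}" "\<lambda>t. U t * V t"] by auto
  have UV: "U t * V t = 1" if "0 \<le> t" for t
    using c[OF that] c[of 0] by (simp add: U0 V0)
  define e where "e t = V t * U t - 1" for t
  have e': "(e has_vector_derivative F t * e t - e t * F t) (at t within {0..})" if "0 \<le> t" for t
    unfolding e_def
    by (rule has_vector_derivative_eq_rhs[OF has_vector_derivative_diff[OF
          has_vector_derivative_mult[OF V[OF that] U[OF that]] has_vector_derivative_const]])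
       (simp add: algebra_simps)
  have Vc: "continuous_on {0..} V" and Uc: "continuous_on {0..} U"
    using V U by (auto intro!: continuous_on_vector_derivative)
  have ec: "continuous_on {0..} e" unfolding e_def by (intro continuous_intros Vc Uc)
  have VU: "V t * U t = 1" if t: "0 \<le> t" for t
  proof -
    have sub: "continuous_on {0..s} g" if "continuous_on {0..} g" for g :: "real \<Rightarrow> bop" and s
      by (rule continuous_on_subset[OF that]) auto
    have "norm (e t) \<le> 2 * 0 * exp (2 * (2 * K) * t)"
    proof (rule gronwall[where \<phi> = "\<lambda>t. norm (e t)" and T = t])
      show "continuous_on {0..t} (\<lambda>t. norm (e t))" by (intro continuous_intros sub ec)
      fix s assume s: "s \<in> {0..t}"
      have "e s = e 0 + integral {0..s} (\<lambda>r. F r * e r - e r * F r)"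
        using s by (intro integral_vector_derivative_eq has_vector_derivative_within_subset[OF e']) auto
      then have "e s = integral {0..s} (\<lambda>r. F r * e r - e r * F r)" by (simp add: e_def V0 U0)
      then have "norm (e s) = norm (integral {0..s} (\<lambda>r. F r * e r - e r * F r))" by simp
      also have "\<dots> \<le> integral {0..s} (\<lambda>r. 2 * K * norm (e r))"
      proof (rule integral_norm_bound_integral)
        show "(\<lambda>r. F r * e r - e r * F r) integrable_on {0..s}"
          by (intro integrable_continuous_real continuous_intros sub ec F)
        show "(\<lambda>r. 2 * K * norm (e r)) integrable_on {0..s}"
          by (intro integrable_continuous_real continuous_intros sub ec)
        fix r assume r: "r \<in> {0..s}"
        have "norm (F r * e r) \<le> K * norm (e r)" "norm (e r * F r) \<le> norm (e r) * K"
          using r K by (auto intro!: order_trans[OF norm_mult_ineq] mult_right_mono mult_left_mono)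
        then show "norm (F r * e r - e r * F r) \<le> 2 * K * norm (e r)"
          using norm_triangle_ineq4[of "F r * e r" "e r * F r"] by (simp add: algebra_simps)
      qed
      finally show "norm (e s) \<le> 0 + 2 * K * integral {0..s} (\<lambda>t. norm (e t))" by simp
    qed (use K t in auto)
    then show ?thesis by (simp add: e_def)
  qed
  show ?thesis using V0 U0 V U UV VU by blast
qed

section \<open>The Riccati flow\<close>

text \<open>A solution of \<open>X' = X F + F\<^sup>* X + C\<close> with \<open>C \<ge> 0\<close> stays nonnegative: along any solution of
  \<open>\<psi>' = - F \<psi>\<close> the function \<open>\<langle>X \<psi>, \<psi>\<rangle>\<close> has derivative \<open>\<langle>C \<psi>, \<psi>\<rangle>\<close>, and \<open>\<psi>\<close> can be given any
  final value.\<close>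

lemma lyapunov_nonneg:
  fixes X F F' C :: "real \<Rightarrow> bop"
  assumes T: "0 \<le> T"
    and X: "\<And>t. t \<in> {0..T} \<Longrightarrow> (X has_vector_derivative X t * F t + F' t * X t + C t) (at t within {0..T})"
    and F: "continuous_on {0..T} F"
    and F': "\<And>t f g. t \<in> {0..T} \<Longrightarrow> (F' t \<odot> f) \<bullet> g = f \<bullet> (F t \<odot> g)"
    and C: "\<And>t f. t \<in> {0..T} \<Longrightarrow> 0 \<le> (C t \<odot> f) \<bullet> f"
    and X0: "\<And>f. 0 \<le> (X 0 \<odot> f) \<bullet> f"
  shows "0 \<le> (X T \<odot> f) \<bullet> f"
proof -
  have "bounded (F ` {0..T})"
    by (intro compact_imp_bounded compact_continuous_image F) simp
  then obtain L where L: "\<And>t. t \<in> {0..T} \<Longrightarrow> norm (F t) \<le> L"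
    unfolding bounded_iff by (metis imageI)
  have "\<exists>V U. V 0 = 1 \<and> U 0 = 1 \<and>
    (\<forall>t\<ge>0. (V has_vector_derivative - F (min t T) * V t) (at t within {0..})) \<and>
    (\<forall>t\<ge>0. (U has_vector_derivative - (U t * - F (min t T))) (at t within {0..})) \<and>
    (\<forall>t\<ge>0. U t * V t = 1 \<and> V t * U t = 1)"
  proof (rule evolution_operator[where L = L])
    show "continuous_on {0..} (\<lambda>t. - F (min t T))"
      using T by (intro continuous_on_minus continuous_on_compose2[OF F] continuous_intros) auto
  qed (use L T in auto)
  then obtain V U where V: "\<And>t. 0 \<le> t \<Longrightarrow> (V has_vector_derivative - F (min t T) * V t) (at t within {0..})"
    and VU: "V T * U T = 1"
    using T by blast
  define \<psi> where "\<psi> t = V t \<odot> U T \<odot> f" for t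
  have \<psi>: "(\<psi> has_vector_derivative - (F t \<odot> \<psi> t)) (at t within {0..T})" if "t \<in> {0..T}" for t
  proof -
    have "(V has_vector_derivative - F t * V t) (at t within {0..T})"
      using V[of t] that by (auto intro: has_vector_derivative_within_subset simp: min_absorb1)
    then show ?thesis unfolding \<psi>_def
      using bounded_linear.has_vector_derivative[OF bop.bounded_linear_left] by (force simp: bop.minus_left)
  qed
  have \<psi>T: "\<psi> T = f" using VU by (simp add: \<psi>_def bop_apply_mult[symmetric] del: bop_apply_mult)
  have "((\<lambda>t. (X t \<odot> \<psi> t) \<bullet> \<psi> t) has_vector_derivative (C t \<odot> \<psi> t) \<bullet> \<psi> t) (at t within {0..T})"
    if t: "t \<in> {0..T}" for t
  proof (rule has_vector_derivative_eq_rhs[OF bounded_bilinear.has_vector_derivative[OF bounded_bilinear_inner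
          bop.has_vector_derivative[OF X[OF t] \<psi>[OF t]] \<psi>[OF t]]])
    show "(X t \<odot> \<psi> t) \<bullet> - (F t \<odot> \<psi> t) + (X t \<odot> - (F t \<odot> \<psi> t) + (X t * F t + F' t * X t + C t) \<odot> \<psi> t) \<bullet> \<psi> t
        = (C t \<odot> \<psi> t) \<bullet> \<psi> t"
      using F'[OF t, of "X t \<odot> \<psi> t" "\<psi> t"]
      by (simp add: bop.add_left bop.minus_right inner_add_left)
  qed
  then have "((\<lambda>t. (C t \<odot> \<psi> t) \<bullet> \<psi> t) has_integral (X T \<odot> \<psi> T) \<bullet> \<psi> T - (X 0 \<odot> \<psi> 0) \<bullet> \<psi> 0) {0..T}"
    by (rule fundamental_theorem_of_calculus[OF T])
  then have "0 \<le> (X T \<odot> \<psi> T) \<bullet> \<psi> T - (X 0 \<odot> \<psi> 0) \<bullet> \<psi> 0"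
    by (rule has_integral_nonneg) (use C in auto)
  with X0[of "\<psi> 0"] \<psi>T show ?thesis by simp
qed

text \<open>The difference of two solutions solves a Lyapunov equation whose generator is symmetrised in the
  two solutions, so the Riccati flow is monotone in the initial value. The defect \<open>C\<close> admits
  subsolutions as comparison functions, in particular \<open>0\<close> with \<open>C = M\<close>.\<close>

lemma riccati_comparison:
  assumes A: "selfadj A" and G: "selfadj G" and T: "0 \<le> T"
    and X: "\<And>t. t \<in> {0..T} \<Longrightarrow> (X has_vector_derivative riccati A G M \<rho> (X t)) (at t within {0..T})"
    and Y: "\<And>t. t \<in> {0..T} \<Longrightarrow> (Y has_vector_derivative riccati A G M \<rho> (Y t) - C) (at t within {0..T})"
    and sX: "\<And>t. t \<in> {0..T} \<Longrightarrow> selfadj (X t)" and sY: "\<And>t. t \<in> {0..T} \<Longrightarrow> selfadj (Y t)"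
    and C: "psd C" and init: "psd (X 0 - Y 0)"
  shows "psd (X T - Y T)"
proof -
  \<comment> \<open>half of the quadratic term and half of the discount go to each side of the difference\<close>
  define F where "F t = A - (\<rho> / 2) *\<^sub>R 1 - (1 / 2) *\<^sub>R (G * (X t + Y t))" for t
  define F' where "F' t = A - (\<rho> / 2) *\<^sub>R 1 - (1 / 2) *\<^sub>R ((X t + Y t) * G)" for t
  have Xc: "continuous_on {0..T} X" by (rule continuous_on_vector_derivative[OF X])
  have Yc: "continuous_on {0..T} Y" by (rule continuous_on_vector_derivative[OF Y])
  have "0 \<le> ((X T - Y T) \<odot> f) \<bullet> f" for f
  proof (rule lyapunov_nonneg[where F = F and F' = F' and C = "\<lambda>_. C" and X = "\<lambda>t. X t - Y t", OF T])
    fix t assume t: "t \<in> {0..T}"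
    have "riccati A G M \<rho> (X t) - (riccati A G M \<rho> (Y t) - C) = (X t - Y t) * F t + F' t * (X t - Y t) + C"
    proof -
      have h: "2 *\<^sub>R (riccati A G M \<rho> (X t) - riccati A G M \<rho> (Y t))
          = 2 *\<^sub>R ((X t - Y t) * F t + F' t * (X t - Y t))"
      proof -
        have "\<rho> *\<^sub>R Z = (\<rho> / 2) *\<^sub>R Z + (\<rho> / 2) *\<^sub>R Z" for Z :: bop
          by (simp add: scaleR_add_left[symmetric])
        then show ?thesis
          unfolding riccati_def F_def F'_def by (simp add: algebra_simps scaleR_2)
      qed
      then have "riccati A G M \<rho> (X t) - riccati A G M \<rho> (Y t) = (X t - Y t) * F t + F' t * (X t - Y t)"
        by simp
      then show ?thesis by (simp add: algebra_simps)
    qed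
    then show "((\<lambda>t. X t - Y t) has_vector_derivative (X t - Y t) * F t + F' t * (X t - Y t) + C) (at t within {0..T})"
      using has_vector_derivative_diff[OF X[OF t] Y[OF t]] by (simp only:)
    show "(F' t \<odot> f) \<bullet> g = f \<bullet> (F t \<odot> g)" for f g
      using A G sX[OF t] sY[OF t]
      by (simp add: F_def F'_def bop.diff_left bop.scaleR_left bop.add_left bop.add_right inner_diff_left inner_diff_right
          inner_add_left inner_add_right selfadjD)
    show "0 \<le> (C \<odot> f) \<bullet> f" for f using C by (rule psd_nonneg)
  next
    show "continuous_on {0..T} F" unfolding F_def by (intro continuous_intros Xc Yc)
    show "0 \<le> ((X 0 - Y 0) \<odot> f) \<bullet> f" for f using init by (rule psd_nonneg)
  qed
  then show ?thesis
    using sX[of T] sY[of T] T by (simp add: psd_def inner_commute)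
qed

lemma psd_zero [simp]: "psd 0"
  by (simp add: psd_def bop.zero_left)

lemma psd_norm_mono: "psd X \<Longrightarrow> psd (S - X) \<Longrightarrow> norm X \<le> norm S"
proof (rule norm_le_of_form_le)
  fix f assume "psd (S - X)"
  then have "f \<bullet> (X \<odot> f) \<le> f \<bullet> (S \<odot> f)"
    using psd_nonneg(1)[of "S - X" f] by (simp add: bop.diff_left inner_diff_right)
  also have "\<dots> \<le> norm f * (norm S * norm f)"
    by (rule order_trans[OF norm_cauchy_schwarz]) (intro mult_left_mono norm_bop_apply norm_ge_zero)
  finally show "f \<bullet> (X \<odot> f) \<le> norm S * (norm f)\<^sup>2" by (simp add: power2_eq_square mult_ac)
qed simp_all

text \<open>The radial retraction onto a ball, used to truncate the quadratic nonlinearity.\<close>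

definition ball_retract :: "real \<Rightarrow> 'a::real_normed_vector \<Rightarrow> 'a" where
  "ball_retract c x = min 1 (c / norm x) *\<^sub>R x"

lemma ball_retract_id: "norm x \<le> c \<Longrightarrow> ball_retract c x = x"
  by (cases "x = 0") (simp_all add: ball_retract_def min_absorb1)

lemma norm_ball_retract: "0 \<le> c \<Longrightarrow> norm (ball_retract c x) \<le> c"
proof (cases "norm x \<le> c")
  case False
  moreover assume "0 \<le> c"
  ultimately show ?thesis by (simp add: ball_retract_def min_absorb2 divide_le_eq_1)
qed (simp add: ball_retract_id)

lemma ball_retract_outside: "c < norm x \<Longrightarrow> ball_retract c x = (c / norm x) *\<^sub>R x" if "0 \<le> c"
  using that by (simp add: ball_retract_def min_absorb2 divide_le_eq_1)

lemma ball_retract_lipschitz_ordered: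
  assumes c: "0 \<le> c" and le: "norm x \<le> norm y"
  shows "norm (ball_retract c x - ball_retract c y) \<le> 2 * norm (x - y)"
proof -
  have tri: "norm y - norm x \<le> norm (x - y)" by (metis norm_minus_commute norm_triangle_ineq2)
  consider "norm y \<le> c" | "norm x \<le> c" "c < norm y" | "c < norm x" using le by linarith
  then show ?thesis
  proof cases
    case 1
    then show ?thesis using le by (simp add: ball_retract_id)
  next
    case 2
    then have y0: "0 < norm y" using c by linarith
    have "y - (c / norm y) *\<^sub>R y = (1 - c / norm y) *\<^sub>R y" by (simp add: scaleR_diff_left)
    then have "norm (y - (c / norm y) *\<^sub>R y) = \<bar>1 - c / norm y\<bar> * norm y" by simp
    also have "\<dots> = norm y - c"
    proof -
      have "0 \<le> 1 - c / norm y" using 2 y0 by (simp add: divide_le_eq)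
      moreover have "(1 - c / norm y) * norm y = norm y - c" using y0 by (simp add: left_diff_distrib)
      ultimately show ?thesis by (simp only: abs_of_nonneg)
    qed
    finally have n: "norm (y - (c / norm y) *\<^sub>R y) = norm y - c" .
    have "norm (x - (c / norm y) *\<^sub>R y) \<le> norm (x - y) + norm (y - (c / norm y) *\<^sub>R y)"
      using norm_triangle_ineq[of "x - y" "y - (c / norm y) *\<^sub>R y"] by simp
    then show ?thesis using 2 n tri c by (simp add: ball_retract_id ball_retract_outside)
  next
    case 3
    then have x0: "0 < norm x" "0 < norm y" and y: "c < norm y" using c le by linarith+
    have e: "(c / norm x) *\<^sub>R x - (c / norm y) *\<^sub>R y
        = (c / norm x) *\<^sub>R (x - y) + (c / norm x - c / norm y) *\<^sub>R y"
      by (simp add: scaleR_diff_right scaleR_diff_left)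
    have "norm ((c / norm x - c / norm y) *\<^sub>R y) = (c / norm x) * (norm y - norm x)"
    proof -
      have "0 \<le> c / norm x - c / norm y" using x0 le c by (simp add: field_simps mult_left_mono)
      then show ?thesis using x0 by (simp add: field_simps)
    qed
    then have "norm ((c / norm x) *\<^sub>R x - (c / norm y) *\<^sub>R y)
        \<le> (c / norm x) * norm (x - y) + (c / norm x) * (norm y - norm x)"
      unfolding e using norm_triangle_ineq[of "(c / norm x) *\<^sub>R (x - y)" "(c / norm x - c / norm y) *\<^sub>R y"] c
      by simp
    also have "\<dots> \<le> 1 * norm (x - y) + 1 * norm (x - y)"
      using 3 x0 c le tri by (intro add_mono mult_mono) (auto simp: divide_le_eq_1)
    finally show ?thesis using 3 y c by (simp add: ball_retract_outside)
  qed
qed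

lemma ball_retract_lipschitz:
  "0 \<le> c \<Longrightarrow> norm (ball_retract c x - ball_retract c y) \<le> 2 * norm (x - y)"
  using ball_retract_lipschitz_ordered[of c x y] ball_retract_lipschitz_ordered[of c y x]
  by (cases "norm x \<le> norm y") (simp_all add: norm_minus_commute)

lemma riccati_lipschitz:
  assumes "norm X \<le> c" "norm Y \<le> c"
  shows "norm (riccati A G M \<rho> X - riccati A G M \<rho> Y) \<le> (2 * norm A + 2 * c * norm G + \<bar>\<rho>\<bar>) * norm (X - Y)"
proof -
  let ?D = "X - Y" and ?n = "norm (X - Y)"
  have c: "0 \<le> c" using assms(1) norm_ge_zero order_trans by blast
  have m: "norm (P * Q) \<le> a * b" if "norm P \<le> a" "norm Q \<le> b" for P Q :: bop and a b
    using that norm_mult_ineq[of P Q] mult_mono[of "norm P" a "norm Q" b] norm_ge_zero[of P]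
    by (smt (verit) norm_ge_zero)
  have "riccati A G M \<rho> X - riccati A G M \<rho> Y
      = ?D * A + A * ?D - (?D * (G * X) + Y * (G * ?D)) - \<rho> *\<^sub>R ?D"
    by (simp add: riccati_def algebra_simps)
  also have "norm \<dots> \<le> norm (?D * A) + norm (A * ?D) + (norm (?D * (G * X)) + norm (Y * (G * ?D))) + norm (\<rho> *\<^sub>R ?D)"
    by (intro order_trans[OF norm_triangle_ineq4] add_mono norm_triangle_ineq order_refl)
  also have "\<dots> \<le> ?n * norm A + norm A * ?n + (?n * (norm G * c) + c * (norm G * ?n)) + \<bar>\<rho>\<bar> * ?n"
    by (intro add_mono m assms order_refl) simp
  also have "\<dots> = (2 * norm A + 2 * c * norm G + \<bar>\<rho>\<bar>) * ?n" by (simp add: algebra_simps)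
  finally show ?thesis .
qed

lemma selfadj_riccati: "selfadj A \<Longrightarrow> selfadj G \<Longrightarrow> selfadj M \<Longrightarrow> selfadj X \<Longrightarrow> selfadj (riccati A G M \<rho> X)"
  by (simp add: riccati_def selfadj_def bop.add_left bop.diff_left bop.scaleR_left inner_simps)

lemma continuous_on_riccati [continuous_intros]:
  "continuous_on S X \<Longrightarrow> continuous_on S (\<lambda>t. riccati A G M \<rho> (X t))"
  unfolding riccati_def by (intro continuous_intros)

text \<open>The equation is truncated outside a ball to make it globally Lipschitz. While the solution stays
  in the ball, comparison with \<open>0\<close> and with the stationary solution \<open>S\<close> shows \<open>0 \<le> X \<le> S\<close>, so it
  stays in a smaller ball and the truncation is never active.\<close>

lemma riccati_flow_exists:
  assumes A: "selfadj A" and G: "psd G" and M: "psd M"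
    and S: "psd S" "riccati A G M \<rho> S = 0"
  shows "\<exists>X. X 0 = 0 \<and> (\<forall>t\<ge>0. (X has_vector_derivative riccati A G M \<rho> (X t)) (at t within {0..})) \<and>
    (\<forall>t\<ge>0. psd (X t))"
proof -
  \<comment> \<open>the margin 1 separates the bound by the norm of S from the truncation radius\<close>
  define c where "c = norm S + 1"
  have c: "0 < c" by (simp add: c_def add_nonneg_pos)
  define K where "K = 2 * (2 * norm A + 2 * c * norm G + \<bar>\<rho>\<bar>) + 1"
  have K: "0 < K" using c unfolding K_def by (intro add_nonneg_pos mult_nonneg_nonneg add_nonneg_nonneg) auto
  \<comment> \<open>self-adjointness as a family of linear constraints\<close>
  define \<Lambda> where "\<Lambda> = (\<lambda>(f, g) (X::bop). (X \<odot> f) \<bullet> g - f \<bullet> (X \<odot> g))"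
  have sel: "selfadj X \<longleftrightarrow> (\<forall>i. \<Lambda> i X = 0)" for X by (auto simp: selfadj_def \<Lambda>_def)
  have "\<exists>X. X 0 = 0 \<and> (\<forall>t\<ge>0. (X has_vector_derivative riccati A G M \<rho> (ball_retract c (X t))) (at t within {0..})) \<and>
    (\<forall>t\<ge>0. \<forall>i. \<Lambda> i (X t) = 0)"
  proof (rule picard_lindeloef[where L = K])
    fix y :: "real \<Rightarrow> bop" assume y: "continuous_on {0..} y"
    have "2-lipschitz_on UNIV (ball_retract c :: bop \<Rightarrow> bop)"
      using ball_retract_lipschitz[of c] c by (intro lipschitz_onI) (auto simp: dist_norm)
    then have "continuous_on UNIV (ball_retract c :: bop \<Rightarrow> bop)" by (rule lipschitz_on_continuous_on)
    then show "continuous_on {0..} (\<lambda>t. riccati A G M \<rho> (ball_retract c (y t)))"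
      using y by (intro continuous_intros continuous_on_compose2[OF _ y]) auto
  next
    fix x y :: bop
    have "norm (riccati A G M \<rho> (ball_retract c x) - riccati A G M \<rho> (ball_retract c y))
        \<le> (2 * norm A + 2 * c * norm G + \<bar>\<rho>\<bar>) * norm (ball_retract c x - ball_retract c y)"
      using c by (intro riccati_lipschitz norm_ball_retract) auto
    also have "\<dots> \<le> (2 * norm A + 2 * c * norm G + \<bar>\<rho>\<bar>) * (2 * norm (x - y))"
      using c by (intro mult_left_mono ball_retract_lipschitz) auto
    also have "\<dots> \<le> K * norm (x - y)" by (simp add: K_def algebra_simps)
    finally show "norm (riccati A G M \<rho> (ball_retract c x) - riccati A G M \<rho> (ball_retract c y)) \<le> K * norm (x - y)" .
  next
    fix x i assume "\<And>i. \<Lambda> i x = 0"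
    then have "selfadj x" using sel by blast
    then have "selfadj (riccati A G M \<rho> (ball_retract c x))"
      using A psd_selfadj[OF G] psd_selfadj[OF M] by (intro selfadj_riccati) (auto simp: ball_retract_def)
    then show "\<Lambda> i (riccati A G M \<rho> (ball_retract c x)) = 0" using sel by blast
  next
    show "bounded_linear (\<Lambda> i)" for i
      unfolding \<Lambda>_def by (cases i)
        (auto intro!: bounded_linear_sub bounded_linear_inner_left_comp bounded_linear_inner_right_comp
          bop.bounded_linear_left)
    show "\<Lambda> i 0 = 0" for i by (cases i) (simp add: \<Lambda>_def bop.zero_left)
  qed (rule K)
  then obtain X where X0: "X 0 = 0"
    and X: "\<And>t. 0 \<le> t \<Longrightarrow> (X has_vector_derivative riccati A G M \<rho> (ball_retract c (X t))) (at t within {0..})"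
    and sX: "\<And>t. 0 \<le> t \<Longrightarrow> selfadj (X t)"
    unfolding sel by blast
  have Xc: "continuous_on {0..} X" using X by (auto intro!: continuous_on_vector_derivative)
  have between: "psd (X T) \<and> psd (S - X T)" if T: "0 \<le> T" and inside: "\<And>t. t \<in> {0..T} \<Longrightarrow> norm (X t) \<le> c" for T
  proof
    have X': "(X has_vector_derivative riccati A G M \<rho> (X t)) (at t within {0..T})" if "t \<in> {0..T}" for t
      using X[of t] that inside[OF that] by (auto simp: ball_retract_id intro: has_vector_derivative_within_subset)
    have "psd (X T - 0)"
      by (rule riccati_comparison[where X = X and Y = "\<lambda>_. 0" and C = M, OF A psd_selfadj[OF G] T X'])
         (auto simp: sX M X0 riccati_def intro!: derivative_eq_intros)
    then show "psd (X T)" by simp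
    show "psd (S - X T)"
    proof (rule riccati_comparison[where X = "\<lambda>_. S" and Y = X and C = 0, OF A psd_selfadj[OF G] T])
      show "(X has_vector_derivative riccati A G M \<rho> (X t) - 0) (at t within {0..T})" if "t \<in> {0..T}" for t
        using X'[OF that] by simp
    qed (use S sX X0 in \<open>auto intro: psd_selfadj\<close>)
  qed
  have small: "norm (X t) \<le> c" if t: "0 \<le> t" for t
  proof (rule ccontr)
    assume out: "\<not> norm (X t) \<le> c"
    have nc: "continuous_on {0..s} (\<lambda>t. norm (X t))" for s
      by (intro continuous_on_norm continuous_on_subset[OF Xc]) auto
    have ivt: "\<exists>r. 0 \<le> r \<and> r \<le> s \<and> norm (X r) = c" if "0 \<le> s" "c \<le> norm (X s)" for s
      using IVT'[of "\<lambda>t. norm (X t)" 0 c s] that nc c X0 by auto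
    define E where "E = {s \<in> {0..t}. norm (X s) = c}"
    have "E \<noteq> {}" using ivt[OF t] out by (auto simp: E_def)
    moreover have "compact E"
    proof -
      have "closed ({0..t} \<inter> (\<lambda>t. norm (X t)) -` {c})"
        using nc[of t] by (intro continuous_closed_preimage) auto
      moreover have "E = {0..t} \<inter> ({0..t} \<inter> (\<lambda>t. norm (X t)) -` {c})" by (auto simp: E_def)
      ultimately show ?thesis by (metis compact_Icc compact_Int_closed)
    qed
    \<comment> \<open>the first time at which the norm reaches the truncation radius\<close>
    ultimately obtain t0 where t0: "t0 \<in> E" "\<And>s. s \<in> E \<Longrightarrow> t0 \<le> s"
      using compact_attains_inf[of E] by auto
    have "norm (X s) \<le> c" if "s \<in> {0..t0}" for s
    proof (rule ccontr)
      assume "\<not> norm (X s) \<le> c"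
      then have "\<exists>r. 0 \<le> r \<and> r \<le> s \<and> norm (X r) = c" using ivt[of s] that by simp
      then obtain r where r: "0 \<le> r" "r \<le> s" "norm (X r) = c" by blast
      then have "r \<in> E" using that t0(1) by (auto simp: E_def)
      then have "s = r" using t0(2)[of r] r that by auto
      with r \<open>\<not> norm (X s) \<le> c\<close> show False by simp
    qed
    then have "psd (X t0) \<and> psd (S - X t0)" using t0(1) by (intro between) (auto simp: E_def)
    then have "norm (X t0) \<le> norm S" using psd_norm_mono by blast
    with t0(1) show False by (simp add: E_def c_def)
  qed
  have "(X has_vector_derivative riccati A G M \<rho> (X t)) (at t within {0..})" if "0 \<le> t" for t
    using X[OF that] ball_retract_id[OF small[OF that]] by simp
  moreover have "psd (X t)" if "0 \<le> t" for t
    using between[OF that] small by simp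
  ultimately show ?thesis using X0 by (intro exI[of _ X]) simp
qed

lemma psd_strong_limit:
  assumes Y: "\<And>n. psd (Y n)" and lim: "\<And>f. (\<lambda>n. Y n \<odot> f) \<longlonglongrightarrow> Z \<odot> f"
  shows "psd Z"
  unfolding psd_def selfadj_def
proof (intro conjI allI)
  fix f g
  have "(\<lambda>n. (Y n \<odot> f) \<bullet> g) \<longlonglongrightarrow> (Z \<odot> f) \<bullet> g" "(\<lambda>n. f \<bullet> (Y n \<odot> g)) \<longlonglongrightarrow> f \<bullet> (Z \<odot> g)"
    by (intro tendsto_intros lim)+
  moreover have "(Y n \<odot> f) \<bullet> g = f \<bullet> (Y n \<odot> g)" for n
    using Y by (simp add: psd_def selfadj_def)
  ultimately show "(Z \<odot> f) \<bullet> g = f \<bullet> (Z \<odot> g)" using LIMSEQ_unique by simp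
  have "(\<lambda>n. f \<bullet> (Y n \<odot> f)) \<longlonglongrightarrow> f \<bullet> (Z \<odot> f)" by (intro tendsto_intros lim)
  then show "0 \<le> f \<bullet> (Z \<odot> f)"
    by (rule LIMSEQ_le_const) (use Y psd_nonneg in blast)
qed

lemma strong_limit_exists:
  fixes Y :: "nat \<Rightarrow> bop"
  assumes conv: "\<And>f. convergent (\<lambda>n. Y n \<odot> f)" and bound: "\<And>n. norm (Y n) \<le> c"
  shows "\<exists>Z. \<forall>f. (\<lambda>n. Y n \<odot> f) \<longlonglongrightarrow> Z \<odot> f"
proof -
  define z where "z f = lim (\<lambda>n. Y n \<odot> f)" for f
  have z: "(\<lambda>n. Y n \<odot> f) \<longlonglongrightarrow> z f" for f
    using conv[of f] by (simp add: z_def convergent_LIMSEQ_iff)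
  have "bounded_linear z"
  proof (rule bounded_linear_intro[where K = c])
    show "z (f + g) = z f + z g" for f g
      using LIMSEQ_unique[OF z[of "f + g"]] tendsto_add[OF z[of f] z[of g]] by (simp add: bop.add_right)
    show "z (r *\<^sub>R f) = r *\<^sub>R z f" for r f
      using LIMSEQ_unique[OF z[of "r *\<^sub>R f"]] tendsto_scaleR[OF tendsto_const z[of f]] by (simp add: bop.scaleR_right)
    show "norm (z f) \<le> norm f * c" for f
    proof (rule LIMSEQ_le_const2[OF tendsto_norm[OF z]], intro exI allI impI)
      fix n
      show "norm (Y n \<odot> f) \<le> norm f * c"
        using norm_bop_apply[of "Y n" f] mult_right_mono[OF bound[of n], of "norm f"]
        by (simp add: mult.commute)
    qed
  qed
  then have "Bop (Blinfun z) \<odot> f = z f" for f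
    by (simp add: Bop_apply bounded_linear_Blinfun_apply)
  with z show ?thesis by (intro exI[of _ "Bop (Blinfun z)"]) simp
qed

text \<open>The minimal solution of the algebraic equation is the strong limit of the flow started at \<open>0\<close>:
  the flow increases, lies below every positive stationary solution, and the quadratic forms control
  the increments, \<open>\<parallel>(X t - X s) f\<parallel>\<^sup>2 \<le> c \<langle>(X t - X s) f, f\<rangle>\<close>. The limit is stationary because the
  increments over unit time steps tend to \<open>0\<close>, while the mean value theorem equates them with values of
  the right hand side at late times.\<close>

proposition riccati_flow_converges:
  assumes A: "selfadj A" and G: "psd G" and M: "psd M"
    and S: "psd S" "riccati A G M \<rho> S = 0"
  obtains X Sinf where "X 0 = 0"
    and "\<And>t. 0 \<le> t \<Longrightarrow> (X has_vector_derivative riccati A G M \<rho> (X t)) (at t within {0..})"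
    and "\<And>t. 0 \<le> t \<Longrightarrow> psd (X t)" and "\<And>t. 0 \<le> t \<Longrightarrow> norm (X t) \<le> norm S"
    and "psd Sinf" and "riccati A G M \<rho> Sinf = 0"
    and "\<And>S'. psd S' \<Longrightarrow> riccati A G M \<rho> S' = 0 \<Longrightarrow> psd (S' - Sinf)"
    and "\<And>f. ((\<lambda>t. X t \<odot> f) \<longlongrightarrow> Sinf \<odot> f) at_top"
proof -
  obtain X where X0: "X 0 = 0"
    and X: "\<And>t. 0 \<le> t \<Longrightarrow> (X has_vector_derivative riccati A G M \<rho> (X t)) (at t within {0..})"
    and pX: "\<And>t. 0 \<le> t \<Longrightarrow> psd (X t)"
    using riccati_flow_exists[OF A G M S] by blast
  have X': "(X has_vector_derivative riccati A G M \<rho> (X t)) (at t within {0..T})" if "t \<in> {0..T}" for t T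
    using X[of t] that by (auto intro: has_vector_derivative_within_subset)
  have below: "psd (S' - X T)" if "psd S'" "riccati A G M \<rho> S' = 0" "0 \<le> T" for S' T
  proof (rule riccati_comparison[where X = "\<lambda>_. S'" and Y = X and C = 0, OF A psd_selfadj[OF G] that(3)])
    show "(X has_vector_derivative riccati A G M \<rho> (X t) - 0) (at t within {0..T})" if "t \<in> {0..T}" for t
      using X'[OF that] by simp
  qed (use that pX X0 psd_selfadj in auto)
  \<comment> \<open>the flow shifted in time solves the same equation and starts above 0\<close>
  have mono: "psd (X t - X s)" if st: "0 \<le> s" "s \<le> t" for s t
  proof -
    define h where "h = t - s"
    have h: "0 \<le> h" using st by (simp add: h_def)
    have "psd (X (s + h) - X s)"
    proof (rule riccati_comparison[where X = "\<lambda>r. X (r + h)" and Y = X and C = 0, OF A psd_selfadj[OF G] st(1)])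
      fix r assume r: "r \<in> {0..s}"
      show "(X has_vector_derivative riccati A G M \<rho> (X r) - 0) (at r within {0..s})"
        using X'[OF r] by simp
      have "(X has_vector_derivative riccati A G M \<rho> (X (r + h))) (at (r + h) within (\<lambda>r. r + h) ` {0..s})"
        using r h by (intro has_vector_derivative_within_subset[OF X]) auto
      moreover have "((\<lambda>r. r + h) has_vector_derivative 1) (at r within {0..s})"
        by (auto intro!: derivative_eq_intros)
      ultimately show "((\<lambda>r. X (r + h)) has_vector_derivative riccati A G M \<rho> (X (r + h))) (at r within {0..s})"
        using vector_diff_chain_within[of "\<lambda>r. r + h" 1 r "{0..s}" X] by (simp add: o_def)
      show "selfadj (X (r + h))" "selfadj (X r)"
        using r h by (auto intro!: psd_selfadj pX)
    qed (use X0 pX[OF h] in auto)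
    then show ?thesis by (simp add: h_def)
  qed
  have nX: "norm (X t) \<le> norm S" if "0 \<le> t" for t
    using psd_norm_mono[OF pX below[OF S]] that by simp
  define q where "q f t = (X t \<odot> f) \<bullet> f" for f t
  have incr: "(norm (X t \<odot> f - X s \<odot> f))\<^sup>2 \<le> norm S * (q f t - q f s)" if st: "0 \<le> s" "s \<le> t" for s t f
  proof -
    have "psd (S - (X t - X s))"
      using psd_add[OF below[OF S] pX, of t s] st by (simp add: algebra_simps)
    then have n: "norm (X t - X s) \<le> norm S" by (rule psd_norm_mono[OF mono[OF st]])
    have "(norm ((X t - X s) \<odot> f))\<^sup>2 \<le> norm (X t - X s) * (((X t - X s) \<odot> f) \<bullet> f)"
      by (rule psd_norm_apply_le[OF mono[OF st]])
    also have "\<dots> \<le> norm S * (((X t - X s) \<odot> f) \<bullet> f)"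
      by (rule mult_right_mono[OF n psd_nonneg(2)[OF mono[OF st]]])
    finally show ?thesis by (simp add: bop.diff_left inner_diff_left q_def)
  qed
  have qmono: "q f s \<le> q f t" if "0 \<le> s" "s \<le> t" for s t f
    using psd_nonneg(2)[OF mono[OF that], of f] by (simp add: q_def bop.diff_left inner_diff_left)
  have qbound: "q f t \<le> norm S * (norm f)\<^sup>2" if "0 \<le> t" for t f
  proof -
    have "q f t \<le> norm (X t \<odot> f) * norm f" unfolding q_def by (rule norm_cauchy_schwarz)
    also have "\<dots> \<le> (norm S * norm f) * norm f"
      using nX[OF that] by (intro mult_right_mono order_trans[OF norm_bop_apply]) auto
    finally show ?thesis by (simp add: power2_eq_square mult.assoc)
  qed
  have qlim: "\<exists>l. (\<lambda>n. q f (real n)) \<longlonglongrightarrow> l \<and> (\<forall>t\<ge>0. q f t \<le> l)" for f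
  proof -
    have "convergent (\<lambda>n. q f (real n))"
    proof (rule Bseq_mono_convergent)
      have "norm (q f (real n)) \<le> norm S * (norm f)\<^sup>2" for n
        using qbound[of "real n" f] psd_nonneg(2)[OF pX[of "real n"], of f] by (simp add: q_def)
      then show "Bseq (\<lambda>n. q f (real n))" by (rule BseqI')
      show "\<forall>m n. m \<le> n \<longrightarrow> q f (real m) \<le> q f (real n)" by (auto intro: qmono)
    qed
    then obtain l where l: "(\<lambda>n. q f (real n)) \<longlonglongrightarrow> l" by (auto simp: convergent_def)
    moreover have "q f t \<le> l" if "0 \<le> t" for t
    proof (rule LIMSEQ_le_const[OF l])
      show "\<exists>N. \<forall>n\<ge>N. q f t \<le> q f (real n)"
      proof (intro exI allI impI)
        fix n assume "nat \<lceil>t\<rceil> \<le> n"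
        then show "q f t \<le> q f (real n)" using that by (intro qmono) linarith+
      qed
    qed
    ultimately show ?thesis by blast
  qed
  have cauchy: "\<exists>m::nat. \<forall>t\<ge>real m. norm (X t \<odot> f - X (real m) \<odot> f) < e" if "0 < e" for e f
  proof -
    obtain l where l: "(\<lambda>n. q f (real n)) \<longlonglongrightarrow> l" "\<And>t. 0 \<le> t \<Longrightarrow> q f t \<le> l" using qlim by blast
    have "(\<lambda>n. norm S * (l - q f (real n))) \<longlonglongrightarrow> norm S * (l - l)" by (intro tendsto_intros l)
    then have "\<forall>\<^sub>F n in sequentially. norm S * (l - q f (real n)) < e\<^sup>2"
      using that by (intro order_tendstoD) auto
    then obtain m where m: "norm S * (l - q f (real m)) < e\<^sup>2"
      by (auto simp: eventually_sequentially)
    have "norm (X t \<odot> f - X (real m) \<odot> f) < e" if "real m \<le> t" for t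
    proof -
      have "(norm (X t \<odot> f - X (real m) \<odot> f))\<^sup>2 \<le> norm S * (q f t - q f (real m))"
        by (rule incr) (use that in auto)
      also have "\<dots> \<le> norm S * (l - q f (real m))"
        using l(2)[of t] that by (intro mult_left_mono) auto
      finally have "(norm (X t \<odot> f - X (real m) \<odot> f))\<^sup>2 < e\<^sup>2" using m by simp
      then show ?thesis using \<open>0 < e\<close> by (intro power2_less_imp_less[of _ e]) auto
    qed
    then show ?thesis by blast
  qed
  have "convergent (\<lambda>n. X (real n) \<odot> f)" for f
  proof -
    have "Cauchy (\<lambda>n. X (real n) \<odot> f)"
    proof (rule CauchyI)
      fix e :: real assume "0 < e"
      then obtain m :: nat where m: "\<And>t. real m \<le> t \<Longrightarrow> norm (X t \<odot> f - X (real m) \<odot> f) < e / 2"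
        using cauchy[of "e / 2"] by auto
      show "\<exists>M. \<forall>i\<ge>M. \<forall>j\<ge>M. norm (X (real i) \<odot> f - X (real j) \<odot> f) < e"
      proof (intro exI allI impI)
        fix i j assume "m \<le> i" "m \<le> j"
        then show "norm (X (real i) \<odot> f - X (real j) \<odot> f) < e"
          using m[of "real i"] m[of "real j"]
            norm_triangle_ineq4[of "X (real i) \<odot> f - X (real m) \<odot> f" "X (real j) \<odot> f - X (real m) \<odot> f"]
          by simp
      qed
    qed
    then show ?thesis by (rule Cauchy_convergent)
  qed
  then obtain Z where Z: "\<And>f. (\<lambda>n. X (real n) \<odot> f) \<longlonglongrightarrow> Z \<odot> f"
    using strong_limit_exists[of "\<lambda>n. X (real n)" "norm S"] nX by auto
  have lim: "((\<lambda>t. X t \<odot> f) \<longlongrightarrow> Z \<odot> f) at_top" for f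
  proof (rule tendstoI)
    fix e :: real assume "0 < e"
    then obtain m :: nat where m: "\<And>t. real m \<le> t \<Longrightarrow> norm (X t \<odot> f - X (real m) \<odot> f) < e / 2"
      using cauchy[of "e / 2"] by auto
    have Zm: "norm (Z \<odot> f - X (real m) \<odot> f) \<le> e / 2"
    proof (rule LIMSEQ_le_const2[OF tendsto_norm[OF tendsto_diff[OF Z tendsto_const]]])
      show "\<exists>N. \<forall>n\<ge>N. norm (X (real n) \<odot> f - X (real m) \<odot> f) \<le> e / 2"
        using m by (intro exI[of _ m]) (simp add: less_imp_le)
    qed
    show "\<forall>\<^sub>F t in at_top. dist (X t \<odot> f) (Z \<odot> f) < e"
      using eventually_ge_at_top[of "real m"]
    proof eventually_elim
      case (elim t)
      show ?case
        using m[OF elim] Zm norm_triangle_ineq4[of "X t \<odot> f - X (real m) \<odot> f" "Z \<odot> f - X (real m) \<odot> f"]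
        by (simp add: dist_norm)
    qed
  qed
  have pZ: "psd Z" by (rule psd_strong_limit[OF _ Z]) (simp add: pX)
  have minimal: "psd (S' - Z)" if "psd S'" "riccati A G M \<rho> S' = 0" for S'
  proof (rule psd_strong_limit)
    show "psd (S' - X (real n))" for n using below[OF that] by simp
    show "(\<lambda>n. (S' - X (real n)) \<odot> f) \<longlonglongrightarrow> (S' - Z) \<odot> f" for f
      unfolding bop.diff_left by (intro tendsto_intros Z)
  qed
  have "(riccati A G M \<rho> Z \<odot> f) \<bullet> g = (0 \<odot> f) \<bullet> g" for f g
  proof -
    define \<phi> where "\<phi> t = (X t \<odot> f) \<bullet> g" for t
    define \<phi>' where "\<phi>' t = (riccati A G M \<rho> (X t) \<odot> f) \<bullet> g" for t
    have expand: "(riccati A G M \<rho> Y \<odot> f) \<bullet> g = (Y \<odot> A \<odot> f) \<bullet> g + (A \<odot> Y \<odot> f) \<bullet> g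
        - (G \<odot> Y \<odot> f) \<bullet> (Y \<odot> g) + (M \<odot> f) \<bullet> g - \<rho> * ((Y \<odot> f) \<bullet> g)" if "psd Y" for Y
      using selfadjD[OF psd_selfadj[OF that], of "G \<odot> Y \<odot> f" g]
      by (simp add: riccati_def bop.add_left bop.diff_left bop.scaleR_left inner_simps)
    have at: "(\<phi> has_real_derivative \<phi>' t) (at t)" if t: "0 < t" for t
    proof -
      have "at t within {0..} = at t" using t by (intro at_within_interior) auto
      then have "(X has_vector_derivative riccati A G M \<rho> (X t)) (at t)" using X[of t] t by simp
      then have "((\<lambda>t. X t \<odot> f) has_vector_derivative riccati A G M \<rho> (X t) \<odot> f) (at t)"
        by (rule bounded_linear.has_vector_derivative[OF bop.bounded_linear_left])
      then have "((\<lambda>t. (X t \<odot> f) \<bullet> g) has_vector_derivative (riccati A G M \<rho> (X t) \<odot> f) \<bullet> g) (at t)"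
        by (rule bounded_linear.has_vector_derivative[OF bounded_linear_inner_left])
      then show ?thesis
        unfolding \<phi>_def[abs_def] \<phi>'_def has_real_derivative_iff_has_vector_derivative .
    qed
    have "\<exists>\<xi>>real n + 1. \<phi> (real n + 2) - \<phi> (real n + 1) = \<phi>' \<xi>" for n
    proof -
      have "\<exists>z. real n + 1 < z \<and> z < real n + 2 \<and> \<phi> (real n + 2) - \<phi> (real n + 1) = (real n + 2 - (real n + 1)) * \<phi>' z"
        by (rule MVT2) (auto intro: at)
      then show ?thesis by auto
    qed
    then obtain \<xi> where \<xi>: "\<And>n. real n + 1 < \<xi> n" "\<And>n. \<phi> (real n + 2) - \<phi> (real n + 1) = \<phi>' (\<xi> n)"
      by metis
    have \<xi>top: "filterlim \<xi> at_top sequentially"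
      by (rule filterlim_at_top_mono[OF filterlim_real_sequentially])
         (use \<xi>(1) in \<open>intro always_eventually allI, smt (verit)\<close>)
    have L: "(\<lambda>n. X (\<xi> n) \<odot> u) \<longlonglongrightarrow> Z \<odot> u" for u
      by (rule filterlim_compose[OF lim \<xi>top])
    have "(\<lambda>n. \<phi>' (\<xi> n)) \<longlonglongrightarrow> (riccati A G M \<rho> Z \<odot> f) \<bullet> g"
    proof -
      have pos: "psd (X (\<xi> n))" for n using \<xi>(1)[of n] by (intro pX) linarith
      show ?thesis
        unfolding \<phi>'_def expand[OF pos] expand[OF pZ]
        by (intro tendsto_intros L bop.tendsto)
    qed
    moreover have "(\<lambda>n. \<phi> (real n + 2) - \<phi> (real n + 1)) \<longlonglongrightarrow> (Z \<odot> f) \<bullet> g - (Z \<odot> f) \<bullet> g"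
    proof (intro tendsto_diff)
      have "filterlim (\<lambda>n. real n + c) at_top sequentially" for c
        by (rule filterlim_tendsto_add_at_top[OF tendsto_const filterlim_real_sequentially, THEN filterlim_cong[THEN iffD1, rotated -1]])
           auto
      then have sh: "(\<lambda>n. X (real n + c) \<odot> f) \<longlonglongrightarrow> Z \<odot> f" for c
        by (rule filterlim_compose[OF lim])
      show "(\<lambda>n. \<phi> (real n + 2)) \<longlonglongrightarrow> (Z \<odot> f) \<bullet> g" "(\<lambda>n. \<phi> (real n + 1)) \<longlonglongrightarrow> (Z \<odot> f) \<bullet> g"
        unfolding \<phi>_def by (intro tendsto_inner tendsto_const sh)+
    qed
    ultimately show ?thesis using \<xi>(2) LIMSEQ_unique by (simp add: bop.zero_left)
  qed
  then have "riccati A G M \<rho> Z = 0" by (simp add: bop_eq_iff_inner)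
  then show thesis using that[OF X0 X pX nX pZ _ minimal lim] by blast
qed

section \<open>Dyadic step functions\<close>

text \<open>The dyadic intervals of length \<open>1/2\<^sup>n\<close> give a nested family of finite orthogonal systems. The projections
  onto their spans serve as coordinates in which the entries of a kernel are integrals over squares.\<close>

definition cutoff :: "real \<Rightarrow> L2" where "cutoff d = L2_class (indicator {..<d})"

definition dyadic_step :: "nat \<Rightarrow> nat \<Rightarrow> L2" where
  "dyadic_step n i = cutoff (real (Suc i) / 2 ^ n) - cutoff (real i / 2 ^ n)"

text \<open>The factor \<open>2\<^sup>n\<close> normalises the steps, so this is the orthogonal projection onto the functions that are
  constant on the dyadic intervals.\<close>

definition dyadic_proj :: "nat \<Rightarrow> L2 \<Rightarrow> L2" where
  "dyadic_proj n f = (\<Sum>i<2 ^ n. (2 ^ n * (f \<bullet> dyadic_step n i)) *\<^sub>R dyadic_step n i)"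

lemma square_integrable_lessThan: "square_integrable (indicator {..<d})"
  by (rule square_integrable_indicator) simp

lemma integral_lessThan:
  assumes "0 \<le> d" "d \<le> 1"
  shows "(LINT x|unit_interval. indicator {..<d} x) = d"
proof -
  have "(LINT x|unit_interval. indicator {..<d} x :: real) = (LINT x|lborel. indicator {0..<d} x)"
  proof -
    have "indicator {0..1} x *\<^sub>R indicator {..<d} x = (indicator {0..<d} x :: real)" for x
      using assms by (auto simp: indicator_def)
    then show ?thesis by (subst integral_restrict_space) simp_all
  qed
  also have "\<dots> = d" using assms by simp
  finally show ?thesis .
qed

lemma cutoff_inner:
  assumes "0 \<le> d" "d \<le> 1" "0 \<le> d'" "d' \<le> 1"
  shows "cutoff d \<bullet> cutoff d' = min d d'"
proof -
  have "cutoff d \<bullet> cutoff d' = (LINT x|unit_interval. indicator {..<d} x * indicator {..<d'} x)"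
    unfolding cutoff_def by (intro inner_L2_class square_integrable_lessThan)
  also have "\<dots> = (LINT x|unit_interval. indicator {..<min d d'} x)"
    by (intro Bochner_Integration.integral_cong) (auto simp: indicator_def)
  also have "\<dots> = min d d'" using assms by (intro integral_lessThan) auto
  finally show ?thesis .
qed

lemma dyadic_step_inner:
  assumes "i < 2 ^ n" "j < 2 ^ n"
  shows "dyadic_step n i \<bullet> dyadic_step n j = (if i = j then 1 / 2 ^ n else 0)"
proof -
  have b: "0 \<le> real k / 2 ^ n" "real k / 2 ^ n \<le> 1" if "k \<le> 2 ^ n" for k
  proof -
    have "real k \<le> real (2 ^ n)" using that by (rule of_nat_mono)
    then show "real k / 2 ^ n \<le> 1" by (simp add: divide_le_eq)
  qed simp
  have c: "cutoff (real k / 2 ^ n) \<bullet> cutoff (real l / 2 ^ n) = real (min k l) / 2 ^ n"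
    if "k \<le> 2 ^ n" "l \<le> 2 ^ n" for k l
    using cutoff_inner[OF b[OF that(1)] b[OF that(2)]] by (simp add: min_def divide_le_cancel)
  show ?thesis
    using assms unfolding dyadic_step_def inner_diff_left inner_diff_right
    by (cases i j rule: linorder_cases)
       (simp_all only: c Suc_leI less_imp_le, auto simp: min_def add_divide_distrib le_Suc_eq)
qed

lemma dyadic_step_refine:
  "dyadic_step n i = dyadic_step (Suc n) (2 * i) + dyadic_step (Suc n) (2 * i + 1)"
proof -
  have a: "real (2 * i) / 2 ^ Suc n = real i / 2 ^ n" by simp
  have b: "real (Suc (2 * i + 1)) / 2 ^ Suc n = real (Suc i) / 2 ^ n" by (simp add: field_simps)
  have c: "real (2 * i + 1) = real (Suc (2 * i))" by simp
  show ?thesis unfolding dyadic_step_def a b c by simp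
qed

lemma dyadic_proj_linear:
  "dyadic_proj n (f + g) = dyadic_proj n f + dyadic_proj n g"
  "dyadic_proj n (c *\<^sub>R f) = c *\<^sub>R dyadic_proj n f"
  by (simp_all add: dyadic_proj_def inner_add_left distrib_left scaleR_add_left sum.distrib
      scaleR_sum_right mult_ac)

lemma dyadic_proj_diff: "dyadic_proj n (f - g) = dyadic_proj n f - dyadic_proj n g"
  using dyadic_proj_linear(1)[of n f "- 1 *\<^sub>R g"] dyadic_proj_linear(2)[of n "- 1" g] by simp

lemma dyadic_proj_sum: "dyadic_proj n (\<Sum>i\<in>I. f i) = (\<Sum>i\<in>I. dyadic_proj n (f i))"
  by (induction I rule: infinite_finite_induct)
     (simp_all add: dyadic_proj_linear, simp_all add: dyadic_proj_def)

lemma dyadic_proj_inner: "dyadic_proj n f \<bullet> g = (\<Sum>i<2 ^ n. 2 ^ n * (f \<bullet> dyadic_step n i) * (g \<bullet> dyadic_step n i))"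
  by (simp add: dyadic_proj_def inner_sum_left inner_commute[of g])

lemma dyadic_proj_selfadj: "dyadic_proj n f \<bullet> g = f \<bullet> dyadic_proj n g"
  by (simp add: dyadic_proj_inner inner_commute[of f "dyadic_proj n g"] mult_ac)

lemma dyadic_proj_step: "i < 2 ^ n \<Longrightarrow> dyadic_proj n (dyadic_step n i) = dyadic_step n i"
proof -
  assume i: "i < 2 ^ n"
  have "dyadic_proj n (dyadic_step n i) = (\<Sum>j<2 ^ n. if j = i then dyadic_step n j else 0)"
    unfolding dyadic_proj_def using i by (intro sum.cong) (auto simp: dyadic_step_inner)
  then show ?thesis using i by simp
qed

lemma dyadic_proj_Suc: "dyadic_proj (Suc n) (dyadic_proj n f) = dyadic_proj n f"
proof -
  have "dyadic_proj (Suc n) (dyadic_step n i) = dyadic_step n i" if "i < 2 ^ n" for i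
    using that unfolding dyadic_step_refine[of n i] dyadic_proj_linear
    by (simp add: dyadic_proj_step)
  then show ?thesis
    by (simp add: dyadic_proj_def[of n f] dyadic_proj_sum dyadic_proj_linear)
qed

lemma dyadic_proj_nested:
  assumes "m \<le> n"
  shows "dyadic_proj n (dyadic_proj m f) = dyadic_proj m f" "dyadic_proj m (dyadic_proj n f) = dyadic_proj m f"
proof -
  have idem: "dyadic_proj k (dyadic_proj k f) = dyadic_proj k f" for k f
    by (simp add: dyadic_proj_def[of k f] dyadic_proj_sum dyadic_proj_linear dyadic_proj_step)
  show 1: "dyadic_proj n (dyadic_proj m f) = dyadic_proj m f" for f
    using assms
  proof (induction n rule: dec_induct)
    case (step n)
    then show ?case using dyadic_proj_Suc[of n "dyadic_proj m f"] by simp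
  qed (rule idem)
  have "dyadic_proj m (dyadic_proj n f) \<bullet> g = dyadic_proj m f \<bullet> g" for g
    by (simp add: dyadic_proj_selfadj 1)
  then show "dyadic_proj m (dyadic_proj n f) = dyadic_proj m f"
    by (metis inner_commute vector_eq_ldot)
qed

lemma dyadic_proj_norm:
  "(norm (dyadic_proj n f))\<^sup>2 = (\<Sum>i<2 ^ n. 2 ^ n * (f \<bullet> dyadic_step n i)\<^sup>2)"
  "norm (dyadic_proj n f) \<le> norm f"
proof -
  have 1: "(norm (dyadic_proj n f))\<^sup>2 = dyadic_proj n f \<bullet> f"
    using dyadic_proj_nested(1)[of n n f] dyadic_proj_selfadj[of n "dyadic_proj n f" f]
    by (simp add: power2_norm_eq_inner)
  then show "(norm (dyadic_proj n f))\<^sup>2 = (\<Sum>i<2 ^ n. 2 ^ n * (f \<bullet> dyadic_step n i)\<^sup>2)"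
    by (simp add: dyadic_proj_inner power2_eq_square mult_ac)
  have "norm (dyadic_proj n f) * norm (dyadic_proj n f) \<le> norm (dyadic_proj n f) * norm f"
    using 1 norm_cauchy_schwarz[of "dyadic_proj n f" f] by (simp add: power2_eq_square)
  then show "norm (dyadic_proj n f) \<le> norm f"
    by (cases "norm (dyadic_proj n f) = 0") (auto simp: mult_le_cancel_left)
qed

text \<open>The initial segments generate the Borel sets and are closed under intersection, so vanishing of the
  integral extends from them to all Borel sets.\<close>

lemma AE_zero_of_initial_segments:
  fixes u :: "real \<Rightarrow> real"
  assumes u: "integrable unit_interval u"
    and seg: "\<And>a. (LINT x|unit_interval. indicator {..<a} x * u x) = 0"
  shows "AE x in unit_interval. u x = 0"
proof -
  have um: "u \<in> borel_measurable unit_interval" using u by simp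
  have ind: "integrable unit_interval (\<lambda>x. indicator B x * u x)" if "B \<in> sets borel" for B
  proof (rule Bochner_Integration.integrable_bound[OF u])
    have "(indicator B :: real \<Rightarrow> real) \<in> borel_measurable unit_interval"
      using square_integrable_indicator[OF that] by (simp add: square_integrable_def)
    then show "(\<lambda>x. indicator B x * u x) \<in> borel_measurable unit_interval"
      using um by measurable
  qed (auto simp: indicator_def)
  have all: "(LINT x|unit_interval. u x) = 0"
    using seg[of 2] by (subst Bochner_Integration.integral_cong[OF refl, of _ _ "\<lambda>x. indicator {..<2} x * u x"])
      (auto simp: indicator_def space_restrict_space)
  have borel0: "(LINT x|unit_interval. indicator B x * u x) = 0" if "B \<in> sets borel" for B
  proof -
    have B_sig: "B \<in> sigma_sets UNIV (range lessThan)"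
      using that unfolding borel_Iio by simp
    have "{..<a} \<inter> {..<b} = {..<min a b}" for a b :: real by auto
    then have "Int_stable (range (lessThan :: real \<Rightarrow> _))" by (auto simp: Int_stable_def)
    moreover have "range (lessThan :: real \<Rightarrow> _) \<subseteq> Pow UNIV" by simp
    ultimately show ?thesis
      using B_sig
    proof (induction rule: sigma_sets_induct_disjoint)
      case (basic A)
      then show ?case using seg by auto
    next
      case (compl A)
      then have A: "A \<in> sets borel" unfolding borel_Iio by simp
      have "(LINT x|unit_interval. indicator (UNIV - A) x * u x) = (LINT x|unit_interval. u x - indicator A x * u x)"
        by (intro Bochner_Integration.integral_cong) (auto simp: indicator_def)
      then show ?case using compl all by (simp add: Bochner_Integration.integral_diff[OF u ind[OF A]])
    next
      case (union A)
      then have A: "\<And>i. A i \<in> sets borel" unfolding borel_Iio by auto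
      have "(\<lambda>n. LINT x|unit_interval. indicator (\<Union>i<n. A i) x * u x)
          \<longlonglongrightarrow> (LINT x|unit_interval. indicator (\<Union>i. A i) x * u x)"
      proof (rule integral_dominated_convergence[where w = "\<lambda>x. \<bar>u x\<bar>"])
        show "AE x in unit_interval. (\<lambda>n. indicator (\<Union>i<n. A i) x * u x) \<longlonglongrightarrow> indicator (\<Union>i. A i) x * u x"
          by (intro AE_I2 tendsto_mult LIMSEQ_indicator_UN tendsto_const)
        show "(\<lambda>x. indicator (\<Union>i. A i) x * u x) \<in> borel_measurable unit_interval"
          by (intro borel_measurable_integrable[OF ind] sets.countable_UN) (use A in auto)
        show "(\<lambda>x. indicator (\<Union>i<n. A i) x * u x) \<in> borel_measurable unit_interval" for n
          by (intro borel_measurable_integrable[OF ind] sets.finite_UN) (use A in auto)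
      qed (use u in \<open>auto simp: indicator_def\<close>)
      moreover have "(LINT x|unit_interval. indicator (\<Union>i<n. A i) x * u x) = 0" for n
      proof (induction n)
        case (Suc n)
        have "A n \<inter> A i = {}" if "i < n" for i
          using union(1) that by (simp add: disjoint_family_on_def)
        then have "A n \<inter> (\<Union>i<n. A i) = {}" by blast
        then have "indicator (\<Union>i<Suc n. A i) x * u x = indicator (\<Union>i<n. A i) x * u x + indicator (A n) x * u x" for x
          by (auto simp: indicator_def lessThan_Suc)
        then show ?case
          using Suc union(3)[of n] A by (simp add: Bochner_Integration.integral_add ind)
      qed simp
      ultimately show ?case by (simp add: LIMSEQ_const_iff)
    qed simp
  qed
  show ?thesis
  proof (rule unit_interval.density_zero[OF u])
    fix A :: "real set" assume "A \<in> sets unit_interval"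
    then have "A \<in> sets borel" by (simp add: sets_restrict_space_iff)
    then show "set_lebesgue_integral unit_interval A u = 0"
      using borel0 by (simp add: set_lebesgue_integral_def)
  qed
qed

text \<open>If all projections vanish, then the integral over \<open>[0, d]\<close> vanishes for every dyadic \<open>d\<close>, and hence for
  every \<open>d\<close> by approximation from below.\<close>

lemma dyadic_proj_zero:
  assumes "\<And>n. dyadic_proj n f = 0"
  shows "f = 0"
proof -
  obtain u where u: "square_integrable u" "f = L2_class u" by (rule L2_cases)
  have ui: "integrable unit_interval u"
    using square_integrable_mult[OF u(1) square_integrable_const[of 1]] by simp
  have um: "u \<in> borel_measurable unit_interval" using ui by simp
  have cut0: "cutoff (real j / 2 ^ n) \<bullet> f = 0" if "j \<le> 2 ^ n" for j n
    using that
  proof (induction j)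
    case 0
    have "cutoff 0 \<bullet> cutoff 0 = 0" using cutoff_inner[of 0 0] by simp
    then have "cutoff 0 = 0" by simp
    then show ?case by simp
  next
    case (Suc j)
    have "dyadic_step n j \<bullet> f = dyadic_step n j \<bullet> dyadic_proj n f"
      using Suc.prems dyadic_proj_selfadj[of n "dyadic_step n j" f] dyadic_proj_step[of j n] by simp
    then have "dyadic_step n j \<bullet> f = 0" using assms by simp
    then show ?case using Suc by (simp add: dyadic_step_def inner_diff_left)
  qed
  have cut_eq: "cutoff a \<bullet> f = (LINT x|unit_interval. indicator {..<a} x * u x)" for a
    unfolding u(2) cutoff_def by (intro inner_L2_class square_integrable_lessThan u)
  have mid: "(LINT x|unit_interval. indicator {..<a} x * u x) = 0" if a: "0 \<le> a" "a \<le> 1" for a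
  proof -
    define d where "d n = real (nat \<lfloor>a * 2 ^ n\<rfloor>) / 2 ^ n" for n
    have d: "d n \<le> a" "a - 1 / 2 ^ n < d n" for n
    proof -
      have "real (nat \<lfloor>a * 2 ^ n\<rfloor>) = of_int \<lfloor>a * 2 ^ n\<rfloor>" using a by simp
      then have "d n * 2 ^ n \<le> a * 2 ^ n" "a * 2 ^ n - 1 < d n * 2 ^ n"
        unfolding d_def using of_int_floor_le[of "a * 2 ^ n"] floor_correct[of "a * 2 ^ n"]
        by (simp_all only: nonzero_eq_divide_eq) auto
      then show "d n \<le> a" "a - 1 / 2 ^ n < d n" by (simp_all add: field_simps)
    qed
    have small: "(\<lambda>n. a - 1 / 2 ^ n) \<longlonglongrightarrow> a - 0"
      by (intro tendsto_diff tendsto_const) (use LIMSEQ_power_zero[of "1/2::real"] in \<open>simp add: power_one_over\<close>)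
    have "(\<lambda>n. LINT x|unit_interval. indicator {..<d n} x * u x) \<longlonglongrightarrow> (LINT x|unit_interval. indicator {..<a} x * u x)"
    proof (rule integral_dominated_convergence[where w = "\<lambda>x. \<bar>u x\<bar>"])
      show "AE x in unit_interval. (\<lambda>n. indicator {..<d n} x * u x) \<longlonglongrightarrow> indicator {..<a} x * u x"
      proof (rule AE_I2)
        fix x
        show "(\<lambda>n. indicator {..<d n} x * u x) \<longlonglongrightarrow> indicator {..<a} x * u x"
        proof (cases "x < a")
          case True
          then have "\<forall>\<^sub>F n in sequentially. x < a - 1 / 2 ^ n"
            using order_tendstoD(1)[OF small, of x] by simp
          then have "\<forall>\<^sub>F n in sequentially. indicator {..<d n} x * u x = indicator {..<a} x * u x"
          proof eventually_elim
            case (elim n)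
            then have "x < d n" using d(2)[of n] by linarith
            then show ?case using True by simp
          qed
          then show ?thesis by (rule tendsto_eventually)
        next
          case False
          then have "\<not> x < d n" for n using d(1)[of n] by linarith
          then show ?thesis using False by simp
        qed
      qed
      show "(\<lambda>x. indicator {..<a} x * u x) \<in> borel_measurable unit_interval"
        "(\<lambda>x. indicator {..<d n} x * u x) \<in> borel_measurable unit_interval" for n
        by (intro borel_measurable_times um square_integrable_measurable[OF square_integrable_lessThan])+
    qed (use ui in \<open>auto simp: indicator_def\<close>)
    moreover have "(LINT x|unit_interval. indicator {..<d n} x * u x) = 0" for n
    proof -
      have "nat \<lfloor>a * 2 ^ n\<rfloor> \<le> 2 ^ n"
        using a by (simp add: nat_le_iff floor_le_iff mult_le_one le_less_trans[of "a * 2 ^ n" "2 ^ n"])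
      then show ?thesis using cut0 unfolding cut_eq[symmetric] d_def by blast
    qed
    ultimately show ?thesis by (simp add: LIMSEQ_const_iff)
  qed
  have "(LINT x|unit_interval. indicator {..<a} x * u x) = 0" for a
  proof -
    have "AE x in lborel. x \<noteq> (1::real)" by (rule AE_lborel_singleton)
    then have ne1: "AE x in unit_interval. x \<noteq> 1"
      by (subst AE_restrict_space_iff) (auto elim: eventually_mono)
    have "(LINT x|unit_interval. indicator {..<a} x * u x)
        = (LINT x|unit_interval. indicator {..<max 0 (min a 1)} x * u x)"
    proof (rule integral_cong_AE)
      have "AE x in unit_interval. x \<in> {0..1}" by (rule AE_I2) (simp add: space_restrict_space)
      with ne1 show "AE x in unit_interval. indicator {..<a} x * u x = indicator {..<max 0 (min a 1)} x * u x"
        by eventually_elim (auto simp: indicator_def)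
      show "(\<lambda>x. indicator {..<a} x * u x) \<in> borel_measurable unit_interval" for a
        by (intro borel_measurable_times um square_integrable_measurable[OF square_integrable_lessThan])
      then show "(\<lambda>x. indicator {..<max 0 (min a 1)} x * u x) \<in> borel_measurable unit_interval" .
    qed
    also have "\<dots> = 0" by (rule mid) auto
    finally show ?thesis .
  qed
  then have "AE x in unit_interval. u x = 0" by (rule AE_zero_of_initial_segments[OF ui])
  then have "L2_class u = L2_class (\<lambda>_. 0)"
    using u(1) square_integrable_const by (intro L2_class_eqI) auto
  then show ?thesis using u(2) L2_class_zero by simp
qed

text \<open>The projections are increasing, so they converge strongly; the limit of \<open>dyadic_proj n f\<close> has
  the same projections as \<open>f\<close>.\<close>

lemma dyadic_proj_tendsto: "(\<lambda>n. dyadic_proj n f) \<longlonglongrightarrow> f"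
proof -
  define q where "q n = (norm (dyadic_proj n f))\<^sup>2" for n
  have diff: "(norm (dyadic_proj n f - dyadic_proj m f))\<^sup>2 = q n - q m" if "m \<le> n" for m n
  proof -
    have "dyadic_proj n f \<bullet> dyadic_proj m f = dyadic_proj m f \<bullet> dyadic_proj m f"
      using dyadic_proj_selfadj[of m "dyadic_proj n f" f] dyadic_proj_selfadj[of m "dyadic_proj m f" f]
        dyadic_proj_nested(2)[OF that] dyadic_proj_nested(2)[of m m]
      by (simp add: dyadic_proj_selfadj[symmetric])
    then show ?thesis
      by (simp add: q_def power2_norm_eq_inner inner_diff_left inner_diff_right inner_commute)
  qed
  have "convergent q"
  proof (rule Bseq_mono_convergent)
    show "Bseq q"
      by (rule BseqI'[where K = "(norm f)\<^sup>2"]) (auto simp: q_def dyadic_proj_norm(2) power_mono)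
    show "\<forall>m n. m \<le> n \<longrightarrow> q m \<le> q n"
      using diff zero_le_power2 by (metis diff_ge_0_iff_ge)
  qed
  then have cq: "Cauchy q" by (rule convergent_Cauchy)
  have "Cauchy (\<lambda>n. dyadic_proj n f)"
  proof (rule CauchyI)
    fix e :: real assume e: "0 < e"
    then obtain N where N: "\<And>m n. N \<le> m \<Longrightarrow> N \<le> n \<Longrightarrow> norm (q m - q n) < e\<^sup>2"
      using CauchyD[OF cq, of "e\<^sup>2"] by auto
    have *: "norm (dyadic_proj n f - dyadic_proj m f) < e" if "N \<le> m" "m \<le> n" for m n
    proof -
      have "(norm (dyadic_proj n f - dyadic_proj m f))\<^sup>2 < e\<^sup>2"
        using diff[OF that(2)] N[of n m] that by (simp add: abs_if split: if_splits)
      then show ?thesis using e by (intro power2_less_imp_less[of _ e]) auto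
    qed
    show "\<exists>M. \<forall>m\<ge>M. \<forall>n\<ge>M. norm (dyadic_proj m f - dyadic_proj n f) < e"
    proof (intro exI allI impI)
      fix m n assume "N \<le> m" "N \<le> n"
      then show "norm (dyadic_proj m f - dyadic_proj n f) < e"
        using *[of m n] *[of n m] by (cases "m \<le> n") (auto simp: norm_minus_commute)
    qed
  qed
  then obtain g where g: "(\<lambda>n. dyadic_proj n f) \<longlonglongrightarrow> g"
    using Cauchy_convergent convergent_def by blast
  have "dyadic_proj m (f - g) = 0" for m
  proof -
    have "bounded_linear (dyadic_proj m)"
      by (rule bounded_linear_intro[where K = 1]) (simp_all add: dyadic_proj_linear dyadic_proj_norm(2))
    then have "(\<lambda>n. dyadic_proj m (dyadic_proj n f)) \<longlonglongrightarrow> dyadic_proj m g"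
      using g by (rule bounded_linear.tendsto)
    moreover have "\<forall>\<^sub>F n in sequentially. dyadic_proj m (dyadic_proj n f) = dyadic_proj m f"
      using eventually_ge_at_top[of m] by eventually_elim (rule dyadic_proj_nested(2))
    ultimately have "dyadic_proj m g = dyadic_proj m f"
      by (metis LIMSEQ_unique tendsto_eventually)
    then show ?thesis by (simp add: dyadic_proj_diff)
  qed
  then have "f - g = 0" by (rule dyadic_proj_zero)
  with g show ?thesis by simp
qed

text \<open>A step has \<open>L\<^sub>1\<close> norm \<open>1/2\<^sup>n\<close>, so each diagonal entry of a bounded kernel in the orthonormal system of
  normalised steps is at most \<open>C/2\<^sup>n\<close>, and there are \<open>2\<^sup>n\<close> of them. The bound on this partial trace is uniform
  in the mesh.\<close>

lemma dyadic_trace_le: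
  assumes Q: "bounded_symmetric_kernel Q"
    and C: "\<And>\<alpha> \<beta>. \<alpha> \<in> {0..1} \<Longrightarrow> \<beta> \<in> {0..1} \<Longrightarrow> \<bar>Q (\<alpha>, \<beta>)\<bar> \<le> C"
  shows "(\<Sum>i<2 ^ n. 2 ^ n * (dyadic_step n i \<bullet> integral_operator Q (dyadic_step n i))) \<le> C"
proof -
  have "2 ^ n * (dyadic_step n i \<bullet> integral_operator Q (dyadic_step n i)) \<le> C / 2 ^ n" if i: "i < 2 ^ n" for i
  proof -
    let ?a = "real i / 2 ^ n" and ?b = "real (Suc i) / 2 ^ n"
    let ?u = "\<lambda>x. indicator {..<?b} x - indicator {..<?a} x :: real"
    have ab: "0 \<le> ?a" "?a \<le> ?b" "?b \<le> 1" "0 \<le> ?b" "?a \<le> 1"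
    proof -
      have "real (Suc i) \<le> real (2 ^ n)" using i by (intro of_nat_mono) simp
      then show "?b \<le> 1" by (simp add: divide_le_eq)
      show "?a \<le> ?b" by (simp add: divide_right_mono)
      then show "?a \<le> 1" using \<open>?b \<le> 1\<close> by (rule order_trans)
    qed auto
    have st: "dyadic_step n i = L2_class ?u"
      unfolding dyadic_step_def cutoff_def by (intro L2_class_diff square_integrable_lessThan)
    have sq: "square_integrable ?u" by (intro square_integrable_diff square_integrable_lessThan)
    have int: "integrable unit_interval (indicator {..<d} :: real \<Rightarrow> real)" for d
      using square_integrable_abs_integrable[OF square_integrable_lessThan[of d]] by simp
    have "(LINT x|unit_interval. \<bar>?u x\<bar>) = (LINT x|unit_interval. ?u x)"
      using ab by (intro Bochner_Integration.integral_cong) (auto simp: indicator_def)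
    also have "\<dots> = ?b - ?a"
      using ab by (simp only: Bochner_Integration.integral_diff[OF int int] integral_lessThan)
    also have "\<dots> = 1 / 2 ^ n" by (simp add: diff_divide_distrib[symmetric])
    finally have "dyadic_step n i \<bullet> integral_operator Q (dyadic_step n i) \<le> C * (1 / 2 ^ n)\<^sup>2"
      using integral_operator_form_le[OF Q C sq] unfolding st by simp
    then have "2 ^ n * (dyadic_step n i \<bullet> integral_operator Q (dyadic_step n i)) \<le> 2 ^ n * (C * (1 / 2 ^ n)\<^sup>2)"
      by (intro mult_left_mono) auto
    also have "\<dots> = C / 2 ^ n" by (simp add: power2_eq_square)
    finally show ?thesis .
  qed
  then have "(\<Sum>i<2 ^ n. 2 ^ n * (dyadic_step n i \<bullet> integral_operator Q (dyadic_step n i))) \<le> (\<Sum>i<(2::nat) ^ n. C / 2 ^ n)"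
    by (intro sum_mono) auto
  also have "\<dots> = C" by simp
  finally show ?thesis .
qed

section \<open>Moments and independence of the noise\<close>

lemma abs_mult_le_squares: "\<bar>a\<bar> * \<bar>b\<bar> \<le> a\<^sup>2 + b\<^sup>2" for a b :: real
proof -
  have "2 * (\<bar>a\<bar> * \<bar>b\<bar>) \<le> a\<^sup>2 + b\<^sup>2"
    using sum_squares_bound[of "\<bar>a\<bar>" "\<bar>b\<bar>"] by simp
  moreover have "0 \<le> \<bar>a\<bar> * \<bar>b\<bar>" by simp
  ultimately show ?thesis by linarith
qed

lemma Int_stable_vimage: "Int_stable {X -` E \<inter> S | E. E \<in> sets M}"
  unfolding Int_stable_def
proof (intro ballI)
  fix a b assume "a \<in> {X -` E \<inter> S | E. E \<in> sets M}" "b \<in> {X -` E \<inter> S | E. E \<in> sets M}"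
  then obtain E E' where E: "E \<in> sets M" "a = X -` E \<inter> S" and E': "E' \<in> sets M" "b = X -` E' \<inter> S"
    by auto
  have "a \<inter> b = X -` (E \<inter> E') \<inter> S" by (auto simp: E E')
  then show "a \<inter> b \<in> {X -` E \<inter> S | E. E \<in> sets M}"
    using sets.Int[OF E(1) E'(1)] by blast
qed

lemma centred_normal_moments:
  assumes "prob_space P" and X: "centred_normal P X"
  shows "integrable P X" "(LINT \<omega>|P. X \<omega>) = 0" "integrable P (\<lambda>\<omega>. (X \<omega>)\<^sup>2)"
proof -
  from X obtain \<sigma> where Xm [measurable]: "X \<in> borel_measurable P"
    and d: "distr P borel X = distr std_normal_distribution borel (\<lambda>z. \<sigma> * z)"
    unfolding centred_normal_def by blast
  have 1: "integrable lborel (\<lambda>x. std_normal_density x * x)"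
    using integrable_std_normal_moment[of 1] by simp
  have 2: "integrable lborel (\<lambda>x. std_normal_density x * x\<^sup>2)"
    by (rule integrable_std_normal_moment)
  have i1: "integrable (distr P borel X) (\<lambda>x. x)"
    unfolding d using 1 integrable_mult_right[OF 1, of \<sigma>]
    by (simp add: integrable_distr_eq integrable_density mult_ac)
  have i2: "integrable (distr P borel X) (\<lambda>x. x\<^sup>2)"
    unfolding d using 2
    by (simp add: integrable_distr_eq integrable_density power_mult_distrib mult_ac)
  show "integrable P X" "integrable P (\<lambda>\<omega>. (X \<omega>)\<^sup>2)"
    using i1 i2 by (simp_all add: integrable_distr_eq)
  have "(LINT \<omega>|P. X \<omega>) = (LINT x|distr P borel X. x)" by (simp add: integral_distr)
  also have "\<dots> = (LINT x|lborel. \<sigma> * (std_normal_density x * x))"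
    unfolding d by (simp add: integral_distr integral_density mult.left_commute[of _ \<sigma>])
  also have "\<dots> = \<sigma> * (LINT x|lborel. std_normal_density x * x)" by simp
  also have "(LINT x|lborel. std_normal_density x * x) = 0"
    using integral_std_normal_moment_odd[of 0] by simp
  finally show "(LINT \<omega>|P. X \<omega>) = 0" by simp
qed

text \<open>Evaluating at the left end of each cell of the mesh \<open>1/(n+1)\<close> gives jointly measurable processes that
  converge to the given one along every path.\<close>

lemma jointly_measurable_of_continuous:
  fixes y :: "real \<Rightarrow> 'w \<Rightarrow> 'b::{second_countable_topology, metric_space}"
  assumes meas: "\<And>t. 0 \<le> t \<Longrightarrow> y t \<in> borel_measurable N"
    and cont: "\<And>\<omega>. \<omega> \<in> space N \<Longrightarrow> continuous_on {0..} (\<lambda>t. y t \<omega>)"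
  shows "(\<lambda>(t, \<omega>). y t \<omega>) \<in> borel_measurable (restrict_space lborel {0..} \<Otimes>\<^sub>M N)"
proof (rule borel_measurable_LIMSEQ_metric)
  let ?M = "restrict_space lborel {0..} \<Otimes>\<^sub>M N"
  define k where "k n t = nat \<lfloor>real (Suc n) * t\<rfloor>" for n and t :: real
  show "(\<lambda>(t, \<omega>). y (real (k n t) / real (Suc n)) \<omega>) \<in> borel_measurable ?M" for n
  proof -
    have "(\<lambda>x. y (real (k n (fst x)) / real (Suc n)) (snd x)) \<in> borel_measurable ?M"
    proof (rule measurable_compose_countable[where f = "\<lambda>i x. y (real i / real (Suc n)) (snd x)" and g = "\<lambda>x. k n (fst x)"])
      show "(\<lambda>x. y (real i / real (Suc n)) (snd x)) \<in> borel_measurable ?M" for i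
        by (rule measurable_compose[OF measurable_snd meas]) simp
      have [measurable]: "(\<lambda>t. t) \<in> restrict_space lborel {0..} \<rightarrow>\<^sub>M (borel :: real measure)"
        by (rule measurable_restrict_space1) simp
      show "(\<lambda>x. k n (fst x)) \<in> ?M \<rightarrow>\<^sub>M count_space UNIV"
        unfolding k_def by (rule measurable_compose[OF measurable_fst]) measurable
    qed
    then show ?thesis by (simp add: case_prod_beta')
  qed
  show "(\<lambda>n. (case x of (t, \<omega>) \<Rightarrow> y (real (k n t) / real (Suc n)) \<omega>)) \<longlonglongrightarrow> (case x of (t, \<omega>) \<Rightarrow> y t \<omega>)"
    if "x \<in> space ?M" for x
  proof -
    obtain t \<omega> where x: "x = (t, \<omega>)" by (cases x)
    have t: "0 \<le> t" and o: "\<omega> \<in> space N"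
      using that by (auto simp: x space_pair_measure space_restrict_space)
    have b: "t - inverse (real (Suc n)) \<le> real (k n t) / real (Suc n)" "real (k n t) / real (Suc n) \<le> t" for n
    proof -
      have "real (k n t) = of_int \<lfloor>real (Suc n) * t\<rfloor>" using t by (simp add: k_def)
      then have "real (k n t) \<le> t * real (Suc n)" "t * real (Suc n) - 1 \<le> real (k n t)"
        using of_int_floor_le[of "real (Suc n) * t"] real_of_int_floor_gt_diff_one[of "real (Suc n) * t"]
        by (simp_all only: mult.commute[of t])
      then show "t - inverse (real (Suc n)) \<le> real (k n t) / real (Suc n)" "real (k n t) / real (Suc n) \<le> t"
        by (simp_all add: pos_le_divide_eq pos_divide_le_eq left_diff_distrib del: of_nat_Suc)
    qed
    have "(\<lambda>n. t - inverse (real (Suc n))) \<longlonglongrightarrow> t - 0"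
      by (intro tendsto_intros LIMSEQ_inverse_real_of_nat)
    then have low: "(\<lambda>n. t - inverse (real (Suc n))) \<longlonglongrightarrow> t" by simp
    have "(\<lambda>n. real (k n t) / real (Suc n)) \<longlonglongrightarrow> t"
    proof (rule tendsto_sandwich[OF _ _ low])
      show "(\<lambda>n. t) \<longlonglongrightarrow> t" by (rule tendsto_const)
      show "\<forall>\<^sub>F n in sequentially. t - inverse (real (Suc n)) \<le> real (k n t) / real (Suc n)"
        "\<forall>\<^sub>F n in sequentially. real (k n t) / real (Suc n) \<le> t"
        using b by (auto intro: always_eventually)
    qed
    then have "(\<lambda>n. y (real (k n t) / real (Suc n)) \<omega>) \<longlonglongrightarrow> y t \<omega>"
      by (rule continuous_on_tendsto_compose[OF cont[OF o]]) (use t in auto)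
    then show ?thesis by (simp add: x)
  qed
qed

locale q_noise = prob_space P for P :: "'w measure" +
  fixes kQ :: "real \<times> real \<Rightarrow> real" and w :: "real \<Rightarrow> 'w \<Rightarrow> L2"
  assumes kernel: "bounded_symmetric_kernel kQ" and noise: "Q_noise P kQ w"
begin

lemma w_measurable: "0 \<le> t \<Longrightarrow> w t \<in> borel_measurable P"
  using noise by (simp add: Q_noise_def)

lemma w_continuous: "\<omega> \<in> space P \<Longrightarrow> continuous_on {0..} (\<lambda>t. w t \<omega>)"
  using noise by (simp add: Q_noise_def)

lemma w_0: "\<omega> \<in> space P \<Longrightarrow> w 0 \<omega> = 0"
  using noise by (simp add: Q_noise_def)

lemma w_inner_moments:
  assumes "0 \<le> t"
  shows "integrable P (\<lambda>\<omega>. w t \<omega> \<bullet> f)" "expectation (\<lambda>\<omega>. w t \<omega> \<bullet> f) = 0"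
    "integrable P (\<lambda>\<omega>. (w t \<omega> \<bullet> f)\<^sup>2)"
proof -
  have N: "\<And>(n::nat) \<tau> f. (\<forall>i<n. 0 \<le> \<tau> i) \<Longrightarrow> centred_normal P (\<lambda>\<omega>. \<Sum>i<n. w (\<tau> i) \<omega> \<bullet> f i)"
    using noise unfolding Q_noise_def by blast
  have "centred_normal P (\<lambda>\<omega>. w t \<omega> \<bullet> f)"
    using N[of 1 "\<lambda>_. t" "\<lambda>_. f"] assms by simp
  from centred_normal_moments[OF prob_space_axioms this]
  show "integrable P (\<lambda>\<omega>. w t \<omega> \<bullet> f)" "expectation (\<lambda>\<omega>. w t \<omega> \<bullet> f) = 0"
    "integrable P (\<lambda>\<omega>. (w t \<omega> \<bullet> f)\<^sup>2)" by auto
qed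

lemma w_inner_mult_integrable:
  assumes "0 \<le> s" "0 \<le> t"
  shows "integrable P (\<lambda>\<omega>. (w t \<omega> \<bullet> f) * (w s \<omega> \<bullet> g))"
proof (rule Bochner_Integration.integrable_bound)
  show "integrable P (\<lambda>\<omega>. (w t \<omega> \<bullet> f)\<^sup>2 + (w s \<omega> \<bullet> g)\<^sup>2)"
    using assms by (intro Bochner_Integration.integrable_add w_inner_moments)
  show "(\<lambda>\<omega>. (w t \<omega> \<bullet> f) * (w s \<omega> \<bullet> g)) \<in> borel_measurable P"
    using w_inner_moments(1)[OF assms(1)] w_inner_moments(1)[OF assms(2)] by (intro borel_measurable_times) auto
  show "AE \<omega> in P. norm ((w t \<omega> \<bullet> f) * (w s \<omega> \<bullet> g)) \<le> norm ((w t \<omega> \<bullet> f)\<^sup>2 + (w s \<omega> \<bullet> g)\<^sup>2)"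
    using abs_mult_le_squares[of "w t _ \<bullet> f" "w s _ \<bullet> g"] by (auto simp: abs_mult)
qed

lemma increment_variance:
  assumes "0 \<le> s" "s \<le> t"
  shows "integrable P (\<lambda>\<omega>. ((w t \<omega> - w s \<omega>) \<bullet> f)\<^sup>2)"
    "expectation (\<lambda>\<omega>. ((w t \<omega> - w s \<omega>) \<bullet> f)\<^sup>2) = (t - s) * (f \<bullet> integral_operator kQ f)"
proof -
  have cov: "expectation (\<lambda>\<omega>. (w r \<omega> \<bullet> f) * (w r' \<omega> \<bullet> f)) = min r r' * (f \<bullet> integral_operator kQ f)"
    if "0 \<le> r" "0 \<le> r'" for r r'
    using noise that unfolding Q_noise_def by simp
  have t: "0 \<le> t" using assms by simp
  note i = w_inner_mult_integrable[of _ _ f f]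
  have e: "((w t \<omega> - w s \<omega>) \<bullet> f)\<^sup>2 = (w t \<omega> \<bullet> f) * (w t \<omega> \<bullet> f) + (w s \<omega> \<bullet> f) * (w s \<omega> \<bullet> f)
      - 2 * ((w t \<omega> \<bullet> f) * (w s \<omega> \<bullet> f))" for \<omega>
    by (simp add: inner_diff_left power2_eq_square algebra_simps)
  show "integrable P (\<lambda>\<omega>. ((w t \<omega> - w s \<omega>) \<bullet> f)\<^sup>2)"
    unfolding e using assms t
    by (intro Bochner_Integration.integrable_add Bochner_Integration.integrable_diff integrable_mult_right i)
  show "expectation (\<lambda>\<omega>. ((w t \<omega> - w s \<omega>) \<bullet> f)\<^sup>2) = (t - s) * (f \<bullet> integral_operator kQ f)"
    unfolding e using assms t
    by (simp add: i cov algebra_simps)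
qed

text \<open>Any bound for the kernel will do; it bounds the trace of the covariance by \<open>dyadic_trace_le\<close>.\<close>

definition trace_bound :: real where
  "trace_bound = (SOME C. \<forall>\<alpha>\<in>{0..1}. \<forall>\<beta>\<in>{0..1}. \<bar>kQ (\<alpha>, \<beta>)\<bar> \<le> C)"

lemma trace_bound: "\<alpha> \<in> {0..1} \<Longrightarrow> \<beta> \<in> {0..1} \<Longrightarrow> \<bar>kQ (\<alpha>, \<beta>)\<bar> \<le> trace_bound"
proof -
  have "\<exists>C. \<forall>\<alpha>\<in>{0..1}. \<forall>\<beta>\<in>{0..1}. \<bar>kQ (\<alpha>, \<beta>)\<bar> \<le> C"
    using kernel by (simp add: bounded_symmetric_kernel_def)
  from someI_ex[OF this] show "\<alpha> \<in> {0..1} \<Longrightarrow> \<beta> \<in> {0..1} \<Longrightarrow> \<bar>kQ (\<alpha>, \<beta>)\<bar> \<le> trace_bound"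
    unfolding trace_bound_def by blast
qed

lemma trace_bound_nonneg: "0 \<le> trace_bound"
  using trace_bound[of 0 0] by simp

text \<open>The diagonal of the unit square is a null set, so the trace of the covariance cannot be read off \<open>kQ\<close>
  directly. The second moments of the dyadic projections are partial traces, which are bounded uniformly,
  and Fatou's lemma passes to the limit.\<close>

lemma increment_second_moment:
  assumes st: "0 \<le> s" "s \<le> t"
  shows "(\<integral>\<^sup>+\<omega>. ennreal ((norm (w t \<omega> - w s \<omega>))\<^sup>2) \<partial>P) \<le> ennreal (trace_bound * (t - s))"
proof -
  let ?d = "\<lambda>\<omega>. w t \<omega> - w s \<omega>"
  have [measurable]: "w t \<in> borel_measurable P" "w s \<in> borel_measurable P"
    using st by (auto intro!: w_measurable)
  have "(\<integral>\<^sup>+\<omega>. ennreal ((norm (?d \<omega>))\<^sup>2) \<partial>P)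
      = (\<integral>\<^sup>+\<omega>. liminf (\<lambda>n. ennreal (\<Sum>i<2 ^ n. 2 ^ n * (?d \<omega> \<bullet> dyadic_step n i)\<^sup>2)) \<partial>P)"
  proof (rule nn_integral_cong)
    fix \<omega>
    have "(\<lambda>n. ennreal ((norm (dyadic_proj n (?d \<omega>)))\<^sup>2)) \<longlonglongrightarrow> ennreal ((norm (?d \<omega>))\<^sup>2)"
      by (intro tendsto_ennrealI tendsto_intros dyadic_proj_tendsto)
    from lim_imp_Liminf[OF sequentially_bot this]
    show "ennreal ((norm (?d \<omega>))\<^sup>2) = liminf (\<lambda>n. ennreal (\<Sum>i<2 ^ n. 2 ^ n * (?d \<omega> \<bullet> dyadic_step n i)\<^sup>2))"
      by (simp add: dyadic_proj_norm(1))
  qed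
  also have "\<dots> \<le> liminf (\<lambda>n. \<integral>\<^sup>+\<omega>. ennreal (\<Sum>i<2 ^ n. 2 ^ n * (?d \<omega> \<bullet> dyadic_step n i)\<^sup>2) \<partial>P)"
    by (rule nn_integral_liminf) simp
  also have "\<dots> \<le> liminf (\<lambda>n::nat. ennreal (trace_bound * (t - s)))"
  proof (intro Liminf_mono always_eventually allI)
    fix n
    have i: "integrable P (\<lambda>\<omega>. \<Sum>i<2 ^ n. 2 ^ n * (?d \<omega> \<bullet> dyadic_step n i)\<^sup>2)"
      by (intro Bochner_Integration.integrable_sum integrable_mult_right increment_variance[OF st])
    have "(\<integral>\<^sup>+\<omega>. ennreal (\<Sum>i<2 ^ n. 2 ^ n * (?d \<omega> \<bullet> dyadic_step n i)\<^sup>2) \<partial>P)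
        = ennreal (expectation (\<lambda>\<omega>. \<Sum>i<2 ^ n. 2 ^ n * (?d \<omega> \<bullet> dyadic_step n i)\<^sup>2))"
      by (rule nn_integral_eq_integral[OF i]) (simp add: sum_nonneg)
    also have "expectation (\<lambda>\<omega>. \<Sum>i<2 ^ n. 2 ^ n * (?d \<omega> \<bullet> dyadic_step n i)\<^sup>2)
        = (t - s) * (\<Sum>i<2 ^ n. 2 ^ n * (dyadic_step n i \<bullet> integral_operator kQ (dyadic_step n i)))"
      by (simp add: Bochner_Integration.integral_sum integrable_mult_right increment_variance[OF st]
          sum_distrib_left mult_ac)
    also have "\<dots> \<le> (t - s) * trace_bound"
      using st by (intro mult_left_mono dyadic_trace_le[OF kernel trace_bound]) auto
    finally show "(\<integral>\<^sup>+\<omega>. ennreal (\<Sum>i<2 ^ n. 2 ^ n * (?d \<omega> \<bullet> dyadic_step n i)\<^sup>2) \<partial>P) \<le> ennreal (trace_bound * (t - s))"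
      by (simp add: mult.commute ennreal_leI)
  qed
  also have "\<dots> = ennreal (trace_bound * (t - s))" by (simp add: Liminf_const)
  finally show ?thesis .
qed

lemma increment_square_integrable:
  assumes st: "0 \<le> s" "s \<le> t"
  shows "integrable P (\<lambda>\<omega>. (norm (w t \<omega> - w s \<omega>))\<^sup>2)"
    "expectation (\<lambda>\<omega>. (norm (w t \<omega> - w s \<omega>))\<^sup>2) \<le> trace_bound * (t - s)"
proof -
  have [measurable]: "w t \<in> borel_measurable P" "w s \<in> borel_measurable P"
    using st by (auto intro!: w_measurable)
  show 1: "integrable P (\<lambda>\<omega>. (norm (w t \<omega> - w s \<omega>))\<^sup>2)"
    using increment_second_moment[OF st] by (intro integrableI_bounded) (auto simp: le_less_trans)
  have "ennreal (expectation (\<lambda>\<omega>. (norm (w t \<omega> - w s \<omega>))\<^sup>2)) \<le> ennreal (trace_bound * (t - s))"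
    using increment_second_moment[OF st] by (subst nn_integral_eq_integral[OF 1, symmetric]) auto
  then show "expectation (\<lambda>\<omega>. (norm (w t \<omega> - w s \<omega>))\<^sup>2) \<le> trace_bound * (t - s)"
    using st trace_bound_nonneg by (subst (asm) ennreal_le_iff) auto
qed

lemma increment_mean:
  assumes st: "0 \<le> s" "s \<le> t"
  shows "integrable P (\<lambda>\<omega>. w t \<omega> - w s \<omega>)" "expectation (\<lambda>\<omega>. w t \<omega> - w s \<omega>) = 0"
proof -
  have [measurable]: "w t \<in> borel_measurable P" "w s \<in> borel_measurable P"
    using st by (auto intro!: w_measurable)
  show i: "integrable P (\<lambda>\<omega>. w t \<omega> - w s \<omega>)"
  proof (rule Bochner_Integration.integrable_bound)
    show "integrable P (\<lambda>\<omega>. 1 + (norm (w t \<omega> - w s \<omega>))\<^sup>2)"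
      using increment_square_integrable[OF st] by simp
    have "a \<le> 1 + a\<^sup>2" for a :: real
      using zero_le_power2[of "a - 1/2"] by (simp add: power2_eq_square algebra_simps)
    then show "AE \<omega> in P. norm (w t \<omega> - w s \<omega>) \<le> norm (1 + (norm (w t \<omega> - w s \<omega>))\<^sup>2)"
      by (simp add: add_nonneg_nonneg)
  qed measurable
  have "expectation (\<lambda>\<omega>. w t \<omega> - w s \<omega>) \<bullet> f = 0 \<bullet> f" for f
  proof -
    have "expectation (\<lambda>\<omega>. w t \<omega> - w s \<omega>) \<bullet> f = expectation (\<lambda>\<omega>. (w t \<omega> - w s \<omega>) \<bullet> f)"
      using i by (intro integral_inner_left[symmetric]) auto
    also have "\<dots> = expectation (\<lambda>\<omega>. w t \<omega> \<bullet> f) - expectation (\<lambda>\<omega>. w s \<omega> \<bullet> f)"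
      unfolding inner_diff_left using st by (intro Bochner_Integration.integral_diff w_inner_moments) auto
    finally show ?thesis using st by (simp add: w_inner_moments)
  qed
  then show "expectation (\<lambda>\<omega>. w t \<omega> - w s \<omega>) = 0"
    by (metis inner_commute vector_eq_ldot)
qed

lemma space_history: "space (history P w t) = space P"
  by (simp add: history_def space_measure_of_conv)

lemma sets_history:
  "sets (history P w t) = sigma_sets (space P) (\<Union>s\<in>{0..t}. {w s -` E \<inter> space P | E. E \<in> sets borel})"
  unfolding history_def by (rule sets_measure_of) auto

lemma subalgebra_history: "subalgebra P (history P w t)"
  unfolding subalgebra_def
proof
  show "sets (history P w t) \<subseteq> sets P"
    unfolding sets_history using measurable_sets[OF w_measurable]
    by (intro sets.sigma_sets_subset) auto
qed (rule space_history)

lemma measurable_of_history: "f \<in> borel_measurable (history P w t) \<Longrightarrow> f \<in> borel_measurable P"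
  by (rule measurable_from_subalg[OF subalgebra_history])

lemma w_measurable_history:
  assumes "0 \<le> s" "s \<le> t"
  shows "w s \<in> borel_measurable (history P w t)"
proof (rule measurableI)
  fix E :: "L2 set" assume "E \<in> sets borel"
  then show "w s -` E \<inter> space (history P w t) \<in> sets (history P w t)"
    unfolding sets_history space_history using assms
    by (intro sigma_sets.Basic UN_I[of s]) auto
qed simp

text \<open>Future increments are orthogonal to square integrable functions of the past. Independence is
  applied to coordinates and carried over by the dyadic projections.\<close>

lemma increment_orthogonal:
  assumes st: "0 \<le> s" "s \<le> t"
    and \<xi>: "\<xi> \<in> borel_measurable (history P w s)" and \<xi>2: "integrable P (\<lambda>\<omega>. (norm (\<xi> \<omega>))\<^sup>2)"
  shows "integrable P (\<lambda>\<omega>. (T \<odot> (w t \<omega> - w s \<omega>)) \<bullet> \<xi> \<omega>)"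
    "expectation (\<lambda>\<omega>. (T \<odot> (w t \<omega> - w s \<omega>)) \<bullet> \<xi> \<omega>) = 0"
proof -
  define d where "d \<omega> = w t \<omega> - w s \<omega>" for \<omega>
  have [measurable]: "w t \<in> borel_measurable P" "w s \<in> borel_measurable P"
    using st by (auto intro!: w_measurable)
  have dm [measurable]: "d \<in> borel_measurable P" unfolding d_def by measurable
  have \<xi>m [measurable]: "\<xi> \<in> borel_measurable P" by (rule measurable_of_history[OF \<xi>])
  have [measurable]: "(\<lambda>f. T \<odot> f) \<in> borel_measurable borel"
    by (intro borel_measurable_continuous_onI continuous_intros)
  have d2: "integrable P (\<lambda>\<omega>. (norm (d \<omega>))\<^sup>2)"
    unfolding d_def by (rule increment_square_integrable[OF st])
  have dom: "integrable P (\<lambda>\<omega>. norm T * ((norm (d \<omega>))\<^sup>2 + (norm (\<xi> \<omega>))\<^sup>2))"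
    by (intro integrable_mult_right Bochner_Integration.integrable_add d2 \<xi>2)
  have bd: "norm (T \<odot> d \<omega>) * norm (\<xi> \<omega>) \<le> norm T * ((norm (d \<omega>))\<^sup>2 + (norm (\<xi> \<omega>))\<^sup>2)" for \<omega>
  proof -
    have "norm (T \<odot> d \<omega>) * norm (\<xi> \<omega>) \<le> norm T * (norm (d \<omega>) * norm (\<xi> \<omega>))"
      using mult_right_mono[OF norm_bop_apply[of T "d \<omega>"], of "norm (\<xi> \<omega>)"] by (simp add: mult.assoc)
    also have "norm (d \<omega>) * norm (\<xi> \<omega>) \<le> (norm (d \<omega>))\<^sup>2 + (norm (\<xi> \<omega>))\<^sup>2"
      using abs_mult_le_squares[of "norm (d \<omega>)" "norm (\<xi> \<omega>)"] by simp
    finally show ?thesis by (simp add: mult_left_mono)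
  qed
  show "integrable P (\<lambda>\<omega>. (T \<odot> (w t \<omega> - w s \<omega>)) \<bullet> \<xi> \<omega>)"
    unfolding d_def[symmetric]
  proof (rule Bochner_Integration.integrable_bound[OF dom])
    show "AE \<omega> in P. norm ((T \<odot> d \<omega>) \<bullet> \<xi> \<omega>) \<le> norm (norm T * ((norm (d \<omega>))\<^sup>2 + (norm (\<xi> \<omega>))\<^sup>2))"
      using Cauchy_Schwarz_ineq2 bd by (intro AE_I2) (fastforce intro: order_trans)
  qed measurable
  have indep: "indep_var borel \<xi> borel d"
    unfolding indep_var_eq
  proof (intro conjI \<xi>m dm)
    have "indep_set (sets (history P w s)) {d -` E \<inter> space P | E. E \<in> sets borel}"
      using noise st unfolding Q_noise_def d_def by blast
    moreover have "{\<xi> -` E \<inter> space P | E. E \<in> sets borel} \<subseteq> sets (history P w s)"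
      using measurable_sets[OF \<xi>] by (auto simp: space_history)
    ultimately have "indep_set {\<xi> -` E \<inter> space P | E. E \<in> sets borel} {d -` E \<inter> space P | E. E \<in> sets borel}"
      unfolding indep_sets2_eq by blast
    then show "indep_set (sigma_sets (space P) {\<xi> -` E \<inter> space P | E. E \<in> sets borel})
        (sigma_sets (space P) {d -` E \<inter> space P | E. E \<in> sets borel})"
    proof (rule indep_set_sigma_sets)
    qed (rule Int_stable_vimage)+
  qed
  have coord: "expectation (\<lambda>\<omega>. ((T \<odot> d \<omega>) \<bullet> h) * (\<xi> \<omega> \<bullet> h)) = 0"
    "integrable P (\<lambda>\<omega>. ((T \<odot> d \<omega>) \<bullet> h) * (\<xi> \<omega> \<bullet> h))" for h
  proof -
    have di: "integrable P d" unfolding d_def by (rule increment_mean[OF st])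
    have Ti: "integrable P (\<lambda>\<omega>. (T \<odot> d \<omega>) \<bullet> h)"
      using integrable_bounded_linear[OF bop.bounded_linear_right di, of T] by (rule integrable_inner_left) 
    have "expectation (\<lambda>\<omega>. (T \<odot> d \<omega>) \<bullet> h) = expectation (\<lambda>\<omega>. T \<odot> d \<omega>) \<bullet> h"
      using integrable_bounded_linear[OF bop.bounded_linear_right di, of T]
      by (intro integral_inner_left) auto
    also have "expectation (\<lambda>\<omega>. T \<odot> d \<omega>) = T \<odot> expectation d"
      by (rule integral_bounded_linear[OF bop.bounded_linear_right di])
    also have "expectation d = 0" unfolding d_def by (rule increment_mean[OF st])
    finally have T0: "expectation (\<lambda>\<omega>. (T \<odot> d \<omega>) \<bullet> h) = 0" by (simp add: bop.zero_right)
    have "integrable P (\<lambda>\<omega>. norm h * (1 + (norm (\<xi> \<omega>))\<^sup>2))"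
      using \<xi>2 by simp
    then have xi: "integrable P (\<lambda>\<omega>. \<xi> \<omega> \<bullet> h)"
    proof (rule Bochner_Integration.integrable_bound)
      have "\<bar>\<xi> \<omega> \<bullet> h\<bar> \<le> norm h * (1 + (norm (\<xi> \<omega>))\<^sup>2)" for \<omega>
      proof -
        have "\<bar>\<xi> \<omega> \<bullet> h\<bar> \<le> norm h * norm (\<xi> \<omega>)"
          using Cauchy_Schwarz_ineq2[of "\<xi> \<omega>" h] by (simp add: mult.commute)
        also have "norm (\<xi> \<omega>) \<le> 1 + (norm (\<xi> \<omega>))\<^sup>2"
          using zero_le_power2[of "norm (\<xi> \<omega>) - 1/2"] by (simp add: power2_eq_square algebra_simps)
        finally show ?thesis by (simp add: mult_left_mono)
      qed
      then show "AE \<omega> in P. norm (\<xi> \<omega> \<bullet> h) \<le> norm (norm h * (1 + (norm (\<xi> \<omega>))\<^sup>2))"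
        by (auto intro: order_trans)
    qed measurable
    have iv: "indep_var borel (\<lambda>\<omega>. \<xi> \<omega> \<bullet> h) borel (\<lambda>\<omega>. (T \<odot> d \<omega>) \<bullet> h)"
      using indep_var_compose[OF indep, of "\<lambda>x. x \<bullet> h" borel "\<lambda>x. (T \<odot> x) \<bullet> h" borel]
      by (simp add: o_def)
    show "expectation (\<lambda>\<omega>. ((T \<odot> d \<omega>) \<bullet> h) * (\<xi> \<omega> \<bullet> h)) = 0"
      using indep_var_lebesgue_integral[OF iv xi Ti] T0 by (simp add: mult.commute)
    show "integrable P (\<lambda>\<omega>. ((T \<odot> d \<omega>) \<bullet> h) * (\<xi> \<omega> \<bullet> h))"
      using indep_var_integrable[OF iv xi Ti] by (simp add: mult.commute)
  qed
  have "(\<lambda>n. expectation (\<lambda>\<omega>. dyadic_proj n (T \<odot> d \<omega>) \<bullet> \<xi> \<omega>)) \<longlonglongrightarrow> expectation (\<lambda>\<omega>. (T \<odot> d \<omega>) \<bullet> \<xi> \<omega>)"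
  proof (rule integral_dominated_convergence[OF _ _ dom])
    show "AE \<omega> in P. (\<lambda>n. dyadic_proj n (T \<odot> d \<omega>) \<bullet> \<xi> \<omega>) \<longlonglongrightarrow> (T \<odot> d \<omega>) \<bullet> \<xi> \<omega>"
      by (intro AE_I2 tendsto_intros dyadic_proj_tendsto)
    show "AE \<omega> in P. norm (dyadic_proj n (T \<odot> d \<omega>) \<bullet> \<xi> \<omega>) \<le> norm T * ((norm (d \<omega>))\<^sup>2 + (norm (\<xi> \<omega>))\<^sup>2)" for n
    proof (rule AE_I2)
      fix \<omega>
      have "norm (dyadic_proj n (T \<odot> d \<omega>) \<bullet> \<xi> \<omega>) \<le> norm (dyadic_proj n (T \<odot> d \<omega>)) * norm (\<xi> \<omega>)"
        using Cauchy_Schwarz_ineq2 by simp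
      also have "\<dots> \<le> norm (T \<odot> d \<omega>) * norm (\<xi> \<omega>)"
        by (intro mult_right_mono dyadic_proj_norm) simp
      finally show "norm (dyadic_proj n (T \<odot> d \<omega>) \<bullet> \<xi> \<omega>) \<le> norm T * ((norm (d \<omega>))\<^sup>2 + (norm (\<xi> \<omega>))\<^sup>2)"
        using bd[of \<omega>] by linarith
    qed
    show "(\<lambda>\<omega>. dyadic_proj n (T \<odot> d \<omega>) \<bullet> \<xi> \<omega>) \<in> borel_measurable P" for n
      unfolding dyadic_proj_inner by measurable
  qed measurable
  moreover have "expectation (\<lambda>\<omega>. dyadic_proj n (T \<odot> d \<omega>) \<bullet> \<xi> \<omega>) = 0" for n
    unfolding dyadic_proj_inner mult.assoc
    by (simp add: Bochner_Integration.integral_sum integrable_mult_right coord)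
  ultimately show "expectation (\<lambda>\<omega>. (T \<odot> (w t \<omega> - w s \<omega>)) \<bullet> \<xi> \<omega>) = 0"
    by (simp add: d_def LIMSEQ_const_iff)
qed

end

section \<open>Integrals of continuous paths\<close>

lemma LBINT_eq_integral:
  fixes f :: "real \<Rightarrow> 'a::{real_inner, banach, second_countable_topology}"
  assumes f: "continuous_on {a..b} f"
  shows "(LBINT s:{a..b}. f s) = integral {a..b} f"
proof -
  have si: "set_integrable lborel {a..b} f" by (rule borel_integrable_atLeastAtMost'[OF f])
  have "(LBINT s:{a..b}. f s) \<bullet> g = integral {a..b} f \<bullet> g" for g
  proof -
    have "(LBINT s:{a..b}. f s) \<bullet> g = (LINT s|lborel. (indicator {a..b} s *\<^sub>R f s) \<bullet> g)"
      using si unfolding set_lebesgue_integral_def set_integrable_def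
      by (intro integral_inner_left[symmetric]) auto
    also have "\<dots> = (LBINT s:{a..b}. f s \<bullet> g)" by (simp add: set_lebesgue_integral_def)
    also have "\<dots> = integral {a..b} (\<lambda>s. f s \<bullet> g)"
      by (intro set_borel_integral_eq_integral borel_integrable_atLeastAtMost' continuous_intros f)
    also have "\<dots> = integral {a..b} f \<bullet> g"
      using integral_linear[OF integrable_continuous_real[OF f] bounded_linear_inner_left[of g]] by (simp add: o_def)
    finally show ?thesis .
  qed
  then show ?thesis by (metis inner_commute vector_eq_ldot)
qed

text \<open>Cauchy--Schwarz in the time variable, from the nonnegativity of the integral of the squared deviation of
  \<open>\<parallel>f\<parallel>\<close> from its mean.\<close>

lemma norm_integral_squared_le:
  fixes f :: "real \<Rightarrow> 'a::banach"
  assumes f: "continuous_on {a..b} f" and ab: "a \<le> b"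
  shows "(norm (integral {a..b} f))\<^sup>2 \<le> (b - a) * integral {a..b} (\<lambda>s. (norm (f s))\<^sup>2)"
proof -
  define g where "g s = norm (f s)" for s
  define I where "I = integral {a..b} g"
  have gc: "continuous_on {a..b} g" unfolding g_def by (intro continuous_intros f)
  have gi: "g integrable_on {a..b}" "(\<lambda>s. (g s)\<^sup>2) integrable_on {a..b}"
    by (intro integrable_continuous_real continuous_on_power gc)+
  have "norm (integral {a..b} f) \<le> I"
    unfolding I_def
  proof (rule integral_norm_bound_integral)
    show "f integrable_on {a..b}" by (rule integrable_continuous_real[OF f])
  qed (simp_all add: gi(1), simp add: g_def)
  then have "(norm (integral {a..b} f))\<^sup>2 \<le> I\<^sup>2" by (intro power_mono) auto
  also have "I\<^sup>2 \<le> (b - a) * integral {a..b} (\<lambda>s. (g s)\<^sup>2)"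
  proof (cases "a = b")
    case False
    with ab have pos: "0 < b - a" by simp
    define c where "c = I / (b - a)"
    have "0 \<le> integral {a..b} (\<lambda>s. (g s - c)\<^sup>2)"
      by (rule integral_nonneg) (auto intro!: integrable_continuous_real continuous_intros gc)
    also have "integral {a..b} (\<lambda>s. (g s - c)\<^sup>2) = integral {a..b} (\<lambda>s. (g s)\<^sup>2 - 2 * c * g s + c\<^sup>2)"
      by (simp add: power2_eq_square algebra_simps)
    also have "\<dots> = integral {a..b} (\<lambda>s. (g s)\<^sup>2) - 2 * c * I + c\<^sup>2 * (b - a)"
    proof -
      have "((\<lambda>s. c\<^sup>2) has_integral c\<^sup>2 * (b - a)) {a..b}"
        using has_integral_const_real[of "c\<^sup>2" a b] ab by (simp add: mult.commute)
      with has_integral_diff[OF integrable_integral[OF gi(2)]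
          has_integral_mult_right[OF integrable_integral[OF gi(1)], of "2 * c"]]
      have "((\<lambda>s. (g s)\<^sup>2 - 2 * c * g s + c\<^sup>2) has_integral
          (integral {a..b} (\<lambda>s. (g s)\<^sup>2) - 2 * c * I + c\<^sup>2 * (b - a))) {a..b}"
        unfolding I_def by (rule has_integral_add)
      then show ?thesis by (rule integral_unique)
    qed
    finally have "0 \<le> (b - a) * (integral {a..b} (\<lambda>s. (g s)\<^sup>2) - 2 * c * I + c\<^sup>2 * (b - a))"
      using pos by (intro mult_nonneg_nonneg) auto
    also have "\<dots> = (b - a) * integral {a..b} (\<lambda>s. (g s)\<^sup>2) - I\<^sup>2"
    proof -
      define J where "J = integral {a..b} (\<lambda>s. (g s)\<^sup>2)"
      have cI: "c * (b - a) = I" using pos by (simp add: c_def)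
      have "(b - a) * (J - 2 * c * I + c\<^sup>2 * (b - a)) = (b - a) * J - 2 * (c * (b - a)) * I + (c * (b - a))\<^sup>2"
        by (simp add: power2_eq_square algebra_simps)
      then show ?thesis unfolding cI J_def[symmetric] by (simp add: power2_eq_square)
    qed
    finally show ?thesis by simp
  qed (simp add: I_def)
  finally show ?thesis by (simp add: g_def)
qed

lemma integral_eq_nn_integral:
  fixes g :: "real \<Rightarrow> real"
  assumes g: "continuous_on {a..b} g" and nn: "\<And>s. s \<in> {a..b} \<Longrightarrow> 0 \<le> g s"
  shows "ennreal (integral {a..b} g) = (\<integral>\<^sup>+s. ennreal (indicator {a..b} s * g s) \<partial>lborel)"
proof -
  have si: "integrable lborel (\<lambda>s. indicator {a..b} s *\<^sub>R g s)"
    using borel_integrable_atLeastAtMost'[OF g] by (simp add: set_integrable_def)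
  have "integral {a..b} g = (LBINT s:{a..b}. g s)" by (rule LBINT_eq_integral[OF g, symmetric])
  then show ?thesis
    using nn_integral_eq_integral[OF si] nn by (simp add: set_lebesgue_integral_def indicator_def)
qed

lemma sigma_finite_halfline: "sigma_finite_measure (restrict_space lborel {0::real..})"
  by (rule sigma_finite_measure_restrict_space) (auto intro: sigma_finite_lborel)

lemma measurable_integral_process:
  fixes y :: "real \<Rightarrow> 'w \<Rightarrow> 'a::{real_inner, banach, second_countable_topology}"
  assumes t: "0 \<le> t" and meas: "\<And>s. s \<in> {0..t} \<Longrightarrow> y s \<in> borel_measurable N"
    and cont: "\<And>\<omega>. \<omega> \<in> space N \<Longrightarrow> continuous_on {0..t} (\<lambda>s. y s \<omega>)"
  shows "(\<lambda>\<omega>. integral {0..t} (\<lambda>s. y s \<omega>)) \<in> borel_measurable N"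
proof -
  let ?H = "restrict_space lborel {0::real..}"
  interpret H: sigma_finite_measure ?H by (rule sigma_finite_halfline)
  define z where "z s = y (min s t)" for s
  have z: "(\<lambda>(s, \<omega>). z s \<omega>) \<in> borel_measurable (?H \<Otimes>\<^sub>M N)"
  proof (rule jointly_measurable_of_continuous)
    show "z s \<in> borel_measurable N" if "0 \<le> s" for s
      using that t by (simp add: z_def meas)
    show "continuous_on {0..} (\<lambda>s. z s \<omega>)" if "\<omega> \<in> space N" for \<omega>
      unfolding z_def using t
      by (intro continuous_on_compose2[OF cont[OF that]] continuous_intros) auto
  qed
  have "(\<lambda>p. z (snd p) (fst p)) \<in> borel_measurable (N \<Otimes>\<^sub>M ?H)"
    using measurable_compose[OF measurable_pair_swap' z] by (simp add: case_prod_beta')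
  then have [measurable]: "(\<lambda>(\<omega>, s). z s \<omega>) \<in> borel_measurable (N \<Otimes>\<^sub>M ?H)"
    by (simp add: case_prod_beta')
  have [measurable]: "{0..t} \<in> sets ?H" by (auto simp: sets_restrict_space_iff)
  have "(\<lambda>\<omega>. LINT s|?H. indicator {0..t} s *\<^sub>R z s \<omega>) \<in> borel_measurable N"
    by (rule H.borel_measurable_lebesgue_integral) measurable
  moreover have "(LINT s|?H. indicator {0..t} s *\<^sub>R z s \<omega>) = integral {0..t} (\<lambda>s. y s \<omega>)"
    if o: "\<omega> \<in> space N" for \<omega>
  proof -
    have "(LINT s|?H. indicator {0..t} s *\<^sub>R z s \<omega>) = (LBINT s:{0..t}. y s \<omega>)"
      unfolding set_lebesgue_integral_def
      by (subst integral_restrict_space) (auto intro!: Bochner_Integration.integral_cong simp: indicator_def z_def)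
    then show ?thesis using LBINT_eq_integral[OF cont[OF o]] by simp
  qed
  ultimately show ?thesis by (simp cong: measurable_cong)
qed

lemma bop_apply_measurable [measurable]: "(\<lambda>f. T \<odot> f) \<in> borel_measurable borel"
  by (intro borel_measurable_continuous_onI continuous_intros)

section \<open>The operator semigroup\<close>

definition op_semigroup :: "bop \<Rightarrow> real \<Rightarrow> bop" where
  "op_semigroup A t = exp (t *\<^sub>R A)"

lemma exp_operator_semigroup: "blinfun_apply (exp_operator (t *\<^sub>R T)) f = op_semigroup (Bop T) t \<odot> f"
  by (simp add: exp_operator_eq op_semigroup_def Bop_algebra blinfun_apply_bop)

lemma op_semigroup_0 [simp]: "op_semigroup A 0 = 1"
  by (simp add: op_semigroup_def)

lemma op_semigroup_derivative:
  "((\<lambda>s. op_semigroup A (s - c)) has_vector_derivative op_semigroup A (s - c) * A) (at s within S)"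
proof -
  have "((\<lambda>s. exp (s *\<^sub>R A)) has_vector_derivative exp ((s - c) *\<^sub>R A) * A) (at (s - c) within (\<lambda>s. s - c) ` S)"
    by (rule exp_scaleR_has_vector_derivative_right)
  moreover have "((\<lambda>s. s - c) has_vector_derivative 1) (at s within S)"
    by (auto intro!: derivative_eq_intros)
  ultimately show ?thesis
    using vector_diff_chain_within[of "\<lambda>s. s - c" 1 s S "\<lambda>s. exp (s *\<^sub>R A)"] by (simp add: op_semigroup_def o_def)
qed

lemma op_semigroup_derivative_reversed:
  "((\<lambda>s. op_semigroup A (t - s)) has_vector_derivative - (op_semigroup A (t - s) * A)) (at s within S)"
proof -
  have "((\<lambda>s. exp (s *\<^sub>R A)) has_vector_derivative exp ((t - s) *\<^sub>R A) * A) (at (t - s) within (\<lambda>s. t - s) ` S)"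
    by (rule exp_scaleR_has_vector_derivative_right)
  moreover have "((\<lambda>s. t - s) has_vector_derivative - 1) (at s within S)"
    by (auto intro!: derivative_eq_intros)
  ultimately show ?thesis
    using vector_diff_chain_within[of "\<lambda>s. t - s" "- 1" s S "\<lambda>s. exp (s *\<^sub>R A)"] by (simp add: op_semigroup_def o_def)
qed

lemma continuous_on_semigroup [continuous_intros]:
  "continuous_on S g \<Longrightarrow> continuous_on S (\<lambda>s. op_semigroup A (g s))"
proof -
  have "continuous_on UNIV (\<lambda>s. exp (s *\<^sub>R A))"
    by (rule continuous_on_vector_derivative) (rule exp_scaleR_has_vector_derivative_right)
  then show "continuous_on S g \<Longrightarrow> continuous_on S (\<lambda>s. op_semigroup A (g s))"
    unfolding op_semigroup_def by (rule continuous_on_compose2) auto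
qed

lemma norm_semigroup: "norm (op_semigroup A t) \<le> exp (\<bar>t\<bar> * norm A)"
  using norm_exp[of "t *\<^sub>R A"] by (simp add: op_semigroup_def)

lemma selfadj_semigroup:
  assumes A: "selfadj A"
  shows "selfadj (op_semigroup A t)"
proof -
  have pow: "selfadj ((t *\<^sub>R A) ^ n)" for n
  proof (induction n)
    case (Suc n)
    have "((t *\<^sub>R A) ^ Suc n \<odot> f) \<bullet> g = f \<bullet> ((t *\<^sub>R A) ^ Suc n \<odot> g)" for f g
    proof -
      have "((t *\<^sub>R A) ^ Suc n \<odot> f) \<bullet> g = ((t *\<^sub>R A) \<odot> ((t *\<^sub>R A) ^ n \<odot> f)) \<bullet> g"
        by (simp only: power_Suc bop_apply_mult)
      also have "\<dots> = f \<bullet> ((t *\<^sub>R A) ^ n \<odot> (t *\<^sub>R A) \<odot> g)"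
        using Suc A by (simp only: selfadjD selfadj_simps)
      also have "\<dots> = f \<bullet> ((t *\<^sub>R A) ^ Suc n \<odot> g)"
        by (simp only: power_Suc2 bop_apply_mult)
      finally show ?thesis .
    qed
    then show ?case by (simp add: selfadj_def)
  qed simp
  have sums: "selfadj (\<Sum>n<N. (t *\<^sub>R A) ^ n /\<^sub>R fact n)" for N
  proof (induction N)
    case (Suc N)
    then show ?case unfolding sum.lessThan_Suc by (intro selfadj_simps pow)
  qed simp
  have "(\<lambda>N. \<Sum>n<N. (t *\<^sub>R A) ^ n /\<^sub>R fact n) \<longlonglongrightarrow> exp (t *\<^sub>R A)"
    using exp_converges[of "t *\<^sub>R A"] by (simp add: sums_def)
  from closed_sequentially[OF closed_selfadj _ this] sums
  show ?thesis by (simp add: op_semigroup_def)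
qed

lemma variation_of_constants:
  fixes y g :: "real \<Rightarrow> L2"
  assumes t: "0 \<le> t"
    and y: "\<And>s. s \<in> {0..t} \<Longrightarrow> (y has_vector_derivative A \<odot> y s + g s) (at s within {0..t})"
  shows "y t = op_semigroup A t \<odot> y 0 + integral {0..t} (\<lambda>s. op_semigroup A (t - s) \<odot> g s)"
proof -
  have "((\<lambda>s. op_semigroup A (t - s) \<odot> y s) has_vector_derivative op_semigroup A (t - s) \<odot> g s) (at s within {0..t})"
    if "s \<in> {0..t}" for s
    by (rule has_vector_derivative_eq_rhs[OF bop.has_vector_derivative[OF op_semigroup_derivative_reversed y[OF that]]])
       (simp add: bop.add_right bop.minus_left)
  from integral_vector_derivative_eq[OF this t] show ?thesis by simp
qed

section \<open>The stochastic convolution\<close>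

text \<open>\<open>stoch_conv A t\<close> is \<open>\<integral>\<^sub>0\<^sup>t e\<^bsup>A(t-s)\<^esup> dw s\<close> after integration by parts, which makes sense path
  by path.\<close>

context q_noise
begin

definition stoch_conv :: "bop \<Rightarrow> real \<Rightarrow> 'w \<Rightarrow> L2" where
  "stoch_conv A t \<omega> = w t \<omega> + integral {0..t} (\<lambda>s. (op_semigroup A (t - s) * A) \<odot> w s \<omega>)"

lemma w_continuous_on: "\<omega> \<in> space P \<Longrightarrow> 0 \<le> a \<Longrightarrow> continuous_on {a..b} (\<lambda>t. w t \<omega>)"
  by (rule continuous_on_subset[OF w_continuous]) auto

lemma stoch_conv_measurable:
  assumes "0 \<le> t"
  shows "stoch_conv A t \<in> borel_measurable P"
proof -
  have "(\<lambda>\<omega>. integral {0..t} (\<lambda>s. (op_semigroup A (t - s) * A) \<odot> w s \<omega>)) \<in> borel_measurable P"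
  proof (rule measurable_integral_process[OF assms])
    show "(\<lambda>\<omega>. (op_semigroup A (t - s) * A) \<odot> w s \<omega>) \<in> borel_measurable P" if "s \<in> {0..t}" for s
      by (rule measurable_compose[OF w_measurable bop_apply_measurable]) (use that in auto)
    show "continuous_on {0..t} (\<lambda>s. (op_semigroup A (t - s) * A) \<odot> w s \<omega>)" if "\<omega> \<in> space P" for \<omega>
      by (intro continuous_intros w_continuous_on that) auto
  qed
  then show ?thesis
    unfolding stoch_conv_def using w_measurable[OF assms] by (rule borel_measurable_add[rotated])
qed

text \<open>The error of a Riemann sum for the stochastic convolution is a sum of such terms over the mesh
  intervals. The square of the length leaves a factor that tends to \<open>0\<close> after summation.\<close>

lemma nn_integral_increments:
  assumes ab: "0 \<le> a" "a \<le> b"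
  shows "(\<integral>\<^sup>+\<omega>. ennreal (integral {a..b} (\<lambda>s. (norm (w b \<omega> - w s \<omega>))\<^sup>2)) \<partial>P)
    \<le> ennreal (trace_bound * (b - a)\<^sup>2)"
proof -
  interpret H: sigma_finite_measure "restrict_space lborel {0::real..}" by (rule sigma_finite_halfline)
  interpret pair_sigma_finite P "restrict_space lborel {0::real..}" ..
  let ?H = "restrict_space lborel {0::real..}"
  let ?g = "\<lambda>s \<omega>. (norm (w b \<omega> - w s \<omega>))\<^sup>2"
  have [measurable]: "(\<lambda>(s, \<omega>). w s \<omega>) \<in> borel_measurable (?H \<Otimes>\<^sub>M P)"
    by (rule jointly_measurable_of_continuous[OF w_measurable w_continuous])
  have [measurable]: "w b \<in> borel_measurable P" using ab by (intro w_measurable) auto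
  have [measurable]: "{a..b} \<in> sets ?H" using ab by (auto simp: sets_restrict_space_iff)
  have j: "(\<lambda>(s, \<omega>). ennreal (indicator {a..b} s * ?g s \<omega>)) \<in> borel_measurable (?H \<Otimes>\<^sub>M P)"
    by measurable
  have j': "(\<lambda>(\<omega>, s). ennreal (indicator {a..b} s * ?g s \<omega>)) \<in> borel_measurable (P \<Otimes>\<^sub>M ?H)"
    using measurable_compose[OF measurable_pair_swap' j] by (simp add: case_prod_beta')
  have "(\<integral>\<^sup>+\<omega>. ennreal (integral {a..b} (\<lambda>s. ?g s \<omega>)) \<partial>P)
      = (\<integral>\<^sup>+\<omega>. \<integral>\<^sup>+s. ennreal (indicator {a..b} s * ?g s \<omega>) \<partial>?H \<partial>P)"
  proof (rule nn_integral_cong)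
    fix \<omega> assume o: "\<omega> \<in> space P"
    have "ennreal (integral {a..b} (\<lambda>s. ?g s \<omega>)) = (\<integral>\<^sup>+s. ennreal (indicator {a..b} s * ?g s \<omega>) \<partial>lborel)"
      by (rule integral_eq_nn_integral) (auto intro!: continuous_intros w_continuous_on o ab)
    also have "\<dots> = (\<integral>\<^sup>+s. ennreal (indicator {a..b} s * ?g s \<omega>) \<partial>?H)"
      using ab by (subst nn_integral_restrict_space) (auto intro!: nn_integral_cong simp: indicator_def)
    finally show "ennreal (integral {a..b} (\<lambda>s. ?g s \<omega>)) = (\<integral>\<^sup>+s. ennreal (indicator {a..b} s * ?g s \<omega>) \<partial>?H)" .
  qed
  also have "\<dots> = (\<integral>\<^sup>+s. \<integral>\<^sup>+\<omega>. ennreal (indicator {a..b} s * ?g s \<omega>) \<partial>P \<partial>?H)"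
    using Fubini[OF j'] by simp
  also have "\<dots> \<le> (\<integral>\<^sup>+s. ennreal (trace_bound * (b - a)) * indicator {a..b} s \<partial>?H)"
  proof (rule nn_integral_mono)
    fix s
    show "(\<integral>\<^sup>+\<omega>. ennreal (indicator {a..b} s * ?g s \<omega>) \<partial>P) \<le> ennreal (trace_bound * (b - a)) * indicator {a..b} s"
    proof (cases "s \<in> {a..b}")
      case True
      then have "(\<integral>\<^sup>+\<omega>. ennreal (?g s \<omega>) \<partial>P) \<le> ennreal (trace_bound * (b - s))"
        using ab by (intro increment_second_moment) auto
      also have "\<dots> \<le> ennreal (trace_bound * (b - a))"
        using True trace_bound_nonneg by (intro ennreal_leI mult_left_mono) auto
      finally show ?thesis using True by simp
    qed simp
  qed
  also have "\<dots> = ennreal (trace_bound * (b - a)) * ennreal (b - a)"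
  proof -
    have "emeasure ?H {a..b} = ennreal (b - a)"
      using ab by (subst emeasure_restrict_space) auto
    then show ?thesis by (simp add: nn_integral_cmult_indicator)
  qed
  also have "\<dots> = ennreal (trace_bound * (b - a)\<^sup>2)"
    using ab trace_bound_nonneg by (subst ennreal_mult[symmetric]) (auto simp: power2_eq_square mult_ac)
  finally show ?thesis .
qed

text \<open>Summation by parts turns the difference between the Riemann sum and \<open>stoch_conv\<close> into integrals
  of the increments of \<open>w\<close> over the mesh intervals, whose mean square is of the order of the mesh.\<close>

lemma stoch_conv_riemann_sum:
  assumes t: "0 \<le> t" and n: "0 < n" and \<omega>: "\<omega> \<in> space P"
  defines "\<tau> \<equiv> \<lambda>k. t * real k / real n"
  shows "(\<Sum>k<n. op_semigroup A (t - \<tau> k) \<odot> (w (\<tau> (Suc k)) \<omega> - w (\<tau> k) \<omega>)) - stoch_conv A t \<omega>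
    = (\<Sum>k<n. integral {\<tau> k..\<tau> (Suc k)} (\<lambda>s. (op_semigroup A (t - s) * A) \<odot> (w (\<tau> (Suc k)) \<omega> - w s \<omega>)))"
proof -
  define \<Phi> where "\<Phi> s = op_semigroup A (t - s)" for s
  have \<tau>: "0 \<le> \<tau> k" "\<tau> k \<le> \<tau> (Suc k)" "\<tau> 0 = 0" "\<tau> n = t" for k
    using t n by (auto simp: \<tau>_def divide_right_mono mult_left_mono)
  have \<Phi>c: "continuous_on S (\<lambda>s. \<Phi> s * A)" for S
    unfolding \<Phi>_def by (intro continuous_intros)
  have step: "(\<Phi> (\<tau> k) - \<Phi> (\<tau> (Suc k))) \<odot> v = integral {\<tau> k..\<tau> (Suc k)} (\<lambda>s. (\<Phi> s * A) \<odot> v)" for k v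
  proof -
    have "((\<lambda>s. (\<Phi> s * A) \<odot> v) has_integral (- \<Phi> (\<tau> (Suc k))) \<odot> v - (- \<Phi> (\<tau> k)) \<odot> v) {\<tau> k..\<tau> (Suc k)}"
    proof (rule fundamental_theorem_of_calculus[OF \<tau>(2)])
      fix s
      have "((\<lambda>s. - \<Phi> s) has_vector_derivative \<Phi> s * A) (at s within {\<tau> k..\<tau> (Suc k)})"
        unfolding \<Phi>_def by (rule has_vector_derivative_eq_rhs[OF has_vector_derivative_minus[OF op_semigroup_derivative_reversed]]) simp
      then show "((\<lambda>s. (- \<Phi> s) \<odot> v) has_vector_derivative (\<Phi> s * A) \<odot> v) (at s within {\<tau> k..\<tau> (Suc k)})"
        by (rule bounded_linear.has_vector_derivative[OF bop.bounded_linear_left])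
    qed
    then show ?thesis by (simp add: integral_unique bop.minus_left bop.diff_left del: bop_apply_mult)
  qed
  have combine: "integral {0..\<tau> m} (\<lambda>s. (\<Phi> s * A) \<odot> w s \<omega>) = (\<Sum>k<m. integral {\<tau> k..\<tau> (Suc k)} (\<lambda>s. (\<Phi> s * A) \<odot> w s \<omega>))" for m
  proof (induction m)
    case 0
    then show ?case by (simp add: \<tau>)
  next
    case (Suc m)
    have "(\<lambda>s. (\<Phi> s * A) \<odot> w s \<omega>) integrable_on {0..\<tau> (Suc m)}"
      by (intro integrable_continuous_real continuous_on_bop_apply \<Phi>c w_continuous_on \<omega>) simp
    from Henstock_Kurzweil_Integration.integral_combine[OF \<tau>(1)[of m] \<tau>(2)[of m] this] Suc show ?case by simp
  qed
  have abel: "(\<Sum>k<m. \<Phi> (\<tau> k) \<odot> (w (\<tau> (Suc k)) \<omega> - w (\<tau> k) \<omega>))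
      = (\<Sum>k<m. (\<Phi> (\<tau> k) - \<Phi> (\<tau> (Suc k))) \<odot> w (\<tau> (Suc k)) \<omega>) + \<Phi> (\<tau> m) \<odot> w (\<tau> m) \<omega>" for m
    by (induction m) (simp_all add: \<tau> w_0[OF \<omega>] bop.zero_right bop.diff_left bop.diff_right)
  have "(\<Sum>k<n. \<Phi> (\<tau> k) \<odot> (w (\<tau> (Suc k)) \<omega> - w (\<tau> k) \<omega>)) - stoch_conv A t \<omega>
      = (\<Sum>k<n. integral {\<tau> k..\<tau> (Suc k)} (\<lambda>s. (\<Phi> s * A) \<odot> w (\<tau> (Suc k)) \<omega>)
          - integral {\<tau> k..\<tau> (Suc k)} (\<lambda>s. (\<Phi> s * A) \<odot> w s \<omega>))"
    unfolding abel step stoch_conv_def \<Phi>_def[symmetric] sum_subtractf combine[of n, unfolded \<tau>(4), symmetric]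
    by (simp add: \<tau>(4)) (simp add: \<Phi>_def)
  also have "\<dots> = (\<Sum>k<n. integral {\<tau> k..\<tau> (Suc k)} (\<lambda>s. (\<Phi> s * A) \<odot> (w (\<tau> (Suc k)) \<omega> - w s \<omega>)))"
  proof (rule sum.cong[OF refl])
    fix k
    have "(\<lambda>s. (\<Phi> s * A) \<odot> w (\<tau> (Suc k)) \<omega>) integrable_on {\<tau> k..\<tau> (Suc k)}"
      "(\<lambda>s. (\<Phi> s * A) \<odot> w s \<omega>) integrable_on {\<tau> k..\<tau> (Suc k)}"
      by (intro integrable_continuous_real continuous_on_bop_apply continuous_on_const \<Phi>c w_continuous_on \<omega> \<tau>)+
    from integral_diff[OF this]
    show "integral {\<tau> k..\<tau> (Suc k)} (\<lambda>s. (\<Phi> s * A) \<odot> w (\<tau> (Suc k)) \<omega>) - integral {\<tau> k..\<tau> (Suc k)} (\<lambda>s. (\<Phi> s * A) \<odot> w s \<omega>)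
      = integral {\<tau> k..\<tau> (Suc k)} (\<lambda>s. (\<Phi> s * A) \<odot> (w (\<tau> (Suc k)) \<omega> - w s \<omega>))"
      by (simp only: bop.diff_right)
  qed
  finally show ?thesis by (simp only: \<Phi>_def)
qed

text \<open>With mesh \<open>t/n\<close> there are \<open>n\<close> error integrals. Cauchy--Schwarz for the sum costs a factor \<open>n\<close>, and for each
  integral it gains \<open>t/n\<close>; the expected squared increments contribute \<open>(t/n)\<^sup>2\<close>, so the mean square error
  is of order \<open>1/n\<close>.\<close>

lemma stoch_conv_is_wiener_integral:
  assumes t: "0 \<le> t"
  shows "is_wiener_integral P w t (\<lambda>s. exp_operator ((t - s) *\<^sub>R blinfun_of_bop A)) (stoch_conv A t)"
  unfolding is_wiener_integral_def
proof
  show "stoch_conv A t \<in> borel_measurable P" by (rule stoch_conv_measurable[OF t])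
  define K where "K = exp (t * norm A) * norm A"
  define err where "err n \<omega> = (\<Sum>k<n. op_semigroup A (t - t * real k / real n) \<odot>
      (w (t * real (Suc k) / real n) \<omega> - w (t * real k / real n) \<omega>)) - stoch_conv A t \<omega>" for n \<omega>
  have K0: "0 \<le> K" by (simp add: K_def)
  have main: "(\<integral>\<^sup>+\<omega>. ennreal ((norm (err n \<omega>))\<^sup>2) \<partial>P) \<le> ennreal (t ^ 3 * K\<^sup>2 * trace_bound * inverse (real n))"
    if n: "0 < n" for n
  proof -
    define \<tau> where "\<tau> k = t * real k / real n" for k
    have \<tau>: "0 \<le> \<tau> k" "\<tau> k \<le> \<tau> (Suc k)" "\<tau> (Suc k) - \<tau> k = t / real n" for k
      using t n by (auto simp: \<tau>_def divide_right_mono mult_left_mono field_simps)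
    have \<tau>t: "\<tau> (Suc k) \<le> t" if "k < n" for k
    proof -
      have "t * real (Suc k) \<le> t * real n" using that t by (intro mult_left_mono) auto
      then show ?thesis using n by (simp add: \<tau>_def pos_divide_le_eq)
    qed
    define D where "D k \<omega> = integral {\<tau> k..\<tau> (Suc k)} (\<lambda>s. (norm (w (\<tau> (Suc k)) \<omega> - w s \<omega>))\<^sup>2)" for k \<omega>
    have pathwise: "(norm (err n \<omega>))\<^sup>2 \<le> (\<Sum>k<n. t * K\<^sup>2 * D k \<omega>)" if \<omega>: "\<omega> \<in> space P" for \<omega>
    proof -
      let ?I = "\<lambda>k. integral {\<tau> k..\<tau> (Suc k)} (\<lambda>s. (op_semigroup A (t - s) * A) \<odot> (w (\<tau> (Suc k)) \<omega> - w s \<omega>))"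
      have e: "err n \<omega> = (\<Sum>k<n. ?I k)"
        unfolding err_def \<tau>_def by (rule stoch_conv_riemann_sum[OF t n \<omega>])
      have "(norm (err n \<omega>))\<^sup>2 \<le> (\<Sum>k<n. norm (?I k))\<^sup>2"
        unfolding e by (intro power_mono norm_sum) auto
      also have "\<dots> \<le> (\<Sum>k<n. (norm (?I k))\<^sup>2) * (\<Sum>k<n. 1\<^sup>2)"
        using Cauchy_Schwarz_ineq_sum[of "\<lambda>k. norm (?I k)" "\<lambda>_. 1" "{..<n}"] by simp
      also have "\<dots> = (\<Sum>k<n. real n * (norm (?I k))\<^sup>2)" by (simp add: sum_distrib_left mult.commute)
      also have "\<dots> \<le> (\<Sum>k<n. t * K\<^sup>2 * D k \<omega>)"
      proof (rule sum_mono)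
        fix k assume k: "k \<in> {..<n}"
        let ?f = "\<lambda>s. (op_semigroup A (t - s) * A) \<odot> (w (\<tau> (Suc k)) \<omega> - w s \<omega>)"
        have fc: "continuous_on {\<tau> k..\<tau> (Suc k)} ?f"
          by (intro continuous_intros w_continuous_on \<omega> \<tau>)
        have dc: "continuous_on {\<tau> k..\<tau> (Suc k)} (\<lambda>s. (norm (w (\<tau> (Suc k)) \<omega> - w s \<omega>))\<^sup>2)"
          by (intro continuous_intros w_continuous_on \<omega> \<tau>)
        have "(norm (?I k))\<^sup>2 \<le> (\<tau> (Suc k) - \<tau> k) * integral {\<tau> k..\<tau> (Suc k)} (\<lambda>s. (norm (?f s))\<^sup>2)"
          by (rule norm_integral_squared_le[OF fc \<tau>(2)])
        also have "integral {\<tau> k..\<tau> (Suc k)} (\<lambda>s. (norm (?f s))\<^sup>2) \<le> integral {\<tau> k..\<tau> (Suc k)} (\<lambda>s. K\<^sup>2 * (norm (w (\<tau> (Suc k)) \<omega> - w s \<omega>))\<^sup>2)"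
        proof (rule integral_le)
          show "(\<lambda>s. (norm (?f s))\<^sup>2) integrable_on {\<tau> k..\<tau> (Suc k)}"
            by (intro integrable_continuous_real continuous_on_power continuous_on_norm fc)
          show "(\<lambda>s. K\<^sup>2 * (norm (w (\<tau> (Suc k)) \<omega> - w s \<omega>))\<^sup>2) integrable_on {\<tau> k..\<tau> (Suc k)}"
            by (intro integrable_continuous_real continuous_on_mult_left dc)
          fix s assume s: "s \<in> {\<tau> k..\<tau> (Suc k)}"
          then have s': "0 \<le> s" "s \<le> t" using \<tau>(1)[of k] \<tau>t[of k] k by auto
          have "norm (op_semigroup A (t - s) * A) \<le> norm (op_semigroup A (t - s)) * norm A" by (rule norm_mult_ineq)
          also have "norm (op_semigroup A (t - s)) \<le> exp (t * norm A)"
            using s' by (intro order_trans[OF norm_semigroup]) (simp add: mult_right_mono)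
          finally have "norm (op_semigroup A (t - s) * A) \<le> K" by (simp add: K_def mult_right_mono)
          then have "norm (?f s) \<le> K * norm (w (\<tau> (Suc k)) \<omega> - w s \<omega>)"
            by (intro order_trans[OF norm_bop_apply] mult_right_mono) auto
          then have "(norm (?f s))\<^sup>2 \<le> (K * norm (w (\<tau> (Suc k)) \<omega> - w s \<omega>))\<^sup>2"
            by (intro power_mono) auto
          then show "(norm (?f s))\<^sup>2 \<le> K\<^sup>2 * (norm (w (\<tau> (Suc k)) \<omega> - w s \<omega>))\<^sup>2" by (simp add: power_mult_distrib)
        qed
        also have "\<dots> = K\<^sup>2 * D k \<omega>" by (simp add: D_def)
        finally have "(norm (?I k))\<^sup>2 \<le> t / real n * (K\<^sup>2 * D k \<omega>)"
          using t n unfolding \<tau>(3) by (simp add: mult_left_mono divide_right_mono)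
        then have "real n * (norm (?I k))\<^sup>2 \<le> real n * (t / real n * (K\<^sup>2 * D k \<omega>))"
          by (intro mult_left_mono) auto
        then show "real n * (norm (?I k))\<^sup>2 \<le> t * K\<^sup>2 * D k \<omega>" using n by (simp add: mult.assoc)
      qed
      finally show ?thesis .
    qed
    have D0: "0 \<le> D k \<omega>" if "\<omega> \<in> space P" for k \<omega>
      unfolding D_def
      by (intro integral_nonneg integrable_continuous_real continuous_intros w_continuous_on that \<tau>) auto
    have Dm: "D k \<in> borel_measurable P" for k
    proof -
      have i: "(\<lambda>\<omega>. integral {0..c} (\<lambda>s. (norm (w (\<tau> (Suc k)) \<omega> - w s \<omega>))\<^sup>2)) \<in> borel_measurable P"
        if "0 \<le> c" for c
      proof (rule measurable_integral_process[OF that])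
        show "(\<lambda>\<omega>. (norm (w (\<tau> (Suc k)) \<omega> - w s \<omega>))\<^sup>2) \<in> borel_measurable P" if "s \<in> {0..c}" for s
          using w_measurable[OF \<tau>(1), of "Suc k"] w_measurable[of s] that by auto
      qed (intro continuous_intros w_continuous_on, auto)
      have "D k \<omega> = integral {0..\<tau> (Suc k)} (\<lambda>s. (norm (w (\<tau> (Suc k)) \<omega> - w s \<omega>))\<^sup>2)
          - integral {0..\<tau> k} (\<lambda>s. (norm (w (\<tau> (Suc k)) \<omega> - w s \<omega>))\<^sup>2)" if "\<omega> \<in> space P" for \<omega>
      proof -
        have "(\<lambda>s. (norm (w (\<tau> (Suc k)) \<omega> - w s \<omega>))\<^sup>2) integrable_on {0..\<tau> (Suc k)}"
          by (intro integrable_continuous_real continuous_intros w_continuous_on that) simp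
        from Henstock_Kurzweil_Integration.integral_combine[OF \<tau>(1)[of k] \<tau>(2)[of k] this] show ?thesis by (simp add: D_def)
      qed
      then have "D k \<in> borel_measurable P \<longleftrightarrow> (\<lambda>\<omega>. integral {0..\<tau> (Suc k)} (\<lambda>s. (norm (w (\<tau> (Suc k)) \<omega> - w s \<omega>))\<^sup>2)
          - integral {0..\<tau> k} (\<lambda>s. (norm (w (\<tau> (Suc k)) \<omega> - w s \<omega>))\<^sup>2)) \<in> borel_measurable P"
        by (rule measurable_cong)
      then show ?thesis using i[OF \<tau>(1), of "Suc k"] i[OF \<tau>(1), of k] by simp
    qed
    have "(\<integral>\<^sup>+\<omega>. ennreal ((norm (err n \<omega>))\<^sup>2) \<partial>P) \<le> (\<integral>\<^sup>+\<omega>. (\<Sum>k<n. ennreal (t * K\<^sup>2) * ennreal (D k \<omega>)) \<partial>P)"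
    proof (rule nn_integral_mono)
      fix \<omega> assume \<omega>: "\<omega> \<in> space P"
      have "ennreal ((norm (err n \<omega>))\<^sup>2) \<le> ennreal (\<Sum>k<n. t * K\<^sup>2 * D k \<omega>)"
        by (rule ennreal_leI[OF pathwise[OF \<omega>]])
      also have "\<dots> = (\<Sum>k<n. ennreal (t * K\<^sup>2 * D k \<omega>))"
        using t D0[OF \<omega>] by (intro sum_ennreal[symmetric]) auto
      also have "\<dots> = (\<Sum>k<n. ennreal (t * K\<^sup>2) * ennreal (D k \<omega>))"
        using t D0[OF \<omega>] by (intro sum.cong refl ennreal_mult) auto
      finally show "ennreal ((norm (err n \<omega>))\<^sup>2) \<le> (\<Sum>k<n. ennreal (t * K\<^sup>2) * ennreal (D k \<omega>))" .
    qed
    also have "\<dots> = (\<Sum>k<n. ennreal (t * K\<^sup>2) * (\<integral>\<^sup>+\<omega>. ennreal (D k \<omega>) \<partial>P))"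
      using Dm by (simp add: nn_integral_sum nn_integral_cmult)
    also have "\<dots> \<le> (\<Sum>k<n. ennreal (t * K\<^sup>2) * ennreal (trace_bound * (t / real n)\<^sup>2))"
      using nn_integral_increments[OF \<tau>(1,2)] unfolding \<tau>(3) D_def by (intro sum_mono mult_left_mono) auto
    also have "\<dots> = ennreal (\<Sum>k<n. t * K\<^sup>2 * (trace_bound * (t / real n)\<^sup>2))"
      using t trace_bound_nonneg by (subst sum_ennreal[symmetric]) (auto simp: ennreal_mult)
    also have "(\<Sum>k<n. t * K\<^sup>2 * (trace_bound * (t / real n)\<^sup>2)) = t ^ 3 * K\<^sup>2 * trace_bound * inverse (real n)"
      using n by (simp add: power2_eq_square power3_eq_cube field_simps)
    finally show ?thesis .
  qed
  have "(\<lambda>n. \<integral>\<^sup>+\<omega>. ennreal ((norm (err n \<omega>))\<^sup>2) \<partial>P) \<longlonglongrightarrow> 0"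
  proof (rule tendsto_sandwich[OF _ _ tendsto_const])
    have "(\<lambda>n. t ^ 3 * K\<^sup>2 * trace_bound * inverse (real n)) \<longlonglongrightarrow> t ^ 3 * K\<^sup>2 * trace_bound * 0"
      by (intro tendsto_intros lim_inverse_n)
    then show "(\<lambda>n. ennreal (t ^ 3 * K\<^sup>2 * trace_bound * inverse (real n))) \<longlonglongrightarrow> 0"
      using tendsto_ennrealI by fastforce
    show "\<forall>\<^sub>F n in sequentially. (\<integral>\<^sup>+\<omega>. ennreal ((norm (err n \<omega>))\<^sup>2) \<partial>P) \<le> ennreal (t ^ 3 * K\<^sup>2 * trace_bound * inverse (real n))"
      using eventually_gt_at_top[of 0] by eventually_elim (rule main)
  qed simp
  then show "(\<lambda>n. \<integral>\<^sup>+\<omega>. ennreal ((norm ((\<Sum>k<n. exp_operator ((t - t * real k / real n) *\<^sub>R blinfun_of_bop A)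
      (w (t * real (Suc k) / real n) \<omega> - w (t * real k / real n) \<omega>)) - stoch_conv A t \<omega>))\<^sup>2) \<partial>P) \<longlonglongrightarrow> 0"
    by (simp only: err_def exp_operator_semigroup blinfun_of_bop_inverse)
qed

text \<open>Mean square limits of the same Riemann sums; the integral is determined only up to null sets.\<close>

lemma wiener_integral_unique:
  assumes t: "0 \<le> t" and Z: "is_wiener_integral P w t \<Phi> Z" and Z': "is_wiener_integral P w t \<Phi> Z'"
  shows "AE \<omega> in P. Z \<omega> = Z' \<omega>"
proof -
  define S where "S n \<omega> = (\<Sum>k<n. \<Phi> (t * real k / real n) (w (t * real (Suc k) / real n) \<omega> - w (t * real k / real n) \<omega>))" for n \<omega>
  have [measurable]: "Z \<in> borel_measurable P" "Z' \<in> borel_measurable P"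
    using Z Z' by (auto simp: is_wiener_integral_def)
  have [measurable]: "S n \<in> borel_measurable P" for n
  proof -
    have "(\<lambda>\<omega>. blinfun_apply (\<Phi> (t * real k / real n)) (w (t * real (Suc k) / real n) \<omega> - w (t * real k / real n) \<omega>)) \<in> borel_measurable P" for k
    proof (rule measurable_compose[where g = "blinfun_apply (\<Phi> (t * real k / real n))"])
      show "(\<lambda>\<omega>. w (t * real (Suc k) / real n) \<omega> - w (t * real k / real n) \<omega>) \<in> borel_measurable P"
        using t by (intro borel_measurable_diff w_measurable) auto
      show "blinfun_apply (\<Phi> (t * real k / real n)) \<in> borel_measurable borel"
        by (intro borel_measurable_continuous_onI continuous_intros)
    qed
    then show ?thesis unfolding S_def by (intro borel_measurable_sum)
  qed
  have lim: "(\<lambda>n. 2 * (\<integral>\<^sup>+\<omega>. ennreal ((norm (S n \<omega> - Z \<omega>))\<^sup>2) \<partial>P) + 2 * (\<integral>\<^sup>+\<omega>. ennreal ((norm (S n \<omega> - Z' \<omega>))\<^sup>2) \<partial>P)) \<longlonglongrightarrow> 2 * 0 + 2 * 0"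
    using Z Z' unfolding is_wiener_integral_def S_def
    by (intro tendsto_add ennreal_tendsto_cmult) auto
  have "(\<integral>\<^sup>+\<omega>. ennreal ((norm (Z \<omega> - Z' \<omega>))\<^sup>2) \<partial>P) \<le> 2 * (\<integral>\<^sup>+\<omega>. ennreal ((norm (S n \<omega> - Z \<omega>))\<^sup>2) \<partial>P) + 2 * (\<integral>\<^sup>+\<omega>. ennreal ((norm (S n \<omega> - Z' \<omega>))\<^sup>2) \<partial>P)" for n
  proof -
    have "(\<integral>\<^sup>+\<omega>. ennreal ((norm (Z \<omega> - Z' \<omega>))\<^sup>2) \<partial>P)
        \<le> (\<integral>\<^sup>+\<omega>. 2 * ennreal ((norm (S n \<omega> - Z \<omega>))\<^sup>2) + 2 * ennreal ((norm (S n \<omega> - Z' \<omega>))\<^sup>2) \<partial>P)"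
    proof (rule nn_integral_mono)
      fix \<omega>
      have "(norm (Z \<omega> - Z' \<omega>))\<^sup>2 \<le> (norm (S n \<omega> - Z \<omega>) + norm (S n \<omega> - Z' \<omega>))\<^sup>2"
        using norm_triangle_ineq4[of "S n \<omega> - Z' \<omega>" "S n \<omega> - Z \<omega>"] by (intro power_mono) auto
      also have "\<dots> \<le> 2 * (norm (S n \<omega> - Z \<omega>))\<^sup>2 + 2 * (norm (S n \<omega> - Z' \<omega>))\<^sup>2"
        using sum_squares_bound[of "norm (S n \<omega> - Z \<omega>)" "norm (S n \<omega> - Z' \<omega>)"] by (simp add: power2_sum)
      finally have "ennreal ((norm (Z \<omega> - Z' \<omega>))\<^sup>2) \<le> ennreal (2 * (norm (S n \<omega> - Z \<omega>))\<^sup>2 + 2 * (norm (S n \<omega> - Z' \<omega>))\<^sup>2)"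
        by (rule ennreal_leI)
      then show "ennreal ((norm (Z \<omega> - Z' \<omega>))\<^sup>2) \<le> 2 * ennreal ((norm (S n \<omega> - Z \<omega>))\<^sup>2) + 2 * ennreal ((norm (S n \<omega> - Z' \<omega>))\<^sup>2)"
        by (simp add: ennreal_plus ennreal_mult)
    qed
    also have "\<dots> = 2 * (\<integral>\<^sup>+\<omega>. ennreal ((norm (S n \<omega> - Z \<omega>))\<^sup>2) \<partial>P) + 2 * (\<integral>\<^sup>+\<omega>. ennreal ((norm (S n \<omega> - Z' \<omega>))\<^sup>2) \<partial>P)"
      by (simp add: nn_integral_add nn_integral_cmult)
    finally show ?thesis .
  qed
  then have "(\<integral>\<^sup>+\<omega>. ennreal ((norm (Z \<omega> - Z' \<omega>))\<^sup>2) \<partial>P) \<le> 2 * 0 + 2 * 0"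
    by (intro LIMSEQ_le_const[OF lim]) auto
  then have "(\<integral>\<^sup>+\<omega>. ennreal ((norm (Z \<omega> - Z' \<omega>))\<^sup>2) \<partial>P) = 0" by simp
  then have "AE \<omega> in P. ennreal ((norm (Z \<omega> - Z' \<omega>))\<^sup>2) = 0"
    by (subst (asm) nn_integral_0_iff_AE) auto
  then show ?thesis by eventually_elim simp
qed

end

section \<open>Linear feedback loops\<close>

context q_noise
begin

text \<open>The closed loop \<open>dx = F x dt + dw\<close>, stated path by path for the absolutely continuous part
  \<open>x - w\<close>.\<close>

definition closed_loop :: "(real \<Rightarrow> bop) \<Rightarrow> L2 \<Rightarrow> (real \<Rightarrow> 'w \<Rightarrow> L2) \<Rightarrow> bool" where
  "closed_loop F x0 x \<longleftrightarrow> (\<forall>t\<ge>0. x t \<in> borel_measurable (history P w t)) \<and>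
    (\<forall>\<omega>\<in>space P. x 0 \<omega> = x0 \<and> continuous_on {0..} (\<lambda>t. x t \<omega>) \<and>
      (\<forall>t\<ge>0. ((\<lambda>t. x t \<omega> - w t \<omega>) has_vector_derivative F t \<odot> x t \<omega>) (at t within {0..})))"

lemma closed_loopD:
  assumes "closed_loop F x0 x"
  shows "0 \<le> t \<Longrightarrow> x t \<in> borel_measurable (history P w t)"
    "\<omega> \<in> space P \<Longrightarrow> x 0 \<omega> = x0"
    "\<omega> \<in> space P \<Longrightarrow> continuous_on {0..} (\<lambda>t. x t \<omega>)"
    "\<omega> \<in> space P \<Longrightarrow> 0 \<le> t \<Longrightarrow> ((\<lambda>t. x t \<omega> - w t \<omega>) has_vector_derivative F t \<odot> x t \<omega>) (at t within {0..})"
  using assms unfolding closed_loop_def by blast+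

lemma closed_loop_continuous_on:
  "closed_loop F x0 x \<Longrightarrow> \<omega> \<in> space P \<Longrightarrow> 0 \<le> a \<Longrightarrow> continuous_on {a..b} (\<lambda>t. x t \<omega>)"
  by (rule continuous_on_subset[OF closed_loopD(3)]) auto

lemma closed_loop_jointly_measurable:
  assumes "closed_loop F x0 x"
  shows "(\<lambda>(t, \<omega>). x t \<omega>) \<in> borel_measurable (restrict_space lborel {0..} \<Otimes>\<^sub>M P)"
  using closed_loopD[OF assms] by (intro jointly_measurable_of_continuous) (auto intro: measurable_of_history)

text \<open>Variation of constants for \<open>y = x - w\<close>, which solves \<open>y' = F y + F w\<close> path by path. The expression depends
  on the path of \<open>w\<close> only up to time \<open>t\<close>, so the solution is adapted.\<close>

lemma closed_loop_exists:
  assumes F: "continuous_on {0..} F" and bound: "\<And>t. 0 \<le> t \<Longrightarrow> norm (F t) \<le> L"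
  shows "\<exists>x. closed_loop F x0 x"
proof -
  obtain V U where V0: "V 0 = 1"
    and V: "\<And>t. 0 \<le> t \<Longrightarrow> (V has_vector_derivative F t * V t) (at t within {0..})"
    and U: "\<And>t. 0 \<le> t \<Longrightarrow> (U has_vector_derivative - (U t * F t)) (at t within {0..})"
    and VU: "\<And>t. 0 \<le> t \<Longrightarrow> V t * U t = 1"
    using evolution_operator[OF F bound] by blast
  have Uc: "continuous_on {0..} U" using U by (intro continuous_on_vector_derivative) auto
  define g where "g \<omega> s = (U s * F s) \<odot> w s \<omega>" for \<omega> s
  have gc: "continuous_on {0..} (g \<omega>)" if "\<omega> \<in> space P" for \<omega>
    unfolding g_def by (intro continuous_intros Uc F w_continuous that)
  define y where "y t \<omega> = V t \<odot> (x0 + integral {0..t} (g \<omega>))" for t \<omega>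
  define x where "x t \<omega> = w t \<omega> + y t \<omega>" for t \<omega>
  have y': "((\<lambda>t. y t \<omega>) has_vector_derivative F t \<odot> x t \<omega>) (at t within {0..})"
    if o: "\<omega> \<in> space P" and t: "0 \<le> t" for t \<omega>
  proof -
    have "((\<lambda>t. x0 + integral {0..t} (g \<omega>)) has_vector_derivative g \<omega> t) (at t within {0..})"
      using integral_has_vector_derivative_halfline[OF gc[OF o] t] by (auto intro!: derivative_eq_intros)
    from bop.has_vector_derivative[OF V[OF t] this]
    have "((\<lambda>t. y t \<omega>) has_vector_derivative V t \<odot> g \<omega> t + (F t * V t) \<odot> (x0 + integral {0..t} (g \<omega>))) (at t within {0..})"
      unfolding y_def .
    moreover have "V t \<odot> g \<omega> t = F t \<odot> w t \<omega>"
    proof -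
      have "V t \<odot> g \<omega> t = (V t * U t) \<odot> F t \<odot> w t \<omega>" by (simp add: g_def)
      then show ?thesis by (simp only: VU[OF t] bop_apply_one)
    qed
    ultimately show ?thesis by (simp add: x_def y_def bop.add_right)
  qed
  have "closed_loop F x0 x"
    unfolding closed_loop_def
  proof (intro conjI allI ballI impI)
    fix t :: real assume t: "0 \<le> t"
    have "(\<lambda>\<omega>. integral {0..t} (\<lambda>s. g \<omega> s)) \<in> borel_measurable (history P w t)"
    proof (rule measurable_integral_process[OF t])
      show "(\<lambda>\<omega>. g \<omega> s) \<in> borel_measurable (history P w t)" if "s \<in> {0..t}" for s
        unfolding g_def using that
        by (intro measurable_compose[OF w_measurable_history bop_apply_measurable]) auto
      show "continuous_on {0..t} (g \<omega>)" if "\<omega> \<in> space (history P w t)" for \<omega>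
        using that by (intro continuous_on_subset[OF gc]) (auto simp: space_history)
    qed
    then have "y t \<in> borel_measurable (history P w t)"
      unfolding y_def by (intro measurable_compose[OF _ bop_apply_measurable] borel_measurable_add) auto
    then show "x t \<in> borel_measurable (history P w t)"
      unfolding x_def using t by (intro borel_measurable_add w_measurable_history) auto
  next
    fix \<omega> assume o: "\<omega> \<in> space P"
    show "x 0 \<omega> = x0" by (simp add: x_def y_def w_0[OF o] V0)
    have "continuous_on {0..} (\<lambda>t. y t \<omega>)" using y'[OF o] by (intro continuous_on_vector_derivative) auto
    then show "continuous_on {0..} (\<lambda>t. x t \<omega>)" unfolding x_def by (intro continuous_intros w_continuous o)
    show "((\<lambda>t. x t \<omega> - w t \<omega>) has_vector_derivative F t \<odot> x t \<omega>) (at t within {0..})" if "0 \<le> t" for t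
      using y'[OF o that] by (simp add: x_def)
  qed
  then show ?thesis by blast
qed

lemma closed_loop_integral:
  assumes x: "closed_loop F x0 x" and o: "\<omega> \<in> space P" and t: "0 \<le> t"
  shows "x t \<omega> = x0 + w t \<omega> + integral {0..t} (\<lambda>s. F s \<odot> x s \<omega>)"
proof -
  have "x t \<omega> - w t \<omega> = (x 0 \<omega> - w 0 \<omega>) + integral {0..t} (\<lambda>s. F s \<odot> x s \<omega>)"
    by (rule integral_vector_derivative_eq[OF _ t])
       (auto intro!: has_vector_derivative_within_subset[OF closed_loopD(4)[OF x o]])
  then show ?thesis by (simp add: closed_loopD(2)[OF x o] w_0[OF o] algebra_simps)
qed

text \<open>Variation of constants for \<open>x - w\<close> with generator \<open>A\<close>: the inhomogeneity is \<open>(F - A) x + A w\<close>, and its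
  second summand produces the integral in \<open>stoch_conv\<close>.\<close>

lemma closed_loop_mild:
  assumes x: "closed_loop F x0 x" and F: "continuous_on {0..} F" and o: "\<omega> \<in> space P" and t: "0 \<le> t"
  shows "x t \<omega> = op_semigroup A t \<odot> x0
    + integral {0..t} (\<lambda>s. op_semigroup A (t - s) \<odot> (F s - A) \<odot> x s \<omega>) + stoch_conv A t \<omega>"
proof -
  note xc = closed_loop_continuous_on[OF x o, of 0 t]
  have Fc: "continuous_on {0..t} F" by (rule continuous_on_subset[OF F]) auto
  define g where "g s = (F s - A) \<odot> x s \<omega> + A \<odot> w s \<omega>" for s
  have "x t \<omega> - w t \<omega> = op_semigroup A t \<odot> (x 0 \<omega> - w 0 \<omega>) + integral {0..t} (\<lambda>s. op_semigroup A (t - s) \<odot> g s)"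
  proof (rule variation_of_constants[where y = "\<lambda>t. x t \<omega> - w t \<omega>", OF t])
    fix s assume s: "s \<in> {0..t}"
    have "((\<lambda>t. x t \<omega> - w t \<omega>) has_vector_derivative F s \<odot> x s \<omega>) (at s within {0..t})"
      using s by (intro has_vector_derivative_within_subset[OF closed_loopD(4)[OF x o]]) auto
    moreover have "F s \<odot> x s \<omega> = A \<odot> (x s \<omega> - w s \<omega>) + g s"
      by (simp add: g_def bop.diff_left bop.diff_right)
    ultimately show "((\<lambda>t. x t \<omega> - w t \<omega>) has_vector_derivative A \<odot> (x s \<omega> - w s \<omega>) + g s) (at s within {0..t})"
      by simp
  qed
  moreover have "integral {0..t} (\<lambda>s. op_semigroup A (t - s) \<odot> g s)
      = integral {0..t} (\<lambda>s. op_semigroup A (t - s) \<odot> (F s - A) \<odot> x s \<omega>)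
      + integral {0..t} (\<lambda>s. (op_semigroup A (t - s) * A) \<odot> w s \<omega>)"
    unfolding g_def bop.add_right bop_apply_mult
    by (rule integral_add; intro integrable_continuous_real continuous_intros xc Fc w_continuous_on o; simp)
  ultimately show ?thesis
    using closed_loopD(2)[OF x o] w_0[OF o] by (simp add: stoch_conv_def algebra_simps)
qed

lemma w_second_moment:
  assumes "0 \<le> t"
  shows "(\<integral>\<^sup>+\<omega>. ennreal ((norm (w t \<omega>))\<^sup>2) \<partial>P) \<le> ennreal (trace_bound * t)"
proof -
  have "(\<integral>\<^sup>+\<omega>. ennreal ((norm (w t \<omega>))\<^sup>2) \<partial>P) = (\<integral>\<^sup>+\<omega>. ennreal ((norm (w t \<omega> - w 0 \<omega>))\<^sup>2) \<partial>P)"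
    by (intro nn_integral_cong) (simp add: w_0)
  then show ?thesis using increment_second_moment[of 0 t] assms by simp
qed

lemma norm_add_squared_le: "(norm (a + b))\<^sup>2 \<le> 2 * (norm a)\<^sup>2 + 2 * (norm b)\<^sup>2"
  for a b :: "'a::real_normed_vector"
proof -
  have "(norm (a + b))\<^sup>2 \<le> (norm a + norm b)\<^sup>2" by (intro power_mono norm_triangle_ineq) simp
  also have "\<dots> \<le> 2 * (norm a)\<^sup>2 + 2 * (norm b)\<^sup>2"
    using sum_squares_bound[of "norm a" "norm b"] by (simp add: power2_sum)
  finally show ?thesis .
qed

text \<open>Gronwall bounds each path by the path of \<open>w\<close>. The time integral of \<open>\<parallel>w s\<parallel>\<^sup>2\<close> is estimated through the
  increments up to \<open>T\<close>, whose expectation is known.\<close>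

lemma closed_loop_second_moment:
  assumes x: "closed_loop F x0 x" and F: "continuous_on {0..} F"
    and bound: "\<And>t. 0 \<le> t \<Longrightarrow> norm (F t) \<le> L" and T: "0 \<le> T"
  shows "\<exists>c\<ge>0. \<forall>t\<in>{0..T}. (\<integral>\<^sup>+\<omega>. ennreal ((norm (x t \<omega>))\<^sup>2) \<partial>P) \<le> ennreal c"
proof -
  define K where "K = \<bar>L\<bar> + 1"
  have K: "0 < K" "\<And>t. 0 \<le> t \<Longrightarrow> norm (F t) \<le> K" using bound by (fastforce simp: K_def)+
  define D where "D \<omega> = integral {0..T} (\<lambda>s. (norm (w T \<omega> - w s \<omega>))\<^sup>2)" for \<omega>
  define E where "E = exp (2 * K * T)"
  \<comment> \<open>Gronwall for \<open>x - w\<close>, driven by \<open>F w\<close>\<close>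
  have path: "(norm (x t \<omega>))\<^sup>2 \<le> 2 * (norm (w t \<omega>))\<^sup>2
      + 16 * E\<^sup>2 * ((norm x0)\<^sup>2 + K\<^sup>2 * T * (2 * D \<omega> + 2 * T * (norm (w T \<omega>))\<^sup>2))"
    if o: "\<omega> \<in> space P" and t: "t \<in> {0..T}" for t \<omega>
  proof -
    note xc = closed_loop_continuous_on[OF x o] and wc = w_continuous_on[OF o]
    have Fc: "continuous_on {0..r} F" for r by (rule continuous_on_subset[OF F]) auto
    define I where "I = integral {0..T} (\<lambda>s. norm (w s \<omega>))"
    have I0: "0 \<le> I" unfolding I_def by (intro integral_nonneg integrable_continuous_real continuous_intros wc) auto
    have "norm (x t \<omega> - w t \<omega>) \<le> 2 * (norm x0 + K * I) * exp (2 * K * t)"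
    proof (rule gronwall[where \<phi> = "\<lambda>t. norm (x t \<omega> - w t \<omega>)" and T = T])
      show "continuous_on {0..T} (\<lambda>t. norm (x t \<omega> - w t \<omega>))" by (intro continuous_intros xc wc) auto
      fix r assume r: "r \<in> {0..T}"
      have "x r \<omega> - w r \<omega> = x0 + integral {0..r} (\<lambda>s. F s \<odot> x s \<omega>)"
        using closed_loop_integral[OF x o, of r] r by simp
      then have "norm (x r \<omega> - w r \<omega>) \<le> norm x0 + norm (integral {0..r} (\<lambda>s. F s \<odot> x s \<omega>))"
        by (simp add: norm_triangle_ineq)
      also have "norm (integral {0..r} (\<lambda>s. F s \<odot> x s \<omega>)) \<le> integral {0..r} (\<lambda>s. K * norm (x s \<omega> - w s \<omega>) + K * norm (w s \<omega>))"
      proof (rule integral_norm_bound_integral)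
        show "(\<lambda>s. F s \<odot> x s \<omega>) integrable_on {0..r}"
          by (intro integrable_continuous_real continuous_intros xc Fc) auto
        show "(\<lambda>s. K * norm (x s \<omega> - w s \<omega>) + K * norm (w s \<omega>)) integrable_on {0..r}"
          by (intro integrable_continuous_real continuous_intros xc wc) auto
        fix s assume s: "s \<in> {0..r}"
        have "norm (F s \<odot> x s \<omega>) \<le> K * norm (x s \<omega>)"
          using s K by (intro order_trans[OF norm_bop_apply] mult_right_mono) auto
        also have "\<dots> \<le> K * (norm (x s \<omega> - w s \<omega>) + norm (w s \<omega>))"
          using K norm_triangle_ineq[of "x s \<omega> - w s \<omega>" "w s \<omega>"] by (intro mult_left_mono) auto
        finally show "norm (F s \<odot> x s \<omega>) \<le> K * norm (x s \<omega> - w s \<omega>) + K * norm (w s \<omega>)" by (simp add: distrib_left)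
      qed
      also have "\<dots> = K * integral {0..r} (\<lambda>s. norm (x s \<omega> - w s \<omega>)) + K * integral {0..r} (\<lambda>s. norm (w s \<omega>))"
        by (subst integral_add) (auto intro!: integrable_continuous_real continuous_intros xc wc)
      also have "integral {0..r} (\<lambda>s. norm (w s \<omega>)) \<le> I"
        unfolding I_def using r
        by (intro integral_subset_le integrable_continuous_real continuous_intros wc) auto
      finally show "norm (x r \<omega> - w r \<omega>) \<le> norm x0 + K * I + K * integral {0..r} (\<lambda>s. norm (x s \<omega> - w s \<omega>))"
        using K by simp
    qed (use K I0 t in auto)
    also have "\<dots> \<le> 2 * (norm x0 + K * I) * E"
      using K I0 t by (intro mult_left_mono) (auto simp: E_def)
    finally have "(norm (x t \<omega> - w t \<omega>))\<^sup>2 \<le> (2 * (norm x0 + K * I) * E)\<^sup>2"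
      by (intro power_mono) auto
    also have "\<dots> = 4 * E\<^sup>2 * (norm x0 + K * I)\<^sup>2" by (simp only: power_mult_distrib) simp
    also have "\<dots> \<le> 4 * E\<^sup>2 * (2 * (norm x0)\<^sup>2 + 2 * (K\<^sup>2 * I\<^sup>2))"
      using sum_squares_bound[of "norm x0" "K * I"] by (intro mult_left_mono) (auto simp: power2_sum power_mult_distrib mult_ac add_ac)
    also have "I\<^sup>2 \<le> T * (2 * D \<omega> + 2 * T * (norm (w T \<omega>))\<^sup>2)"
    proof -
      have "I\<^sup>2 \<le> T * integral {0..T} (\<lambda>s. (norm (w s \<omega>))\<^sup>2)"
        using norm_integral_squared_le[of 0 T "\<lambda>s. norm (w s \<omega>)"] T I0
        by (simp add: I_def continuous_on_norm wc)
      also have "integral {0..T} (\<lambda>s. (norm (w s \<omega>))\<^sup>2) \<le> integral {0..T} (\<lambda>s. 2 * (norm (w T \<omega> - w s \<omega>))\<^sup>2 + 2 * (norm (w T \<omega>))\<^sup>2)"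
      proof (rule integral_le)
        show "(norm (w s \<omega>))\<^sup>2 \<le> 2 * (norm (w T \<omega> - w s \<omega>))\<^sup>2 + 2 * (norm (w T \<omega>))\<^sup>2" for s
          using norm_add_squared_le[of "w s \<omega> - w T \<omega>" "w T \<omega>"] by (simp add: norm_minus_commute)
      qed (auto intro!: integrable_continuous_real continuous_intros wc)
      also have "\<dots> = 2 * D \<omega> + 2 * T * (norm (w T \<omega>))\<^sup>2"
        unfolding D_def using T
        by (subst integral_add) (auto intro!: integrable_continuous_real continuous_intros wc)
      finally show ?thesis using T by (simp add: mult_left_mono)
    qed
    finally have "(norm (x t \<omega> - w t \<omega>))\<^sup>2 \<le> 4 * E\<^sup>2 * (2 * (norm x0)\<^sup>2 + 2 * (K\<^sup>2 * (T * (2 * D \<omega> + 2 * T * (norm (w T \<omega>))\<^sup>2))))"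
      by (simp add: mult_left_mono)
    then show ?thesis
      using norm_add_squared_le[of "w t \<omega>" "x t \<omega> - w t \<omega>"] by (simp add: algebra_simps)
  qed
  define c where "c = 2 * (trace_bound * T)
      + 16 * E\<^sup>2 * ((norm x0)\<^sup>2 + K\<^sup>2 * T * (2 * (trace_bound * T\<^sup>2) + 2 * T * (trace_bound * T)))"
  have c0: "0 \<le> c" unfolding c_def using T trace_bound_nonneg by simp
  have "(\<integral>\<^sup>+\<omega>. ennreal ((norm (x t \<omega>))\<^sup>2) \<partial>P) \<le> ennreal c" if t: "t \<in> {0..T}" for t
  proof -
    let ?a = "16 * E\<^sup>2 * K\<^sup>2 * T * 2" and ?b = "16 * E\<^sup>2 * K\<^sup>2 * T * 2 * T"
    have ab: "0 \<le> ?a" "0 \<le> ?b" using T by auto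
    have D0: "0 \<le> D \<omega>" if "\<omega> \<in> space P" for \<omega>
      unfolding D_def by (intro integral_nonneg integrable_continuous_real continuous_intros w_continuous_on that) auto
    have Dm [measurable]: "D \<in> borel_measurable P"
      unfolding D_def
    proof (rule measurable_integral_process[OF T])
      show "(\<lambda>\<omega>. (norm (w T \<omega> - w s \<omega>))\<^sup>2) \<in> borel_measurable P" if "s \<in> {0..T}" for s
        using w_measurable[OF T] w_measurable[of s] that by auto
    qed (intro continuous_intros w_continuous_on, auto)
    have [measurable]: "w t \<in> borel_measurable P" "w T \<in> borel_measurable P"
      using t T by (auto intro: w_measurable)
    have "(\<integral>\<^sup>+\<omega>. ennreal ((norm (x t \<omega>))\<^sup>2) \<partial>P) \<le> (\<integral>\<^sup>+\<omega>. 2 * ennreal ((norm (w t \<omega>))\<^sup>2) + ennreal (16 * E\<^sup>2 * (norm x0)\<^sup>2)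
        + ennreal ?a * ennreal (D \<omega>) + ennreal ?b * ennreal ((norm (w T \<omega>))\<^sup>2) \<partial>P)"
    proof (rule nn_integral_mono)
      fix \<omega> assume o: "\<omega> \<in> space P"
      have "(norm (x t \<omega>))\<^sup>2 \<le> 2 * (norm (w t \<omega>))\<^sup>2 + 16 * E\<^sup>2 * (norm x0)\<^sup>2 + ?a * D \<omega> + ?b * (norm (w T \<omega>))\<^sup>2"
        using path[OF o t] by (simp add: algebra_simps)
      then have "ennreal ((norm (x t \<omega>))\<^sup>2) \<le> ennreal (2 * (norm (w t \<omega>))\<^sup>2 + 16 * E\<^sup>2 * (norm x0)\<^sup>2 + ?a * D \<omega> + ?b * (norm (w T \<omega>))\<^sup>2)"
        by (rule ennreal_leI)
      also have "\<dots> = 2 * ennreal ((norm (w t \<omega>))\<^sup>2) + ennreal (16 * E\<^sup>2 * (norm x0)\<^sup>2)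
        + ennreal ?a * ennreal (D \<omega>) + ennreal ?b * ennreal ((norm (w T \<omega>))\<^sup>2)"
        using D0[OF o] ab by (simp add: ennreal_plus ennreal_mult')
      finally show "ennreal ((norm (x t \<omega>))\<^sup>2) \<le> 2 * ennreal ((norm (w t \<omega>))\<^sup>2) + ennreal (16 * E\<^sup>2 * (norm x0)\<^sup>2)
        + ennreal ?a * ennreal (D \<omega>) + ennreal ?b * ennreal ((norm (w T \<omega>))\<^sup>2)" .
    qed
    also have "\<dots> = 2 * (\<integral>\<^sup>+\<omega>. ennreal ((norm (w t \<omega>))\<^sup>2) \<partial>P) + ennreal (16 * E\<^sup>2 * (norm x0)\<^sup>2)
        + ennreal ?a * (\<integral>\<^sup>+\<omega>. ennreal (D \<omega>) \<partial>P) + ennreal ?b * (\<integral>\<^sup>+\<omega>. ennreal ((norm (w T \<omega>))\<^sup>2) \<partial>P)"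
      by (simp add: nn_integral_add nn_integral_cmult emeasure_space_1)
    also have "\<dots> \<le> 2 * ennreal (trace_bound * T) + ennreal (16 * E\<^sup>2 * (norm x0)\<^sup>2)
        + ennreal ?a * ennreal (trace_bound * T\<^sup>2) + ennreal ?b * ennreal (trace_bound * T)"
    proof (intro add_mono mult_left_mono order_refl zero_le)
      have "(\<integral>\<^sup>+\<omega>. ennreal ((norm (w t \<omega>))\<^sup>2) \<partial>P) \<le> ennreal (trace_bound * t)" using t by (intro w_second_moment) auto
      also have "\<dots> \<le> ennreal (trace_bound * T)" using t trace_bound_nonneg by (intro ennreal_leI mult_left_mono) auto
      finally show "(\<integral>\<^sup>+\<omega>. ennreal ((norm (w t \<omega>))\<^sup>2) \<partial>P) \<le> ennreal (trace_bound * T)" .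
      show "(\<integral>\<^sup>+\<omega>. ennreal (D \<omega>) \<partial>P) \<le> ennreal (trace_bound * T\<^sup>2)"
        using nn_integral_increments[of 0 T] T by (simp add: D_def)
      show "(\<integral>\<^sup>+\<omega>. ennreal ((norm (w T \<omega>))\<^sup>2) \<partial>P) \<le> ennreal (trace_bound * T)" by (rule w_second_moment[OF T])
    qed
    also have "\<dots> = ennreal c"
    proof -
      have "c = 2 * (trace_bound * T) + 16 * E\<^sup>2 * (norm x0)\<^sup>2 + ?a * (trace_bound * T\<^sup>2) + ?b * (trace_bound * T)"
        by (simp add: c_def algebra_simps)
      then show ?thesis using T trace_bound_nonneg ab by (simp add: ennreal_plus ennreal_mult')
    qed
    finally show ?thesis .
  qed
  with c0 show ?thesis by blast
qed

text \<open>Gronwall, with \<open>(F n - F') y\<close> as the forcing term. Strong convergence suffices because this term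
  evaluates the operators along the single limit path, where dominated convergence applies.\<close>

lemma closed_loop_tendsto:
  fixes F :: "nat \<Rightarrow> real \<Rightarrow> bop"
  assumes xn: "\<And>n. closed_loop (F n) x0 (x n)" and y: "closed_loop F' x0 y"
    and F: "\<And>n. continuous_on {0..} (F n)" and F': "continuous_on {0..} F'"
    and bound: "\<And>n t. 0 \<le> t \<Longrightarrow> norm (F n t) \<le> L"
    and conv: "\<And>s f. s \<in> {0..t} \<Longrightarrow> (\<lambda>n. F n s \<odot> f) \<longlonglongrightarrow> F' s \<odot> f"
    and o: "\<omega> \<in> space P" and t: "0 \<le> t"
  shows "(\<lambda>n. x n t \<omega>) \<longlonglongrightarrow> y t \<omega>"
proof -
  define K where "K = \<bar>L\<bar> + 1"
  have K: "0 < K" "norm (F n t) \<le> K" if "0 \<le> t" for n t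
    using bound[OF that, of n] by (auto simp: K_def)
  note xc = closed_loop_continuous_on[OF xn o] and yc = closed_loop_continuous_on[OF y o]
  have Fc: "continuous_on {0..r} (F n)" "continuous_on {0..r} F'" for n r
    by (rule continuous_on_subset[OF F], auto) (rule continuous_on_subset[OF F'], auto)
  define \<delta> where "\<delta> n = integral {0..t} (\<lambda>s. norm ((F n s - F' s) \<odot> y s \<omega>))" for n
  have \<delta>0: "0 \<le> \<delta> n" for n
    unfolding \<delta>_def by (intro integral_nonneg integrable_continuous_real continuous_intros Fc yc) auto
  have bd: "norm (x n t \<omega> - y t \<omega>) \<le> 2 * \<delta> n * exp (2 * K * t)" for n
  proof (rule gronwall[where \<phi> = "\<lambda>t. norm (x n t \<omega> - y t \<omega>)" and T = t])
    show "continuous_on {0..t} (\<lambda>t. norm (x n t \<omega> - y t \<omega>))" by (intro continuous_intros xc yc) auto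
    fix r assume r: "r \<in> {0..t}"
    have "x n r \<omega> - y r \<omega> = integral {0..r} (\<lambda>s. F n s \<odot> x n s \<omega>) - integral {0..r} (\<lambda>s. F' s \<odot> y s \<omega>)"
      using closed_loop_integral[OF xn o, of r n] closed_loop_integral[OF y o, of r] r by simp
    also have "\<dots> = integral {0..r} (\<lambda>s. F n s \<odot> x n s \<omega> - F' s \<odot> y s \<omega>)"
      by (rule integral_diff[symmetric]; intro integrable_continuous_real continuous_intros xc yc Fc; simp)
    finally have "norm (x n r \<omega> - y r \<omega>) = norm (integral {0..r} (\<lambda>s. F n s \<odot> x n s \<omega> - F' s \<odot> y s \<omega>))" by simp
    also have "\<dots> \<le> integral {0..r} (\<lambda>s. norm ((F n s - F' s) \<odot> y s \<omega>) + K * norm (x n s \<omega> - y s \<omega>))"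
    proof (rule integral_norm_bound_integral)
      show "(\<lambda>s. F n s \<odot> x n s \<omega> - F' s \<odot> y s \<omega>) integrable_on {0..r}"
        by (intro integrable_continuous_real continuous_intros xc yc Fc) auto
      show "(\<lambda>s. norm ((F n s - F' s) \<odot> y s \<omega>) + K * norm (x n s \<omega> - y s \<omega>)) integrable_on {0..r}"
        by (intro integrable_continuous_real continuous_intros xc yc Fc) auto
      fix s assume s: "s \<in> {0..r}"
      have "F n s \<odot> x n s \<omega> - F' s \<odot> y s \<omega> = (F n s - F' s) \<odot> y s \<omega> + F n s \<odot> (x n s \<omega> - y s \<omega>)"
        by (simp add: bop.diff_left bop.diff_right)
      also have "norm \<dots> \<le> norm ((F n s - F' s) \<odot> y s \<omega>) + norm (F n s \<odot> (x n s \<omega> - y s \<omega>))"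
        by (rule norm_triangle_ineq)
      also have "norm (F n s \<odot> (x n s \<omega> - y s \<omega>)) \<le> K * norm (x n s \<omega> - y s \<omega>)"
        using s K by (intro order_trans[OF norm_bop_apply] mult_right_mono) auto
      finally show "norm (F n s \<odot> x n s \<omega> - F' s \<odot> y s \<omega>) \<le> norm ((F n s - F' s) \<odot> y s \<omega>) + K * norm (x n s \<omega> - y s \<omega>)"
        by simp
    qed
    also have "\<dots> = integral {0..r} (\<lambda>s. norm ((F n s - F' s) \<odot> y s \<omega>)) + K * integral {0..r} (\<lambda>s. norm (x n s \<omega> - y s \<omega>))"
      by (subst integral_add) (auto intro!: integrable_continuous_real continuous_intros xc yc Fc)
    also have "integral {0..r} (\<lambda>s. norm ((F n s - F' s) \<odot> y s \<omega>)) \<le> \<delta> n"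
      unfolding \<delta>_def using r
      by (intro integral_subset_le integrable_continuous_real continuous_intros yc Fc) auto
    finally show "norm (x n r \<omega> - y r \<omega>) \<le> \<delta> n + K * integral {0..r} (\<lambda>s. norm (x n s \<omega> - y s \<omega>))" by simp
  qed (use K \<delta>0 t in auto)
  have "\<delta> \<longlonglongrightarrow> integral {0..t} (\<lambda>s. 0)"
    unfolding \<delta>_def[abs_def]
  proof (rule dominated_convergence)
    show "(\<lambda>s. norm ((F n s - F' s) \<odot> y s \<omega>)) integrable_on {0..t}" for n
      by (intro integrable_continuous_real continuous_intros yc Fc) auto
    show "(\<lambda>s. (K + norm (F' s)) * norm (y s \<omega>)) integrable_on {0..t}"
      by (intro integrable_continuous_real continuous_intros yc Fc) auto
    show "norm (norm ((F n s - F' s) \<odot> y s \<omega>)) \<le> (K + norm (F' s)) * norm (y s \<omega>)" if "s \<in> {0..t}" for n s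
    proof -
      have "norm (F n s - F' s) \<le> K + norm (F' s)"
        using K(2)[of s n] that norm_triangle_ineq4[of "F n s" "F' s"] by auto
      then show ?thesis using order_trans[OF norm_bop_apply mult_right_mono] by auto
    qed
    show "(\<lambda>n. norm ((F n s - F' s) \<odot> y s \<omega>)) \<longlonglongrightarrow> 0" if "s \<in> {0..t}" for s
      using tendsto_diff[OF conv[OF that, of "y s \<omega>"] tendsto_const[of "F' s \<odot> y s \<omega>"]]
      by (simp add: bop.diff_left tendsto_norm_zero_iff)
  qed
  then have "(\<lambda>n. 2 * \<delta> n * exp (2 * K * t)) \<longlonglongrightarrow> 2 * 0 * exp (2 * K * t)"
    by (intro tendsto_intros) simp
  then have up: "(\<lambda>n. 2 * \<delta> n * exp (2 * K * t)) \<longlonglongrightarrow> 0" by simp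
  have "(\<lambda>n. norm (x n t \<omega> - y t \<omega>)) \<longlonglongrightarrow> 0"
    by (rule tendsto_sandwich[OF _ _ tendsto_const up]) (simp_all add: bd)
  then have "(\<lambda>n. x n t \<omega> - y t \<omega>) \<longlonglongrightarrow> 0" by (rule tendsto_norm_zero_cancel)
  then show ?thesis by (rule LIM_zero_cancel)
qed

end

section \<open>Discounted costs on finite and infinite horizons\<close>

abbreviation halfline :: "real measure" where "halfline \<equiv> restrict_space lborel {0..}"

abbreviation horizon :: "real \<Rightarrow> real measure" where "horizon T \<equiv> restrict_space lborel {0..T}"

definition running_cost :: "real \<Rightarrow> bop \<Rightarrow> bop \<Rightarrow> (real \<Rightarrow> 'w \<Rightarrow> L2) \<Rightarrow> (real \<Rightarrow> 'w \<Rightarrow> L2) \<Rightarrow> real \<Rightarrow> 'w \<Rightarrow> real" where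
  "running_cost \<rho> M R x u t \<omega> = exp (- \<rho> * t) * (x t \<omega> \<bullet> (M \<odot> x t \<omega>) + u t \<omega> \<bullet> (R \<odot> u t \<omega>))"

lemma running_cost_nonneg: "psd M \<Longrightarrow> psd R \<Longrightarrow> 0 \<le> running_cost \<rho> M R x u t \<omega>"
  by (simp add: running_cost_def psd_nonneg)

lemma finite_measure_horizon: "finite_measure (horizon T)"
  by (intro finite_measureI) (cases "0 \<le> T", simp_all add: emeasure_restrict_space space_restrict_space)

lemma measurable_horizon_halfline: "(\<lambda>t. t) \<in> horizon T \<rightarrow>\<^sub>M halfline"
  by (rule measurable_restrict_space3) auto

lemma measurable_halfline_borel: "(\<lambda>t. t) \<in> halfline \<rightarrow>\<^sub>M (borel :: real measure)"
  by (rule measurable_restrict_space1) simp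

lemma measurable_horizon_borel: "(\<lambda>t. t) \<in> horizon T \<rightarrow>\<^sub>M (borel :: real measure)"
  by (rule measurable_restrict_space1) simp

lemma measurable_apply_continuous:
  fixes K :: "real \<Rightarrow> bop"
  assumes K: "continuous_on UNIV K" and g: "g \<in> borel_measurable N" and f: "f \<in> borel_measurable N"
  shows "(\<lambda>x. K (g x) \<odot> f x) \<in> borel_measurable N"
proof -
  have "continuous_on UNIV (\<lambda>p. K (fst p) \<odot> snd p)"
    by (intro continuous_intros continuous_on_compose2[OF K]) auto
  then have "(\<lambda>p. K (fst p) \<odot> snd p) \<in> borel_measurable (borel :: (real \<times> L2) measure)"
    by (rule borel_measurable_continuous_onI)
  then have K': "(\<lambda>p. K (fst p) \<odot> snd p) \<in> borel_measurable (borel \<Otimes>\<^sub>M borel)"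
    by (simp add: borel_prod)
  have "(\<lambda>x. (g x, f x)) \<in> N \<rightarrow>\<^sub>M borel \<Otimes>\<^sub>M borel"
    using g f by (rule measurable_Pair)
  from measurable_compose[OF this K'] show ?thesis by simp
qed

lemma set_integral_horizon:
  fixes h :: "real \<Rightarrow> 'a::{real_inner, banach, second_countable_topology}"
  assumes h: "continuous_on {a..b} h" and ab: "0 \<le> a" "b \<le> T"
  shows "integrable (horizon T) (\<lambda>t. indicator {a..b} t *\<^sub>R h t)"
    "(LINT t|horizon T. indicator {a..b} t *\<^sub>R h t) = integral {a..b} h"
proof -
  have e: "indicator {0..T} t * indicator {a..b} t = (indicator {a..b} t :: real)" for t
    using ab by (auto simp: indicator_def)
  show "integrable (horizon T) (\<lambda>t. indicator {a..b} t *\<^sub>R h t)"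
    using borel_integrable_atLeastAtMost'[OF h]
    by (subst integrable_restrict_space) (simp_all add: e set_integrable_def)
  show "(LINT t|horizon T. indicator {a..b} t *\<^sub>R h t) = integral {a..b} h"
    unfolding LBINT_eq_integral[OF h, symmetric] set_lebesgue_integral_def
    by (subst integral_restrict_space) (simp_all add: e)
qed

context prob_space
begin

text \<open>The finite horizon cost is an integral over the product space, so that Fubini and Fatou apply to it
  directly.\<close>

definition horizon_cost :: "real \<Rightarrow> bop \<Rightarrow> bop \<Rightarrow> real \<Rightarrow> (real \<Rightarrow> 'a \<Rightarrow> L2) \<Rightarrow> (real \<Rightarrow> 'a \<Rightarrow> L2) \<Rightarrow> ennreal" where
  "horizon_cost \<rho> M' R' T x u = (\<integral>\<^sup>+p. ennreal (running_cost \<rho> M' R' x u (fst p) (snd p)) \<partial>(horizon T \<Otimes>\<^sub>M M))"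

lemma running_cost_measurable_halfline:
  assumes "jointly_measurable M x" "jointly_measurable M u"
  shows "(\<lambda>(t, \<omega>). running_cost \<rho> M' R' x u t \<omega>) \<in> borel_measurable (halfline \<Otimes>\<^sub>M M)"
proof -
  have [measurable]: "(\<lambda>(t, \<omega>). x t \<omega>) \<in> borel_measurable (halfline \<Otimes>\<^sub>M M)"
    "(\<lambda>(t, \<omega>). u t \<omega>) \<in> borel_measurable (halfline \<Otimes>\<^sub>M M)"
    using assms by (simp_all add: jointly_measurable_def)
  note [measurable] = measurable_halfline_borel
  show ?thesis unfolding running_cost_def by measurable
qed

lemma jointly_measurable_horizon:
  fixes y :: "real \<Rightarrow> 'a \<Rightarrow> 'b::topological_space"
  assumes "(\<lambda>(t, \<omega>). y t \<omega>) \<in> borel_measurable (halfline \<Otimes>\<^sub>M M)"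
  shows "(\<lambda>(t, \<omega>). y t \<omega>) \<in> borel_measurable (horizon T \<Otimes>\<^sub>M M)"
proof -
  have "(\<lambda>p. (fst p, snd p)) \<in> horizon T \<Otimes>\<^sub>M M \<rightarrow>\<^sub>M halfline \<Otimes>\<^sub>M M"
    by (intro measurable_Pair measurable_compose[OF measurable_fst measurable_horizon_halfline] measurable_snd)
  from measurable_compose[OF this assms] show ?thesis by (simp add: case_prod_beta')
qed

lemma cost_time_marginal:
  fixes \<rho> :: real and M' R' :: bop
  assumes x: "jointly_measurable M x" and u: "jointly_measurable M u"
  defines "g \<equiv> \<lambda>t. \<integral>\<^sup>+\<omega>. ennreal (running_cost \<rho> M' R' x u t \<omega>) \<partial>M"
  shows "g \<in> borel_measurable halfline"
    "discounted_cost M \<rho> (blinfun_of_bop M') (blinfun_of_bop R') x u = (\<integral>\<^sup>+t. g t \<partial>halfline)"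
    "0 \<le> T \<Longrightarrow> horizon_cost \<rho> M' R' T x u = (\<integral>\<^sup>+t. g t * indicator {0..T} t \<partial>halfline)"
proof -
  interpret H: sigma_finite_measure halfline by (rule sigma_finite_halfline)
  interpret PH: pair_sigma_finite M halfline ..
  note j = running_cost_measurable_halfline[OF x u, of \<rho> M' R']
  have je: "(\<lambda>(t, \<omega>). ennreal (running_cost \<rho> M' R' x u t \<omega>)) \<in> borel_measurable (halfline \<Otimes>\<^sub>M M)"
    using j by measurable
  show g: "g \<in> borel_measurable halfline"
    unfolding g_def using je by (rule borel_measurable_nn_integral)
  have je': "(\<lambda>(\<omega>, t). ennreal (running_cost \<rho> M' R' x u t \<omega>)) \<in> borel_measurable (M \<Otimes>\<^sub>M halfline)"
    using measurable_compose[OF measurable_pair_swap' je] by (simp add: case_prod_beta')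
  have "discounted_cost M \<rho> (blinfun_of_bop M') (blinfun_of_bop R') x u
      = (\<integral>\<^sup>+\<omega>. \<integral>\<^sup>+t. ennreal (running_cost \<rho> M' R' x u t \<omega>) \<partial>halfline \<partial>M)"
    unfolding discounted_cost_def running_cost_def blinfun_apply_bop
    by (subst nn_integral_restrict_space) auto
  also have "\<dots> = (\<integral>\<^sup>+t. g t \<partial>halfline)"
    unfolding g_def using PH.Fubini[OF je'] by simp
  finally show "discounted_cost M \<rho> (blinfun_of_bop M') (blinfun_of_bop R') x u = (\<integral>\<^sup>+t. g t \<partial>halfline)" .
  assume T: "0 \<le> T"
  have jh: "(\<lambda>(t, \<omega>). ennreal (running_cost \<rho> M' R' x u t \<omega>)) \<in> borel_measurable (horizon T \<Otimes>\<^sub>M M)"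
    using jointly_measurable_horizon[OF je, of T] .
  have "horizon_cost \<rho> M' R' T x u = (\<integral>\<^sup>+t. g t \<partial>horizon T)"
    unfolding horizon_cost_def g_def using nn_integral_fst[OF jh] by (simp add: case_prod_beta')
  also have "\<dots> = (\<integral>\<^sup>+t. g t * indicator {0..T} t \<partial>halfline)"
    using T by (subst (1 2) nn_integral_restrict_space) (auto intro!: nn_integral_cong simp: indicator_def)
  finally show "horizon_cost \<rho> M' R' T x u = (\<integral>\<^sup>+t. g t * indicator {0..T} t \<partial>halfline)" .
qed

lemma horizon_cost_le_discounted:
  assumes "jointly_measurable M x" "jointly_measurable M u" "0 \<le> T"
  shows "horizon_cost \<rho> M' R' T x u \<le> discounted_cost M \<rho> (blinfun_of_bop M') (blinfun_of_bop R') x u"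
  unfolding cost_time_marginal(2)[OF assms(1,2)] cost_time_marginal(3)[OF assms]
  by (intro nn_integral_mono) (auto simp: indicator_def)

lemma horizon_cost_mono:
  assumes "jointly_measurable M x" "jointly_measurable M u" "0 \<le> S" "S \<le> T"
  shows "horizon_cost \<rho> M' R' S x u \<le> horizon_cost \<rho> M' R' T x u"
proof -
  have T: "0 \<le> T" using assms by simp
  show ?thesis
    unfolding cost_time_marginal(3)[OF assms(1,2,3)] cost_time_marginal(3)[OF assms(1,2) T]
    using assms(4) by (intro nn_integral_mono) (auto simp: indicator_def)
qed

lemma discounted_cost_le_of_horizons:
  assumes x: "jointly_measurable M x" and u: "jointly_measurable M u"
    and le: "\<And>n. horizon_cost \<rho> M' R' (real n) x u \<le> c"
  shows "discounted_cost M \<rho> (blinfun_of_bop M') (blinfun_of_bop R') x u \<le> c"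
proof -
  define g where "g t = (\<integral>\<^sup>+\<omega>. ennreal (running_cost \<rho> M' R' x u t \<omega>) \<partial>M)" for t
  have [measurable]: "g \<in> borel_measurable halfline"
    unfolding g_def by (rule cost_time_marginal(1)[OF x u])
  have hc: "horizon_cost \<rho> M' R' (real n) x u = (\<integral>\<^sup>+t. g t * indicator {0..real n} t \<partial>halfline)" for n
    unfolding g_def by (rule cost_time_marginal(3)[OF x u]) simp
  have [measurable]: "{0..a} \<in> sets halfline" for a :: real by (auto simp: sets_restrict_space_iff)
  have sup: "(SUP n. g t * indicator {0..real n} t) = g t" if "t \<in> space halfline" for t
  proof (rule antisym)
    show "(SUP n. g t * indicator {0..real n} t) \<le> g t"
      by (intro SUP_least) (auto simp: indicator_def)
    obtain n where "t \<le> real n" using real_arch_simple by blast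
    then have "g t \<le> g t * indicator {0..real n} t"
      using that by (simp add: space_restrict_space)
    also have "\<dots> \<le> (SUP n. g t * indicator {0..real n} t)" by (rule SUP_upper) simp
    finally show "g t \<le> (SUP n. g t * indicator {0..real n} t)" .
  qed
  have "discounted_cost M \<rho> (blinfun_of_bop M') (blinfun_of_bop R') x u = (\<integral>\<^sup>+t. g t \<partial>halfline)"
    unfolding g_def by (rule cost_time_marginal(2)[OF x u])
  also have "\<dots> = (\<integral>\<^sup>+t. (SUP n. g t * indicator {0..real n} t) \<partial>halfline)"
    by (intro nn_integral_cong) (simp add: sup)
  also have "\<dots> = (SUP n. \<integral>\<^sup>+t. g t * indicator {0..real n} t \<partial>halfline)"
  proof (rule nn_integral_monotone_convergence_SUP)
    show "incseq (\<lambda>n t. g t * indicator {0..real n} t)"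
      by (intro incseq_SucI le_funI) (auto simp: indicator_def)
  qed measurable
  also have "\<dots> \<le> c"
    using le unfolding hc by (rule SUP_least)
  finally show ?thesis .
qed

end

section \<open>Optimality on a finite horizon\<close>

text \<open>Here \<open>X\<close> is a bounded Riccati flow started at \<open>0\<close>. The coercivity constant \<open>\<kappa>\<close> of \<open>R\<close> makes controls of
  finite cost square integrable.\<close>

locale regulator = q_noise P kQ w
  for P :: "'w measure" and kQ and w :: "real \<Rightarrow> 'w \<Rightarrow> L2" +
  fixes A B M R Ri :: bop and \<rho> \<kappa> c :: real and X :: "real \<Rightarrow> bop"
  assumes A: "selfadj A" and B: "selfadj B" and M: "psd M" and R: "psd R"
    and R_Ri: "R * Ri = 1" and \<rho>: "0 < \<rho>" and coercive: "\<And>f. (norm f)\<^sup>2 \<le> \<kappa> * (f \<bullet> (R \<odot> f))"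
    and X_0: "X 0 = 0"
    and X_flow: "\<And>t. 0 \<le> t \<Longrightarrow> (X has_vector_derivative riccati A (B * Ri * B) M \<rho> (X t)) (at t within {0..})"
    and X_bound: "\<And>t. 0 \<le> t \<Longrightarrow> norm (X t) \<le> c"
begin

text \<open>The value operator with time \<open>T - t\<close> to go, extended by \<open>X 0\<close> beyond the horizon so that the feedback
  and its closed loop are defined for all times.\<close>

definition to_go :: "real \<Rightarrow> real \<Rightarrow> bop" where "to_go T t = X (max 0 (T - t))"

definition gain :: "real \<Rightarrow> real \<Rightarrow> bop" where "gain T t = - (Ri * B * to_go T t)"

definition loop :: "real \<Rightarrow> real \<Rightarrow> bop" where "loop T t = A + B * gain T t"

lemma continuous_on_to_go [continuous_intros]: "continuous_on S (to_go T)"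
proof -
  have "continuous_on {0..} X" using X_flow by (intro continuous_on_vector_derivative) auto
  then show ?thesis
    unfolding to_go_def by (rule continuous_on_compose2) (auto intro!: continuous_intros)
qed

lemma continuous_on_gain [continuous_intros]: "continuous_on S (gain T)"
  unfolding gain_def by (intro continuous_intros)

lemma continuous_on_loop [continuous_intros]: "continuous_on S (loop T)"
  unfolding loop_def by (intro continuous_intros)

lemma norm_to_go: "norm (to_go T t) \<le> c"
  unfolding to_go_def by (rule X_bound) simp

lemma c_nonneg: "0 \<le> c"
  using X_bound[of 0] norm_ge_zero[of "X 0"] by linarith

lemma norm_loop: "norm (loop T t) \<le> norm A + norm B * (norm (Ri * B) * c)"
proof -
  have "norm (loop T t) \<le> norm A + norm (B * (Ri * B * to_go T t))"
    unfolding loop_def gain_def using norm_triangle_ineq4[of A "B * (Ri * B * to_go T t)"] by simp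
  also have "norm (B * (Ri * B * to_go T t)) \<le> norm B * (norm (Ri * B) * c)"
    by (intro order_trans[OF norm_mult_ineq] mult_left_mono norm_ge_zero order_trans[OF norm_mult_ineq[of "Ri * B"]] norm_to_go)
  finally show ?thesis by simp
qed

text \<open>The kernel that applies to the noise after time \<open>s\<close> in the adjoint state below.\<close>

definition noise_kernel :: "real \<Rightarrow> real \<Rightarrow> real \<Rightarrow> bop" where
  "noise_kernel T s t = exp (- \<rho> * t) *\<^sub>R (op_semigroup A (t - s) * (to_go T t * loop T t + M))"

lemma continuous_on_noise_kernel [continuous_intros]: "continuous_on S (noise_kernel T s)"
  unfolding noise_kernel_def by (intro continuous_intros)

text \<open>The derivative of \<open>e\<^bsup>-\<rho>t\<^esup> e\<^bsup>A(t-s)\<^esup> X(T-t) (x t - (w t - w s))\<close> in \<open>t\<close> is integrated from \<open>s\<close> to \<open>T\<close>. Subtracting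
  the increment makes the state differentiable and does not change it at time \<open>s\<close>; at time \<open>T\<close> the
  product vanishes because \<open>X 0 = 0\<close>. The Riccati equation reduces the derivative to \<open>- e\<^bsup>-\<rho>t\<^esup> e\<^bsup>A(t-s)\<^esup> M x t\<close>
  and terms in the increment.\<close>

lemma adjoint_state:
  assumes x: "closed_loop (loop T) x0 x" and o: "\<omega> \<in> space P" and s: "0 \<le> s" "s \<le> T"
  shows "integral {s..T} (\<lambda>t. exp (- \<rho> * t) *\<^sub>R (op_semigroup A (t - s) \<odot> M \<odot> x t \<omega>))
    = exp (- \<rho> * s) *\<^sub>R (to_go T s \<odot> x s \<omega>) + integral {s..T} (\<lambda>t. noise_kernel T s t \<odot> (w t \<omega> - w s \<omega>))"
proof -
  let ?E = "\<lambda>t. op_semigroup A (t - s)" and ?Y = "to_go T" and ?F = "loop T"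
  define z where "z t = x t \<omega> - w t \<omega> + w s \<omega>" for t
  have Y': "(?Y has_vector_derivative - riccati A (B * Ri * B) M \<rho> (?Y t)) (at t within {s..T})" if t: "t \<in> {s..T}" for t
  proof (rule has_vector_derivative_transform[where f = "\<lambda>t. X (T - t)"])
    have "(X has_vector_derivative riccati A (B * Ri * B) M \<rho> (X (T - t))) (at (T - t) within (\<lambda>t. T - t) ` {s..T})"
      using t s by (intro has_vector_derivative_within_subset[OF X_flow]) auto
    moreover have "((\<lambda>t. T - t) has_vector_derivative - 1) (at t within {s..T})"
      by (auto intro!: derivative_eq_intros)
    ultimately show "((\<lambda>t. X (T - t)) has_vector_derivative - riccati A (B * Ri * B) M \<rho> (?Y t)) (at t within {s..T})"
      using vector_diff_chain_within[of "\<lambda>t. T - t" "- 1" t "{s..T}" X] t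
      by (simp add: o_def to_go_def max_absorb2)
  qed (use t in \<open>auto simp: to_go_def max_absorb2\<close>)
  have z': "(z has_vector_derivative ?F t \<odot> x t \<omega>) (at t within {s..T})" if t: "t \<in> {s..T}" for t
  proof -
    have "((\<lambda>t. x t \<omega> - w t \<omega>) has_vector_derivative ?F t \<odot> x t \<omega>) (at t within {s..T})"
      using t s by (intro has_vector_derivative_within_subset[OF closed_loopD(4)[OF x o]]) auto
    from has_vector_derivative_add[OF this has_vector_derivative_const] show ?thesis
      unfolding z_def by simp
  qed
  have e': "((\<lambda>t. exp (- \<rho> * t)) has_real_derivative - \<rho> * exp (- \<rho> * t)) (at t within {s..T})" for t
    by (auto intro!: derivative_eq_intros)
  define h where "h t = exp (- \<rho> * t) *\<^sub>R ((?E t * ?Y t) \<odot> z t)" for t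
  define g1 where "g1 t = exp (- \<rho> * t) *\<^sub>R (?E t \<odot> M \<odot> x t \<omega>)" for t
  define g2 where "g2 t = noise_kernel T s t \<odot> (w t \<omega> - w s \<omega>)" for t
  have "(h has_vector_derivative g2 t - g1 t) (at t within {s..T})" if t: "t \<in> {s..T}" for t
  proof -
    have "(h has_vector_derivative exp (- \<rho> * t) *\<^sub>R ((?E t * ?Y t) \<odot> ?F t \<odot> x t \<omega>
        + (?E t * - riccati A (B * Ri * B) M \<rho> (?Y t) + ?E t * A * ?Y t) \<odot> z t)
        + (- \<rho> * exp (- \<rho> * t)) *\<^sub>R ((?E t * ?Y t) \<odot> z t)) (at t within {s..T})"
      unfolding h_def
      by (rule has_vector_derivative_scaleR[OF e' bop.has_vector_derivative[OF
            has_vector_derivative_mult[OF op_semigroup_derivative Y'[OF t]] z'[OF t]]])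
    moreover have "exp (- \<rho> * t) *\<^sub>R ((?E t * ?Y t) \<odot> ?F t \<odot> x t \<omega>
        + (?E t * - riccati A (B * Ri * B) M \<rho> (?Y t) + ?E t * A * ?Y t) \<odot> z t)
        + (- \<rho> * exp (- \<rho> * t)) *\<^sub>R ((?E t * ?Y t) \<odot> z t) = g2 t - g1 t"
    proof -
      have ric: "- riccati A (B * Ri * B) M \<rho> (?Y t) + A * ?Y t - \<rho> *\<^sub>R ?Y t = - (?Y t * ?F t + M)"
        by (simp add: riccati_def loop_def gain_def algebra_simps)
      have "(?E t * - riccati A (B * Ri * B) M \<rho> (?Y t) + ?E t * A * ?Y t) \<odot> z t - \<rho> *\<^sub>R ((?E t * ?Y t) \<odot> z t)
          = (?E t * (- riccati A (B * Ri * B) M \<rho> (?Y t) + A * ?Y t - \<rho> *\<^sub>R ?Y t)) \<odot> z t"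
        by (simp add: distrib_left right_diff_distrib bop.add_left bop.diff_left bop.scaleR_left bop.scaleR_right
            bop.minus_left bop.minus_right bop.add_right bop.diff_right)
      also have "\<dots> = - (?E t \<odot> (?Y t * ?F t + M) \<odot> z t)"
        unfolding ric by (simp only: bop_apply_mult bop.minus_left bop.minus_right)
      finally have k: "(?E t * - riccati A (B * Ri * B) M \<rho> (?Y t) + ?E t * A * ?Y t) \<odot> z t
          = \<rho> *\<^sub>R ((?E t * ?Y t) \<odot> z t) - ?E t \<odot> (?Y t * ?F t + M) \<odot> z t"
        by (simp add: algebra_simps del: bop_apply_mult)
      have zx: "z t = x t \<omega> - (w t \<omega> - w s \<omega>)" by (simp add: z_def)
      have "(?E t * ?Y t) \<odot> ?F t \<odot> x t \<omega> - ?E t \<odot> (?Y t * ?F t + M) \<odot> z t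
          = ?E t \<odot> (?Y t * ?F t + M) \<odot> (w t \<omega> - w s \<omega>) - ?E t \<odot> M \<odot> x t \<omega>"
        unfolding zx by (simp add: bop.add_left bop.diff_right bop.add_right)
      then have "exp (- \<rho> * t) *\<^sub>R ((?E t * ?Y t) \<odot> ?F t \<odot> x t \<omega> - ?E t \<odot> (?Y t * ?F t + M) \<odot> z t) = g2 t - g1 t"
        by (simp add: g1_def g2_def noise_kernel_def scaleR_diff_right bop.scaleR_left)
      then show ?thesis
        unfolding k by (simp add: scaleR_add_right scaleR_diff_right algebra_simps del: bop_apply_mult)
    qed
    ultimately show ?thesis by (simp only:)
  qed
  from integral_unique[OF fundamental_theorem_of_calculus[OF s(2) this]]
  have "integral {s..T} (\<lambda>t. g2 t - g1 t) = h T - h s" by simp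
  moreover have "h T = 0" by (simp add: h_def to_go_def X_0 bop.zero_left bop.zero_right)
  moreover have "h s = exp (- \<rho> * s) *\<^sub>R (?Y s \<odot> x s \<omega>)" by (simp add: h_def z_def)
  moreover have "integral {s..T} (\<lambda>t. g2 t - g1 t) = integral {s..T} g2 - integral {s..T} g1"
    unfolding g1_def g2_def
    by (rule integral_diff; intro integrable_continuous_real continuous_intros closed_loop_continuous_on[OF x o] w_continuous_on o s)
  ultimately show ?thesis unfolding g1_def g2_def by (simp add: algebra_simps)
qed

text \<open>Fubini reduces the claim to the orthogonality of each increment to the past; the second moment bound
  on the increments provides the integrability.\<close>

lemma noise_term_orthogonal:
  assumes s: "0 \<le> s" "s \<le> T"
    and \<xi>: "\<xi> \<in> borel_measurable (history P w s)" and \<xi>2: "integrable P (\<lambda>\<omega>. (norm (\<xi> \<omega>))\<^sup>2)"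
  shows "expectation (\<lambda>\<omega>. integral {s..T} (\<lambda>t. noise_kernel T s t \<odot> (w t \<omega> - w s \<omega>)) \<bullet> \<xi> \<omega>) = 0"
proof -
  interpret H: finite_measure "horizon T" by (rule finite_measure_horizon)
  interpret HP: pair_sigma_finite "horizon T" P ..
  define f where "f t \<omega> = indicator {s..T} t * ((noise_kernel T s t \<odot> (w t \<omega> - w s \<omega>)) \<bullet> \<xi> \<omega>)" for t \<omega>
  have "compact (noise_kernel T s ` {s..T})"
    by (intro compact_continuous_image continuous_intros) simp
  then have "bounded (noise_kernel T s ` {s..T})" by (rule compact_imp_bounded)
  then obtain C where C: "\<And>t. t \<in> {s..T} \<Longrightarrow> norm (noise_kernel T s t) \<le> C"
    unfolding bounded_iff by blast
  have C0: "0 \<le> C" using order_trans[OF norm_ge_zero C[of s]] s by simp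
  have [measurable]: "\<xi> \<in> borel_measurable P" by (rule measurable_of_history[OF \<xi>])
  have [measurable]: "w s \<in> borel_measurable P" by (rule w_measurable[OF s(1)])
  have [measurable]: "(\<lambda>(t, \<omega>). w t \<omega>) \<in> borel_measurable (horizon T \<Otimes>\<^sub>M P)"
    by (intro jointly_measurable_horizon jointly_measurable_of_continuous w_measurable w_continuous)
  note [measurable] = measurable_horizon_borel
  have km: "(\<lambda>(t, \<omega>). noise_kernel T s t \<odot> (w t \<omega> - w s \<omega>)) \<in> borel_measurable (horizon T \<Otimes>\<^sub>M P)"
    unfolding case_prod_beta' by (rule measurable_apply_continuous[OF continuous_on_noise_kernel]) measurable
  have [measurable]: "{s..T} \<in> sets (horizon T)" using s by (auto simp: sets_restrict_space_iff)
  have fm: "(\<lambda>(t, \<omega>). f t \<omega>) \<in> borel_measurable (horizon T \<Otimes>\<^sub>M P)"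
    using km unfolding f_def by measurable
  have e2: "expectation (\<lambda>\<omega>. f t \<omega>) = 0" "integrable P (\<lambda>\<omega>. f t \<omega>)" if "t \<in> {0..T}" for t
  proof -
    have "expectation (\<lambda>\<omega>. f t \<omega>) = 0 \<and> integrable P (\<lambda>\<omega>. f t \<omega>)"
    proof (cases "t \<in> {s..T}")
      case True
      then show ?thesis
        using increment_orthogonal[OF s(1) _ \<xi> \<xi>2, of t "noise_kernel T s t"] by (simp add: f_def)
    qed (simp add: f_def)
    then show "expectation (\<lambda>\<omega>. f t \<omega>) = 0" "integrable P (\<lambda>\<omega>. f t \<omega>)" by auto
  qed
  have bd: "norm (f t \<omega>) \<le> C * ((norm (w t \<omega> - w s \<omega>))\<^sup>2 + (norm (\<xi> \<omega>))\<^sup>2) * indicator {s..T} t" for t \<omega>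
  proof (cases "t \<in> {s..T}")
    case True
    have "\<bar>(noise_kernel T s t \<odot> (w t \<omega> - w s \<omega>)) \<bullet> \<xi> \<omega>\<bar> \<le> norm (noise_kernel T s t \<odot> (w t \<omega> - w s \<omega>)) * norm (\<xi> \<omega>)"
      by (rule Cauchy_Schwarz_ineq2)
    also have "\<dots> \<le> (C * norm (w t \<omega> - w s \<omega>)) * norm (\<xi> \<omega>)"
      using C[OF True] by (intro mult_right_mono order_trans[OF norm_bop_apply]) auto
    also have "\<dots> \<le> C * ((norm (w t \<omega> - w s \<omega>))\<^sup>2 + (norm (\<xi> \<omega>))\<^sup>2)"
      using abs_mult_le_squares[of "norm (w t \<omega> - w s \<omega>)" "norm (\<xi> \<omega>)"] C0 by (simp add: mult.assoc mult_left_mono)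
    finally show ?thesis using True by (simp add: f_def)
  qed (simp add: f_def)
  have int: "integrable (horizon T \<Otimes>\<^sub>M P) (\<lambda>(t, \<omega>). f t \<omega>)"
  proof (rule HP.Fubini_integrable[OF fm])
    define e where "e = expectation (\<lambda>\<omega>. (norm (\<xi> \<omega>))\<^sup>2)"
    show "integrable (horizon T) (\<lambda>t. LINT \<omega>|P. norm (case (t, \<omega>) of (t, \<omega>) \<Rightarrow> f t \<omega>))"
    proof (rule H.integrable_const_bound[where B = "C * (trace_bound * (T - s) + e)"])
      show "(\<lambda>t. LINT \<omega>|P. norm (case (t, \<omega>) of (t, \<omega>) \<Rightarrow> f t \<omega>)) \<in> borel_measurable (horizon T)"
        using fm by measurable
      show "AE t in horizon T. norm (LINT \<omega>|P. norm (case (t, \<omega>) of (t, \<omega>) \<Rightarrow> f t \<omega>)) \<le> C * (trace_bound * (T - s) + e)"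
      proof (rule AE_I2)
        fix t assume "t \<in> space (horizon T)"
        then have t: "t \<in> {0..T}" by (simp add: space_restrict_space)
        have e0: "0 \<le> e" unfolding e_def by simp
        show "norm (LINT \<omega>|P. norm (case (t, \<omega>) of (t, \<omega>) \<Rightarrow> f t \<omega>)) \<le> C * (trace_bound * (T - s) + e)"
        proof (cases "t \<in> {s..T}")
          case True
          then have st: "0 \<le> s" "s \<le> t" using s by auto
          have "(LINT \<omega>|P. norm (f t \<omega>)) \<le> (LINT \<omega>|P. C * ((norm (w t \<omega> - w s \<omega>))\<^sup>2 + (norm (\<xi> \<omega>))\<^sup>2))"
          proof (rule integral_mono)
            show "integrable P (\<lambda>\<omega>. norm (f t \<omega>))" using e2(2)[OF t] by (rule integrable_norm)
            show "integrable P (\<lambda>\<omega>. C * ((norm (w t \<omega> - w s \<omega>))\<^sup>2 + (norm (\<xi> \<omega>))\<^sup>2))"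
              by (intro integrable_mult_right Bochner_Integration.integrable_add increment_square_integrable[OF st] \<xi>2)
            show "norm (f t \<omega>) \<le> C * ((norm (w t \<omega> - w s \<omega>))\<^sup>2 + (norm (\<xi> \<omega>))\<^sup>2)" for \<omega>
              using bd[of t \<omega>] True by simp
          qed
          also have "\<dots> = C * (expectation (\<lambda>\<omega>. (norm (w t \<omega> - w s \<omega>))\<^sup>2) + e)"
            unfolding e_def using increment_square_integrable(1)[OF st] \<xi>2 by simp
          also have "\<dots> \<le> C * (trace_bound * (T - s) + e)"
          proof -
            have "trace_bound * (t - s) \<le> trace_bound * (T - s)"
              using True trace_bound_nonneg by (intro mult_left_mono) auto
            then show ?thesis
              using increment_square_integrable(2)[OF st] C0 by (intro mult_left_mono add_mono) auto
          qed
          finally show ?thesis by simp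
        next
          case False
          then show ?thesis using C0 e0 s trace_bound_nonneg by (simp add: f_def)
        qed
      qed
    qed
    show "AE t in horizon T. integrable P (\<lambda>\<omega>. case (t, \<omega>) of (t, \<omega>) \<Rightarrow> f t \<omega>)"
      by (rule AE_I2) (simp add: space_restrict_space e2)
  qed
  have path: "(LINT t|horizon T. f t \<omega>) = integral {s..T} (\<lambda>t. noise_kernel T s t \<odot> (w t \<omega> - w s \<omega>)) \<bullet> \<xi> \<omega>"
    if o: "\<omega> \<in> space P" for \<omega>
  proof -
    let ?h = "\<lambda>t. noise_kernel T s t \<odot> (w t \<omega> - w s \<omega>)"
    have hc: "continuous_on {s..T} ?h" by (intro continuous_intros w_continuous_on o s)
    have "(LINT t|horizon T. f t \<omega>) = integral {s..T} (\<lambda>t. ?h t \<bullet> \<xi> \<omega>)"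
      using set_integral_horizon(2)[of s T "\<lambda>t. ?h t \<bullet> \<xi> \<omega>" T] hc s by (simp add: f_def continuous_on_inner)
    also have "\<dots> = integral {s..T} ?h \<bullet> \<xi> \<omega>"
      using integral_linear[OF integrable_continuous_real[OF hc] bounded_linear_inner_left[of "\<xi> \<omega>"]] by (simp add: o_def)
    finally show ?thesis .
  qed
  have "expectation (\<lambda>\<omega>. integral {s..T} (\<lambda>t. noise_kernel T s t \<odot> (w t \<omega> - w s \<omega>)) \<bullet> \<xi> \<omega>) = (LINT \<omega>|P. LINT t|horizon T. f t \<omega>)"
    by (intro Bochner_Integration.integral_cong) (simp_all add: path)
  also have "\<dots> = (LINT t|horizon T. LINT \<omega>|P. f t \<omega>)"
    by (rule HP.Fubini_integral[OF int])
  also have "\<dots> = (LINT t|horizon T. 0)"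
    by (intro Bochner_Integration.integral_cong) (simp_all add: space_restrict_space e2)
  finally show ?thesis by simp
qed

lemma closed_loop_horizon_square_integrable:
  assumes x: "closed_loop (loop T) x0 x" and T: "0 \<le> T"
  shows "integrable (horizon T \<Otimes>\<^sub>M P) (\<lambda>(t, \<omega>). (norm (x t \<omega>))\<^sup>2)"
proof (rule integrableI_bounded)
  let ?H = "horizon T"
  let ?N = "?H \<Otimes>\<^sub>M P"
  have spH: "space ?H = {0..T}" by (simp add: space_restrict_space)
  have emH: "emeasure ?H {0..T} = ennreal T" using T by (simp add: emeasure_restrict_space)
  have xm [measurable]: "(\<lambda>(t, \<omega>). x t \<omega>) \<in> borel_measurable ?N"
    by (rule jointly_measurable_horizon[OF closed_loop_jointly_measurable[OF x]])
  show "(\<lambda>(t, \<omega>). (norm (x t \<omega>))\<^sup>2) \<in> borel_measurable ?N" by measurable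
  obtain c2 where c2: "0 \<le> c2" "\<And>t. t \<in> {0..T} \<Longrightarrow> (\<integral>\<^sup>+\<omega>. ennreal ((norm (x t \<omega>))\<^sup>2) \<partial>P) \<le> ennreal c2"
    using closed_loop_second_moment[OF x continuous_on_loop norm_loop T] by blast
  have "(\<integral>\<^sup>+p. ennreal (norm (case p of (t, \<omega>) \<Rightarrow> (norm (x t \<omega>))\<^sup>2)) \<partial>?N)
      = (\<integral>\<^sup>+t. \<integral>\<^sup>+\<omega>. ennreal ((norm (x t \<omega>))\<^sup>2) \<partial>P \<partial>?H)"
    by (subst nn_integral_fst[symmetric]) (simp_all add: case_prod_beta')
  also have "\<dots> \<le> (\<integral>\<^sup>+t. ennreal c2 \<partial>?H)" by (intro nn_integral_mono c2) (simp add: spH)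
  also have "\<dots> < \<infinity>" by (simp add: spH emH ennreal_mult_less_top)
  finally show "(\<integral>\<^sup>+p. ennreal (norm (case p of (t, \<omega>) \<Rightarrow> (norm (x t \<omega>))\<^sup>2)) \<partial>?N) < \<infinity>" .
qed

text \<open>First variation of the cost. A perturbation \<open>v\<close> of the feedback control moves the state by \<open>\<Delta>\<close>;
  exchanging the order of integration turns the term \<open>\<langle>M x, \<Delta>\<rangle>\<close> into the adjoint state paired with
  \<open>B v\<close>, and the adjoint state cancels the control term up to noise that is orthogonal to \<open>v\<close>.\<close>

lemma first_variation_zero:
  assumes x: "closed_loop (loop T) x0 x" and T: "0 \<le> T"
    and vm: "(\<lambda>(t, \<omega>). v t \<omega>) \<in> borel_measurable (horizon T \<Otimes>\<^sub>M P)"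
    and vh: "\<And>t. t \<in> {0..T} \<Longrightarrow> v t \<in> borel_measurable (history P w t)"
    and v2: "integrable (horizon T \<Otimes>\<^sub>M P) (\<lambda>(t, \<omega>). (norm (v t \<omega>))\<^sup>2)"
    and \<Delta>m: "(\<lambda>(t, \<omega>). \<Delta> t \<omega>) \<in> borel_measurable (horizon T \<Otimes>\<^sub>M P)"
    and \<Delta>: "\<And>t. t \<in> {0..T} \<Longrightarrow> AE \<omega> in P. set_integrable lborel {0..t} (\<lambda>s. op_semigroup A (t - s) \<odot> B \<odot> v s \<omega>) \<and>
      \<Delta> t \<omega> = (LBINT s:{0..t}. op_semigroup A (t - s) \<odot> B \<odot> v s \<omega>)"
  defines "cr \<equiv> \<lambda>t \<omega>. exp (- \<rho> * t) * (\<Delta> t \<omega> \<bullet> (M \<odot> x t \<omega>) + v t \<omega> \<bullet> (R \<odot> gain T t \<odot> x t \<omega>))"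
  shows "integrable (horizon T \<Otimes>\<^sub>M P) (\<lambda>(t, \<omega>). cr t \<omega>)"
    and "(LINT p|(horizon T \<Otimes>\<^sub>M P). cr (fst p) (snd p)) = 0"
proof -
  let ?H = "horizon T"
  let ?N = "?H \<Otimes>\<^sub>M P"
  interpret H: finite_measure ?H by (rule finite_measure_horizon)
  interpret HP: pair_sigma_finite ?H P ..
  interpret HN: pair_sigma_finite ?H ?N ..
  have spH: "space ?H = {0..T}" by (simp add: space_restrict_space)
  have emH: "emeasure ?H {0..T} = ennreal T" using T by (simp add: emeasure_restrict_space)
  note [measurable] = measurable_horizon_borel vm \<Delta>m
  have xm [measurable]: "(\<lambda>(t, \<omega>). x t \<omega>) \<in> borel_measurable ?N"
    by (rule jointly_measurable_horizon[OF closed_loop_jointly_measurable[OF x]])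
  have gx [measurable]: "(\<lambda>(t, \<omega>). gain T t \<odot> x t \<omega>) \<in> borel_measurable ?N"
    unfolding case_prod_beta' by (rule measurable_apply_continuous[OF continuous_on_gain]) measurable
  have yx [measurable]: "(\<lambda>(t, \<omega>). to_go T t \<odot> x t \<omega>) \<in> borel_measurable ?N"
    unfolding case_prod_beta' by (rule measurable_apply_continuous[OF continuous_on_to_go]) measurable
  obtain c2 where c2: "0 \<le> c2" "\<And>t. t \<in> {0..T} \<Longrightarrow> (\<integral>\<^sup>+\<omega>. ennreal ((norm (x t \<omega>))\<^sup>2) \<partial>P) \<le> ennreal c2"
    using closed_loop_second_moment[OF x continuous_on_loop norm_loop T] by blast
  have x2: "integrable ?N (\<lambda>(t, \<omega>). (norm (x t \<omega>))\<^sup>2)"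
    by (rule closed_loop_horizon_square_integrable[OF x T])
  define a where "a t s \<omega> = exp (- \<rho> * t) * ((op_semigroup A (t - s) \<odot> M \<odot> x t \<omega>) \<bullet> (B \<odot> v s \<omega>))" for t s \<omega>
  define f where "f t s \<omega> = indicator {s..T} t * a t s \<omega>" for t s \<omega>
  define K where "K = exp (T * norm A) * norm M * norm B"
  have K0: "0 \<le> K" by (simp add: K_def)
  have sg: "norm (op_semigroup A (t - s)) \<le> exp (T * norm A)" if "t \<in> {0..T}" "s \<in> {0..T}" for t s
    using that by (intro order_trans[OF norm_semigroup]) (simp add: mult_right_mono abs_if)
  have disc: "\<bar>exp (- \<rho> * t) * y\<bar> \<le> \<bar>y\<bar>" if "0 \<le> t" for t y
  proof -
    have "exp (- \<rho> * t) \<le> 1" using \<rho> that by simp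
    from mult_right_mono[OF this, of "\<bar>y\<bar>"] show ?thesis by (simp add: abs_mult)
  qed
  have a_bd: "\<bar>a t s \<omega>\<bar> \<le> K * ((norm (x t \<omega>))\<^sup>2 + (norm (v s \<omega>))\<^sup>2)" if t: "t \<in> {0..T}" and s: "s \<in> {0..T}" for t s \<omega>
  proof -
    have "\<bar>a t s \<omega>\<bar> \<le> \<bar>(op_semigroup A (t - s) \<odot> M \<odot> x t \<omega>) \<bullet> (B \<odot> v s \<omega>)\<bar>"
      unfolding a_def using t by (intro disc) auto
    also have "\<dots> \<le> norm (op_semigroup A (t - s) \<odot> M \<odot> x t \<omega>) * norm (B \<odot> v s \<omega>)" by (rule Cauchy_Schwarz_ineq2)
    also have "\<dots> \<le> (exp (T * norm A) * (norm M * norm (x t \<omega>))) * (norm B * norm (v s \<omega>))"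
      using sg[OF t s] by (intro mult_mono order_trans[OF norm_bop_apply[of "op_semigroup A (t - s)"]] norm_bop_apply) auto
    also have "\<dots> = K * (\<bar>norm (x t \<omega>)\<bar> * \<bar>norm (v s \<omega>)\<bar>)" by (simp add: K_def mult_ac)
    also have "\<dots> \<le> K * ((norm (x t \<omega>))\<^sup>2 + (norm (v s \<omega>))\<^sup>2)"
      by (intro mult_left_mono abs_mult_le_squares K0)
    finally show ?thesis .
  qed
  have fm [measurable]: "(\<lambda>(t, s, \<omega>). f t s \<omega>) \<in> borel_measurable (?H \<Otimes>\<^sub>M ?N)"
  proof -
    have 1: "(\<lambda>p. x (fst p) (snd (snd p))) \<in> borel_measurable (?H \<Otimes>\<^sub>M ?N)"
    proof -
      have "(\<lambda>p. (fst p, snd (snd p))) \<in> ?H \<Otimes>\<^sub>M ?N \<rightarrow>\<^sub>M ?H \<Otimes>\<^sub>M P" by measurable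
      from measurable_compose[OF this xm] show ?thesis by simp
    qed
    have [measurable]: "(\<lambda>p. v (fst (snd p)) (snd (snd p))) \<in> borel_measurable (?H \<Otimes>\<^sub>M ?N)"
      using measurable_compose[OF measurable_snd vm] by (simp add: case_prod_beta')
    have [measurable]: "(\<lambda>p. fst p) \<in> borel_measurable (?H \<Otimes>\<^sub>M ?N)"
      by (rule measurable_compose[OF measurable_fst measurable_horizon_borel])
    have [measurable]: "(\<lambda>p. fst (snd p)) \<in> borel_measurable (?H \<Otimes>\<^sub>M ?N)"
      by (rule measurable_compose[OF measurable_snd measurable_compose[OF measurable_fst measurable_horizon_borel]])
    have sgc: "continuous_on UNIV (op_semigroup A)" by (intro continuous_intros)
    have [measurable]: "(\<lambda>p. op_semigroup A (fst p - fst (snd p)) \<odot> M \<odot> x (fst p) (snd (snd p))) \<in> borel_measurable (?H \<Otimes>\<^sub>M ?N)"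
      by (rule measurable_apply_continuous[OF sgc]) (use measurable_compose[OF 1 bop_apply_measurable] in measurable)
    have e: "f t s \<omega> = (if s \<le> t \<and> t \<le> T then a t s \<omega> else 0)" for t s \<omega> by (simp add: f_def indicator_def)
    show ?thesis unfolding e a_def case_prod_beta' by measurable
  qed
  have fm' [measurable]: "(\<lambda>p. f (fst p) (fst (snd p)) (snd (snd p))) \<in> borel_measurable (?H \<Otimes>\<^sub>M ?N)"
    using fm by (simp add: case_prod_beta')
  have f_bd: "\<bar>f t s \<omega>\<bar> \<le> K * ((norm (x t \<omega>))\<^sup>2 + (norm (v s \<omega>))\<^sup>2)" if "t \<in> {0..T}" "s \<in> {0..T}" for t s \<omega>
    using a_bd[OF that, of \<omega>] K0 by (auto simp: f_def indicator_def)
  have fi: "integrable (?H \<Otimes>\<^sub>M ?N) (\<lambda>(t, s, \<omega>). f t s \<omega>)"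
  proof (rule integrableI_bounded)
    have "(\<integral>\<^sup>+p. ennreal (norm (case p of (t, s, \<omega>) \<Rightarrow> f t s \<omega>)) \<partial>(?H \<Otimes>\<^sub>M ?N))
        = (\<integral>\<^sup>+t. \<integral>\<^sup>+q. ennreal \<bar>f t (fst q) (snd q)\<bar> \<partial>?N \<partial>?H)"
      by (subst HP.P.nn_integral_fst[symmetric]) (simp_all add: case_prod_beta')
    also have "\<dots> = (\<integral>\<^sup>+t. \<integral>\<^sup>+s. \<integral>\<^sup>+\<omega>. ennreal \<bar>f t s \<omega>\<bar> \<partial>P \<partial>?H \<partial>?H)"
    proof (rule nn_integral_cong)
      fix t assume "t \<in> space ?H"
      then have "(\<lambda>q. ennreal \<bar>f t (fst q) (snd q)\<bar>) \<in> borel_measurable ?N"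
        using measurable_compose[OF measurable_Pair1'[of t ?H ?N] fm] by (simp add: case_prod_beta')
      then show "(\<integral>\<^sup>+q. ennreal \<bar>f t (fst q) (snd q)\<bar> \<partial>?N) = (\<integral>\<^sup>+s. \<integral>\<^sup>+\<omega>. ennreal \<bar>f t s \<omega>\<bar> \<partial>P \<partial>?H)"
        by (subst nn_integral_fst[symmetric]) simp_all
    qed
    also have "\<dots> \<le> (\<integral>\<^sup>+t. \<integral>\<^sup>+s. ennreal K * (ennreal c2 + (\<integral>\<^sup>+\<omega>. ennreal ((norm (v s \<omega>))\<^sup>2) \<partial>P)) \<partial>?H \<partial>?H)"
    proof (intro nn_integral_mono)
      fix t s assume t: "t \<in> space ?H" and s: "s \<in> space ?H"
      have [measurable]: "x t \<in> borel_measurable P" "v s \<in> borel_measurable P"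
        using measurable_compose[OF measurable_Pair1'[OF t] xm] measurable_compose[OF measurable_Pair1'[OF s] vm] by simp_all
      have "(\<integral>\<^sup>+\<omega>. ennreal \<bar>f t s \<omega>\<bar> \<partial>P) \<le> (\<integral>\<^sup>+\<omega>. ennreal K * (ennreal ((norm (x t \<omega>))\<^sup>2) + ennreal ((norm (v s \<omega>))\<^sup>2)) \<partial>P)"
      proof (rule nn_integral_mono)
        fix \<omega>
        have "ennreal \<bar>f t s \<omega>\<bar> \<le> ennreal (K * ((norm (x t \<omega>))\<^sup>2 + (norm (v s \<omega>))\<^sup>2))"
          using t s by (intro ennreal_leI f_bd) (auto simp: spH)
        then show "ennreal \<bar>f t s \<omega>\<bar> \<le> ennreal K * (ennreal ((norm (x t \<omega>))\<^sup>2) + ennreal ((norm (v s \<omega>))\<^sup>2))"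
          using K0 by (simp add: ennreal_mult ennreal_plus)
      qed
      also have "\<dots> = ennreal K * ((\<integral>\<^sup>+\<omega>. ennreal ((norm (x t \<omega>))\<^sup>2) \<partial>P) + (\<integral>\<^sup>+\<omega>. ennreal ((norm (v s \<omega>))\<^sup>2) \<partial>P))"
        by (simp add: nn_integral_cmult nn_integral_add)
      also have "\<dots> \<le> ennreal K * (ennreal c2 + (\<integral>\<^sup>+\<omega>. ennreal ((norm (v s \<omega>))\<^sup>2) \<partial>P))"
        using t c2(2)[of t] by (intro mult_left_mono add_right_mono) (auto simp: spH)
      finally show "(\<integral>\<^sup>+\<omega>. ennreal \<bar>f t s \<omega>\<bar> \<partial>P) \<le> ennreal K * (ennreal c2 + (\<integral>\<^sup>+\<omega>. ennreal ((norm (v s \<omega>))\<^sup>2) \<partial>P))" .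
    qed
    also have "\<dots> = (ennreal K * (ennreal c2 * ennreal T + (\<integral>\<^sup>+q. ennreal ((norm (v (fst q) (snd q)))\<^sup>2) \<partial>?N))) * ennreal T"
    proof -
      have vN: "(\<lambda>q. ennreal ((norm (v (fst q) (snd q)))\<^sup>2)) \<in> borel_measurable ?N"
        using vm by (simp add: case_prod_beta')
      have m: "(\<lambda>s. \<integral>\<^sup>+\<omega>. ennreal ((norm (v s \<omega>))\<^sup>2) \<partial>P) \<in> borel_measurable ?H"
        using borel_measurable_nn_integral_fst[OF vN] by simp
      have "(\<integral>\<^sup>+s. ennreal K * (ennreal c2 + (\<integral>\<^sup>+\<omega>. ennreal ((norm (v s \<omega>))\<^sup>2) \<partial>P)) \<partial>?H)
          = ennreal K * (ennreal c2 * ennreal T + (\<integral>\<^sup>+s. \<integral>\<^sup>+\<omega>. ennreal ((norm (v s \<omega>))\<^sup>2) \<partial>P \<partial>?H))"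
        using m by (simp add: nn_integral_cmult nn_integral_add spH emH)
      also have "(\<integral>\<^sup>+s. \<integral>\<^sup>+\<omega>. ennreal ((norm (v s \<omega>))\<^sup>2) \<partial>P \<partial>?H) = (\<integral>\<^sup>+q. ennreal ((norm (v (fst q) (snd q)))\<^sup>2) \<partial>?N)"
        using nn_integral_fst[OF vN] by simp
      finally show ?thesis by (simp add: spH emH)
    qed
    also have "\<dots> < \<infinity>"
      using v2 unfolding integrable_iff_bounded by (simp add: case_prod_beta' ennreal_mult_less_top ennreal_add_less_top)
    finally show "(\<integral>\<^sup>+p. ennreal (norm (case p of (t, s, \<omega>) \<Rightarrow> f t s \<omega>)) \<partial>(?H \<Otimes>\<^sub>M ?N)) < \<infinity>" .
  qed measurable
  \<comment> \<open>integrating over \<open>t\<close> first produces the adjoint state\<close>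
  define r1 where "r1 s \<omega> = exp (- \<rho> * s) * (v s \<omega> \<bullet> (R \<odot> gain T s \<odot> x s \<omega>))" for s \<omega>
  define r2 where "r2 s \<omega> = integral {s..T} (\<lambda>t. noise_kernel T s t \<odot> (w t \<omega> - w s \<omega>)) \<bullet> (B \<odot> v s \<omega>)" for s \<omega>
  have inner_t: "(LINT t|?H. f t s \<omega>) = r2 s \<omega> - r1 s \<omega>" if s: "s \<in> {0..T}" and o: "\<omega> \<in> space P" for s \<omega>
  proof -
    let ?h = "\<lambda>t. exp (- \<rho> * t) *\<^sub>R (op_semigroup A (t - s) \<odot> M \<odot> x t \<omega>)"
    have hc: "continuous_on {s..T} ?h" using s by (intro continuous_intros closed_loop_continuous_on[OF x o]) auto
    have "(LINT t|?H. f t s \<omega>) = integral {s..T} (\<lambda>t. ?h t \<bullet> (B \<odot> v s \<omega>))"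
      using set_integral_horizon(2)[OF continuous_on_inner[OF hc continuous_on_const[of _ "B \<odot> v s \<omega>"]], of T] s
      by (simp add: f_def a_def)
    also have "\<dots> = integral {s..T} ?h \<bullet> (B \<odot> v s \<omega>)"
      using integral_linear[OF integrable_continuous_real[OF hc] bounded_linear_inner_left[of "B \<odot> v s \<omega>"]] by (simp add: o_def)
    also have "\<dots> = exp (- \<rho> * s) * ((to_go T s \<odot> x s \<omega>) \<bullet> (B \<odot> v s \<omega>)) + r2 s \<omega>"
      using adjoint_state[OF x o, of s] s by (simp add: inner_add_left r2_def)
    also have "exp (- \<rho> * s) * ((to_go T s \<odot> x s \<omega>) \<bullet> (B \<odot> v s \<omega>)) = - r1 s \<omega>"
    proof -
      have "R \<odot> gain T s \<odot> x s \<omega> = - ((R * Ri) \<odot> B \<odot> to_go T s \<odot> x s \<omega>)"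
        by (simp add: gain_def bop.minus_left bop.minus_right)
      also have "\<dots> = - (B \<odot> to_go T s \<odot> x s \<omega>)" by (simp only: R_Ri bop_apply_one)
      finally show ?thesis using selfadjD[OF B, of "v s \<omega>" "to_go T s \<odot> x s \<omega>"] by (simp add: r1_def inner_commute)
    qed
    finally show ?thesis by simp
  qed
  have r1m: "(\<lambda>(s, \<omega>). r1 s \<omega>) \<in> borel_measurable ?N" unfolding r1_def by measurable
  define K1 where "K1 = norm R * (norm (Ri * B) * c)"
  have K10: "0 \<le> K1" unfolding K1_def using c_nonneg by simp
  have r1_bd: "\<bar>r1 s \<omega>\<bar> \<le> K1 * ((norm (x s \<omega>))\<^sup>2 + (norm (v s \<omega>))\<^sup>2)" if s: "s \<in> {0..T}" for s \<omega>
  proof -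
    have "\<bar>r1 s \<omega>\<bar> \<le> \<bar>v s \<omega> \<bullet> (R \<odot> gain T s \<odot> x s \<omega>)\<bar>"
      unfolding r1_def using s by (intro disc) auto
    also have "\<dots> \<le> norm (v s \<omega>) * norm (R \<odot> gain T s \<odot> x s \<omega>)" by (rule Cauchy_Schwarz_ineq2)
    also have "norm (R \<odot> gain T s \<odot> x s \<omega>) \<le> norm R * (norm (gain T s) * norm (x s \<omega>))"
      by (intro order_trans[OF norm_bop_apply] mult_left_mono norm_bop_apply) simp
    also have "norm (gain T s) \<le> norm (Ri * B) * c"
      unfolding gain_def norm_minus_cancel
      by (rule order_trans[OF norm_mult_ineq]) (intro mult_left_mono norm_to_go norm_ge_zero)
    finally have "\<bar>r1 s \<omega>\<bar> \<le> K1 * (\<bar>norm (x s \<omega>)\<bar> * \<bar>norm (v s \<omega>)\<bar>)"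
      by (simp add: K1_def mult_left_mono mult_right_mono mult_ac)
    also have "\<dots> \<le> K1 * ((norm (x s \<omega>))\<^sup>2 + (norm (v s \<omega>))\<^sup>2)"
      by (intro mult_left_mono abs_mult_le_squares K10)
    finally show ?thesis .
  qed
  have r1i: "integrable ?N (\<lambda>(s, \<omega>). r1 s \<omega>)"
  proof (rule Bochner_Integration.integrable_bound)
    show "integrable ?N (\<lambda>p. K1 * ((case p of (t, \<omega>) \<Rightarrow> (norm (x t \<omega>))\<^sup>2) + (case p of (t, \<omega>) \<Rightarrow> (norm (v t \<omega>))\<^sup>2)))"
      by (intro integrable_mult_right Bochner_Integration.integrable_add x2 v2)
    show "AE p in ?N. norm (case p of (s, \<omega>) \<Rightarrow> r1 s \<omega>) \<le> norm (K1 * ((case p of (t, \<omega>) \<Rightarrow> (norm (x t \<omega>))\<^sup>2) + (case p of (t, \<omega>) \<Rightarrow> (norm (v t \<omega>))\<^sup>2)))"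
      using r1_bd K10 by (intro AE_I2) (auto simp: space_pair_measure spH abs_mult)
  qed (rule r1m)
  have fN: "integrable ?N (\<lambda>q. LINT t|?H. f t (fst q) (snd q))"
    using HN.integrable_snd[of "\<lambda>t q. f t (fst q) (snd q)"] fi by (simp add: case_prod_beta')
  have r12: "AE q in ?N. (LINT t|?H. f t (fst q) (snd q)) = r2 (fst q) (snd q) - r1 (fst q) (snd q)"
    by (rule AE_I2) (auto simp: space_pair_measure spH inner_t)
  have r2m: "(\<lambda>q. r2 (fst q) (snd q)) \<in> borel_measurable ?N"
  proof -
    have "(\<lambda>q. (LINT t|?H. f t (fst q) (snd q)) + r1 (fst q) (snd q)) \<in> borel_measurable ?N"
      using fN r1m by (intro borel_measurable_add) (auto simp: case_prod_beta')
    then show ?thesis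
      by (rule measurable_cong[THEN iffD1, rotated]) (auto simp: space_pair_measure spH inner_t)
  qed
  have r2i: "integrable ?N (\<lambda>q. r2 (fst q) (snd q))"
  proof -
    have "integrable ?N (\<lambda>q. (LINT t|?H. f t (fst q) (snd q)) + r1 (fst q) (snd q))"
      using fN r1i by (intro Bochner_Integration.integrable_add) (auto simp: case_prod_beta')
    then show ?thesis
      by (rule integrable_cong_AE_imp[OF _ r2m]) (use r12 in \<open>eventually_elim, simp\<close>)
  qed
  have r2_zero: "(LINT q|?N. r2 (fst q) (snd q)) = 0"
  proof -
    have vfin: "AE s in ?H. integrable P (\<lambda>\<omega>. (norm (v s \<omega>))\<^sup>2)"
      using HP.AE_integrable_fst'[OF v2] by simp
    have "(LINT q|?N. r2 (fst q) (snd q)) = (LINT s|?H. LINT \<omega>|P. r2 s \<omega>)"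
      using HP.integral_fst'[OF r2i] by simp
    also have "\<dots> = (LINT s|?H. 0)"
    proof (rule integral_cong_AE)
      show "(\<lambda>s. LINT \<omega>|P. r2 s \<omega>) \<in> borel_measurable ?H"
        using HP.integrable_fst'[OF r2i] by simp
      have "AE s in ?H. s \<in> {0..T}" by (rule AE_I2) (simp add: spH)
      with vfin show "AE s in ?H. (LINT \<omega>|P. r2 s \<omega>) = 0"
      proof eventually_elim
        case (elim s)
        have Bh: "(\<lambda>\<omega>. B \<odot> v s \<omega>) \<in> borel_measurable (history P w s)"
          by (rule measurable_compose[OF vh bop_apply_measurable]) (use elim in auto)
        have "integrable P (\<lambda>\<omega>. (norm B)\<^sup>2 * (norm (v s \<omega>))\<^sup>2)" using elim by simp
        then have "integrable P (\<lambda>\<omega>. (norm (B \<odot> v s \<omega>))\<^sup>2)"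
        proof (rule Bochner_Integration.integrable_bound)
          show "(\<lambda>\<omega>. (norm (B \<odot> v s \<omega>))\<^sup>2) \<in> borel_measurable P"
            using measurable_of_history[OF Bh] by measurable
          have "(norm (B \<odot> v s \<omega>))\<^sup>2 \<le> (norm B)\<^sup>2 * (norm (v s \<omega>))\<^sup>2" for \<omega>
            using power_mono[OF norm_bop_apply[of B "v s \<omega>"], of 2] by (simp add: power_mult_distrib)
          then show "AE \<omega> in P. norm ((norm (B \<odot> v s \<omega>))\<^sup>2) \<le> norm ((norm B)\<^sup>2 * (norm (v s \<omega>))\<^sup>2)" by simp
        qed
        then show ?case unfolding r2_def using elim by (intro noise_term_orthogonal Bh) auto
      qed
    qed simp
    finally show ?thesis by simp
  qed
  \<comment> \<open>integrating over \<open>s\<close> first produces the displacement \<open>\<Delta>\<close>\<close>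
  define k where "k t \<omega> = exp (- \<rho> * t) * (\<Delta> t \<omega> \<bullet> (M \<odot> x t \<omega>))" for t \<omega>
  have km: "(\<lambda>(t, \<omega>). k t \<omega>) \<in> borel_measurable ?N" unfolding k_def by measurable
  have inner_s: "AE \<omega> in P. (LINT s|?H. f t s \<omega>) = k t \<omega>" if t: "t \<in> {0..T}" for t
    using \<Delta>[OF t]
  proof eventually_elim
    case (elim \<omega>)
    let ?z = "\<lambda>s. op_semigroup A (t - s) \<odot> B \<odot> v s \<omega>"
    have "(LINT s|?H. f t s \<omega>) = (LINT s|lborel. exp (- \<rho> * t) * ((indicator {0..t} s *\<^sub>R ?z s) \<bullet> (M \<odot> x t \<omega>)))"
    proof (subst integral_restrict_space)
      have "indicator {0..T} s *\<^sub>R f t s \<omega> = exp (- \<rho> * t) * ((indicator {0..t} s *\<^sub>R ?z s) \<bullet> (M \<odot> x t \<omega>))" for s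
        using t selfadjD[OF selfadj_semigroup[OF A], of "t - s" "M \<odot> x t \<omega>" "B \<odot> v s \<omega>"]
        by (auto simp: f_def a_def indicator_def inner_commute)
      then show "(LINT s|lborel. indicator {0..T} s *\<^sub>R f t s \<omega>) = (LINT s|lborel. exp (- \<rho> * t) * ((indicator {0..t} s *\<^sub>R ?z s) \<bullet> (M \<odot> x t \<omega>)))"
        by simp
    qed simp
    also have "\<dots> = exp (- \<rho> * t) * ((LINT s|lborel. indicator {0..t} s *\<^sub>R ?z s) \<bullet> (M \<odot> x t \<omega>))"
      using elim unfolding set_integrable_def by (simp only: integral_mult_right_zero integral_inner_left)
    also have "\<dots> = k t \<omega>" using elim by (simp add: k_def set_lebesgue_integral_def)
    finally show ?case .
  qed
  have fN_t: "(\<lambda>q. f t (fst q) (snd q)) \<in> borel_measurable ?N" if "t \<in> {0..T}" for t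
    using measurable_compose[OF measurable_Pair1'[of t ?H ?N] fm] that by (simp add: case_prod_beta' spH)
  have ki: "integrable ?N (\<lambda>(t, \<omega>). k t \<omega>)"
  proof (rule integrableI_bounded[OF km])
    have "(\<integral>\<^sup>+p. ennreal (norm (case p of (t, \<omega>) \<Rightarrow> k t \<omega>)) \<partial>?N) = (\<integral>\<^sup>+t. \<integral>\<^sup>+\<omega>. ennreal \<bar>k t \<omega>\<bar> \<partial>P \<partial>?H)"
      using km by (subst nn_integral_fst[symmetric]) (simp_all add: case_prod_beta')
    also have "\<dots> \<le> (\<integral>\<^sup>+t. \<integral>\<^sup>+q. ennreal \<bar>f t (fst q) (snd q)\<bar> \<partial>?N \<partial>?H)"
    proof (rule nn_integral_mono)
      fix t assume "t \<in> space ?H"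
      then have t: "t \<in> {0..T}" by (simp add: spH)
      note ft = fN_t[OF t]
      have "(\<integral>\<^sup>+\<omega>. ennreal \<bar>k t \<omega>\<bar> \<partial>P) \<le> (\<integral>\<^sup>+\<omega>. \<integral>\<^sup>+s. ennreal \<bar>f t s \<omega>\<bar> \<partial>?H \<partial>P)"
      proof (rule nn_integral_mono_AE, use inner_s[OF t] in eventually_elim)
        case (elim \<omega>)
        have "ennreal \<bar>LINT s|?H. f t s \<omega>\<bar> \<le> (\<integral>\<^sup>+s. ennreal \<bar>f t s \<omega>\<bar> \<partial>?H)"
          using integral_norm_bound_ennreal[of ?H "\<lambda>s. f t s \<omega>"]
          by (cases "integrable ?H (\<lambda>s. f t s \<omega>)") (simp_all add: not_integrable_integral_eq)
        then show ?case unfolding elim .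
      qed
      also have "\<dots> = (\<integral>\<^sup>+q. ennreal \<bar>f t (fst q) (snd q)\<bar> \<partial>?N)"
      proof -
        have "(\<lambda>q. ennreal \<bar>f t (fst q) (snd q)\<bar>) \<in> borel_measurable ?N" using ft by measurable
        from HP.nn_integral_snd[OF this] show ?thesis by simp
      qed
      finally show "(\<integral>\<^sup>+\<omega>. ennreal \<bar>k t \<omega>\<bar> \<partial>P) \<le> (\<integral>\<^sup>+q. ennreal \<bar>f t (fst q) (snd q)\<bar> \<partial>?N)" .
    qed
    also have "\<dots> = (\<integral>\<^sup>+p. ennreal (norm (case p of (t, s, \<omega>) \<Rightarrow> f t s \<omega>)) \<partial>(?H \<Otimes>\<^sub>M ?N))"
      by (subst HP.P.nn_integral_fst[symmetric]) (simp_all add: case_prod_beta')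
    also have "\<dots> < \<infinity>" using fi unfolding integrable_iff_bounded by simp
    finally show "(\<integral>\<^sup>+p. ennreal (norm (case p of (t, \<omega>) \<Rightarrow> k t \<omega>)) \<partial>?N) < \<infinity>" .
  qed
  have k_eq: "(LINT p|?N. k (fst p) (snd p)) = (LINT q|?N. LINT t|?H. f t (fst q) (snd q))"
  proof -
    have fi': "integrable (?H \<Otimes>\<^sub>M ?N) (\<lambda>(t, q). f t (fst q) (snd q))" using fi by (simp add: case_prod_beta')
    have ki': "integrable ?N (\<lambda>p. k (fst p) (snd p))" using ki by (simp add: case_prod_beta')
    have "(LINT p|?N. k (fst p) (snd p)) = (LINT t|?H. LINT \<omega>|P. k t \<omega>)"
      using HP.integral_fst'[OF ki'] by simp
    also have "\<dots> = (LINT t|?H. LINT q|?N. f t (fst q) (snd q))"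
    proof (rule integral_cong_AE)
      show "(\<lambda>t. LINT \<omega>|P. k t \<omega>) \<in> borel_measurable ?H"
        using HP.integrable_fst'[OF ki'] by simp
      show "(\<lambda>t. LINT q|?N. f t (fst q) (snd q)) \<in> borel_measurable ?H"
        using HN.integrable_fst'[OF fi'] by simp
      have "AE t in ?H. t \<in> {0..T}" by (rule AE_I2) (simp add: spH)
      with HN.AE_integrable_fst'[OF fi'] show "AE t in ?H. (LINT \<omega>|P. k t \<omega>) = (LINT q|?N. f t (fst q) (snd q))"
      proof eventually_elim
        case (elim t)
        then have i: "integrable ?N (\<lambda>q. f t (fst q) (snd q))" by simp
        have "(LINT q|?N. f t (fst q) (snd q)) = (LINT \<omega>|P. LINT s|?H. f t s \<omega>)"
          using HP.integral_snd[of "\<lambda>s \<omega>. f t s \<omega>"] i by (simp add: case_prod_beta')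
        also have "\<dots> = (LINT \<omega>|P. k t \<omega>)"
        proof (rule integral_cong_AE)
          show "(\<lambda>\<omega>. LINT s|?H. f t s \<omega>) \<in> borel_measurable P"
            using HP.integrable_snd[of "\<lambda>s \<omega>. f t s \<omega>"] i by (simp add: case_prod_beta')
          show "k t \<in> borel_measurable P"
            using measurable_compose[OF measurable_Pair1'[of t ?H P] km] elim by (simp add: spH)
        qed (rule inner_s[OF elim(2)])
        finally show ?case by simp
      qed
    qed
    also have "\<dots> = (LINT q|?N. LINT t|?H. f t (fst q) (snd q))"
      using HN.Fubini_integral[OF fi'] by simp
    finally show ?thesis .
  qed
  have cr_eq: "cr t \<omega> = k t \<omega> + r1 t \<omega>" for t \<omega>
    by (simp add: cr_def k_def r1_def distrib_left)
  have ki': "integrable ?N (\<lambda>p. k (fst p) (snd p))" using ki by (simp add: case_prod_beta')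
  have r1i': "integrable ?N (\<lambda>p. r1 (fst p) (snd p))" using r1i by (simp add: case_prod_beta')
  show "integrable ?N (\<lambda>(t, \<omega>). cr t \<omega>)"
    unfolding cr_eq case_prod_beta' using ki' r1i' by (rule Bochner_Integration.integrable_add)
  have "(LINT p|?N. cr (fst p) (snd p)) = (LINT p|?N. k (fst p) (snd p)) + (LINT p|?N. r1 (fst p) (snd p))"
    unfolding cr_eq using ki' r1i' by (rule Bochner_Integration.integral_add)
  also have "(LINT p|?N. k (fst p) (snd p)) = (LINT q|?N. r2 (fst q) (snd q) - r1 (fst q) (snd q))"
    unfolding k_eq using fN r2m r1m r12 by (intro integral_cong_AE) (auto simp: case_prod_beta')
  also have "\<dots> = - (LINT p|?N. r1 (fst p) (snd p))"
    using r2_zero by (simp add: Bochner_Integration.integral_diff[OF r2i r1i'])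
  finally show "(LINT p|?N. cr (fst p) (snd p)) = 0" by simp
qed

end

context q_noise
begin

lemma path_measurable:
  fixes y :: "real \<Rightarrow> 'w \<Rightarrow> L2"
  assumes y: "jointly_measurable P y" and o: "\<omega> \<in> space P"
  shows "(\<lambda>s. indicator {0..t} s *\<^sub>R y s \<omega>) \<in> borel_measurable lborel"
proof -
  have "(\<lambda>s. (s, \<omega>)) \<in> halfline \<rightarrow>\<^sub>M halfline \<Otimes>\<^sub>M P" using o by simp
  from measurable_compose[OF measurable_compose[OF measurable_horizon_halfline this] y[unfolded jointly_measurable_def]]
  have "(\<lambda>s. y s \<omega>) \<in> borel_measurable (horizon t)" by simp
  then show ?thesis by (simp add: borel_measurable_restrict_space_iff)
qed

text \<open>Both processes contain the same stochastic convolution up to a null set, so it cancels and the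
  difference is an integral over time along each path.\<close>

lemma mild_difference:
  assumes x: "closed_loop F x0 x" and F: "continuous_on {0..} F" and g: "continuous_on {0..} g"
    and Fg: "\<And>s. 0 \<le> s \<Longrightarrow> F s = A + B * g s"
    and u': "admissible P w u'" and x': "mild_solution P w (blinfun_of_bop A) (blinfun_of_bop B) x0 u' x'"
    and t: "0 \<le> t"
  shows "AE \<omega> in P. set_integrable lborel {0..t} (\<lambda>s. op_semigroup A (t - s) \<odot> B \<odot> (u' s \<omega> - g s \<odot> x s \<omega>)) \<and>
    x' t \<omega> - x t \<omega> = (LBINT s:{0..t}. op_semigroup A (t - s) \<odot> B \<odot> (u' s \<omega> - g s \<odot> x s \<omega>))"
proof -
  obtain Z where Z: "is_wiener_integral P w t (\<lambda>s. exp_operator ((t - s) *\<^sub>R blinfun_of_bop A)) Z"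
    and xZ: "AE \<omega> in P. x' t \<omega> = exp_operator (t *\<^sub>R blinfun_of_bop A) x0
           + (LBINT s:{0..t}. exp_operator ((t - s) *\<^sub>R blinfun_of_bop A) (blinfun_of_bop B (u' s \<omega>))) + Z \<omega>"
    using x' t unfolding mild_solution_def by blast
  have ZW: "AE \<omega> in P. Z \<omega> = stoch_conv A t \<omega>"
    by (rule wiener_integral_unique[OF t Z stoch_conv_is_wiener_integral[OF t]])
  have sq: "AE \<omega> in P. \<forall>T\<ge>0. set_integrable lborel {0..T} (\<lambda>t. (norm (u' t \<omega>))\<^sup>2)"
    and ju: "jointly_measurable P u'"
    using u' by (simp_all add: admissible_def)
  have sgc: "continuous_on {0..t} (\<lambda>s. op_semigroup A (t - s) * B)" by (intro continuous_intros)
  then have "bounded ((\<lambda>s. op_semigroup A (t - s) * B) ` {0..t})"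
    by (intro compact_imp_bounded compact_continuous_image) auto
  then obtain C where C: "\<And>s. s \<in> {0..t} \<Longrightarrow> norm (op_semigroup A (t - s) * B) \<le> C"
    unfolding bounded_iff by blast
  have C0: "0 \<le> C" using order_trans[OF norm_ge_zero C[of 0]] t by simp
  show ?thesis
    using xZ ZW sq AE_space
  proof eventually_elim
    case (elim \<omega>)
    then have o: "\<omega> \<in> space P" by simp
    have gc: "continuous_on {0..t} g" by (rule continuous_on_subset[OF g]) auto
    have Fc: "continuous_on {0..t} F" by (rule continuous_on_subset[OF F]) auto
    let ?a = "\<lambda>s. op_semigroup A (t - s) \<odot> B \<odot> u' s \<omega>" and ?b = "\<lambda>s. op_semigroup A (t - s) \<odot> B \<odot> g s \<odot> x s \<omega>"
    have bc: "continuous_on {0..t} ?b"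
      by (intro continuous_intros gc closed_loop_continuous_on[OF x o]) auto
    have b: "set_integrable lborel {0..t} ?b" by (rule borel_integrable_atLeastAtMost'[OF bc])
    have a: "set_integrable lborel {0..t} ?a"
      unfolding set_integrable_def
    proof (rule Bochner_Integration.integrable_bound)
      show "integrable lborel (\<lambda>s. C * (indicator {0..t} s * (1 + (norm (u' s \<omega>))\<^sup>2)))"
      proof (rule integrable_mult_right)
        have "set_integrable lborel {0..t} (\<lambda>s. 1 + (norm (u' s \<omega>))\<^sup>2)"
          using elim t by (intro set_integral_add) (auto simp: set_integrable_def)
        then show "integrable lborel (\<lambda>s. indicator {0..t} s * (1 + (norm (u' s \<omega>))\<^sup>2))"
          by (simp add: set_integrable_def)
      qed
      have "continuous_on UNIV (\<lambda>s. op_semigroup A (t - s) * B)" by (intro continuous_intros)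
      from measurable_apply_continuous[OF this _ path_measurable[OF ju o, of t], of "\<lambda>s. s"]
      show "(\<lambda>s. indicator {0..t} s *\<^sub>R ?a s) \<in> borel_measurable lborel" by (simp add: bop.scaleR_right)
      show "AE s in lborel. norm (indicator {0..t} s *\<^sub>R ?a s) \<le> norm (C * (indicator {0..t} s * (1 + (norm (u' s \<omega>))\<^sup>2)))"
      proof (rule AE_I2)
        fix s
        have "norm (?a s) \<le> C * (1 + (norm (u' s \<omega>))\<^sup>2)" if s: "s \<in> {0..t}"
        proof -
          have "norm (?a s) \<le> C * norm (u' s \<omega>)"
            using norm_bop_apply[of "op_semigroup A (t - s) * B" "u' s \<omega>"] mult_right_mono[OF C[OF s], of "norm (u' s \<omega>)"]
            by simp
          also have "norm (u' s \<omega>) \<le> 1 + (norm (u' s \<omega>))\<^sup>2"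
            using zero_le_power2[of "norm (u' s \<omega>) - 1/2"] by (simp add: power2_eq_square algebra_simps)
          finally show ?thesis using C0 by (simp add: mult_left_mono)
        qed
        then show "norm (indicator {0..t} s *\<^sub>R ?a s) \<le> norm (C * (indicator {0..t} s * (1 + (norm (u' s \<omega>))\<^sup>2)))"
          using C0 by (cases "s \<in> {0..t}") (auto simp: abs_mult)
      qed
    qed
    have "x t \<omega> = op_semigroup A t \<odot> x0 + integral {0..t} (\<lambda>s. op_semigroup A (t - s) \<odot> (F s - A) \<odot> x s \<omega>) + stoch_conv A t \<omega>"
      by (rule closed_loop_mild[OF x F o t])
    also have "integral {0..t} (\<lambda>s. op_semigroup A (t - s) \<odot> (F s - A) \<odot> x s \<omega>) = integral {0..t} ?b"
      by (rule integral_cong) (simp add: Fg)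
    also have "\<dots> = (LBINT s:{0..t}. ?b s)" by (rule LBINT_eq_integral[OF bc, symmetric])
    finally have xt: "x t \<omega> = op_semigroup A t \<odot> x0 + (LBINT s:{0..t}. ?b s) + stoch_conv A t \<omega>" .
    have x't: "x' t \<omega> = op_semigroup A t \<odot> x0 + (LBINT s:{0..t}. ?a s) + stoch_conv A t \<omega>"
      using elim by (simp add: exp_operator_semigroup blinfun_of_bop_inverse blinfun_apply_bop)
    have "x' t \<omega> - x t \<omega> = (LBINT s:{0..t}. ?a s) - (LBINT s:{0..t}. ?b s)"
      unfolding xt x't by simp
    also have "\<dots> = (LBINT s:{0..t}. ?a s - ?b s)"
      by (rule set_integral_diff(2)[OF a b, symmetric])
    finally show ?case
      using set_integral_diff(1)[OF a b] by (simp add: bop.diff_right)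
  qed
qed

end

context regulator
begin

lemma norm_gain: "norm (gain T t) \<le> norm (Ri * B) * c"
  unfolding gain_def norm_minus_cancel
  by (rule order_trans[OF norm_mult_ineq]) (intro mult_left_mono norm_to_go norm_ge_zero)

text \<open>The cost is quadratic with positive second order part, so a vanishing first variation makes the
  feedback optimal on the horizon. Competitors of infinite cost are harmless; for the others coercivity of
  \<open>R\<close> provides the square integrability that the first variation needs.\<close>

proposition horizon_optimal:
  assumes x: "closed_loop (loop T) x0 x" and T: "0 \<le> T"
    and u': "admissible P w u'" and x': "mild_solution P w (blinfun_of_bop A) (blinfun_of_bop B) x0 u' x'"
  shows "horizon_cost \<rho> M R T x (\<lambda>t \<omega>. gain T t \<odot> x t \<omega>) \<le> horizon_cost \<rho> M R T x' u'"
proof (cases "horizon_cost \<rho> M R T x' u' = \<infinity>")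
  case False
  let ?N = "horizon T \<Otimes>\<^sub>M P"
  define u where "u t \<omega> = gain T t \<odot> x t \<omega>" for t \<omega>
  define v where "v t \<omega> = u' t \<omega> - u t \<omega>" for t \<omega>
  define \<Delta> where "\<Delta> t \<omega> = x' t \<omega> - x t \<omega>" for t \<omega>
  have spN: "fst p \<in> {0..T}" if "p \<in> space ?N" for p
    using that by (auto simp: space_pair_measure space_restrict_space)
  have [measurable]: "(\<lambda>(t, \<omega>). x t \<omega>) \<in> borel_measurable ?N"
    by (rule jointly_measurable_horizon[OF closed_loop_jointly_measurable[OF x]])
  have um [measurable]: "(\<lambda>(t, \<omega>). u t \<omega>) \<in> borel_measurable ?N"
    unfolding u_def case_prod_beta'
    by (rule measurable_apply_continuous[OF continuous_on_gain])
       (use measurable_horizon_borel in measurable)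
  have u'm [measurable]: "(\<lambda>(t, \<omega>). u' t \<omega>) \<in> borel_measurable ?N"
    using u' by (intro jointly_measurable_horizon) (simp add: admissible_def jointly_measurable_def)
  have x'm [measurable]: "(\<lambda>(t, \<omega>). x' t \<omega>) \<in> borel_measurable ?N"
    using x' by (intro jointly_measurable_horizon) (simp add: mild_solution_def jointly_measurable_def)
  note [measurable] = measurable_horizon_borel
  have x2: "integrable ?N (\<lambda>(t, \<omega>). (norm (x t \<omega>))\<^sup>2)"
    by (rule closed_loop_horizon_square_integrable[OF x T])
  define a where "a p = running_cost \<rho> M R x' u' (fst p) (snd p)" for p
  define j where "j p = running_cost \<rho> M R x u (fst p) (snd p)" for p
  have a0: "0 \<le> a p" and j0: "0 \<le> j p" for p
    unfolding a_def j_def by (rule running_cost_nonneg[OF M R])+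
  have am: "a \<in> borel_measurable ?N" and jm: "j \<in> borel_measurable ?N"
    unfolding a_def[abs_def] j_def[abs_def] running_cost_def by measurable
  have ai: "integrable ?N a"
    using False am a0 by (intro integrableI_bounded) (simp_all add: horizon_cost_def a_def[symmetric] top.not_eq_extremum less_top)
  have u'2: "integrable ?N (\<lambda>(t, \<omega>). (norm (u' t \<omega>))\<^sup>2)"
  proof (rule Bochner_Integration.integrable_bound)
    show "integrable ?N (\<lambda>p. \<bar>\<kappa>\<bar> * exp (\<rho> * T) * a p)" by (intro integrable_mult_right ai)
    show "AE p in ?N. norm (case p of (t, \<omega>) \<Rightarrow> (norm (u' t \<omega>))\<^sup>2) \<le> norm (\<bar>\<kappa>\<bar> * exp (\<rho> * T) * a p)"
    proof (rule AE_I2)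
      fix p assume "p \<in> space ?N"
      then have t: "fst p \<in> {0..T}" by (rule spN)
      obtain t \<omega> where p: "p = (t, \<omega>)" by (cases p)
      have q: "0 \<le> u' t \<omega> \<bullet> (R \<odot> u' t \<omega>)" "0 \<le> x' t \<omega> \<bullet> (M \<odot> x' t \<omega>)"
        by (rule psd_nonneg[OF R], rule psd_nonneg[OF M])
      have "(norm (u' t \<omega>))\<^sup>2 \<le> \<kappa> * (u' t \<omega> \<bullet> (R \<odot> u' t \<omega>))" by (rule coercive)
      also have "\<dots> \<le> \<bar>\<kappa>\<bar> * (x' t \<omega> \<bullet> (M \<odot> x' t \<omega>) + u' t \<omega> \<bullet> (R \<odot> u' t \<omega>))"
        using q by (intro mult_mono) auto
      also have "\<dots> = \<bar>\<kappa>\<bar> * exp (\<rho> * t) * a p"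
        by (simp add: a_def p running_cost_def exp_minus)
      also have "\<dots> \<le> \<bar>\<kappa>\<bar> * exp (\<rho> * T) * a p"
        using t \<rho> a0[of p] by (intro mult_right_mono mult_left_mono) (auto simp: p)
      finally show "norm (case p of (t, \<omega>) \<Rightarrow> (norm (u' t \<omega>))\<^sup>2) \<le> norm (\<bar>\<kappa>\<bar> * exp (\<rho> * T) * a p)"
        using a0[of p] by (simp add: p abs_mult)
    qed
  qed measurable
  have u2: "integrable ?N (\<lambda>(t, \<omega>). (norm (u t \<omega>))\<^sup>2)"
  proof (rule Bochner_Integration.integrable_bound)
    show "integrable ?N (\<lambda>p. (norm (Ri * B) * c)\<^sup>2 * (case p of (t, \<omega>) \<Rightarrow> (norm (x t \<omega>))\<^sup>2))"
      by (intro integrable_mult_right x2)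
    have "(norm (u t \<omega>))\<^sup>2 \<le> (norm (Ri * B) * c)\<^sup>2 * (norm (x t \<omega>))\<^sup>2" for t \<omega>
    proof -
      have "norm (u t \<omega>) \<le> (norm (Ri * B) * c) * norm (x t \<omega>)"
        unfolding u_def by (intro order_trans[OF norm_bop_apply] mult_right_mono norm_gain) simp
      from power_mono[OF this, of 2] show ?thesis by (simp add: power_mult_distrib)
    qed
    then show "AE p in ?N. norm (case p of (t, \<omega>) \<Rightarrow> (norm (u t \<omega>))\<^sup>2) \<le> norm ((norm (Ri * B) * c)\<^sup>2 * (case p of (t, \<omega>) \<Rightarrow> (norm (x t \<omega>))\<^sup>2))"
      by (intro AE_I2) (simp add: case_prod_beta' abs_mult)
  qed measurable
  have v2: "integrable ?N (\<lambda>(t, \<omega>). (norm (v t \<omega>))\<^sup>2)"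
  proof (rule Bochner_Integration.integrable_bound)
    show "integrable ?N (\<lambda>p. 2 * (case p of (t, \<omega>) \<Rightarrow> (norm (u' t \<omega>))\<^sup>2) + 2 * (case p of (t, \<omega>) \<Rightarrow> (norm (u t \<omega>))\<^sup>2))"
      by (intro integrable_mult_right Bochner_Integration.integrable_add u2 u'2)
    show "AE p in ?N. norm (case p of (t, \<omega>) \<Rightarrow> (norm (v t \<omega>))\<^sup>2)
        \<le> norm (2 * (case p of (t, \<omega>) \<Rightarrow> (norm (u' t \<omega>))\<^sup>2) + 2 * (case p of (t, \<omega>) \<Rightarrow> (norm (u t \<omega>))\<^sup>2))"
    proof (rule AE_I2)
      fix p
      show "norm (case p of (t, \<omega>) \<Rightarrow> (norm (v t \<omega>))\<^sup>2)
        \<le> norm (2 * (case p of (t, \<omega>) \<Rightarrow> (norm (u' t \<omega>))\<^sup>2) + 2 * (case p of (t, \<omega>) \<Rightarrow> (norm (u t \<omega>))\<^sup>2))"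
        using norm_add_squared_le[of "u' (fst p) (snd p)" "- u (fst p) (snd p)"]
        by (simp add: case_prod_beta' v_def)
    qed
    show "(\<lambda>(t, \<omega>). (norm (v t \<omega>))\<^sup>2) \<in> borel_measurable ?N" unfolding v_def by measurable
  qed
  have ji: "integrable ?N j"
  proof (rule Bochner_Integration.integrable_bound[OF _ jm])
    show "integrable ?N (\<lambda>p. norm M * (case p of (t, \<omega>) \<Rightarrow> (norm (x t \<omega>))\<^sup>2) + norm R * (case p of (t, \<omega>) \<Rightarrow> (norm (u t \<omega>))\<^sup>2))"
      by (intro integrable_mult_right Bochner_Integration.integrable_add u2 x2)
    show "AE p in ?N. norm (j p) \<le> norm (norm M * (case p of (t, \<omega>) \<Rightarrow> (norm (x t \<omega>))\<^sup>2) + norm R * (case p of (t, \<omega>) \<Rightarrow> (norm (u t \<omega>))\<^sup>2))"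
    proof (rule AE_I2)
      fix p assume "p \<in> space ?N"
      then have t: "fst p \<in> {0..T}" by (rule spN)
      obtain t \<omega> where p: "p = (t, \<omega>)" by (cases p)
      have quad: "f \<bullet> (S \<odot> f) \<le> norm S * (norm f)\<^sup>2" for S f
        using order_trans[OF norm_cauchy_schwarz[of f "S \<odot> f"] mult_left_mono[OF norm_bop_apply[of S f], of "norm f"]]
        by (simp add: power2_eq_square mult_ac)
      have nn: "0 \<le> x t \<omega> \<bullet> (M \<odot> x t \<omega>) + u t \<omega> \<bullet> (R \<odot> u t \<omega>)"
        using psd_nonneg(1)[OF M] psd_nonneg(1)[OF R] by (rule add_nonneg_nonneg)
      have "exp (- \<rho> * t) \<le> 1" using \<rho> t by (simp add: p)
      from mult_right_mono[OF this nn] have "j p \<le> x t \<omega> \<bullet> (M \<odot> x t \<omega>) + u t \<omega> \<bullet> (R \<odot> u t \<omega>)"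
        by (simp add: j_def p running_cost_def)
      also have "\<dots> \<le> norm M * (norm (x t \<omega>))\<^sup>2 + norm R * (norm (u t \<omega>))\<^sup>2"
        by (intro add_mono quad)
      finally show "norm (j p) \<le> norm (norm M * (case p of (t, \<omega>) \<Rightarrow> (norm (x t \<omega>))\<^sup>2) + norm R * (case p of (t, \<omega>) \<Rightarrow> (norm (u t \<omega>))\<^sup>2))"
        using j0[of p] by (simp add: p)
    qed
  qed
  define cr where "cr t \<omega> = exp (- \<rho> * t) * (\<Delta> t \<omega> \<bullet> (M \<odot> x t \<omega>) + v t \<omega> \<bullet> (R \<odot> gain T t \<odot> x t \<omega>))" for t \<omega>
  have var: "integrable ?N (\<lambda>(t, \<omega>). cr t \<omega>)" "(LINT p|?N. cr (fst p) (snd p)) = 0"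
  proof -
    have vm: "(\<lambda>(t, \<omega>). v t \<omega>) \<in> borel_measurable ?N" unfolding v_def by measurable
    have \<Delta>m: "(\<lambda>(t, \<omega>). \<Delta> t \<omega>) \<in> borel_measurable ?N" unfolding \<Delta>_def by measurable
    have vh: "v t \<in> borel_measurable (history P w t)" if t: "t \<in> {0..T}" for t
    proof -
      have "u' t \<in> borel_measurable (history P w t)" using u' t by (simp add: admissible_def)
      moreover have "u t \<in> borel_measurable (history P w t)"
        unfolding u_def using closed_loopD(1)[OF x, of t] t
        by (intro measurable_compose[OF _ bop_apply_measurable]) auto
      ultimately show ?thesis unfolding v_def by (rule borel_measurable_diff)
    qed
    have \<Delta>: "AE \<omega> in P. set_integrable lborel {0..t} (\<lambda>s. op_semigroup A (t - s) \<odot> B \<odot> v s \<omega>) \<and>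
      \<Delta> t \<omega> = (LBINT s:{0..t}. op_semigroup A (t - s) \<odot> B \<odot> v s \<omega>)" if "t \<in> {0..T}" for t
      unfolding v_def u_def \<Delta>_def
      by (rule mild_difference[OF x continuous_on_loop continuous_on_gain loop_def u' x']) (use that in auto)
    note fv = first_variation_zero[OF x T vm vh v2 \<Delta>m \<Delta>]
    show "integrable ?N (\<lambda>(t, \<omega>). cr t \<omega>)" unfolding cr_def by (rule fv(1))
    show "(LINT p|?N. cr (fst p) (snd p)) = 0" unfolding cr_def by (rule fv(2))
  qed
  have cri: "integrable ?N (\<lambda>p. cr (fst p) (snd p))" using var(1) by (simp add: case_prod_beta')
  have le: "j p + 2 * cr (fst p) (snd p) \<le> a p" for p
  proof -
    obtain t \<omega> where p: "p = (t, \<omega>)" by (cases p)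
    have xx: "x' t \<omega> = x t \<omega> + \<Delta> t \<omega>" and uu: "u' t \<omega> = u t \<omega> + v t \<omega>" by (simp_all add: \<Delta>_def v_def)
    have expand: "(f + g) \<bullet> (S \<odot> (f + g)) = f \<bullet> (S \<odot> f) + 2 * (g \<bullet> (S \<odot> f)) + g \<bullet> (S \<odot> g)" if "selfadj S" for S f g
      using selfadjD[OF that, of f g] by (simp add: bop.add_right inner_add_left inner_add_right inner_commute)
    have "0 \<le> exp (- \<rho> * t) * (\<Delta> t \<omega> \<bullet> (M \<odot> \<Delta> t \<omega>) + v t \<omega> \<bullet> (R \<odot> v t \<omega>))"
      by (intro mult_nonneg_nonneg add_nonneg_nonneg psd_nonneg M R) simp
    moreover have "a p = j p + 2 * cr t \<omega> + exp (- \<rho> * t) * (\<Delta> t \<omega> \<bullet> (M \<odot> \<Delta> t \<omega>) + v t \<omega> \<bullet> (R \<odot> v t \<omega>))"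
      unfolding a_def j_def running_cost_def p fst_conv snd_conv xx uu
        expand[OF psd_selfadj[OF M]] expand[OF psd_selfadj[OF R]]
      by (simp add: cr_def u_def algebra_simps)
    ultimately show ?thesis by (simp add: p)
  qed
  have "(LINT p|?N. j p) = (LINT p|?N. j p + 2 * cr (fst p) (snd p))"
    using ji cri var(2) by simp
  also have "\<dots> \<le> (LINT p|?N. a p)"
    using le by (intro integral_mono Bochner_Integration.integrable_add integrable_mult_right ji cri ai)
  finally have "ennreal (LINT p|?N. j p) \<le> ennreal (LINT p|?N. a p)" by (rule ennreal_leI)
  then have "(\<integral>\<^sup>+p. ennreal (j p) \<partial>?N) \<le> (\<integral>\<^sup>+p. ennreal (a p) \<partial>?N)"
    using ji ai j0 a0 by (simp add: nn_integral_eq_integral)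
  then show ?thesis by (simp add: horizon_cost_def a_def j_def u_def[abs_def])
qed simp

end

section \<open>Optimality on the infinite horizon\<close>

context regulator
begin

text \<open>The optimal pairs for the horizons \<open>[0, n]\<close> converge path by path to the stationary feedback, so
  by Fatou's lemma the stationary cost up to a fixed time is at most the limit of the finite horizon
  optima, each of which is at most the cost of any competitor.\<close>

proposition stationary_feedback_optimal:
  assumes lim: "\<And>f. ((\<lambda>t. X t \<odot> f) \<longlongrightarrow> S \<odot> f) at_top"
  defines "K \<equiv> - (Ri * B * S)"
  assumes x: "closed_loop (\<lambda>_. A + B * K) x0 x"
    and u': "admissible P w u'" and x': "mild_solution P w (blinfun_of_bop A) (blinfun_of_bop B) x0 u' x'"
  shows "discounted_cost P \<rho> (blinfun_of_bop M) (blinfun_of_bop R) x (\<lambda>t \<omega>. K \<odot> x t \<omega>)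
    \<le> discounted_cost P \<rho> (blinfun_of_bop M) (blinfun_of_bop R) x' u'"
proof -
  have "\<forall>n. \<exists>y. closed_loop (loop (real n)) x0 y"
    using closed_loop_exists[OF continuous_on_loop norm_loop] by blast
  then obtain y where y: "\<And>n. closed_loop (loop (real n)) x0 (y n)" by metis
  define v where "v n t \<omega> = gain (real n) t \<odot> y n t \<omega>" for n t \<omega>
  define u where "u t \<omega> = K \<odot> x t \<omega>" for t \<omega>
  have jx: "jointly_measurable P x" and jy: "jointly_measurable P (y n)" for n
    unfolding jointly_measurable_def by (rule closed_loop_jointly_measurable[OF x], rule closed_loop_jointly_measurable[OF y])
  have ju: "jointly_measurable P u"
    using measurable_compose[OF jx[unfolded jointly_measurable_def] bop_apply_measurable[of K]]
    by (simp add: jointly_measurable_def u_def[abs_def] case_prod_beta')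
  have jv: "jointly_measurable P (v n)" for n
    unfolding jointly_measurable_def v_def case_prod_beta'
    by (rule measurable_apply_continuous[OF continuous_on_gain])
       (use jy[of n, unfolded jointly_measurable_def] measurable_halfline_borel in measurable)
  have to_go_lim: "(\<lambda>n. to_go (real n) s \<odot> f) \<longlonglongrightarrow> S \<odot> f" for s f
  proof -
    have "filterlim (\<lambda>n. - s + real n) at_top sequentially"
      by (rule filterlim_tendsto_add_at_top[OF tendsto_const filterlim_real_sequentially])
    then have "filterlim (\<lambda>n. max 0 (real n - s)) at_top sequentially"
      by (rule filterlim_at_top_mono) (auto intro: always_eventually)
    from filterlim_compose[OF lim this] show ?thesis by (simp add: to_go_def)
  qed
  have gain_lim: "(\<lambda>n. gain (real n) s \<odot> f) \<longlonglongrightarrow> K \<odot> f" for s f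
    unfolding gain_def K_def bop.minus_left bop_apply_mult by (intro tendsto_intros bop.tendsto to_go_lim)
  have y_lim: "(\<lambda>n. y n t \<omega>) \<longlonglongrightarrow> x t \<omega>" if "\<omega> \<in> space P" "0 \<le> t" for t \<omega>
  proof (rule closed_loop_tendsto[OF y x continuous_on_loop continuous_on_const norm_loop _ that])
    show "(\<lambda>n. loop (real n) s \<odot> f) \<longlonglongrightarrow> (A + B * K) \<odot> f" for s f
      unfolding loop_def bop.add_left bop_apply_mult by (intro tendsto_intros bop.tendsto gain_lim)
  qed
  have v_lim: "(\<lambda>n. v n t \<omega>) \<longlonglongrightarrow> u t \<omega>" if "\<omega> \<in> space P" "0 \<le> t" for t \<omega>
  proof -
    have "(\<lambda>n. (norm (Ri * B) * c) * norm (y n t \<omega> - x t \<omega>)) \<longlonglongrightarrow> (norm (Ri * B) * c) * norm (x t \<omega> - x t \<omega>)"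
      by (intro tendsto_intros y_lim that)
    then have up: "(\<lambda>n. (norm (Ri * B) * c) * norm (y n t \<omega> - x t \<omega>)) \<longlonglongrightarrow> 0" by simp
    have "(\<lambda>n. norm (gain (real n) t \<odot> (y n t \<omega> - x t \<omega>))) \<longlonglongrightarrow> 0"
    proof (rule tendsto_sandwich[OF _ _ tendsto_const up])
      show "\<forall>\<^sub>F n in sequentially. norm (gain (real n) t \<odot> (y n t \<omega> - x t \<omega>)) \<le> (norm (Ri * B) * c) * norm (y n t \<omega> - x t \<omega>)"
        by (intro always_eventually allI order_trans[OF norm_bop_apply] mult_right_mono norm_gain) simp
    qed simp
    then have "(\<lambda>n. gain (real n) t \<odot> (y n t \<omega> - x t \<omega>)) \<longlonglongrightarrow> 0" by (rule tendsto_norm_zero_cancel)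
    from tendsto_add[OF this gain_lim[of t "x t \<omega>"]] show ?thesis
      by (simp add: v_def u_def bop.diff_right)
  qed
  have "discounted_cost P \<rho> (blinfun_of_bop M) (blinfun_of_bop R) x u \<le> discounted_cost P \<rho> (blinfun_of_bop M) (blinfun_of_bop R) x' u'"
  proof (rule discounted_cost_le_of_horizons[OF jx ju])
    fix m :: nat
    let ?N = "horizon (real m) \<Otimes>\<^sub>M P"
    have mono: "\<forall>\<^sub>F n in sequentially. horizon_cost \<rho> M R (real m) (y n) (v n)
        \<le> discounted_cost P \<rho> (blinfun_of_bop M) (blinfun_of_bop R) x' u'"
      using eventually_ge_at_top[of m]
    proof eventually_elim
      case (elim n)
      have "horizon_cost \<rho> M R (real m) (y n) (v n) \<le> horizon_cost \<rho> M R (real n) (y n) (v n)"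
        by (rule horizon_cost_mono[OF jy jv]) (use elim in auto)
      also have "\<dots> \<le> horizon_cost \<rho> M R (real n) x' u'"
        unfolding v_def[abs_def] by (rule horizon_optimal[OF y _ u' x']) simp
      also have "\<dots> \<le> discounted_cost P \<rho> (blinfun_of_bop M) (blinfun_of_bop R) x' u'"
        using u' x' by (intro horizon_cost_le_discounted) (auto simp: admissible_def mild_solution_def)
      finally show ?case .
    qed
    have meas: "(\<lambda>p. running_cost \<rho> M R (y n) (v n) (fst p) (snd p)) \<in> borel_measurable ?N" for n
      using jointly_measurable_horizon[OF running_cost_measurable_halfline[OF jy jv, of \<rho> M R n n], of "real m"]
      by (simp add: case_prod_beta')
    have "horizon_cost \<rho> M R (real m) x u = (\<integral>\<^sup>+p. liminf (\<lambda>n. ennreal (running_cost \<rho> M R (y n) (v n) (fst p) (snd p))) \<partial>?N)"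
      unfolding horizon_cost_def
    proof (rule nn_integral_cong)
      fix p assume "p \<in> space ?N"
      then have p: "0 \<le> fst p" "snd p \<in> space P" by (auto simp: space_pair_measure space_restrict_space)
      have "(\<lambda>n. ennreal (running_cost \<rho> M R (y n) (v n) (fst p) (snd p))) \<longlonglongrightarrow> ennreal (running_cost \<rho> M R x u (fst p) (snd p))"
        unfolding running_cost_def
        by (intro tendsto_ennrealI tendsto_intros bop.tendsto y_lim v_lim p)
      from lim_imp_Liminf[OF sequentially_bot this]
      show "ennreal (running_cost \<rho> M R x u (fst p) (snd p)) = liminf (\<lambda>n. ennreal (running_cost \<rho> M R (y n) (v n) (fst p) (snd p)))"
        by simp
    qed
    also have "\<dots> \<le> liminf (\<lambda>n. horizon_cost \<rho> M R (real m) (y n) (v n))"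
      unfolding horizon_cost_def by (rule nn_integral_liminf) (use meas in measurable)
    also have "\<dots> \<le> liminf (\<lambda>n::nat. discounted_cost P \<rho> (blinfun_of_bop M) (blinfun_of_bop R) x' u')"
      by (rule Liminf_mono[OF mono])
    also have "\<dots> = discounted_cost P \<rho> (blinfun_of_bop M) (blinfun_of_bop R) x' u'" by (simp add: Liminf_const)
    finally show "horizon_cost \<rho> M R (real m) x u \<le> discounted_cost P \<rho> (blinfun_of_bop M) (blinfun_of_bop R) x' u'" .
  qed
  then show ?thesis by (simp add: u_def[abs_def])
qed

end

context q_noise
begin

lemma closed_loop_feedback_pair:
  assumes x: "closed_loop (\<lambda>_. A + B * K) x0 x"
  shows "feedback_pair P w (blinfun_of_bop A) (blinfun_of_bop B) (blinfun_of_bop K) x0 x (\<lambda>t \<omega>. K \<odot> x t \<omega>)"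
  unfolding feedback_pair_def
proof (intro conjI allI ballI impI)
  note jx = closed_loop_jointly_measurable[OF x]
  show "admissible P w (\<lambda>t \<omega>. K \<odot> x t \<omega>)"
    unfolding admissible_def
  proof (intro conjI allI impI)
    show "jointly_measurable P (\<lambda>t \<omega>. K \<odot> x t \<omega>)"
      using measurable_compose[OF jx bop_apply_measurable[of K]] by (simp add: jointly_measurable_def case_prod_beta')
    show "(\<lambda>\<omega>. K \<odot> x t \<omega>) \<in> borel_measurable (history P w t)" if "0 \<le> t" for t
      by (rule measurable_compose[OF closed_loopD(1)[OF x that] bop_apply_measurable])
    show "AE \<omega> in P. \<forall>T\<ge>0. set_integrable lborel {0..T} (\<lambda>t. (norm (K \<odot> x t \<omega>))\<^sup>2)"
    proof (rule AE_I2, intro allI impI)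
      fix \<omega> T assume "\<omega> \<in> space P"
      then show "set_integrable lborel {0..T} (\<lambda>t. (norm (K \<odot> x t \<omega>))\<^sup>2)"
        by (intro borel_integrable_atLeastAtMost' continuous_intros closed_loop_continuous_on[OF x]) auto
    qed
  qed
  show "mild_solution P w (blinfun_of_bop A) (blinfun_of_bop B) x0 (\<lambda>t \<omega>. K \<odot> x t \<omega>) x"
    unfolding mild_solution_def
  proof (intro conjI allI impI)
    show "jointly_measurable P x" using jx by (simp add: jointly_measurable_def)
    fix t :: real assume t: "0 \<le> t"
    have "AE \<omega> in P. x t \<omega> = exp_operator (t *\<^sub>R blinfun_of_bop A) x0
           + (LBINT s:{0..t}. exp_operator ((t - s) *\<^sub>R blinfun_of_bop A) (blinfun_of_bop B (K \<odot> x s \<omega>))) + stoch_conv A t \<omega>"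
    proof (rule AE_I2)
      fix \<omega> assume o: "\<omega> \<in> space P"
      have c: "continuous_on {0..t} (\<lambda>s. op_semigroup A (t - s) \<odot> B \<odot> K \<odot> x s \<omega>)"
        by (intro continuous_intros closed_loop_continuous_on[OF x o]) auto
      have "x t \<omega> = op_semigroup A t \<odot> x0 + integral {0..t} (\<lambda>s. op_semigroup A (t - s) \<odot> B \<odot> K \<odot> x s \<omega>) + stoch_conv A t \<omega>"
        using closed_loop_mild[OF x continuous_on_const o t, of A] by simp
      then show "x t \<omega> = exp_operator (t *\<^sub>R blinfun_of_bop A) x0
           + (LBINT s:{0..t}. exp_operator ((t - s) *\<^sub>R blinfun_of_bop A) (blinfun_of_bop B (K \<odot> x s \<omega>))) + stoch_conv A t \<omega>"
        by (simp add: exp_operator_semigroup blinfun_of_bop_inverse blinfun_apply_bop LBINT_eq_integral[OF c])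
    qed
    with stoch_conv_is_wiener_integral[OF t]
    show "\<exists>Z. is_wiener_integral P w t (\<lambda>s. exp_operator ((t - s) *\<^sub>R blinfun_of_bop A)) Z \<and>
        (AE \<omega> in P. x t \<omega> = exp_operator (t *\<^sub>R blinfun_of_bop A) x0
           + (LBINT s:{0..t}. exp_operator ((t - s) *\<^sub>R blinfun_of_bop A) (blinfun_of_bop B (K \<odot> x s \<omega>))) + Z \<omega>)"
      by blast
  qed
  show "K \<odot> x t \<omega> = blinfun_of_bop K (x t \<omega>)" for t \<omega> by (simp add: blinfun_apply_bop)
qed

text \<open>A mild solution is determined only almost surely at each time. Fubini turns this into almost every
  time along almost every path, and Gronwall identifies every feedback pair with the continuous
  closed loop up to such null sets.\<close>

lemma feedback_pair_unique:
  assumes x: "closed_loop (\<lambda>_. A + B * K) x0 x"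
    and yu: "feedback_pair P w (blinfun_of_bop A) (blinfun_of_bop B) (blinfun_of_bop K) x0 y u"
  shows "AE \<omega> in P. AE t in lborel. 0 \<le> t \<longrightarrow> y t \<omega> = x t \<omega>"
proof -
  have u: "admissible P w u" and y: "mild_solution P w (blinfun_of_bop A) (blinfun_of_bop B) x0 u y"
    and uK: "\<And>t \<omega>. 0 \<le> t \<Longrightarrow> \<omega> \<in> space P \<Longrightarrow> u t \<omega> = K \<odot> y t \<omega>"
    using yu by (auto simp: feedback_pair_def blinfun_apply_bop)
  have ju: "jointly_measurable P u" and jy: "jointly_measurable P y"
    using u y by (simp_all add: admissible_def mild_solution_def)
  have sq: "AE \<omega> in P. \<forall>T\<ge>0. set_integrable lborel {0..T} (\<lambda>t. (norm (u t \<omega>))\<^sup>2)"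
    using u by (simp add: admissible_def)
  define \<delta> where "\<delta> s \<omega> = u s \<omega> - K \<odot> x s \<omega>" for s \<omega>
  have horizon_eq: "AE \<omega> in P. AE t in horizon T. y t \<omega> = x t \<omega>" if T: "0 \<le> T" for T
  proof -
    let ?H = "horizon T"
    interpret H: finite_measure ?H by (rule finite_measure_horizon)
    interpret HP: pair_sigma_finite ?H P ..
    have spH: "space ?H = {0..T}" by (simp add: space_restrict_space)
    have "bounded ((\<lambda>r. op_semigroup A r * B) ` {0..T})"
      by (intro compact_imp_bounded compact_continuous_image continuous_intros) auto
    then obtain C where C: "\<And>r. r \<in> {0..T} \<Longrightarrow> norm (op_semigroup A r * B) \<le> C"
      unfolding bounded_iff by blast
    have C0: "0 \<le> C" using order_trans[OF norm_ge_zero C[of 0]] T by simp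
    note [measurable] = measurable_horizon_borel
    have um [measurable]: "(\<lambda>(t, \<omega>). u t \<omega>) \<in> borel_measurable (?H \<Otimes>\<^sub>M P)"
      using ju by (intro jointly_measurable_horizon) (simp add: jointly_measurable_def)
    have ym [measurable]: "(\<lambda>(t, \<omega>). y t \<omega>) \<in> borel_measurable (?H \<Otimes>\<^sub>M P)"
      using jy by (intro jointly_measurable_horizon) (simp add: jointly_measurable_def)
    have xm [measurable]: "(\<lambda>(t, \<omega>). x t \<omega>) \<in> borel_measurable (?H \<Otimes>\<^sub>M P)"
      by (rule jointly_measurable_horizon[OF closed_loop_jointly_measurable[OF x]])
    have \<delta>m: "(\<lambda>(t, \<omega>). \<delta> t \<omega>) \<in> borel_measurable (?H \<Otimes>\<^sub>M P)"
      unfolding \<delta>_def by measurable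
    define \<Phi> where "\<Phi> t \<omega> = (\<integral>\<^sup>+s. ennreal (if s \<le> t then norm (\<delta> s \<omega>) else 0) \<partial>?H)" for t \<omega>
    have \<Phi>m: "(\<lambda>p. \<Phi> (fst p) (snd p)) \<in> borel_measurable (?H \<Otimes>\<^sub>M P)"
      unfolding \<Phi>_def
    proof (rule H.borel_measurable_nn_integral)
      let ?N = "(?H \<Otimes>\<^sub>M P) \<Otimes>\<^sub>M ?H"
      have "(\<lambda>q. (snd q, snd (fst q))) \<in> ?N \<rightarrow>\<^sub>M ?H \<Otimes>\<^sub>M P" by measurable
      from measurable_compose[OF this \<delta>m]
      have [measurable]: "(\<lambda>q. \<delta> (snd q) (snd (fst q))) \<in> borel_measurable ?N" by simp
      have [measurable]: "(\<lambda>q. snd q) \<in> borel_measurable ?N"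
        by (rule measurable_compose[OF measurable_snd measurable_horizon_borel])
      have [measurable]: "(\<lambda>q. fst (fst q)) \<in> borel_measurable ?N"
        by (rule measurable_compose[OF measurable_fst measurable_compose[OF measurable_fst measurable_horizon_borel]])
      show "(\<lambda>(p, s). ennreal (if s \<le> fst p then norm (\<delta> s (snd p)) else 0)) \<in> borel_measurable ?N"
        unfolding case_prod_beta' by measurable
    qed
    have each_t: "AE t in ?H. AE \<omega> in P. ennreal (norm (y t \<omega> - x t \<omega>)) \<le> ennreal C * \<Phi> t \<omega>"
    proof (rule AE_I2)
      fix t assume "t \<in> space ?H"
      then have t: "t \<in> {0..T}" by (simp add: spH)
      have "AE \<omega> in P. set_integrable lborel {0..t} (\<lambda>s. op_semigroup A (t - s) \<odot> B \<odot> \<delta> s \<omega>) \<and>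
          y t \<omega> - x t \<omega> = (LBINT s:{0..t}. op_semigroup A (t - s) \<odot> B \<odot> \<delta> s \<omega>)"
        unfolding \<delta>_def
        by (rule mild_difference[OF x continuous_on_const continuous_on_const _ u y]) (use t in auto)
      then show "AE \<omega> in P. ennreal (norm (y t \<omega> - x t \<omega>)) \<le> ennreal C * \<Phi> t \<omega>"
        using AE_space
      proof eventually_elim
        case (elim \<omega>)
        have "(\<lambda>s. (s, \<omega>)) \<in> ?H \<rightarrow>\<^sub>M ?H \<Otimes>\<^sub>M P" using elim by simp
        from measurable_compose[OF this \<delta>m] have [measurable]: "(\<lambda>s. \<delta> s \<omega>) \<in> borel_measurable ?H" by simp
        have "ennreal (norm (y t \<omega> - x t \<omega>)) \<le> (\<integral>\<^sup>+s. ennreal (norm (indicator {0..t} s *\<^sub>R (op_semigroup A (t - s) \<odot> B \<odot> \<delta> s \<omega>))) \<partial>lborel)"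
          using elim integral_norm_bound_ennreal[of lborel "\<lambda>s. indicator {0..t} s *\<^sub>R (op_semigroup A (t - s) \<odot> B \<odot> \<delta> s \<omega>)"]
          by (simp add: set_integrable_def set_lebesgue_integral_def)
        also have "\<dots> \<le> (\<integral>\<^sup>+s. (ennreal C * ennreal (if s \<le> t then norm (\<delta> s \<omega>) else 0)) * indicator {0..T} s \<partial>lborel)"
        proof (rule nn_integral_mono)
          fix s
          show "ennreal (norm (indicator {0..t} s *\<^sub>R (op_semigroup A (t - s) \<odot> B \<odot> \<delta> s \<omega>)))
            \<le> (ennreal C * ennreal (if s \<le> t then norm (\<delta> s \<omega>) else 0)) * indicator {0..T} s"
          proof (cases "s \<in> {0..t}")
            case True
            have "norm (op_semigroup A (t - s) \<odot> B \<odot> \<delta> s \<omega>) \<le> C * norm (\<delta> s \<omega>)"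
              using norm_bop_apply[of "op_semigroup A (t - s) * B" "\<delta> s \<omega>"] mult_right_mono[OF C[of "t - s"], of "norm (\<delta> s \<omega>)"] True t
              by simp
            then show ?thesis using True t C0 by (simp add: ennreal_mult[symmetric] ennreal_leI)
          qed simp
        qed
        also have "\<dots> = (\<integral>\<^sup>+s. ennreal C * ennreal (if s \<le> t then norm (\<delta> s \<omega>) else 0) \<partial>?H)"
          by (subst nn_integral_restrict_space) auto
        also have "\<dots> = ennreal C * \<Phi> t \<omega>"
          unfolding \<Phi>_def by (rule nn_integral_cmult) measurable
        finally show ?case .
      qed
    qed
    have "AE \<omega> in P. AE t in ?H. ennreal (norm (y t \<omega> - x t \<omega>)) \<le> ennreal C * \<Phi> t \<omega>"
    proof (rule HP.AE_commute[THEN iffD1, OF _ each_t])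
      show "{p \<in> space (?H \<Otimes>\<^sub>M P). ennreal (norm (y (fst p) (snd p) - x (fst p) (snd p))) \<le> ennreal C * \<Phi> (fst p) (snd p)} \<in> sets (?H \<Otimes>\<^sub>M P)"
        using \<Phi>m ym xm by measurable
    qed
    then show ?thesis
      using sq AE_space
    proof eventually_elim
      case (elim \<omega>)
      then have o: "\<omega> \<in> space P" by simp
      note xc = closed_loop_continuous_on[OF x o]
      have \<delta>p: "(\<lambda>s. indicator {0..T} s *\<^sub>R \<delta> s \<omega>) \<in> borel_measurable lborel"
      proof -
        have "(\<lambda>s. indicator {0..T} s *\<^sub>R (K \<odot> x s \<omega>)) \<in> borel_measurable lborel"
          using borel_integrable_atLeastAtMost'[of 0 T "\<lambda>s. K \<odot> x s \<omega>"] xc[of 0 T]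
          by (simp add: set_integrable_def continuous_intros)
        from borel_measurable_diff[OF path_measurable[OF ju o, of T] this]
        show ?thesis by (simp add: \<delta>_def scaleR_diff_right)
      qed
      have si: "set_integrable lborel {0..T} (\<lambda>s. norm (\<delta> s \<omega>))"
        unfolding set_integrable_def
      proof (rule Bochner_Integration.integrable_bound)
        have "set_integrable lborel {0..T} (\<lambda>s. 1 + norm (K \<odot> x s \<omega>) + (norm (u s \<omega>))\<^sup>2)"
        proof (rule set_integral_add(1))
          show "set_integrable lborel {0..T} (\<lambda>s. 1 + norm (K \<odot> x s \<omega>))"
            by (intro borel_integrable_atLeastAtMost' continuous_intros xc) auto
          show "set_integrable lborel {0..T} (\<lambda>s. (norm (u s \<omega>))\<^sup>2)" using elim T by blast
        qed
        then show "integrable lborel (\<lambda>s. indicator {0..T} s * (1 + norm (K \<odot> x s \<omega>) + (norm (u s \<omega>))\<^sup>2))"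
          by (simp add: set_integrable_def)
        have "(\<lambda>s. norm (indicator {0..T} s *\<^sub>R \<delta> s \<omega>)) \<in> borel_measurable lborel"
          using \<delta>p by measurable
        then show "(\<lambda>s. indicator {0..T} s *\<^sub>R norm (\<delta> s \<omega>)) \<in> borel_measurable lborel" by simp
        show "AE s in lborel. norm (indicator {0..T} s *\<^sub>R norm (\<delta> s \<omega>)) \<le> norm (indicator {0..T} s * (1 + norm (K \<odot> x s \<omega>) + (norm (u s \<omega>))\<^sup>2))"
        proof (rule AE_I2)
          fix s
          have "norm (u s \<omega>) \<le> 1 + (norm (u s \<omega>))\<^sup>2"
            using zero_le_power2[of "norm (u s \<omega>) - 1/2"] by (simp add: power2_eq_square algebra_simps)
          then have "norm (\<delta> s \<omega>) \<le> 1 + norm (K \<odot> x s \<omega>) + (norm (u s \<omega>))\<^sup>2"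
            using norm_triangle_ineq4[of "u s \<omega>" "K \<odot> x s \<omega>"] by (simp add: \<delta>_def)
          then show "norm (indicator {0..T} s *\<^sub>R norm (\<delta> s \<omega>)) \<le> norm (indicator {0..T} s * (1 + norm (K \<odot> x s \<omega>) + (norm (u s \<omega>))\<^sup>2))"
            by (auto simp: indicator_def)
        qed
      qed
      define \<phi> where "\<phi> t = integral {0..t} (\<lambda>s. norm (\<delta> s \<omega>))" for t
      have \<phi>c: "continuous_on {0..T} \<phi>"
        unfolding \<phi>_def using set_borel_integral_eq_integral(1)[OF si] by (rule indefinite_integral_continuous_1)
      have sit: "set_integrable lborel {0..t} (\<lambda>s. norm (\<delta> s \<omega>))" if "t \<in> {0..T}" for t
        by (rule set_integrable_subset[OF si]) (use that in auto)
      have \<phi>L: "\<phi> t = (LBINT s:{0..t}. norm (\<delta> s \<omega>))" if "t \<in> {0..T}" for t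
        unfolding \<phi>_def by (rule set_borel_integral_eq_integral(2)[OF sit[OF that], symmetric])
      have \<phi>0: "0 \<le> \<phi> t" if "t \<in> {0..T}" for t
        unfolding \<phi>L[OF that] set_lebesgue_integral_def by (rule Bochner_Integration.integral_nonneg) simp
      have \<Phi>\<phi>: "\<Phi> t \<omega> = ennreal (\<phi> t)" if t: "t \<in> {0..T}" for t
      proof -
        have "\<Phi> t \<omega> = (\<integral>\<^sup>+s. ennreal (indicator {0..t} s *\<^sub>R norm (\<delta> s \<omega>)) \<partial>lborel)"
          unfolding \<Phi>_def using t
          by (subst nn_integral_restrict_space) (auto intro!: nn_integral_cong simp: indicator_def)
        also have "\<dots> = ennreal (\<phi> t)"
          unfolding \<phi>L[OF t] set_lebesgue_integral_def
          by (rule nn_integral_eq_integral) (use sit[OF t] in \<open>simp_all add: set_integrable_def\<close>)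
        finally show ?thesis .
      qed
      have d: "AE t in lborel. t \<in> {0..T} \<longrightarrow> norm (y t \<omega> - x t \<omega>) \<le> C * \<phi> t"
      proof -
        have "AE t in lborel. t \<in> {0..T} \<longrightarrow> ennreal (norm (y t \<omega> - x t \<omega>)) \<le> ennreal C * \<Phi> t \<omega>"
          using elim(1) by (subst (asm) AE_restrict_space_iff) auto
        then show ?thesis
        proof eventually_elim
          case (elim t)
          show ?case
          proof
            assume t: "t \<in> {0..T}"
            then have "ennreal (norm (y t \<omega> - x t \<omega>)) \<le> ennreal (C * \<phi> t)"
              using elim C0 \<phi>0[OF t] by (simp add: \<Phi>\<phi> ennreal_mult)
            then show "norm (y t \<omega> - x t \<omega>) \<le> C * \<phi> t"
              using C0 \<phi>0[OF t] by (subst (asm) ennreal_le_iff) auto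
          qed
        qed
      qed
      define L where "L = norm K * C + 1"
      have L: "0 < L" using C0 by (simp add: L_def add_nonneg_pos)
      have \<delta>L: "AE s in lborel. s \<in> {0..T} \<longrightarrow> norm (\<delta> s \<omega>) \<le> L * \<phi> s"
        using d
      proof eventually_elim
        case (elim s)
        show ?case
        proof
          assume s: "s \<in> {0..T}"
          have "\<delta> s \<omega> = K \<odot> (y s \<omega> - x s \<omega>)" using uK[OF _ o, of s] s by (simp add: \<delta>_def bop.diff_right)
          then have "norm (\<delta> s \<omega>) \<le> norm K * norm (y s \<omega> - x s \<omega>)" by (simp add: norm_bop_apply)
          also have "\<dots> \<le> norm K * (C * \<phi> s)" using elim s by (intro mult_left_mono) auto
          also have "\<dots> \<le> L * \<phi> s" using \<phi>0[OF s] by (simp add: L_def algebra_simps)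
          finally show "norm (\<delta> s \<omega>) \<le> L * \<phi> s" .
        qed
      qed
      have zero: "\<phi> t \<le> 2 * 0 * exp (2 * L * t)" if t: "t \<in> {0..T}" for t
      proof (rule gronwall[OF \<phi>c L order_refl _ t])
        fix r assume r: "r \<in> {0..T}"
        have rc: "continuous_on {0..r} (\<lambda>s. L * \<phi> s)"
          by (intro continuous_intros continuous_on_subset[OF \<phi>c]) (use r in auto)
        have "\<phi> r \<le> (LBINT s:{0..r}. L * \<phi> s)"
          unfolding \<phi>L[OF r] set_lebesgue_integral_def
        proof (rule integral_mono_AE)
          show "integrable lborel (\<lambda>s. indicator {0..r} s *\<^sub>R norm (\<delta> s \<omega>))"
            using sit[OF r] by (simp add: set_integrable_def)
          show "integrable lborel (\<lambda>s. indicator {0..r} s *\<^sub>R (L * \<phi> s))"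
            using borel_integrable_atLeastAtMost'[OF rc] by (simp add: set_integrable_def)
          show "AE s in lborel. indicator {0..r} s *\<^sub>R norm (\<delta> s \<omega>) \<le> indicator {0..r} s *\<^sub>R (L * \<phi> s)"
            using \<delta>L by eventually_elim (use r in \<open>auto simp: indicator_def\<close>)
        qed
        also have "\<dots> = integral {0..r} (\<lambda>s. L * \<phi> s)" by (rule LBINT_eq_integral[OF rc])
        also have "\<dots> = 0 + L * integral {0..r} \<phi>" by simp
        finally show "\<phi> r \<le> 0 + L * integral {0..r} \<phi>" .
      qed
      have "AE t in lborel. t \<in> {0..T} \<longrightarrow> y t \<omega> = x t \<omega>"
        using d
      proof eventually_elim
        case (elim t)
        show ?case
        proof
          assume t: "t \<in> {0..T}"
          then have "norm (y t \<omega> - x t \<omega>) \<le> C * 0"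
            using elim zero[OF t] \<phi>0[OF t] by (metis antisym mult_zero_left mult_zero_right)
          then show "y t \<omega> = x t \<omega>" by simp
        qed
      qed
      then show ?case by (subst AE_restrict_space_iff) auto
    qed
  qed
  have "AE \<omega> in P. \<forall>n::nat. AE t in horizon (real n). y t \<omega> = x t \<omega>"
    unfolding AE_all_countable using horizon_eq by simp
  then show ?thesis
  proof eventually_elim
    case (elim \<omega>)
    then have "\<forall>n::nat. AE t in lborel. t \<in> {0..real n} \<longrightarrow> y t \<omega> = x t \<omega>"
      by (subst (asm) AE_restrict_space_iff) auto
    then have "AE t in lborel. \<forall>n::nat. t \<in> {0..real n} \<longrightarrow> y t \<omega> = x t \<omega>"
      unfolding AE_all_countable .
    then show ?case
    proof eventually_elim
      case (elim t)
      obtain n where "t \<le> real n" using real_arch_simple by blast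
      with elim show ?case by auto
    qed
  qed
qed

end

section \<open>The regulator problem for graphon systems\<close>

text \<open>Cauchy--Schwarz for the form of \<open>R\<close>, applied to \<open>R\<inverse> f\<close> and \<open>f\<close>.\<close>

lemma inverse_positive_coercive:
  assumes R: "psd R" and Ri: "R * Ri = 1"
  shows "psd Ri" "(norm f)\<^sup>2 \<le> norm Ri * (f \<bullet> (R \<odot> f))"
proof -
  have RRi: "R \<odot> Ri \<odot> g = g" for g using Ri by (metis bop_apply_mult bop_apply_one)
  have "(Ri \<odot> g) \<bullet> h = g \<bullet> (Ri \<odot> h)" for g h
    using selfadjD[OF psd_selfadj[OF R], of "Ri \<odot> g" "Ri \<odot> h"] by (simp add: RRi)
  moreover have "0 \<le> g \<bullet> (Ri \<odot> g)" for g
    using psd_nonneg(2)[OF R, of "Ri \<odot> g"] by (simp add: RRi)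
  ultimately show "psd Ri" by (simp add: psd_def selfadj_def)
  have "(f \<bullet> f)\<^sup>2 \<le> (f \<bullet> (Ri \<odot> f)) * ((R \<odot> f) \<bullet> f)"
    using psd_Cauchy_Schwarz[OF R, of "Ri \<odot> f" f] by (simp add: RRi)
  also have "\<dots> \<le> (norm f * (norm Ri * norm f)) * ((R \<odot> f) \<bullet> f)"
    by (intro mult_right_mono psd_nonneg(2)[OF R] order_trans[OF norm_cauchy_schwarz] mult_left_mono norm_bop_apply) simp
  finally have "(norm f)\<^sup>2 * (norm f)\<^sup>2 \<le> (norm Ri * (f \<bullet> (R \<odot> f))) * (norm f)\<^sup>2"
    by (simp add: power2_norm_eq_inner[symmetric] power2_eq_square inner_commute mult_ac)
  then show "(norm f)\<^sup>2 \<le> norm Ri * (f \<bullet> (R \<odot> f))"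
    by (cases "f = 0") (simp_all only: mult_le_cancel_right zero_less_power2 norm_zero power_zero_numeral norm_ge_zero norm_eq_zero, auto)
qed

text \<open>A positive solution keeps the Riccati flow bounded; the flow then supplies both the minimal solution and
  the data of the regulator problem. A feedback pair agrees with the continuous closed loop \<open>z\<close> outside
  null sets, so the two have the same cost.\<close>

theorem minimal_riccati_solution_optimal:
  fixes A B M R R' S0 :: "L2 \<Rightarrow>\<^sub>L L2"
  assumes \<rho>: "0 < \<rho>" and A: "selfadj (Bop A)" and B: "selfadj (Bop B)"
    and M: "positive_operator M" and R: "positive_operator R" and R': "is_inverse_operator R R'"
    and noise: "q_noise P kQ w"
    and S0: "positive_operator S0" "discounted_riccati \<rho> A B M R S0"
  shows "\<exists>Sinf. positive_operator Sinf \<and> discounted_riccati \<rho> A B M R Sinf \<and>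
          (\<forall>S. positive_operator S \<and> discounted_riccati \<rho> A B M R S \<longrightarrow>
             (\<forall>f. f \<bullet> Sinf f \<le> f \<bullet> S f)) \<and>
          (let K = - (inverse_operator R o\<^sub>L adjoint_operator B o\<^sub>L Sinf) in
           \<forall>x0. (\<exists>x u. feedback_pair P w A B K x0 x u) \<and>
             (\<forall>x u. feedback_pair P w A B K x0 x u \<longrightarrow> minimizes_cost P w A B M R \<rho> x0 x u))"
proof -
  interpret q_noise P kQ w by (rule noise)
  define a b m r ri where "a = Bop A" and "b = Bop B" and "m = Bop M" and "r = Bop R" and "ri = Bop R'"
  have unbop: "blinfun_of_bop a = A" "blinfun_of_bop b = B" "blinfun_of_bop m = M" "blinfun_of_bop r = R"
    by (simp_all add: a_def b_def m_def r_def Bop_inverse)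
  have sa: "selfadj a" and sb: "selfadj b" and pm: "psd m" and pr: "psd r"
    using A B M R by (simp_all add: a_def b_def m_def r_def positive_operator_iff)
  have rri: "r * ri = 1"
    using R' by (simp add: is_inverse_operator_def r_def ri_def Bop_algebra[symmetric])
  note inv = inverse_positive_coercive[OF pr rri]
  define G where "G = b * ri * b"
  have pG: "psd G" unfolding G_def by (rule psd_sandwich[OF sb inv(1)])
  have ric: "discounted_riccati \<rho> A B M R S \<longleftrightarrow> riccati a G m \<rho> (Bop S) = 0" for S
    using discounted_riccati_iff[OF A B R'] by (simp add: a_def b_def m_def ri_def G_def)
  have S0': "psd (Bop S0)" "riccati a G m \<rho> (Bop S0) = 0"
    using S0 by (simp_all add: positive_operator_iff ric)
  obtain X Si where X: "X 0 = 0"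
    "\<And>t. 0 \<le> t \<Longrightarrow> (X has_vector_derivative riccati a G m \<rho> (X t)) (at t within {0..})"
    "\<And>t. 0 \<le> t \<Longrightarrow> psd (X t)" "\<And>t. 0 \<le> t \<Longrightarrow> norm (X t) \<le> norm (Bop S0)"
    and Si: "psd Si" "riccati a G m \<rho> Si = 0"
    and minimal: "\<And>S'. psd S' \<Longrightarrow> riccati a G m \<rho> S' = 0 \<Longrightarrow> psd (S' - Si)"
    and lim: "\<And>f. ((\<lambda>t. X t \<odot> f) \<longlongrightarrow> Si \<odot> f) at_top"
    using riccati_flow_converges[OF sa pG pm S0'] by blast
  interpret regulator P kQ w a b m r ri \<rho> "norm ri" "norm (Bop S0)" X
    by unfold_locales (use sa sb pm pr rri \<rho> inv(2) X in \<open>simp_all add: G_def\<close>)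
  define k where "k = - (ri * b * Si)"
  define Sinf where "Sinf = blinfun_of_bop Si"
  have BS: "Bop Sinf = Si" by (simp add: Sinf_def blinfun_of_bop_inverse)
  have K: "- (inverse_operator R o\<^sub>L adjoint_operator B o\<^sub>L Sinf) = blinfun_of_bop k"
    by (simp add: inverse_operator_eq[OF R'] adjoint_operator_selfadj[OF assms(3)] k_def ri_def b_def BS[symmetric]
        Bop_algebra[symmetric] Bop_inverse)
  have below: "f \<bullet> Sinf f \<le> f \<bullet> S f" if "positive_operator S" "discounted_riccati \<rho> A B M R S" for S f
    using psd_nonneg(1)[OF minimal[of "Bop S"], of f] that
    by (simp add: positive_operator_iff ric bop.diff_left inner_diff_right Bop_apply Sinf_def blinfun_apply_bop)
  have opt: "(\<exists>x u. feedback_pair P w A B (blinfun_of_bop k) x0 x u) \<and>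
     (\<forall>x u. feedback_pair P w A B (blinfun_of_bop k) x0 x u \<longrightarrow> minimizes_cost P w A B M R \<rho> x0 x u)" for x0
  proof (intro conjI allI impI)
    obtain z where z: "closed_loop (\<lambda>_. a + b * k) x0 z"
      using closed_loop_exists[of "\<lambda>_. a + b * k" "norm (a + b * k)"] by auto
    show "\<exists>x u. feedback_pair P w A B (blinfun_of_bop k) x0 x u"
      using closed_loop_feedback_pair[OF z] unfolding unbop by blast
    fix x u assume xu: "feedback_pair P w A B (blinfun_of_bop k) x0 x u"
    have eq: "AE \<omega> in P. AE t in lborel. 0 \<le> t \<longrightarrow> x t \<omega> = z t \<omega>"
      by (rule feedback_pair_unique[OF z]) (use xu in \<open>simp add: unbop\<close>)
    have "discounted_cost P \<rho> M R x u = discounted_cost P \<rho> M R z (\<lambda>t \<omega>. k \<odot> z t \<omega>)"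
      unfolding discounted_cost_def
    proof (rule nn_integral_cong_AE)
      show "AE \<omega> in P. (\<integral>\<^sup>+t\<in>{0..}. ennreal (exp (- \<rho> * t) * (x t \<omega> \<bullet> M (x t \<omega>) + u t \<omega> \<bullet> R (u t \<omega>))) \<partial>lborel)
        = (\<integral>\<^sup>+t\<in>{0..}. ennreal (exp (- \<rho> * t) * (z t \<omega> \<bullet> M (z t \<omega>) + (k \<odot> z t \<omega>) \<bullet> R (k \<odot> z t \<omega>))) \<partial>lborel)"
        using eq AE_space
      proof eventually_elim
        case (elim \<omega>)
        show ?case
        proof (rule nn_integral_cong_AE, use elim(1) in eventually_elim)
          case (elim t)
          show ?case
          proof (cases "0 \<le> t")
            case True
            then have "u t \<omega> = k \<odot> x t \<omega>" "x t \<omega> = z t \<omega>"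
              using xu elim \<open>\<omega> \<in> space P\<close> by (auto simp: feedback_pair_def blinfun_apply_bop)
            then show ?thesis by simp
          qed simp
        qed
      qed
    qed
    also have "\<dots> \<le> discounted_cost P \<rho> M R x' u'" if "admissible P w u'" "mild_solution P w A B x0 u' x'" for x' u'
      using stationary_feedback_optimal[OF lim, of x0 z u' x'] z that by (simp add: k_def unbop)
    finally show "minimizes_cost P w A B M R \<rho> x0 x u"
      using xu by (auto simp: minimizes_cost_def feedback_pair_def)
  qed
  show ?thesis
    unfolding Let_def
    by (intro exI[of _ Sinf] conjI allI impI)
       (use opt below Si in \<open>auto simp: K positive_operator_iff ric BS\<close>)
qed

theorem lemma3p5:
  fixes kA kB kM kR kQ :: "real \<times> real \<Rightarrow> real" and a b m r \<rho> :: real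
    and A B M R :: "L2 \<Rightarrow>\<^sub>L L2" and P :: "'w measure" and w :: "real \<Rightarrow> 'w \<Rightarrow> L2"
  assumes "\<rho> > 0"
    and "bounded_symmetric_kernel kA" and "A = integral_operator kA + a *\<^sub>R id_blinfun"
    and "bounded_symmetric_kernel kB" and "B = integral_operator kB + b *\<^sub>R id_blinfun"
    and "bounded_symmetric_kernel kM" and "M = integral_operator kM + m *\<^sub>R id_blinfun"
    and "m \<ge> 0" and "positive_operator M"
    and "bounded_symmetric_kernel kR" and "R = integral_operator kR + r *\<^sub>R id_blinfun"
    and "r > 0" and "positive_operator R" and "\<exists>R'. is_inverse_operator R R'"
    and "bounded_symmetric_kernel kQ" and "positive_operator (integral_operator kQ)"
    and "prob_space P" and "Q_noise P kQ w"
  shows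
    "((\<exists>S. positive_operator S \<and> discounted_riccati \<rho> A B M R S) \<longrightarrow>
       (\<exists>Sinf. positive_operator Sinf \<and> discounted_riccati \<rho> A B M R Sinf \<and>
          (\<forall>S. positive_operator S \<and> discounted_riccati \<rho> A B M R S \<longrightarrow>
             (\<forall>f. f \<bullet> Sinf f \<le> f \<bullet> S f)) \<and>
          (let K = - (inverse_operator R o\<^sub>L adjoint_operator B o\<^sub>L Sinf) in
           \<forall>x0. (\<exists>x u. feedback_pair P w A B K x0 x u) \<and>
             (\<forall>x u. feedback_pair P w A B K x0 x u \<longrightarrow> minimizes_cost P w A B M R \<rho> x0 x u)))) \<and>
     (B = id_blinfun \<and> R = id_blinfun \<and> adjoint_operator A = A \<longrightarrow>
       (let \<Gamma> = A - (\<rho> / 2) *\<^sub>R id_blinfun; Srho = \<Gamma> + sqrt_operator ((\<Gamma> o\<^sub>L \<Gamma>) + M) in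
        positive_operator Srho \<and> discounted_riccati \<rho> A B M R Srho \<and>
        (\<forall>S. positive_definite_operator S \<and> discounted_riccati \<rho> A B M R S \<longrightarrow> S = Srho) \<and>
        (positive_definite_operator M \<longrightarrow>
           positive_definite_operator Srho \<and>
           (\<forall>S. positive_operator S \<and> discounted_riccati \<rho> A B M R S \<longrightarrow> S = Srho))))"
proof -
  have A: "selfadj (Bop A)" and B: "selfadj (Bop B)"
    unfolding assms(3,5) by (rule selfadj_kernel_plus_scalar[OF assms(2)], rule selfadj_kernel_plus_scalar[OF assms(4)])
  obtain R' where R': "is_inverse_operator R R'" using assms(14) ..
  have noise: "q_noise P kQ w"
    using assms(15,17,18) by (simp add: q_noise_def q_noise_axioms_def)
  note feedback = minimal_riccati_solution_optimal[OF assms(1) A B assms(9,13) R' noise]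
  note closed_form = discounted_riccati_closed_form[OF A assms(9), where \<rho>=\<rho>]
  show ?thesis
  proof (rule conjI)
    show "(\<exists>S. positive_operator S \<and> discounted_riccati \<rho> A B M R S) \<longrightarrow>
       (\<exists>Sinf. positive_operator Sinf \<and> discounted_riccati \<rho> A B M R Sinf \<and>
          (\<forall>S. positive_operator S \<and> discounted_riccati \<rho> A B M R S \<longrightarrow>
             (\<forall>f. f \<bullet> Sinf f \<le> f \<bullet> S f)) \<and>
          (let K = - (inverse_operator R o\<^sub>L adjoint_operator B o\<^sub>L Sinf) in
           \<forall>x0. (\<exists>x u. feedback_pair P w A B K x0 x u) \<and>
             (\<forall>x u. feedback_pair P w A B K x0 x u \<longrightarrow> minimizes_cost P w A B M R \<rho> x0 x u)))"
      using feedback by blast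
    show "B = id_blinfun \<and> R = id_blinfun \<and> adjoint_operator A = A \<longrightarrow>
       (let \<Gamma> = A - (\<rho> / 2) *\<^sub>R id_blinfun; Srho = \<Gamma> + sqrt_operator ((\<Gamma> o\<^sub>L \<Gamma>) + M) in
        positive_operator Srho \<and> discounted_riccati \<rho> A B M R Srho \<and>
        (\<forall>S. positive_definite_operator S \<and> discounted_riccati \<rho> A B M R S \<longrightarrow> S = Srho) \<and>
        (positive_definite_operator M \<longrightarrow>
           positive_definite_operator Srho \<and>
           (\<forall>S. positive_operator S \<and> discounted_riccati \<rho> A B M R S \<longrightarrow> S = Srho)))"
      unfolding Let_def using closed_form by blast
  qed
qed

end
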